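(* Let $\kappa\in\mathbb{R}$ and let $(X,d)$ be an Alexandrov space with curvature $\ge\kappa$. Suppose that $(x;y,z,w)$ is a quadruple in $X$, with size less than $2\pi/\sqrt\kappa$ if $\kappa>0$, such that $x\notin[y,z]\cup[z,w]\cup[w,y]$ and $$\tilde\angle_\kappa(x;y,z)+\tilde\angle_\kappa(x;z,w)+\tilde\angle_\kappa(x;w,y)=2\pi .$$ Then the triangle $\Delta yzw$ spans the unique closed triangular region $D\subset X$ which contains $x$ and is isometric to the triangular region in $M^2_\kappa$ with vertices $\tilde y,\tilde z$ and $\tilde w$.
   Context: Comparison angle: $\mathrm{peri}(x,y,z):=d(x,y)+d(y,z)+d(z,x)$. For $\kappa>0$ let $S_\kappa(r)=\sin(\sqrt\kappa r)/\sqrt\kappa$, for $\kappa<0$ let $S_\kappa(r)=\sinh(\sqrt{-\kappa}r)/\sqrt{-\kappa}$, and $C_\kappa:=S_\kappa'$. For points $x,y,z$ of a metric space (with $x\ne y$, $x\neq z$, and $\mathrm{peri}(x,y,z)<2\pi/\sqrt\kappa$ if $\kappa>0$), $\tilde\angle_\kappa(x;y,z)\in[0,\pi]$ is defined by $\cos\tilde\angle_\kappa(x;y,z)=\frac{d(x,y)^2+d(x,z)^2-d(y,z)^2}{2d(x,y)d(x,z)}$ if $\kappa=0$, and $\cos\tilde\angle_\kappa(x;y,z)=\frac{C_\kappa(d(y,z))-C_\kappa(d(x,y))C_\kappa(d(x,z))}{\kappa S_\kappa(d(x,y))S_\kappa(d(x,z))}$ if $\kappa\ne0$. A quadruple consists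 of four distinct points; its size is the maximum of the perimeters of all triangles formed by the four points. A metric space has curvature $\ge\kappa$ if $\tilde\angle_\kappa(x;y,z)+\tilde\angle_\kappa(x;z,w)+\tilde\angle_\kappa(x;w,y)\le2\pi$ for every quadruple $(x;y,z,w)$, of size less than $2\pi/\sqrt\kappa$ if $\kappa>0$. An Alexandrov space with curvature $\ge\kappa$ is a complete length space (distance = infimum of lengths of connecting curves; not necessarily geodesic, locally compact or finite dimensional) with curvature $\ge\kappa$. $[a,b]:=\{u: d(a,b)=d(a,u)+d(u,b)\}$ for points $a,b$ of a metric space. $\Delta yzw$ denotes the three point set $\{y,z,w\}$. $M^2_\kappa$ is the simply connected complete surface of constant curvature $\kappa$; $\{\tilde y,\tilde z,\tilde w\}\subset M^2_\kappa$ is the image of $\{y,z,w\}$ under an isometric embedding into $M^2_\kappa$ (comparison triangle). The triangular region with given vertices in $M^2_\kappa$ is the closed region bounded by the geodesic triangle with these vertices. The region $D$ spanned by $\Delta yzw$ has $y,z,w$ as its vertices, i.e. they correspond to $\tilde y,\tilde z,\tilde w$ under the isometry; subsets of metric spaces carry the restricted metric. *)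

theory Defs
  imports "HOL-Analysis.Analysis"
begin

section \<open>Comparison angles\<close>

definition peri :: "'a::metric_space \<Rightarrow> 'a \<Rightarrow> 'a \<Rightarrow> real" where
  "peri x y z = dist x y + dist y z + dist z x"

text \<open>The values at curvature \<open>0\<close> are the limits as the curvature tends to \<open>0\<close>; they are
  not used below.\<close>

definition md_sin :: "real \<Rightarrow> real \<Rightarrow> real" where
  "md_sin \<kappa> r =
    (if \<kappa> > 0 then sin (sqrt \<kappa> * r) / sqrt \<kappa>
     else if \<kappa> < 0 then sinh (sqrt (-\<kappa>) * r) / sqrt (-\<kappa>)
     else r)"

definition md_cos :: "real \<Rightarrow> real \<Rightarrow> real" where
  "md_cos \<kappa> r =
    (if \<kappa> > 0 then cos (sqrt \<kappa> * r)
     else if \<kappa> < 0 then cosh (sqrt (-\<kappa>) * r)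
     else 1)"

lemma DERIV_md_sin: "(md_sin \<kappa> has_real_derivative md_cos \<kappa> r) (at r)"
  unfolding md_sin_def md_cos_def
  by (cases "\<kappa> > 0"; cases "\<kappa> < 0") (auto intro!: derivative_eq_intros simp: mult.assoc)

text \<open>Only meaningful for \<open>x \<noteq> y\<close>, \<open>x \<noteq> z\<close> and, if \<open>\<kappa> > 0\<close>, perimeter less than
  \<open>2 * pi / sqrt \<kappa>\<close>; then the argument of \<^const>\<open>arccos\<close> lies in \<open>[-1, 1]\<close>.\<close>

definition comparison_angle :: "real \<Rightarrow> 'a::metric_space \<Rightarrow> 'a \<Rightarrow> 'a \<Rightarrow> real" where
  "comparison_angle \<kappa> x y z =
    arccos (if \<kappa> = 0
      then ((dist x y)\<^sup>2 + (dist x z)\<^sup>2 - (dist y z)\<^sup>2) / (2 * dist x y * dist x z)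
      else (md_cos \<kappa> (dist y z) - md_cos \<kappa> (dist x y) * md_cos \<kappa> (dist x z))
             / (\<kappa> * md_sin \<kappa> (dist x y) * md_sin \<kappa> (dist x z)))"


section \<open>Alexandrov spaces\<close>

definition quadruple :: "'a \<Rightarrow> 'a \<Rightarrow> 'a \<Rightarrow> 'a \<Rightarrow> bool" where
  "quadruple x y z w \<longleftrightarrow> distinct [x, y, z, w]"

definition quadruple_size :: "'a::metric_space \<Rightarrow> 'a \<Rightarrow> 'a \<Rightarrow> 'a \<Rightarrow> real" where
  "quadruple_size x y z w = Max {peri x y z, peri x z w, peri x w y, peri y z w}"

definition angle_sum :: "real \<Rightarrow> 'a::metric_space \<Rightarrow> 'a \<Rightarrow> 'a \<Rightarrow> 'a \<Rightarrow> real" where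
  "angle_sum \<kappa> x y z w =
    comparison_angle \<kappa> x y z + comparison_angle \<kappa> x z w + comparison_angle \<kappa> x w y"

definition curvature_ge :: "'a::metric_space itself \<Rightarrow> real \<Rightarrow> bool" where
  "curvature_ge _ \<kappa> \<longleftrightarrow>
    (\<forall>x y z w :: 'a. quadruple x y z w
      \<longrightarrow> (\<kappa> > 0 \<longrightarrow> quadruple_size x y z w < 2 * pi / sqrt \<kappa>)
      \<longrightarrow> angle_sum \<kappa> x y z w \<le> 2 * pi)"

text \<open>Partitions of \<open>[0, 1]\<close> are initial segments \<open>t 0 \<le> \<dots> \<le> t n\<close> of monotone sequences.\<close>

definition path_length :: "(real \<Rightarrow> 'a::metric_space) \<Rightarrow> ennreal" where
  "path_length g =
    (SUP (n, t) \<in> {(n :: nat, t :: nat \<Rightarrow> real). mono t \<and> range t \<subseteq> {0..1}}.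
      ennreal (\<Sum>i<n. dist (g (t i)) (g (t (Suc i)))))"

definition length_space :: "'a::metric_space itself \<Rightarrow> bool" where
  "length_space _ \<longleftrightarrow>
    (\<forall>x y :: 'a. ennreal (dist x y) =
      (INF g \<in> {g. path g \<and> pathstart g = x \<and> pathfinish g = y}. path_length g))"

definition alexandrov_space :: "'a::metric_space itself \<Rightarrow> real \<Rightarrow> bool" where
  "alexandrov_space T \<kappa> \<longleftrightarrow>
    complete (UNIV :: 'a set) \<and> length_space T \<and> curvature_ge T \<kappa>"

definition metric_interval :: "'a::metric_space \<Rightarrow> 'a \<Rightarrow> 'a set" where
  "metric_interval a b = {u. dist a b = dist a u + dist u b}"


section \<open>Model planes and triangular regions\<close>

text \<open>The model plane of curvature \<open>\<kappa>\<close> is the round sphere of radius \<open>1 / sqrt \<kappa>\<close> with its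
  angular metric, the Euclidean plane, or the upper sheet of the hyperboloid
  \<open>lorentz p p = 1 / \<kappa>\<close> in Minkowski space. In all three cases the topology induced by
  \<open>model_dist \<kappa>\<close> is the subspace topology of the ambient \<open>real ^ 3\<close>, and the sets bounded for
  \<open>model_dist \<kappa>\<close> are those bounded in \<open>real ^ 3\<close>.\<close>

definition lorentz :: "real ^ 3 \<Rightarrow> real ^ 3 \<Rightarrow> real" where
  "lorentz p q = p $ 1 * q $ 1 + p $ 2 * q $ 2 - p $ 3 * q $ 3"

definition model_plane :: "real \<Rightarrow> (real ^ 3) set" where
  "model_plane \<kappa> =
    (if \<kappa> > 0 then sphere 0 (1 / sqrt \<kappa>)
     else if \<kappa> < 0 then {p. lorentz p p = 1 / \<kappa> \<and> p $ 3 > 0}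
     else {p. p $ 3 = 0})"

definition model_dist :: "real \<Rightarrow> real ^ 3 \<Rightarrow> real ^ 3 \<Rightarrow> real" where
  "model_dist \<kappa> p q =
    (if \<kappa> > 0 then arccos (\<kappa> * (p \<bullet> q)) / sqrt \<kappa>
     else if \<kappa> < 0 then arcosh (\<kappa> * lorentz p q) / sqrt (-\<kappa>)
     else dist p q)"

text \<open>The minimal geodesic between two points that are not antipodal.\<close>

definition model_segment :: "real \<Rightarrow> real ^ 3 \<Rightarrow> real ^ 3 \<Rightarrow> (real ^ 3) set" where
  "model_segment \<kappa> a b =
    {u \<in> model_plane \<kappa>. model_dist \<kappa> a b = model_dist \<kappa> a u + model_dist \<kappa> u b}"

definition geodesic_triangle :: "real \<Rightarrow> real ^ 3 \<Rightarrow> real ^ 3 \<Rightarrow> real ^ 3 \<Rightarrow> (real ^ 3) set" where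
  "geodesic_triangle \<kappa> a b c =
    model_segment \<kappa> a b \<union> model_segment \<kappa> b c \<union> model_segment \<kappa> c a"

text \<open>The closed regions bounded by a non-degenerate geodesic triangle. For \<open>\<kappa> \<le> 0\<close> there is
  exactly one; on the sphere there are two, one on each side of the triangle.\<close>

definition is_triangular_region ::
    "real \<Rightarrow> real ^ 3 \<Rightarrow> real ^ 3 \<Rightarrow> real ^ 3 \<Rightarrow> (real ^ 3) set \<Rightarrow> bool" where
  "is_triangular_region \<kappa> a b c R \<longleftrightarrow>
    (\<exists>C \<in> components (model_plane \<kappa> - geodesic_triangle \<kappa> a b c). bounded C \<and> R = closure C)"

definition is_comparison_triangle ::
    "real \<Rightarrow> 'a::metric_space \<Rightarrow> 'a \<Rightarrow> 'a \<Rightarrow> real ^ 3 \<Rightarrow> real ^ 3 \<Rightarrow> real ^ 3 \<Rightarrow> bool" where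
  "is_comparison_triangle \<kappa> y z w y' z' w' \<longleftrightarrow>
    {y', z', w'} \<subseteq> model_plane \<kappa> \<and>
    model_dist \<kappa> y' z' = dist y z \<and>
    model_dist \<kappa> z' w' = dist z w \<and>
    model_dist \<kappa> w' y' = dist w y"

text \<open>\<open>D\<close> is isometric to a triangular region with vertices \<open>y', z', w'\<close>, and \<open>y, z, w\<close>
  correspond to these vertices. On the sphere, which of the two regions it is depends on the
  points that \<open>D\<close> is required to contain.\<close>

definition spans_region ::
    "real \<Rightarrow> 'a::metric_space \<Rightarrow> 'a \<Rightarrow> 'a \<Rightarrow> real ^ 3 \<Rightarrow> real ^ 3 \<Rightarrow> real ^ 3 \<Rightarrow> 'a set \<Rightarrow> bool" where
  "spans_region \<kappa> y z w y' z' w' D \<longleftrightarrow>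
    (\<exists>R f. is_triangular_region \<kappa> y' z' w' R \<and> f ` R = D \<and>
      (\<forall>p\<in>R. \<forall>q\<in>R. dist (f p) (f q) = model_dist \<kappa> p q) \<and>
      f y' = y \<and> f z' = z \<and> f w' = w)"

end

theory Submission
  imports Defs
begin

text \<open>The curvature condition says that at every point the matrix of products
  \<open>S\<^sub>i * S\<^sub>j * cos\<close> of comparison angles is copositive; in this form it survives limits, and it
  passes to an ultrapower of the space, which is moreover geodesic. There, equality in the angle sum
  means that \<open>x, y, z, w\<close> embed isometrically into the model plane, with \<open>x\<close> corresponding to
  a point \<open>X\<close> of the plane that has the vertices around it. Distances from points of the sides to the other
  points are squeezed between the comparison inequality and the copositivity at \<open>x\<close>, so they equal
  the model distances. Iterating this yields an isometric copy of the open cone spanned by the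
  vertices; on spheres, where \<open>X\<close> may lie outside the small triangle, two points at distance
  \<open>pi / sqrt \<kappa>\<close> appear and the space is a suspension. Near \<open>x\<close> a point of the copy is the only
  point with its distances to \<open>x, y, z, w\<close>, and farther away it is determined by the ray from
  \<open>x\<close>. Points of the ultrapower that are so determined belong to the given space by completeness,
  which moves the region there and also shows its uniqueness.\<close>

section \<open>Trigonometry uniform in the curvature\<close>

text \<open>The obstacle is the sphere. Comparison is available only for triangles of perimeter less
  than \<open>2 * pi / sqrt \<kappa>\<close>, so each estimate has to bring a proof that its
  triangles are admissible (\<open>okp\<close>). Such proofs have three sources: steps too short to
  use up the strict inequality, vertices in an open half space, and linearly independent vertices.
  Configurations on a great circle, where the perimeter is exactly critical, are reached by limits.
  Angles are avoided, as they are undefined for coinciding points. In the model plane a segment is a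
  linear relation with nonnegative weights (\<open>seg_rel\<close>, \<open>cone_between\<close>),
  and projecting a relation to the tangent plane at \<open>X\<close> makes the Gram form vanish at
  its weights. Copositivity at \<open>x\<close> with the same weights compares the space with the
  plane: lower bounds for two distances force an upper bound for the third
  (\<open>hinge_ge_model\<close>). Relations are stated modulo multiples of \<open>X\<close>,
  because this form survives the shortening of legs.\<close>

text \<open>The antiderivative of \<^term>\<open>md_sin \<kappa>\<close>; unlike \<^term>\<open>md_cos \<kappa>\<close> it determines distances also
  for \<open>\<kappa> = 0\<close>.\<close>

definition md_m :: "real \<Rightarrow> real \<Rightarrow> real" where
  "md_m \<kappa> r = (if \<kappa> = 0 then r\<^sup>2 / 2 else (1 - md_cos \<kappa> r) / \<kappa>)"

lemma md_cos_eq: "md_cos \<kappa> r = 1 - \<kappa> * md_m \<kappa> r"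
  by (simp add: md_m_def md_cos_def)

lemma md_zero [simp]: "md_m \<kappa> 0 = 0" "md_sin \<kappa> 0 = 0" "md_cos \<kappa> 0 = 1"
  by (auto simp: md_m_def md_sin_def md_cos_def)

lemma md_minus [simp]: "md_m \<kappa> (- r) = md_m \<kappa> r" "md_sin \<kappa> (- r) = - md_sin \<kappa> r"
  by (auto simp: md_m_def md_sin_def md_cos_def)

lemma md_cos_add: "md_cos \<kappa> (s + t) = md_cos \<kappa> s * md_cos \<kappa> t - \<kappa> * md_sin \<kappa> s * md_sin \<kappa> t"
proof -
  consider "\<kappa> > 0" | "\<kappa> = 0" | "\<kappa> < 0" by linarith
  then show ?thesis
  proof cases
    case 1
    have "sqrt \<kappa> * sqrt \<kappa> = \<kappa>" using 1 by simp
    then show ?thesis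
      using 1 by (simp add: md_cos_def md_sin_def distrib_left cos_add)
  next
    case 3
    have "sqrt (-\<kappa>) * sqrt (-\<kappa>) = -\<kappa>" using 3 by simp
    then show ?thesis
      using 3 by (simp add: md_cos_def md_sin_def distrib_left cosh_add)
  qed (simp add: md_cos_def md_sin_def)
qed

lemma md_sin_add: "md_sin \<kappa> (s + t) = md_sin \<kappa> s * md_cos \<kappa> t + md_cos \<kappa> s * md_sin \<kappa> t"
  by (auto simp: md_cos_def md_sin_def distrib_left sin_add sinh_add add_divide_distrib)

lemma md_m_add: "md_m \<kappa> (s + t) = md_m \<kappa> s + md_m \<kappa> t - \<kappa> * md_m \<kappa> s * md_m \<kappa> t + md_sin \<kappa> s * md_sin \<kappa> t"
proof (cases "\<kappa> = 0")
  case True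
  then show ?thesis by (simp add: md_m_def md_sin_def power2_eq_square field_simps)
next
  case False
  have "\<kappa> * md_m \<kappa> (s + t) = \<kappa> * (md_m \<kappa> s + md_m \<kappa> t - \<kappa> * md_m \<kappa> s * md_m \<kappa> t + md_sin \<kappa> s * md_sin \<kappa> t)"
    using md_cos_add[of \<kappa> s t] unfolding md_cos_eq by (simp add: algebra_simps)
  then show ?thesis using False by simp
qed

lemma md_m_diff: "md_m \<kappa> (s - t) = md_m \<kappa> s + md_m \<kappa> t - \<kappa> * md_m \<kappa> s * md_m \<kappa> t - md_sin \<kappa> s * md_sin \<kappa> t"
  using md_m_add[of \<kappa> s "- t"] by simp

lemma md_sin_sq: "(md_sin \<kappa> r)\<^sup>2 = 2 * md_m \<kappa> r - \<kappa> * (md_m \<kappa> r)\<^sup>2"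
  using md_m_diff[of \<kappa> r r] by (simp add: power2_eq_square)

lemma md_sin_pos:
  assumes "0 < r" "\<kappa> > 0 \<Longrightarrow> r < pi / sqrt \<kappa>"
  shows "md_sin \<kappa> r > 0"
proof -
  consider "\<kappa> > 0" | "\<kappa> = 0" | "\<kappa> < 0" by linarith
  then show ?thesis
  proof cases
    case 1
    then have "sqrt \<kappa> * r < pi" using assms(2) by (simp add: field_simps)
    then show ?thesis using 1 assms(1) by (simp add: md_sin_def sin_gt_zero)
  qed (use assms in \<open>auto simp: md_sin_def\<close>)
qed

lemma md_sin_nonneg:
  assumes "0 \<le> r" "\<kappa> > 0 \<Longrightarrow> r \<le> pi / sqrt \<kappa>"
  shows "md_sin \<kappa> r \<ge> 0"
proof -
  consider "\<kappa> > 0" | "\<kappa> = 0" | "\<kappa> < 0" by linarith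
  then show ?thesis
  proof cases
    case 1
    then have "sqrt \<kappa> * r \<le> pi" using assms(2) by (simp add: field_simps)
    then show ?thesis using 1 assms(1) by (simp add: md_sin_def sin_ge_zero)
  qed (use assms in \<open>auto simp: md_sin_def\<close>)
qed

lemma DERIV_md_m: "(md_m \<kappa> has_real_derivative md_sin \<kappa> r) (at r)"
proof -
  consider "\<kappa> > 0" | "\<kappa> = 0" | "\<kappa> < 0" by linarith
  then show ?thesis
  proof cases
    case 1
    have "md_m \<kappa> = (\<lambda>r. (1 - cos (sqrt \<kappa> * r)) / \<kappa>)" using 1 by (auto simp: md_m_def md_cos_def fun_eq_iff)
    moreover have "sqrt \<kappa> / \<kappa> = 1 / sqrt \<kappa>" using 1 by (simp add: field_simps)
    then have "sin (sqrt \<kappa> * r) * sqrt \<kappa> / \<kappa> = sin (sqrt \<kappa> * r) / sqrt \<kappa>"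
      by (metis mult.right_neutral times_divide_eq_right)
    ultimately show ?thesis using 1 by (auto intro!: derivative_eq_intros simp: md_sin_def)
  next
    case 2
    have "md_m \<kappa> = (\<lambda>r. r\<^sup>2 / 2)" using 2 by (auto simp: md_m_def fun_eq_iff)
    then show ?thesis using 2 by (auto intro!: derivative_eq_intros simp: md_sin_def)
  next
    case 3
    have "md_m \<kappa> = (\<lambda>r. (1 - cosh (sqrt (-\<kappa>) * r)) / \<kappa>)" using 3 by (auto simp: md_m_def md_cos_def fun_eq_iff)
    moreover have "sqrt (-\<kappa>) / \<kappa> = - 1 / sqrt (-\<kappa>)" using 3 by (simp add: field_simps)
    then have "sinh (sqrt (-\<kappa>) * r) * sqrt (-\<kappa>) / \<kappa> = - sinh (sqrt (-\<kappa>) * r) / sqrt (-\<kappa>)"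
      by (metis (no_types, opaque_lifting) mult.commute mult_minus1 times_divide_eq_right times_divide_eq_left)
    ultimately show ?thesis using 3 by (auto intro!: derivative_eq_intros simp: md_sin_def)
  qed
qed

lemma tendsto_md_m [tendsto_intros]:
  "(f \<longlongrightarrow> l) F \<Longrightarrow> ((\<lambda>x. md_m \<kappa> (f x)) \<longlongrightarrow> md_m \<kappa> l) F"
  by (rule isCont_tendsto_compose) (auto intro: DERIV_isCont DERIV_md_m)

lemma tendsto_md_sin [tendsto_intros]:
  "(f \<longlongrightarrow> l) F \<Longrightarrow> ((\<lambda>x. md_sin \<kappa> (f x)) \<longlongrightarrow> md_sin \<kappa> l) F"
  by (rule isCont_tendsto_compose) (auto intro: DERIV_isCont DERIV_md_sin)

lemma md_m_strict_mono:
  assumes "0 \<le> s" "s < t" "\<kappa> > 0 \<Longrightarrow> t \<le> pi / sqrt \<kappa>"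
  shows "md_m \<kappa> s < md_m \<kappa> t"
proof (rule DERIV_pos_imp_increasing_open[OF assms(2)])
  fix x assume x: "s < x" "x < t"
  have "md_sin \<kappa> x > 0" by (rule md_sin_pos) (use x assms in force)+
  then show "\<exists>y. (md_m \<kappa> has_real_derivative y) (at x) \<and> y > 0" using DERIV_md_m by blast
qed (auto intro!: continuous_at_imp_continuous_on intro: DERIV_isCont DERIV_md_m)

lemma md_m_less_iff:
  assumes "0 \<le> s" "0 \<le> t" "\<kappa> > 0 \<Longrightarrow> s \<le> pi / sqrt \<kappa>" "\<kappa> > 0 \<Longrightarrow> t \<le> pi / sqrt \<kappa>"
  shows "md_m \<kappa> s < md_m \<kappa> t \<longleftrightarrow> s < t"
  using md_m_strict_mono[of s t \<kappa>] md_m_strict_mono[of t s \<kappa>] assms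
  by (metis linorder_neqE_linordered_idom order_less_asym)

lemma md_m_le_iff:
  assumes "0 \<le> s" "0 \<le> t" "\<kappa> > 0 \<Longrightarrow> s \<le> pi / sqrt \<kappa>" "\<kappa> > 0 \<Longrightarrow> t \<le> pi / sqrt \<kappa>"
  shows "md_m \<kappa> s \<le> md_m \<kappa> t \<longleftrightarrow> s \<le> t"
  using md_m_less_iff[of t s \<kappa>] assms by (simp add: linorder_not_less[symmetric])

lemma md_m_eq_iff:
  assumes "0 \<le> s" "0 \<le> t" "\<kappa> > 0 \<Longrightarrow> s \<le> pi / sqrt \<kappa>" "\<kappa> > 0 \<Longrightarrow> t \<le> pi / sqrt \<kappa>"
  shows "md_m \<kappa> s = md_m \<kappa> t \<longleftrightarrow> s = t"
  using md_m_le_iff[of s t \<kappa>] md_m_le_iff[of t s \<kappa>] assms by (metis antisym order_refl)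

lemma md_m_reflect: "\<kappa> > 0 \<Longrightarrow> md_m \<kappa> (2 * pi / sqrt \<kappa> - r) = md_m \<kappa> r"
  "\<kappa> > 0 \<Longrightarrow> md_sin \<kappa> (2 * pi / sqrt \<kappa> - r) = - md_sin \<kappa> r"
  by (auto simp: md_m_def md_cos_def md_sin_def right_diff_distrib cos_diff sin_diff)

lemma md_sin_reflect: "\<kappa> > 0 \<Longrightarrow> md_sin \<kappa> (pi / sqrt \<kappa> - r) = md_sin \<kappa> r"
  "\<kappa> > 0 \<Longrightarrow> md_m \<kappa> (pi / sqrt \<kappa> - r) = 2 / \<kappa> - md_m \<kappa> r"
proof -
  assume k: "\<kappa> > 0"
  have e: "sqrt \<kappa> * (pi / sqrt \<kappa> - r) = pi - sqrt \<kappa> * r" using k by (simp add: right_diff_distrib)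
  show "md_sin \<kappa> (pi / sqrt \<kappa> - r) = md_sin \<kappa> r" "md_m \<kappa> (pi / sqrt \<kappa> - r) = 2 / \<kappa> - md_m \<kappa> r"
    using k by (simp_all add: md_sin_def md_m_def md_cos_def e diff_divide_distrib add_divide_distrib)
qed

lemma md_sin_surj_small:
  assumes "0 \<le> t0" "0 \<le> c" "c \<le> md_sin \<kappa> t0"
  obtains t where "0 \<le> t" "t \<le> t0" "md_sin \<kappa> t = c"
proof -
  have "\<exists>t\<ge>0. t \<le> t0 \<and> md_sin \<kappa> t = c"
    by (rule IVT) (use assms in \<open>auto intro: DERIV_isCont DERIV_md_sin\<close>)
  then show ?thesis using that by blast
qed

section \<open>Law of cosines and admissible perimeters\<close>

text \<open>For a triangle with sides \<open>a, b, c\<close>, \<open>c\<close> opposite to the hinge, this is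
  \<open>S a * S b\<close> times the cosine of the comparison angle, uniformly in \<open>\<kappa>\<close>.\<close>

definition hk :: "real \<Rightarrow> real \<Rightarrow> real \<Rightarrow> real \<Rightarrow> real" where
  "hk \<kappa> a b c = md_m \<kappa> a + md_m \<kappa> b - md_m \<kappa> c - \<kappa> * md_m \<kappa> a * md_m \<kappa> b"

lemma hk_sum: "hk \<kappa> a b (a + b) = - md_sin \<kappa> a * md_sin \<kappa> b"
  by (simp add: hk_def md_m_add)

lemma hk_diff: "hk \<kappa> a b (a - b) = md_sin \<kappa> a * md_sin \<kappa> b"
  by (simp add: hk_def md_m_diff)

lemma hk_commute: "hk \<kappa> a b c = hk \<kappa> b a c" by (simp add: hk_def)

definition okp :: "real \<Rightarrow> real \<Rightarrow> bool" where
  "okp \<kappa> p \<longleftrightarrow> (\<kappa> > 0 \<longrightarrow> p < 2 * pi / sqrt \<kappa>)"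

lemma okp_mono: "okp \<kappa> p \<Longrightarrow> q \<le> p \<Longrightarrow> okp \<kappa> q"
  by (auto simp: okp_def)

lemma okp_half: "okp \<kappa> p \<Longrightarrow> 2 * r \<le> p \<Longrightarrow> \<kappa> > 0 \<Longrightarrow> r < pi / sqrt \<kappa>"
  by (auto simp: okp_def)

lemma okp_slack:
  assumes "okp \<kappa> p" obtains e where "e > 0" "\<And>q. q \<le> p + e \<Longrightarrow> okp \<kappa> q"
proof (cases "\<kappa> > 0")
  case True
  show ?thesis by (rule that[of "(2 * pi / sqrt \<kappa> - p) / 2"]) (use assms True in \<open>auto simp: okp_def field_simps\<close>)
qed (use that[of 1] in \<open>auto simp: okp_def\<close>)

text \<open>The comparison cosine lies in \<open>[-1, 1]\<close>: this compares
  \<open>md_m \<kappa> c\<close> with the values at \<open>a + b\<close> and \<open>a - b\<close>.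
  If \<open>a + b\<close> exceeds \<open>pi / sqrt \<kappa>\<close>, where \<open>md_m\<close> turns
  around, the reflected argument \<open>2 * pi / sqrt \<kappa> - (a + b)\<close> is used instead; it
  is at least \<open>c\<close> by the bound on the perimeter.\<close>

lemma hk_bounds:
  assumes "0 \<le> a" "0 \<le> b" "c \<le> a + b" "a \<le> b + c" "b \<le> a + c" "okp \<kappa> (a + b + c)"
  shows "\<bar>hk \<kappa> a b c\<bar> \<le> md_sin \<kappa> a * md_sin \<kappa> b"
proof -
  have c0: "0 \<le> c" using assms by linarith
  have cP: "\<kappa> > 0 \<Longrightarrow> c \<le> pi / sqrt \<kappa>" using okp_half[OF assms(6), of c] assms(3) by force
  have aP: "\<kappa> > 0 \<Longrightarrow> a \<le> pi / sqrt \<kappa>" using okp_half[OF assms(6), of a] assms(4) by force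
  have bP: "\<kappa> > 0 \<Longrightarrow> b \<le> pi / sqrt \<kappa>" using okp_half[OF assms(6), of b] assms(5) by force
  have "md_m \<kappa> c \<le> md_m \<kappa> (a + b)"
  proof (cases "\<kappa> > 0 \<and> a + b > pi / sqrt \<kappa>")
    case True
    then have "md_m \<kappa> c \<le> md_m \<kappa> (2 * pi / sqrt \<kappa> - (a + b))"
      by (subst md_m_le_iff) (use assms(6) cP c0 aP bP True in \<open>auto simp: okp_def\<close>)
    then show ?thesis using md_m_reflect True by simp
  next
    case False
    then show ?thesis by (subst md_m_le_iff) (use assms cP c0 in auto)
  qed
  then have 1: "hk \<kappa> a b c \<ge> - md_sin \<kappa> a * md_sin \<kappa> b" using hk_sum[of \<kappa> a b] by (simp add: hk_def)
  have "md_m \<kappa> \<bar>a - b\<bar> \<le> md_m \<kappa> c"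
    by (subst md_m_le_iff) (use assms cP c0 aP bP in \<open>auto simp: abs_if\<close>)
  moreover have "md_m \<kappa> \<bar>a - b\<bar> = md_m \<kappa> (a - b)" by (metis abs_if md_minus(1))
  ultimately have 2: "hk \<kappa> a b c \<le> md_sin \<kappa> a * md_sin \<kappa> b" using hk_diff[of \<kappa> a b] by (simp add: hk_def)
  show ?thesis using 1 2 by (auto simp: abs_if)
qed

text \<open>If two of the angles add up to at least pi, lay three unit vectors out in the plane with
  these two angles between neighbours: the form dominates the squared length of their weighted sum,
  as the third angle is at most the one that closes up the circle. Otherwise any two cosines have a
  nonnegative sum, so at most one is negative and the other two compensate it.\<close>

lemma arccos_copositive:
  fixes \<alpha> \<beta> \<gamma> l1 l2 l3 :: real
  assumes "0 \<le> \<alpha>" "\<alpha> \<le> pi" "0 \<le> \<beta>" "\<beta> \<le> pi" "0 \<le> \<gamma>" "\<gamma> \<le> pi" "\<alpha> + \<beta> + \<gamma> \<le> 2 * pi"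
    and "l1 \<ge> 0" "l2 \<ge> 0" "l3 \<ge> 0"
  shows "l1\<^sup>2 + l2\<^sup>2 + l3\<^sup>2 + 2 * l1 * l2 * cos \<alpha> + 2 * l2 * l3 * cos \<beta> + 2 * l3 * l1 * cos \<gamma> \<ge> 0"
proof -
  have planar: "l1\<^sup>2 + l2\<^sup>2 + l3\<^sup>2 + 2 * l1 * l2 * cos \<alpha> + 2 * l2 * l3 * cos \<beta> + 2 * l3 * l1 * cos \<gamma> \<ge> 0"
    if "\<alpha> + \<beta> \<ge> pi" "\<gamma> \<ge> 0" "\<alpha> + \<beta> + \<gamma> \<le> 2 * pi" "l1 \<ge> 0" "l3 \<ge> 0"
    for \<alpha> \<beta> \<gamma> l1 l2 l3 :: real
  proof -
    have "cos (\<alpha> + \<beta>) = cos (2 * pi - (\<alpha> + \<beta>))" by (simp add: cos_diff)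
    also have "\<dots> \<le> cos \<gamma>" by (rule cos_monotone_0_pi_le) (use that in auto)
    finally have c: "cos (\<alpha> + \<beta>) \<le> cos \<gamma>" .
    \<comment> \<open>The squared length of the sum of the unit vectors at angles 0,
      \<open>\<alpha>\<close> and \<open>\<alpha> + \<beta>\<close> with weights \<open>l1\<close>,
      \<open>l2\<close>, \<open>l3\<close>.\<close>
    have "0 \<le> (l1 + l2 * cos \<alpha> + l3 * cos (\<alpha> + \<beta>))\<^sup>2 + (l2 * sin \<alpha> + l3 * sin (\<alpha> + \<beta>))\<^sup>2" by simp
    also have "\<dots> = l1\<^sup>2 + l2\<^sup>2 * ((sin \<alpha>)\<^sup>2 + (cos \<alpha>)\<^sup>2) + l3\<^sup>2 * ((sin (\<alpha> + \<beta>))\<^sup>2 + (cos (\<alpha> + \<beta>))\<^sup>2)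
        + 2 * l1 * l2 * cos \<alpha> + 2 * l2 * l3 * (cos (\<alpha> + \<beta>) * cos \<alpha> + sin (\<alpha> + \<beta>) * sin \<alpha>) + 2 * l3 * l1 * cos (\<alpha> + \<beta>)"
      by algebra
    also have "cos (\<alpha> + \<beta>) * cos \<alpha> + sin (\<alpha> + \<beta>) * sin \<alpha> = cos \<beta>"
      using cos_diff[of "\<alpha> + \<beta>" \<alpha>] by simp
    finally have "0 \<le> l1\<^sup>2 + l2\<^sup>2 + l3\<^sup>2 + 2 * l1 * l2 * cos \<alpha> + 2 * l2 * l3 * cos \<beta> + 2 * l3 * l1 * cos (\<alpha> + \<beta>)"
      by (simp only: sin_cos_squared_add mult_1_right)
    moreover have "2 * l3 * l1 * cos (\<alpha> + \<beta>) \<le> 2 * l3 * l1 * cos \<gamma>"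
      by (rule mult_left_mono[OF c]) (use that in auto)
    ultimately show ?thesis by linarith
  qed
  \<comment> \<open>Here \<open>c\<close> is the only cosine that may be negative. The terms with
    \<open>y\<close> are nonnegative, and without them the square of \<open>x - z\<close> remains as
    a lower bound.\<close>
  have nn: "x\<^sup>2 + y\<^sup>2 + z\<^sup>2 + 2 * x * y * a + 2 * y * z * b + 2 * z * x * c \<ge> 0"
    if "x \<ge> 0" "y \<ge> 0" "z \<ge> 0" "a \<ge> -c" "b \<ge> -c" "-1 \<le> c" "c \<le> 0" for x y z a b c :: real
  proof -
    have "2 * x * y * a \<ge> 2 * x * y * (-c)" by (rule mult_left_mono) (use that in simp_all)
    moreover have "2 * y * z * b \<ge> 2 * y * z * (-c)" by (rule mult_left_mono) (use that in simp_all)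
    moreover have "2 * x * y * (-c) \<ge> 0" by (intro mult_nonneg_nonneg) (use that in simp_all)
    moreover have "2 * y * z * (-c) \<ge> 0" by (intro mult_nonneg_nonneg) (use that in simp_all)
    moreover have "2 * z * x * c \<ge> 2 * z * x * (-1)" using that by (intro mult_left_mono) auto
    moreover have "x\<^sup>2 + z\<^sup>2 - 2 * z * x \<ge> 0" using zero_le_power2[of "x - z"] by (simp add: power2_eq_square algebra_simps)
    moreover have "y\<^sup>2 \<ge> 0" by simp
    ultimately show ?thesis by linarith
  qed
  consider "\<alpha> + \<beta> \<ge> pi" | "\<beta> + \<gamma> \<ge> pi" | "\<gamma> + \<alpha> \<ge> pi"
    | "\<alpha> + \<beta> \<le> pi" "\<beta> + \<gamma> \<le> pi" "\<gamma> + \<alpha> \<le> pi" by linarith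
  then show ?thesis
  proof cases
    case 1
    have "l1\<^sup>2 + l2\<^sup>2 + l3\<^sup>2 + 2 * l1 * l2 * cos \<alpha> + 2 * l2 * l3 * cos \<beta> + 2 * l3 * l1 * cos \<gamma> \<ge> 0"
      by (rule planar) (use assms 1 in linarith)+
    then show ?thesis by simp
  next
    case 2
    have "l2\<^sup>2 + l3\<^sup>2 + l1\<^sup>2 + 2 * l2 * l3 * cos \<beta> + 2 * l3 * l1 * cos \<gamma> + 2 * l1 * l2 * cos \<alpha> \<ge> 0"
      by (rule planar) (use assms 2 in linarith)+
    then show ?thesis by linarith
  next
    case 3
    have "l3\<^sup>2 + l1\<^sup>2 + l2\<^sup>2 + 2 * l3 * l1 * cos \<gamma> + 2 * l1 * l2 * cos \<alpha> + 2 * l2 * l3 * cos \<beta> \<ge> 0"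
      by (rule planar) (use assms 3 in linarith)+
    then show ?thesis by linarith
  next
    case 4
    have le: "cos s \<ge> - cos t" if "s + t \<le> pi" "0 \<le> s" "0 \<le> t" for s t :: real
      using cos_monotone_0_pi_le[of s "pi - t"] that by simp
    have ab: "cos \<alpha> \<ge> - cos \<beta>" "cos \<beta> \<ge> - cos \<gamma>" "cos \<gamma> \<ge> - cos \<alpha>" using le[of \<alpha> \<beta>] le[of \<beta> \<gamma>] le[of \<gamma> \<alpha>] 4 assms by auto
    consider "cos \<gamma> \<le> 0" | "cos \<alpha> \<le> 0" | "cos \<beta> \<le> 0" | "cos \<alpha> \<ge> 0" "cos \<beta> \<ge> 0" "cos \<gamma> \<ge> 0" by linarith
    then show ?thesis
    proof cases
      case 1
      have "l1\<^sup>2 + l2\<^sup>2 + l3\<^sup>2 + 2 * l1 * l2 * cos \<alpha> + 2 * l2 * l3 * cos \<beta> + 2 * l3 * l1 * cos \<gamma> \<ge> 0"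
        by (rule nn) (use assms ab 1 cos_ge_minus_one[of \<gamma>] in linarith)+
      then show ?thesis by linarith
    next
      case 2
      have "l2\<^sup>2 + l3\<^sup>2 + l1\<^sup>2 + 2 * l2 * l3 * cos \<beta> + 2 * l3 * l1 * cos \<gamma> + 2 * l1 * l2 * cos \<alpha> \<ge> 0"
        by (rule nn) (use assms ab 2 cos_ge_minus_one[of \<alpha>] in linarith)+
      then show ?thesis by linarith
    next
      case 3
      have "l3\<^sup>2 + l1\<^sup>2 + l2\<^sup>2 + 2 * l3 * l1 * cos \<gamma> + 2 * l1 * l2 * cos \<alpha> + 2 * l2 * l3 * cos \<beta> \<ge> 0"
        by (rule nn) (use assms ab 3 cos_ge_minus_one[of \<beta>] in linarith)+
      then show ?thesis by linarith
    qed (use assms in simp)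
  qed
qed

section \<open>Model planes\<close>

definition mform :: "real \<Rightarrow> real ^ 3 \<Rightarrow> real ^ 3 \<Rightarrow> real" where
  "mform \<kappa> u v = (if \<kappa> < 0 then lorentz u v else u \<bullet> v)"

text \<open>For \<open>\<kappa> = 0\<close> the model plane is moved to height \<open>1\<close>, so that affine combinations of its
  points become linear combinations of vectors, as for the other curvatures.\<close>

definition hat :: "real \<Rightarrow> real ^ 3 \<Rightarrow> real ^ 3" where
  "hat \<kappa> p = (if \<kappa> = 0 then p + axis 3 1 else p)"

definition hat_plane :: "real \<Rightarrow> (real ^ 3) set" where
  "hat_plane \<kappa> = (if \<kappa> = 0 then {p. p $ 3 = 1} else model_plane \<kappa>)"

text \<open>Half the squared chord of the ambient form. It equals \<open>md_m\<close> of the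
  distance (\<open>model_dist_props\<close>), so it expresses distances by polynomials in the
  coordinates, without inverse functions.\<close>

definition mu :: "real \<Rightarrow> real ^ 3 \<Rightarrow> real ^ 3 \<Rightarrow> real" where
  "mu \<kappa> p q = mform \<kappa> (p - q) (p - q) / 2"

text \<open>\<open>tg \<kappa> x\<close> is the projection along \<open>x\<close> onto the tangent plane at \<open>x\<close>.\<close>

definition lf :: "real \<Rightarrow> real ^ 3 \<Rightarrow> real ^ 3 \<Rightarrow> real" where
  "lf \<kappa> x v = (if \<kappa> = 0 then v $ 3 else \<kappa> * mform \<kappa> v x)"

definition tg :: "real \<Rightarrow> real ^ 3 \<Rightarrow> real ^ 3 \<Rightarrow> real ^ 3" where
  "tg \<kappa> x v = v - lf \<kappa> x v *\<^sub>R x"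

lemma mform_simps:
  "mform \<kappa> (u + v) w = mform \<kappa> u w + mform \<kappa> v w"
  "mform \<kappa> (u - v) w = mform \<kappa> u w - mform \<kappa> v w"
  "mform \<kappa> (c *\<^sub>R u) w = c * mform \<kappa> u w"
  "mform \<kappa> (- u) w = - mform \<kappa> u w"
  "mform \<kappa> 0 w = 0"
  "mform \<kappa> w (u + v) = mform \<kappa> w u + mform \<kappa> w v"
  "mform \<kappa> w (u - v) = mform \<kappa> w u - mform \<kappa> w v"
  "mform \<kappa> w (c *\<^sub>R u) = c * mform \<kappa> w u"
  "mform \<kappa> w (- u) = - mform \<kappa> w u"
  "mform \<kappa> w 0 = 0"
  by (auto simp: mform_def lorentz_def inner_simps algebra_simps)

lemma mform_commute: "mform \<kappa> u v = mform \<kappa> v u"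
  by (auto simp: mform_def lorentz_def inner_commute algebra_simps)

lemma lf_simps:
  "lf \<kappa> x (u + v) = lf \<kappa> x u + lf \<kappa> x v"
  "lf \<kappa> x (u - v) = lf \<kappa> x u - lf \<kappa> x v"
  "lf \<kappa> x (c *\<^sub>R u) = c * lf \<kappa> x u"
  "lf \<kappa> x (- u) = - lf \<kappa> x u"
  "lf \<kappa> x 0 = 0"
  by (auto simp: lf_def mform_simps algebra_simps)

lemma tg_simps:
  "tg \<kappa> x (u + v) = tg \<kappa> x u + tg \<kappa> x v"
  "tg \<kappa> x (u - v) = tg \<kappa> x u - tg \<kappa> x v"
  "tg \<kappa> x (c *\<^sub>R u) = c *\<^sub>R tg \<kappa> x u"
  "tg \<kappa> x (- u) = - tg \<kappa> x u"
  "tg \<kappa> x 0 = 0"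
  by (auto simp: tg_def lf_simps algebra_simps)

text \<open>The third coordinates are the square roots of \<open>a + P\<close> and
  \<open>a + Q\<close>, and \<open>(a + R)\<^sup>2 \<le> (a + P) * (a + Q)\<close> follows from the
  planar Cauchy-Schwarz inequality \<open>R\<^sup>2 \<le> P * Q\<close> together with
  \<open>2 * R \<le> P + Q\<close>.\<close>

lemma lorentz_reverse_cs:
  assumes "lorentz p p = - a" "lorentz q q = - a" "a > 0" "p $ 3 > 0" "q $ 3 > 0"
  shows "lorentz p q \<le> - a"
proof -
  define P Q where "P = p $ 1 * p $ 1 + p $ 2 * p $ 2" and "Q = q $ 1 * q $ 1 + q $ 2 * q $ 2"
  define R where "R = p $ 1 * q $ 1 + p $ 2 * q $ 2"
  have p: "(p $ 3)\<^sup>2 = a + P" and q: "(q $ 3)\<^sup>2 = a + Q"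
    using assms by (auto simp: lorentz_def P_def Q_def power2_eq_square)
  have "P * Q - R\<^sup>2 = (p $ 1 * q $ 2 - p $ 2 * q $ 1)\<^sup>2" unfolding P_def Q_def R_def by algebra
  then have 1: "R\<^sup>2 \<le> P * Q" by (smt (verit) zero_le_power2)
  have "P + Q - 2 * R = (p $ 1 - q $ 1)\<^sup>2 + (p $ 2 - q $ 2)\<^sup>2" unfolding P_def Q_def R_def by algebra
  then have 2: "2 * R \<le> P + Q" by (smt (verit) zero_le_power2)
  have "(a + R)\<^sup>2 = a\<^sup>2 + a * (2 * R) + R\<^sup>2" by algebra
  also have "\<dots> \<le> a\<^sup>2 + a * (P + Q) + P * Q" using 1 2 assms(3) by (intro add_mono mult_left_mono) auto
  also have "\<dots> = (p $ 3 * q $ 3)\<^sup>2" by (simp add: power_mult_distrib p q) algebra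
  finally have "a + R \<le> p $ 3 * q $ 3" by (rule power2_le_imp_le) (use assms in simp)
  then show ?thesis by (simp add: lorentz_def R_def)
qed

lemma hat_plane_pos: "\<kappa> > 0 \<Longrightarrow> p \<in> hat_plane \<kappa> \<longleftrightarrow> p \<bullet> p = 1 / \<kappa>"
proof -
  assume k: "\<kappa> > 0"
  have "norm p = 1 / sqrt \<kappa> \<longleftrightarrow> (norm p)\<^sup>2 = (1 / sqrt \<kappa>)\<^sup>2"
    by (rule power2_eq_iff_nonneg[symmetric]) (use k in auto)
  then show ?thesis using k by (auto simp: hat_plane_def model_plane_def power2_norm_eq_inner power_divide)
qed

lemma hat_plane_neg: "\<kappa> < 0 \<Longrightarrow> p \<in> hat_plane \<kappa> \<longleftrightarrow> lorentz p p = 1 / \<kappa> \<and> p $ 3 > 0"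
  by (auto simp: hat_plane_def model_plane_def)

lemma mform_self: "\<kappa> \<noteq> 0 \<Longrightarrow> p \<in> hat_plane \<kappa> \<Longrightarrow> mform \<kappa> p p = 1 / \<kappa>"
  by (cases "\<kappa> > 0") (auto simp: hat_plane_pos hat_plane_neg mform_def)

lemma lf_self [simp]: "p \<in> hat_plane \<kappa> \<Longrightarrow> lf \<kappa> p p = 1"
  by (cases "\<kappa> = 0") (auto simp: lf_def mform_self hat_plane_def)

lemma tg_self [simp]: "p \<in> hat_plane \<kappa> \<Longrightarrow> tg \<kappa> p p = 0"
  by (simp add: tg_def)

lemma lf_tg: "x \<in> hat_plane \<kappa> \<Longrightarrow> lf \<kappa> x (tg \<kappa> x v) = 0"
  by (simp add: tg_def lf_simps)

lemma mu_commute: "mu \<kappa> p q = mu \<kappa> q p"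
  by (simp add: mu_def mform_simps mform_commute)

lemma mu_nonzero: "\<kappa> \<noteq> 0 \<Longrightarrow> p \<in> hat_plane \<kappa> \<Longrightarrow> q \<in> hat_plane \<kappa> \<Longrightarrow> mu \<kappa> p q = 1 / \<kappa> - mform \<kappa> p q"
  using mform_commute[of \<kappa> q p] by (simp add: mu_def mform_simps mform_self)

lemma lf_mu:
  assumes "x \<in> hat_plane \<kappa>" "a \<in> hat_plane \<kappa>"
  shows "lf \<kappa> x a = 1 - \<kappa> * mu \<kappa> x a"
proof (cases "\<kappa> = 0")
  case False
  then show ?thesis using mu_nonzero[OF False assms] mform_commute[of \<kappa> a x]
    by (simp add: lf_def right_diff_distrib)
qed (use assms in \<open>simp add: lf_def hat_plane_def\<close>)

text \<open>Law of cosines without angles: the Gram matrix of tangent projections is the same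
  polynomial in \<open>mu\<close> that \<open>hk\<close> is in \<open>md_m\<close>. This is the
  bridge between the copositivity assumption and linear relations in the model plane.\<close>

lemma tg_gram:
  assumes "x \<in> hat_plane \<kappa>" "a \<in> hat_plane \<kappa>" "b \<in> hat_plane \<kappa>"
  shows "mform \<kappa> (tg \<kappa> x a) (tg \<kappa> x b) = mu \<kappa> x a + mu \<kappa> x b - mu \<kappa> a b - \<kappa> * mu \<kappa> x a * mu \<kappa> x b"
proof (cases "\<kappa> = 0")
  case True
  then have t: "tg \<kappa> x a = a - x" "tg \<kappa> x b = b - x" using assms by (auto simp: tg_def lf_def hat_plane_def)
  show ?thesis unfolding t using True
    by (simp add: mu_def mform_def inner_diff_left inner_diff_right inner_commute field_simps)
next
  case False
  define A B G where "A = mform \<kappa> a x" and "B = mform \<kappa> b x" and "G = mform \<kappa> a b"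
  have "mform \<kappa> (tg \<kappa> x a) (tg \<kappa> x b) = G - \<kappa> * A * B"
    using False mform_commute[of \<kappa> x b] mform_self[OF False assms(1)]
    by (simp add: tg_def lf_def mform_simps A_def[symmetric] B_def[symmetric] G_def[symmetric] algebra_simps)
  moreover have "mu \<kappa> x a = 1 / \<kappa> - A" "mu \<kappa> x b = 1 / \<kappa> - B" "mu \<kappa> a b = 1 / \<kappa> - G"
    using mu_nonzero[OF False] assms mform_commute[of \<kappa>] by (auto simp: A_def B_def G_def)
  moreover have "G - \<kappa> * A * B = (1 / \<kappa> - A) + (1 / \<kappa> - B) - (1 / \<kappa> - G) - \<kappa> * (1 / \<kappa> - A) * (1 / \<kappa> - B)"
    using False by (simp add: field_simps)
  ultimately show ?thesis by simp
qed

text \<open>In the hyperbolic case Lagrange's identity bounds \<open>(t $ 3 * x $ 3)\<^sup>2\<close>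
  by \<open>T * X\<close>, so that a vector orthogonal to the timelike \<open>x\<close> satisfies
  \<open>lorentz t t * (x $ 3)\<^sup>2 \<ge> T * a\<close>.\<close>

lemma tangent_pos:
  assumes "x \<in> hat_plane \<kappa>" "lf \<kappa> x t = 0"
  shows "mform \<kappa> t t \<ge> 0" "mform \<kappa> t t = 0 \<Longrightarrow> t = 0"
proof -
  have "mform \<kappa> t t \<ge> 0 \<and> (mform \<kappa> t t = 0 \<longrightarrow> t = 0)"
  proof (cases "\<kappa> < 0")
    case True
    define a where "a = - 1 / \<kappa>"
    have a: "a > 0" using True by (simp add: a_def)
    define T X where "T = t $ 1 * t $ 1 + t $ 2 * t $ 2" and "X = x $ 1 * x $ 1 + x $ 2 * x $ 2"
    have x3: "x $ 3 * x $ 3 = X + a" "x $ 3 > 0"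
      using assms(1) True by (auto simp: hat_plane_neg lorentz_def X_def a_def)
    have "lorentz t x = 0" using assms(2) True by (simp add: lf_def mform_def)
    then have t3: "t $ 3 * x $ 3 = t $ 1 * x $ 1 + t $ 2 * x $ 2" by (simp add: lorentz_def)
    have "T * X - (t $ 3 * x $ 3)\<^sup>2 = (t $ 1 * x $ 2 - t $ 2 * x $ 1)\<^sup>2"
      unfolding T_def X_def t3 by algebra
    then have "(t $ 3 * x $ 3)\<^sup>2 \<le> T * X" by (smt (verit) zero_le_power2)
    moreover have "lorentz t t * (x $ 3 * x $ 3) = T * (X + a) - (t $ 3 * x $ 3)\<^sup>2"
      unfolding x3(1)[symmetric] by (simp add: lorentz_def T_def power2_eq_square algebra_simps)
    ultimately have ge: "lorentz t t * (x $ 3 * x $ 3) \<ge> T * a" by (simp add: algebra_simps)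
    have T0: "T \<ge> 0" by (simp add: T_def)
    have x33: "x $ 3 * x $ 3 > 0" using x3(2) by simp
    have "0 \<le> T * a" using T0 a by simp
    then have "0 \<le> lorentz t t * (x $ 3 * x $ 3)" using ge by linarith
    then have "lorentz t t \<ge> 0" using x33 x3(2) by (simp add: zero_le_mult_iff)
    moreover have "t = 0" if "lorentz t t = 0"
    proof -
      have "T * a \<le> 0" using ge that by simp
      then have "T = 0" using T0 a by (simp add: mult_le_0_iff)
      then have "t $ 1 = 0" "t $ 2 = 0" unfolding T_def by (simp_all add: sum_squares_eq_zero_iff)
      moreover then have "t $ 3 = 0" using t3 x3(2) by simp
      ultimately show ?thesis by (simp add: vec_eq_iff forall_3)
    qed
    ultimately show ?thesis using True by (simp add: mform_def)
  qed (simp add: mform_def)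
  then show "mform \<kappa> t t \<ge> 0" "mform \<kappa> t t = 0 \<Longrightarrow> t = 0" by auto
qed

text \<open>The quadratic equation leaves two sheets. On the lower one \<open>lf \<kappa> a\<close>
  is negative, by the reversed Cauchy-Schwarz inequality for \<open>a\<close> and
  \<open>- p\<close>.\<close>

lemma hat_plane_negI:
  assumes "\<kappa> < 0" "a \<in> hat_plane \<kappa>" "mform \<kappa> p p = 1 / \<kappa>" "lf \<kappa> a p > 0"
  shows "p \<in> hat_plane \<kappa>"
proof -
  have p: "lorentz p p = 1 / \<kappa>" using assms by (simp add: mform_def)
  have "p $ 3 > 0"
  proof (rule ccontr)
    assume n: "\<not> p $ 3 > 0"
    have "p $ 3 \<noteq> 0"
    proof
      assume "p $ 3 = 0"
      then have "lorentz p p \<ge> 0" by (simp add: lorentz_def)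
      then show False using p assms(1) by (simp add: field_simps)
    qed
    then have "(- p) $ 3 > 0" using n by simp
    moreover have "lorentz (-p) (-p) = 1 / \<kappa>" using p by (simp add: lorentz_def)
    ultimately have "lorentz a (-p) \<le> - (- 1 / \<kappa>)"
      using assms(1,2) by (intro lorentz_reverse_cs) (auto simp: hat_plane_neg)
    moreover have "lorentz a (-p) = - lorentz p a" by (simp add: lorentz_def algebra_simps)
    moreover have "1 / \<kappa> < 0" using assms(1) by simp
    ultimately have "lorentz p a > 0" by linarith
    then have "\<kappa> * lorentz p a < 0" using assms(1) by (simp add: mult_neg_pos)
    then show False using assms(1,4) by (simp add: lf_def mform_def)
  qed
  then show ?thesis using p assms(1) by (simp add: hat_plane_neg)
qed

lemma model_dist_props:
  assumes "p \<in> hat_plane \<kappa>" "q \<in> hat_plane \<kappa>"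
  shows "md_m \<kappa> (model_dist \<kappa> p q) = mu \<kappa> p q" "model_dist \<kappa> p q \<ge> 0"
    "\<kappa> > 0 \<Longrightarrow> model_dist \<kappa> p q \<le> pi / sqrt \<kappa>"
proof -
  have "md_m \<kappa> (model_dist \<kappa> p q) = mu \<kappa> p q \<and> model_dist \<kappa> p q \<ge> 0 \<and>
    (\<kappa> > 0 \<longrightarrow> model_dist \<kappa> p q \<le> pi / sqrt \<kappa>)"
  proof -
    consider "\<kappa> > 0" | "\<kappa> = 0" | "\<kappa> < 0" by linarith
    then show ?thesis
    proof cases
      case 1
      have "(p \<bullet> q)\<^sup>2 \<le> (1 / \<kappa>)\<^sup>2" using Cauchy_Schwarz_ineq[of p q] assms 1
        by (simp add: hat_plane_pos power2_eq_square)
      then have "\<bar>p \<bullet> q\<bar> \<le> \<bar>1 / \<kappa>\<bar>" by (simp only: abs_le_square_iff)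
      then have "\<kappa> * \<bar>p \<bullet> q\<bar> \<le> 1" using 1 by (simp add: pos_le_divide_eq mult.commute)
      then have "\<bar>\<kappa> * (p \<bullet> q)\<bar> \<le> 1" using 1 by (simp add: abs_mult)
      then have b: "-1 \<le> \<kappa> * (p \<bullet> q)" "\<kappa> * (p \<bullet> q) \<le> 1" by linarith+
      have d: "model_dist \<kappa> p q = arccos (\<kappa> * (p \<bullet> q)) / sqrt \<kappa>" using 1 by (simp add: model_dist_def)
      have "md_m \<kappa> (model_dist \<kappa> p q) = (1 - \<kappa> * (p \<bullet> q)) / \<kappa>"
        using 1 b by (simp add: d md_m_def md_cos_def)
      also have "\<dots> = mu \<kappa> p q" using 1 assms mu_nonzero[of \<kappa> p q] by (simp add: mform_def diff_divide_distrib)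
      finally show ?thesis using 1 b by (simp add: d arccos_lbound arccos_ubound divide_right_mono)
    next
      case 2
      then show ?thesis
        by (simp add: model_dist_def md_m_def mu_def mform_def dist_norm power2_norm_eq_inner)
    next
      case 3
      have "lorentz p q \<le> - (- 1 / \<kappa>)" using assms 3
        by (intro lorentz_reverse_cs) (auto simp: hat_plane_neg)
      then have b: "\<kappa> * lorentz p q \<ge> 1" using 3 by (simp add: field_simps)
      have d: "model_dist \<kappa> p q = arcosh (\<kappa> * lorentz p q) / sqrt (- \<kappa>)" using 3 by (simp add: model_dist_def)
      have "md_m \<kappa> (model_dist \<kappa> p q) = (1 - \<kappa> * lorentz p q) / \<kappa>"
        using 3 b by (simp add: d md_m_def md_cos_def)
      also have "\<dots> = mu \<kappa> p q" using 3 assms mu_nonzero[of \<kappa> p q] by (simp add: mform_def diff_divide_distrib)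
      finally show ?thesis using 3 b by (simp add: d arcosh_nonneg_real)
    qed
  qed
  then show "md_m \<kappa> (model_dist \<kappa> p q) = mu \<kappa> p q" "model_dist \<kappa> p q \<ge> 0"
    "\<kappa> > 0 \<Longrightarrow> model_dist \<kappa> p q \<le> pi / sqrt \<kappa>" by auto
qed

abbreviation PP :: "real \<Rightarrow> real" where "PP \<kappa> \<equiv> pi / sqrt \<kappa>"

lemma model_dist_eqI:
  assumes "p \<in> hat_plane \<kappa>" "q \<in> hat_plane \<kappa>" "mu \<kappa> p q = md_m \<kappa> r" "0 \<le> r" "\<kappa> > 0 \<Longrightarrow> r \<le> PP \<kappa>"
  shows "model_dist \<kappa> p q = r"
proof -
  have "md_m \<kappa> (model_dist \<kappa> p q) = md_m \<kappa> r" using assms model_dist_props(1) by simp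
  then show ?thesis by (subst (asm) md_m_eq_iff) (use assms model_dist_props in auto)
qed

lemma model_dist_commute:
  assumes "p \<in> hat_plane \<kappa>" "q \<in> hat_plane \<kappa>"
  shows "model_dist \<kappa> p q = model_dist \<kappa> q p"
  by (rule model_dist_eqI) (use assms model_dist_props mu_commute[of \<kappa> p q] in auto)

lemma model_dist_self [simp]: "p \<in> hat_plane \<kappa> \<Longrightarrow> model_dist \<kappa> p p = 0"
  by (rule model_dist_eqI) (auto simp: mu_def mform_simps)

lemma lf_cos: "p \<in> hat_plane \<kappa> \<Longrightarrow> q \<in> hat_plane \<kappa> \<Longrightarrow> lf \<kappa> p q = md_cos \<kappa> (model_dist \<kappa> p q)"
  by (simp add: lf_mu md_cos_eq model_dist_props)

lemma lf_commute: "p \<in> hat_plane \<kappa> \<Longrightarrow> q \<in> hat_plane \<kappa> \<Longrightarrow> lf \<kappa> p q = lf \<kappa> q p"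
  by (simp add: lf_mu mu_commute)

lemma tg_gram_hk:
  assumes "x \<in> hat_plane \<kappa>" "a \<in> hat_plane \<kappa>" "b \<in> hat_plane \<kappa>"
  shows "mform \<kappa> (tg \<kappa> x a) (tg \<kappa> x b) = hk \<kappa> (model_dist \<kappa> x a) (model_dist \<kappa> x b) (model_dist \<kappa> a b)"
  using assms by (simp add: tg_gram hk_def model_dist_props)

lemma tg_norm:
  assumes "x \<in> hat_plane \<kappa>" "a \<in> hat_plane \<kappa>"
  shows "mform \<kappa> (tg \<kappa> x a) (tg \<kappa> x a) = (md_sin \<kappa> (model_dist \<kappa> x a))\<^sup>2"
  using assms by (simp add: tg_gram_hk hk_def md_sin_sq) (simp add: power2_eq_square)

lemma tg_eq_0_iff:
  assumes "x \<in> hat_plane \<kappa>"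
  shows "tg \<kappa> x v = 0 \<longleftrightarrow> (\<exists>c. v = c *\<^sub>R x)"
proof
  assume "tg \<kappa> x v = 0"
  then show "\<exists>c. v = c *\<^sub>R x" by (auto simp: tg_def)
next
  assume "\<exists>c. v = c *\<^sub>R x"
  then show "tg \<kappa> x v = 0" using assms by (auto simp: tg_simps)
qed

lemma tg_eq_0D: "tg \<kappa> x v = 0 \<Longrightarrow> v = lf \<kappa> x v *\<^sub>R x"
  by (simp add: tg_def)

lemma md_sin_model_nonneg:
  assumes "p \<in> hat_plane \<kappa>" "q \<in> hat_plane \<kappa>"
  shows "md_sin \<kappa> (model_dist \<kappa> p q) \<ge> 0"
  using assms by (auto intro: md_sin_nonneg model_dist_props)

lemma model_dist_eq_0:
  assumes "p \<in> hat_plane \<kappa>" "q \<in> hat_plane \<kappa>" "model_dist \<kappa> p q = 0"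
  shows "p = q"
proof -
  have "mform \<kappa> (tg \<kappa> p q) (tg \<kappa> p q) = 0" using assms by (simp add: tg_norm)
  then have "tg \<kappa> p q = 0" using tangent_pos(2)[OF assms(1)] lf_tg[OF assms(1)] by blast
  then have "q = lf \<kappa> p q *\<^sub>R p" by (rule tg_eq_0D)
  then show ?thesis using lf_cos[OF assms(1,2)] assms(3) by simp
qed

text \<open>Cauchy-Schwarz in the tangent plane at \<open>b\<close>: the cosine at \<open>b\<close>
  is at least -1. The triangle inequality follows by comparison with \<open>hk_sum\<close>.\<close>

lemma model_hk_ge:
  assumes "b \<in> hat_plane \<kappa>" "a \<in> hat_plane \<kappa>" "c \<in> hat_plane \<kappa>"
  shows "hk \<kappa> (model_dist \<kappa> b a) (model_dist \<kappa> b c) (model_dist \<kappa> a c)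
    \<ge> - md_sin \<kappa> (model_dist \<kappa> b a) * md_sin \<kappa> (model_dist \<kappa> b c)"
proof -
  let ?sa = "md_sin \<kappa> (model_dist \<kappa> b a)" and ?sc = "md_sin \<kappa> (model_dist \<kappa> b c)"
  let ?u = "tg \<kappa> b a" and ?v = "tg \<kappa> b c"
  let ?K = "hk \<kappa> (model_dist \<kappa> b a) (model_dist \<kappa> b c) (model_dist \<kappa> a c)"
  have K: "mform \<kappa> ?u ?v = ?K" "mform \<kappa> ?v ?u = ?K" using tg_gram_hk[OF assms] mform_commute[of \<kappa> ?v ?u] by auto
  have n: "mform \<kappa> ?u ?u = ?sa\<^sup>2" "mform \<kappa> ?v ?v = ?sc\<^sup>2" using tg_norm assms by auto
  have s: "?sa \<ge> 0" "?sc \<ge> 0" using md_sin_model_nonneg assms by auto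
  consider "?sa = 0" | "?sc = 0" | "?sa > 0" "?sc > 0" using s by linarith
  then show ?thesis
  proof cases
    case 1
    then have "?u = 0" using tangent_pos(2)[OF assms(1) lf_tg[OF assms(1)]] n by simp
    then show ?thesis using K 1 by (simp add: mform_simps)
  next
    case 2
    then have "?v = 0" using tangent_pos(2)[OF assms(1) lf_tg[OF assms(1)]] n by simp
    then show ?thesis using K 2 by (simp add: mform_simps)
  next
    case 3
    have "0 \<le> mform \<kappa> (?sc *\<^sub>R ?u + ?sa *\<^sub>R ?v) (?sc *\<^sub>R ?u + ?sa *\<^sub>R ?v)"
      by (rule tangent_pos(1)[OF assms(1)]) (simp add: lf_simps lf_tg assms)
    also have "\<dots> = 2 * (?sa * ?sc) * (?sa * ?sc + ?K)"
      by (simp add: mform_simps K n) algebra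
    finally have "0 \<le> 2 * (?sa * ?sc) * (?sa * ?sc + ?K)" .
    moreover have "0 < 2 * (?sa * ?sc)" using 3 by simp
    ultimately have "0 \<le> ?sa * ?sc + ?K" by (simp only: zero_le_mult_iff) linarith
    then show ?thesis by simp
  qed
qed

lemma model_dist_triangle:
  assumes "a \<in> hat_plane \<kappa>" "b \<in> hat_plane \<kappa>" "c \<in> hat_plane \<kappa>"
  shows "model_dist \<kappa> a c \<le> model_dist \<kappa> a b + model_dist \<kappa> b c"
proof (cases "\<kappa> > 0 \<and> model_dist \<kappa> a b + model_dist \<kappa> b c > PP \<kappa>")
  case True
  then show ?thesis using model_dist_props(3)[OF assms(1,3)] by simp
next
  case False
  have "md_m \<kappa> (model_dist \<kappa> a c) \<le> md_m \<kappa> (model_dist \<kappa> b a + model_dist \<kappa> b c)"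
    using model_hk_ge[OF assms(2,1,3)] hk_sum[of \<kappa> "model_dist \<kappa> b a" "model_dist \<kappa> b c"]
    by (simp add: hk_def)
  then show ?thesis
    by (subst (asm) md_m_le_iff) (use model_dist_props assms False model_dist_commute in \<open>auto simp: not_less\<close>)
qed

text \<open>Equality in the triangle inequality makes the tangent vectors at \<open>b\<close>
  towards \<open>a\<close> and \<open>c\<close> opposite: the combination with the sines as weights
  has length 0. The factor of \<open>b\<close> is found by applying \<open>lf \<kappa> b\<close> and
  the addition theorem for the sine.\<close>

lemma seg_rel:
  assumes "a \<in> hat_plane \<kappa>" "b \<in> hat_plane \<kappa>" "c \<in> hat_plane \<kappa>"
    and "model_dist \<kappa> a c = model_dist \<kappa> a b + model_dist \<kappa> b c"
  shows "md_sin \<kappa> (model_dist \<kappa> b c) *\<^sub>R a + md_sin \<kappa> (model_dist \<kappa> a b) *\<^sub>R c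
    = md_sin \<kappa> (model_dist \<kappa> a c) *\<^sub>R b"
proof -
  let ?sa = "md_sin \<kappa> (model_dist \<kappa> a b)" and ?sc = "md_sin \<kappa> (model_dist \<kappa> b c)"
  let ?u = "tg \<kappa> b a" and ?v = "tg \<kappa> b c"
  have ba: "model_dist \<kappa> b a = model_dist \<kappa> a b" using model_dist_commute assms by auto
  have K: "mform \<kappa> ?u ?v = - ?sa * ?sc" "mform \<kappa> ?v ?u = - ?sa * ?sc"
    using tg_gram_hk[OF assms(2,1,3)] hk_sum[of \<kappa> "model_dist \<kappa> a b" "model_dist \<kappa> b c"] assms(4) ba mform_commute[of \<kappa> ?v ?u] by auto
  have n: "mform \<kappa> ?u ?u = ?sa\<^sup>2" "mform \<kappa> ?v ?v = ?sc\<^sup>2" using tg_norm assms ba by auto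
  have "mform \<kappa> (?sc *\<^sub>R ?u + ?sa *\<^sub>R ?v) (?sc *\<^sub>R ?u + ?sa *\<^sub>R ?v) = 0"
    by (simp add: mform_simps K n) algebra
  then have "tg \<kappa> b (?sc *\<^sub>R a + ?sa *\<^sub>R c) = 0"
    using tangent_pos(2)[OF assms(2), of "?sc *\<^sub>R ?u + ?sa *\<^sub>R ?v"] assms(2) by (simp add: lf_simps lf_tg tg_simps)
  then have "?sc *\<^sub>R a + ?sa *\<^sub>R c = lf \<kappa> b (?sc *\<^sub>R a + ?sa *\<^sub>R c) *\<^sub>R b" by (rule tg_eq_0D)
  also have "lf \<kappa> b (?sc *\<^sub>R a + ?sa *\<^sub>R c) = md_sin \<kappa> (model_dist \<kappa> a c)"
    using assms ba by (simp add: lf_simps lf_cos md_sin_add)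
  finally show ?thesis .
qed

section \<open>Geodesics and segments in the model plane\<close>

definition gexp :: "real \<Rightarrow> real ^ 3 \<Rightarrow> real ^ 3 \<Rightarrow> real \<Rightarrow> real ^ 3" where
  "gexp \<kappa> a t s = md_cos \<kappa> s *\<^sub>R a + md_sin \<kappa> s *\<^sub>R t"

lemma md_cos_pos_nonpos: "\<kappa> \<le> 0 \<Longrightarrow> md_cos \<kappa> s > 0"
  by (cases "\<kappa> = 0") (auto simp: md_cos_def)

lemma gexp_mem:
  assumes "a \<in> hat_plane \<kappa>" "lf \<kappa> a t = 0" "mform \<kappa> t t = 1"
  shows "gexp \<kappa> a t s \<in> hat_plane \<kappa>" "lf \<kappa> a (gexp \<kappa> a t s) = md_cos \<kappa> s"
    "tg \<kappa> a (gexp \<kappa> a t s) = md_sin \<kappa> s *\<^sub>R t"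
    "mu \<kappa> a (gexp \<kappa> a t s) = md_m \<kappa> s"
proof -
  let ?p = "gexp \<kappa> a t s"
  show l: "lf \<kappa> a ?p = md_cos \<kappa> s" using assms by (simp add: gexp_def lf_simps)
  then show "tg \<kappa> a ?p = md_sin \<kappa> s *\<^sub>R t" by (simp add: tg_def gexp_def)
  show mem: "?p \<in> hat_plane \<kappa>"
  proof (cases "\<kappa> = 0")
    case True
    then show ?thesis using l by (simp add: lf_def hat_plane_def md_cos_def)
  next
    case False
    have at: "mform \<kappa> t a = 0" "mform \<kappa> a t = 0"
      using assms(2) False mform_commute[of \<kappa> t a] by (auto simp: lf_def)
    have "mform \<kappa> ?p ?p = (md_cos \<kappa> s)\<^sup>2 / \<kappa> + (md_sin \<kappa> s)\<^sup>2"
      using mform_self[OF False assms(1)] assms(3) at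
      by (simp add: gexp_def mform_simps power2_eq_square)
    also have "\<dots> = 1 / \<kappa>"
      using False unfolding md_sin_sq md_cos_eq by (simp add: field_simps power2_eq_square)
    finally have pp: "mform \<kappa> ?p ?p = 1 / \<kappa>" .
    show ?thesis
    proof (cases "\<kappa> > 0")
      case True
      then show ?thesis using pp by (simp add: hat_plane_pos mform_def)
    next
      case F: False
      then show ?thesis using hat_plane_negI[OF _ assms(1) pp] l md_cos_pos_nonpos[of \<kappa> s] False by simp
    qed
  qed
  show "mu \<kappa> a ?p = md_m \<kappa> s"
  proof (cases "\<kappa> = 0")
    case True
    have "a - ?p = - s *\<^sub>R t" using True by (simp add: gexp_def md_cos_def md_sin_def)
    then show ?thesis using True assms(3) by (simp add: mu_def mform_simps md_m_def power2_eq_square)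
  next
    case False
    then show ?thesis using l lf_mu[OF assms(1) mem] md_cos_eq[of \<kappa> s] by simp
  qed
qed

text \<open>The point at arc length \<open>s\<close> on the geodesic from \<open>a\<close> through
  \<open>c\<close>, written with sines as a combination of the two points. By
  \<open>mpt_gexp\<close> it is the exponential map \<open>gexp\<close> along the unit vector
  towards \<open>c\<close>, and the formula continues the geodesic beyond \<open>c\<close>.\<close>

definition mpt :: "real \<Rightarrow> real ^ 3 \<Rightarrow> real ^ 3 \<Rightarrow> real \<Rightarrow> real ^ 3" where
  "mpt \<kappa> a c s = (md_sin \<kappa> (model_dist \<kappa> a c - s) / md_sin \<kappa> (model_dist \<kappa> a c)) *\<^sub>R a
     + (md_sin \<kappa> s / md_sin \<kappa> (model_dist \<kappa> a c)) *\<^sub>R c"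

lemma mpt_gexp:
  assumes "a \<in> hat_plane \<kappa>" "c \<in> hat_plane \<kappa>" "0 < model_dist \<kappa> a c" "\<kappa> > 0 \<Longrightarrow> model_dist \<kappa> a c < PP \<kappa>"
  defines "t \<equiv> (1 / md_sin \<kappa> (model_dist \<kappa> a c)) *\<^sub>R tg \<kappa> a c"
  shows "mpt \<kappa> a c s = gexp \<kappa> a t s" "lf \<kappa> a t = 0" "mform \<kappa> t t = 1"
    "gexp \<kappa> a t (model_dist \<kappa> a c) = c"
proof -
  let ?D = "model_dist \<kappa> a c"
  have S: "md_sin \<kappa> ?D > 0" using assms by (intro md_sin_pos) auto
  show "lf \<kappa> a t = 0" by (simp add: t_def lf_simps lf_tg assms)
  show "mform \<kappa> t t = 1" using S tg_norm[OF assms(1,2)] by (simp add: t_def mform_simps power2_eq_square)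
  have t: "t = (1 / md_sin \<kappa> ?D) *\<^sub>R c - (md_cos \<kappa> ?D / md_sin \<kappa> ?D) *\<^sub>R a"
    using lf_cos[OF assms(1,2)] by (simp add: t_def tg_def scaleR_diff_right)
  have e: "md_sin \<kappa> (?D - s) / md_sin \<kappa> ?D = md_cos \<kappa> s - md_sin \<kappa> s * (md_cos \<kappa> ?D / md_sin \<kappa> ?D)"
    using md_sin_add[of \<kappa> ?D "-s"] S by (simp add: md_cos_eq field_simps)
  show "mpt \<kappa> a c s = gexp \<kappa> a t s"
    unfolding mpt_def gexp_def t e by (simp add: algebra_simps)
  show "gexp \<kappa> a t (model_dist \<kappa> a c) = c" using S by (simp add: gexp_def t algebra_simps)
qed

lemma gexp_dist:
  assumes "a \<in> hat_plane \<kappa>" "lf \<kappa> a t = 0" "mform \<kappa> t t = 1" "0 \<le> s" "\<kappa> > 0 \<Longrightarrow> s \<le> PP \<kappa>"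
  shows "model_dist \<kappa> a (gexp \<kappa> a t s) = s"
  using assms gexp_mem[OF assms(1-3)] by (intro model_dist_eqI) auto

lemma gexp_dist2:
  assumes "a \<in> hat_plane \<kappa>" "lf \<kappa> a t = 0" "mform \<kappa> t t = 1" "0 \<le> r" "r \<le> s" "\<kappa> > 0 \<Longrightarrow> s \<le> PP \<kappa>"
  shows "model_dist \<kappa> (gexp \<kappa> a t r) (gexp \<kappa> a t s) = s - r"
proof (rule model_dist_eqI)
  note g = gexp_mem[OF assms(1-3)]
  have "mform \<kappa> (tg \<kappa> a (gexp \<kappa> a t r)) (tg \<kappa> a (gexp \<kappa> a t s)) = md_sin \<kappa> r * md_sin \<kappa> s"
    using assms(3) by (simp add: g mform_simps)
  then show "mu \<kappa> (gexp \<kappa> a t r) (gexp \<kappa> a t s) = md_m \<kappa> (s - r)"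
    using tg_gram[OF assms(1) g(1) g(1), of r s] g(4) md_m_diff[of \<kappa> s r]
    by (simp add: algebra_simps)
qed (use assms gexp_mem[OF assms(1-3)] in auto)

lemma mpt_props:
  assumes "a \<in> hat_plane \<kappa>" "c \<in> hat_plane \<kappa>" "0 < model_dist \<kappa> a c" "\<kappa> > 0 \<Longrightarrow> model_dist \<kappa> a c < PP \<kappa>"
    "0 \<le> s" "s \<le> model_dist \<kappa> a c"
  shows "mpt \<kappa> a c s \<in> hat_plane \<kappa>" "model_dist \<kappa> a (mpt \<kappa> a c s) = s"
    "model_dist \<kappa> (mpt \<kappa> a c s) c = model_dist \<kappa> a c - s"
    "tg \<kappa> a (mpt \<kappa> a c s) = (md_sin \<kappa> s / md_sin \<kappa> (model_dist \<kappa> a c)) *\<^sub>R tg \<kappa> a c"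
proof -
  note m = mpt_gexp[OF assms(1-4)]
  have s: "\<kappa> > 0 \<Longrightarrow> s \<le> PP \<kappa>" using assms by fastforce
  show "mpt \<kappa> a c s \<in> hat_plane \<kappa>" using m gexp_mem(1)[OF assms(1) m(2,3)] by simp
  show "model_dist \<kappa> a (mpt \<kappa> a c s) = s" using m gexp_dist[OF assms(1) m(2,3) assms(5) s] by simp
  show "model_dist \<kappa> (mpt \<kappa> a c s) c = model_dist \<kappa> a c - s"
    using m(1,4) gexp_dist2[OF assms(1) m(2,3) assms(5,6)] assms(4) by fastforce
  show "tg \<kappa> a (mpt \<kappa> a c s) = (md_sin \<kappa> s / md_sin \<kappa> (model_dist \<kappa> a c)) *\<^sub>R tg \<kappa> a c"
    using m(1) gexp_mem(3)[OF assms(1) m(2,3)] by simp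
qed

lemma hat_plane_scale:
  assumes "a \<in> hat_plane \<kappa>" "b \<in> hat_plane \<kappa>" "b = \<tau> *\<^sub>R a" "\<tau> \<ge> 0"
  shows "b = a"
proof -
  have "\<tau> * lf \<kappa> b a = 1" using assms(2) lf_simps(3)[of \<kappa> b \<tau> a] assms(3) by simp
  moreover have "lf \<kappa> b a = lf \<kappa> a b" by (rule lf_commute[OF assms(2,1)])
  moreover have "lf \<kappa> a b = \<tau>" using assms(1) assms(3) by (simp add: lf_simps)
  ultimately have "\<tau>\<^sup>2 = 1" by (simp add: power2_eq_square)
  then have "\<tau> = 1" using assms(4) by (auto simp: power2_eq_1_iff)
  then show ?thesis using assms(3) by simp
qed

text \<open>Converse of \<open>seg_rel\<close>. The tangent vectors at \<open>b\<close> are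
  opposite, so the distance from \<open>a\<close> to \<open>c\<close> and the sum
  \<open>?d + ?e\<close> have the same \<open>md_m\<close>. On a sphere it remains to exclude a sum
  beyond \<open>pi / sqrt \<kappa>\<close>: there the sine of the sum would be negative, unless both
  distances are maximal, whereas \<open>one\<close> and the addition theorem make it
  nonnegative.\<close>

lemma cone_between:
  assumes "a \<in> hat_plane \<kappa>" "b \<in> hat_plane \<kappa>" "c \<in> hat_plane \<kappa>"
    and "b = \<sigma> *\<^sub>R a + \<tau> *\<^sub>R c" "\<sigma> \<ge> 0" "\<tau> \<ge> 0"
  shows "model_dist \<kappa> a c = model_dist \<kappa> a b + model_dist \<kappa> b c"
proof -
  consider "\<sigma> = 0" | "\<tau> = 0" | "\<sigma> > 0" "\<tau> > 0" using assms by linarith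
  then show ?thesis
  proof cases
    case 1
    then have "b = c" using hat_plane_scale[OF assms(3,2) _ assms(6)] assms(4) by simp
    then show ?thesis using assms by simp
  next
    case 2
    then have "b = a" using hat_plane_scale[OF assms(1,2) _ assms(5)] assms(4) by simp
    then show ?thesis using assms by simp
  next
    case 3
    let ?d = "model_dist \<kappa> a b" and ?e = "model_dist \<kappa> b c"
    have ba: "model_dist \<kappa> b a = ?d" using model_dist_commute assms by auto
    have "tg \<kappa> b (\<sigma> *\<^sub>R a + \<tau> *\<^sub>R c) = 0" using assms(2,4) by (metis tg_self)
    then have r: "\<tau> *\<^sub>R tg \<kappa> b c = - \<sigma> *\<^sub>R tg \<kappa> b a" by (simp add: tg_simps add_eq_0_iff)
    have v: "tg \<kappa> b c = (- \<sigma> / \<tau>) *\<^sub>R tg \<kappa> b a"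
      using arg_cong[OF r, of "\<lambda>u. (1/\<tau>) *\<^sub>R u"] 3 by simp
    have Sd: "md_sin \<kappa> ?d \<ge> 0" and Se: "md_sin \<kappa> ?e \<ge> 0" using md_sin_model_nonneg assms by auto
    have "(md_sin \<kappa> ?e)\<^sup>2 = (\<sigma> / \<tau> * md_sin \<kappa> ?d)\<^sup>2"
      using tg_norm[OF assms(2,3)] tg_norm[OF assms(2,1)] ba
      by (simp add: v mform_simps power2_eq_square ac_simps)
    then have e: "md_sin \<kappa> ?e = \<sigma> / \<tau> * md_sin \<kappa> ?d"
      by (subst (asm) power2_eq_iff_nonneg) (use Sd Se 3 in auto)
    have "hk \<kappa> ?d ?e (model_dist \<kappa> a c) = mform \<kappa> (tg \<kappa> b a) (tg \<kappa> b c)"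
      using tg_gram_hk[OF assms(2,1,3)] ba by simp
    also have "\<dots> = - (\<sigma> / \<tau>) * (md_sin \<kappa> ?d)\<^sup>2" using tg_norm[OF assms(2,1)] ba by (simp add: v mform_simps)
    also have "\<dots> = hk \<kappa> ?d ?e (?d + ?e)" by (simp add: hk_sum e power2_eq_square)
    finally have m: "md_m \<kappa> (model_dist \<kappa> a c) = md_m \<kappa> (?d + ?e)" by (simp add: hk_def)
    have one: "\<sigma> * md_cos \<kappa> ?d + \<tau> * md_cos \<kappa> ?e = 1"
      using lf_self[OF assms(2)] arg_cong[OF assms(4), of "lf \<kappa> b"] lf_cos[OF assms(2,1)] lf_cos[OF assms(2,3)] ba
      by (simp add: lf_simps)
    have le: "?d + ?e \<le> PP \<kappa>" if k: "\<kappa> > 0"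
    proof (rule ccontr)
      assume c: "\<not> ?d + ?e \<le> PP \<kappa>"
      have d: "?d \<le> PP \<kappa>" "?e \<le> PP \<kappa>" using model_dist_props(3) assms k by auto
      have "\<tau> * md_sin \<kappa> (?d + ?e) = md_sin \<kappa> ?d * (\<sigma> * md_cos \<kappa> ?d + \<tau> * md_cos \<kappa> ?e)"
        using 3 unfolding md_sin_add e by (simp add: field_simps)
      then have "\<tau> * md_sin \<kappa> (?d + ?e) \<ge> 0" using one Sd by simp
      then have ge: "md_sin \<kappa> (?d + ?e) \<ge> 0" using 3 by (simp add: zero_le_mult_iff)
      show False
      proof (cases "?d + ?e = 2 * PP \<kappa>")
        case True
        then have "?d = PP \<kappa>" "?e = PP \<kappa>" using d by auto
        moreover have "md_cos \<kappa> (PP \<kappa>) = -1" using k by (simp add: md_cos_def)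
        ultimately show False using one 3 by simp
      next
        case False
        have "md_sin \<kappa> (2 * pi / sqrt \<kappa> - (?d + ?e)) > 0"
          by (rule md_sin_pos) (use c d False k in auto)
        then show False using md_m_reflect(2)[OF k] ge by simp
      qed
    qed
    show ?thesis using m
      by (subst (asm) md_m_eq_iff) (use model_dist_props assms le in auto)
  qed
qed

section \<open>Antipodes and critical perimeters on spheres\<close>

lemma model_antipode:
  assumes "\<kappa> > 0" "a \<in> hat_plane \<kappa>" "c \<in> hat_plane \<kappa>"
  shows "- c \<in> hat_plane \<kappa>" "model_dist \<kappa> a (- c) = PP \<kappa> - model_dist \<kappa> a c"
proof -
  show m: "- c \<in> hat_plane \<kappa>" using assms by (simp add: hat_plane_pos)
  have "mu \<kappa> a (- c) = 2 / \<kappa> - mu \<kappa> a c"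
    using assms m by (simp add: mu_nonzero mform_simps)
  also have "\<dots> = md_m \<kappa> (PP \<kappa> - model_dist \<kappa> a c)"
    using assms by (simp add: md_sin_reflect model_dist_props)
  finally show "model_dist \<kappa> a (- c) = PP \<kappa> - model_dist \<kappa> a c"
    by (rule model_dist_eqI[OF assms(2) m]) (use model_dist_props[OF assms(2,3)] assms(1) in auto)
qed

lemma model_dist_PP:
  assumes "\<kappa> > 0" "a \<in> hat_plane \<kappa>" "c \<in> hat_plane \<kappa>" "model_dist \<kappa> a c = PP \<kappa>"
  shows "c = - a"
proof -
  have "model_dist \<kappa> a (- c) = 0" using model_antipode[OF assms(1-3)] assms(4) by simp
  then have "a = - c" by (intro model_dist_eq_0[OF assms(2) model_antipode(1)[OF assms(1-3)]])
  then show ?thesis by simp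
qed

lemma model_dist_less_PP:
  assumes "a \<in> hat_plane \<kappa>" "c \<in> hat_plane \<kappa>" "c \<noteq> - a" "\<kappa> > 0"
  shows "model_dist \<kappa> a c < PP \<kappa>"
  using assms model_dist_PP[of \<kappa> a c] model_dist_props(3)[of a \<kappa> c] by fastforce

text \<open>Replacing \<open>c\<close> by \<open>- c\<close> turns a perimeter of at least
  \<open>2 * PP \<kappa>\<close> into equality in the triangle inequality for \<open>a\<close>,
  \<open>- c\<close>, \<open>b\<close>, and \<open>seg_rel\<close> supplies the relation, with the
  sines of the opposite sides as weights. If all of these vanish, two vertices are
  antipodal.\<close>

lemma model_perimeter:
  assumes "a \<in> hat_plane \<kappa>" "b \<in> hat_plane \<kappa>" "c \<in> hat_plane \<kappa>"
    and "\<not> okp \<kappa> (model_dist \<kappa> a b + model_dist \<kappa> b c + model_dist \<kappa> c a)"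
  obtains \<alpha> \<beta> \<gamma> where "\<alpha> \<ge> 0" "\<beta> \<ge> 0" "\<gamma> \<ge> 0" "\<alpha> + \<beta> + \<gamma> > 0"
    "\<alpha> *\<^sub>R a + \<beta> *\<^sub>R b + \<gamma> *\<^sub>R c = 0"
proof -
  have k: "\<kappa> > 0" and ge: "model_dist \<kappa> a b + model_dist \<kappa> b c + model_dist \<kappa> c a \<ge> 2 * PP \<kappa>"
    using assms(4) by (auto simp: okp_def)
  note anti = model_antipode[OF k]
  have ca: "model_dist \<kappa> c a = model_dist \<kappa> a c" using model_dist_commute assms by auto
  have cb: "model_dist \<kappa> (- c) b = model_dist \<kappa> b (- c)" using model_dist_commute assms anti by auto
  have "model_dist \<kappa> a b \<le> model_dist \<kappa> a (- c) + model_dist \<kappa> (- c) b"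
    by (rule model_dist_triangle) (use assms anti in auto)
  then have eq: "model_dist \<kappa> a b = model_dist \<kappa> a (- c) + model_dist \<kappa> (- c) b"
    using ge anti[OF assms(1,3)] anti[OF assms(2,3)] ca cb by simp
  have rel: "md_sin \<kappa> (model_dist \<kappa> b c) *\<^sub>R a + md_sin \<kappa> (model_dist \<kappa> a c) *\<^sub>R b
      + md_sin \<kappa> (model_dist \<kappa> a b) *\<^sub>R c = 0"
    using seg_rel[OF assms(1) anti(1)[OF assms(1,3)] assms(2) eq] anti(2)[OF assms(1,3)] anti(2)[OF assms(2,3)] cb
    by (simp add: md_sin_reflect k)
  have nn: "md_sin \<kappa> (model_dist \<kappa> b c) \<ge> 0" "md_sin \<kappa> (model_dist \<kappa> a c) \<ge> 0" "md_sin \<kappa> (model_dist \<kappa> a b) \<ge> 0"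
    using md_sin_model_nonneg assms by auto
  show ?thesis
  proof (cases "md_sin \<kappa> (model_dist \<kappa> b c) + md_sin \<kappa> (model_dist \<kappa> a c) + md_sin \<kappa> (model_dist \<kappa> a b) > 0")
    case True
    show ?thesis by (rule that[OF _ _ _ _ rel]) (use nn True in auto)
  next
    case False
    then have z: "md_sin \<kappa> (model_dist \<kappa> a b) = 0" "md_sin \<kappa> (model_dist \<kappa> b c) = 0" using nn by linarith+
    have v: "d = 0 \<or> d = PP \<kappa>" if "md_sin \<kappa> d = 0" "d \<ge> 0" "d \<le> PP \<kappa>" for d
      using that md_sin_pos[of d \<kappa>] by fastforce
    have "model_dist \<kappa> a b = PP \<kappa> \<or> model_dist \<kappa> b c = PP \<kappa>"
    proof (rule ccontr)
      assume "\<not> ?thesis"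
      then have "model_dist \<kappa> a b = 0" "model_dist \<kappa> b c = 0"
        using v[OF z(1)] v[OF z(2)] model_dist_props[OF assms(1,2)] model_dist_props[OF assms(2,3)] k by auto
      then show False using ge model_dist_props(3)[OF assms(3,1) k] k
        by (simp add: field_simps) (use pi_gt_zero in linarith)
    qed
    then have "b = - a \<or> c = - b" using model_dist_PP[OF k assms(1,2)] model_dist_PP[OF k assms(2,3)] by auto
    then show ?thesis using that[of 1 1 0] that[of 0 1 1] by auto
  qed
qed

text \<open>A critical perimeter would give a vanishing combination with nonnegative weights, which
  is impossible in an open half space. Perimeters of points of an open cone are checked in this
  way.\<close>

lemma okp_halfspace:
  assumes "a \<in> hat_plane \<kappa>" "b \<in> hat_plane \<kappa>" "c \<in> hat_plane \<kappa>" "n \<bullet> a > 0" "n \<bullet> b > 0" "n \<bullet> c > 0"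
  shows "okp \<kappa> (model_dist \<kappa> a b + model_dist \<kappa> b c + model_dist \<kappa> c a)"
proof (rule ccontr)
  assume n: "\<not> ?thesis"
  obtain \<alpha> \<beta> \<gamma> where nn: "\<alpha> \<ge> 0" "\<beta> \<ge> 0" "\<gamma> \<ge> 0" "\<alpha> + \<beta> + \<gamma> > 0"
    and r: "\<alpha> *\<^sub>R a + \<beta> *\<^sub>R b + \<gamma> *\<^sub>R c = 0" by (rule model_perimeter[OF assms(1-3) n])
  have "\<alpha> * (n \<bullet> a) + \<beta> * (n \<bullet> b) + \<gamma> * (n \<bullet> c) = n \<bullet> (\<alpha> *\<^sub>R a + \<beta> *\<^sub>R b + \<gamma> *\<^sub>R c)"
    by (simp add: inner_add_right)
  then have z: "\<alpha> * (n \<bullet> a) + \<beta> * (n \<bullet> b) + \<gamma> * (n \<bullet> c) = 0" using r by simp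
  have p: "\<alpha> * (n \<bullet> a) \<ge> 0" "\<beta> * (n \<bullet> b) \<ge> 0" "\<gamma> * (n \<bullet> c) \<ge> 0" using nn assms by auto
  then have "\<alpha> * (n \<bullet> a) = 0" "\<beta> * (n \<bullet> b) = 0" "\<gamma> * (n \<bullet> c) = 0" using z by linarith+
  then show False using assms nn by auto
qed

section \<open>Determinants and linear independence\<close>

definition det3 :: "real ^ 3 \<Rightarrow> real ^ 3 \<Rightarrow> real ^ 3 \<Rightarrow> real" where
  "det3 a b c = a \<bullet> cross3 b c"

lemma det3_simps:
  "det3 (u + v) b c = det3 u b c + det3 v b c" "det3 (r *\<^sub>R u) b c = r * det3 u b c"
  "det3 b (u + v) c = det3 b u c + det3 b v c" "det3 b (r *\<^sub>R u) c = r * det3 b u c"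
  "det3 b c (u + v) = det3 b c u + det3 b c v" "det3 b c (r *\<^sub>R u) = r * det3 b c u"
  "det3 a a b = 0" "det3 a b a = 0" "det3 b a a = 0"
  "det3 (- u) b c = - det3 u b c" "det3 b (- u) c = - det3 b u c" "det3 b c (- u) = - det3 b c u"
  "det3 0 b c = 0" "det3 b 0 c = 0" "det3 b c 0 = 0"
  by (simp_all add: det3_def cross3_def inner_vec_def sum_3 vector_3 algebra_simps)

lemma det3_cyclic: "det3 b c a = det3 a b c" "det3 c a b = det3 a b c"
  by (simp_all add: det3_def cross3_def inner_vec_def sum_3 vector_3 algebra_simps)

lemma det3_expand: "det3 a b c *\<^sub>R v = det3 v b c *\<^sub>R a + det3 a v c *\<^sub>R b + det3 a b v *\<^sub>R c"
  by (simp add: vec_eq_iff forall_3 det3_def cross3_def inner_vec_def sum_3 vector_3 algebra_simps)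

lemma det3_basis:
  assumes "det3 a b c \<noteq> 0"
  shows "v = (det3 v b c / det3 a b c) *\<^sub>R a + (det3 a v c / det3 a b c) *\<^sub>R b + (det3 a b v / det3 a b c) *\<^sub>R c"
proof -
  have "v = (1 / det3 a b c) *\<^sub>R (det3 a b c *\<^sub>R v)" using assms by simp
  also have "\<dots> = (det3 v b c / det3 a b c) *\<^sub>R a + (det3 a v c / det3 a b c) *\<^sub>R b + (det3 a b v / det3 a b c) *\<^sub>R c"
    unfolding det3_expand[of a b c v] by (simp add: scaleR_add_right)
  finally show ?thesis .
qed

lemma det3_zero_inner:
  assumes "det3 a b c \<noteq> 0" "n \<bullet> a = 0" "n \<bullet> b = 0" "n \<bullet> c = 0"
  shows "n = 0"
proof -
  have "n \<bullet> n = 0" by (subst (2) det3_basis[OF assms(1), of n]) (simp add: inner_add_right assms)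
  then show ?thesis by simp
qed

lemma okp_independent:
  assumes "a \<in> hat_plane \<kappa>" "b \<in> hat_plane \<kappa>" "c \<in> hat_plane \<kappa>" "det3 a b c \<noteq> 0"
  shows "okp \<kappa> (model_dist \<kappa> a b + model_dist \<kappa> b c + model_dist \<kappa> c a)"
proof (rule ccontr)
  assume n: "\<not> ?thesis"
  obtain \<alpha> \<beta> \<gamma> where nn: "\<alpha> + \<beta> + \<gamma> > 0"
    and r: "\<alpha> *\<^sub>R a + \<beta> *\<^sub>R b + \<gamma> *\<^sub>R c = 0" by (rule model_perimeter[OF assms(1-3) n])
  have "det3 (\<alpha> *\<^sub>R a + \<beta> *\<^sub>R b + \<gamma> *\<^sub>R c) b c = 0" "det3 a (\<alpha> *\<^sub>R a + \<beta> *\<^sub>R b + \<gamma> *\<^sub>R c) c = 0"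
    "det3 a b (\<alpha> *\<^sub>R a + \<beta> *\<^sub>R b + \<gamma> *\<^sub>R c) = 0" by (simp_all add: r det3_simps(13-15))
  then have "\<alpha> = 0" "\<beta> = 0" "\<gamma> = 0" using assms(4) by (simp_all add: det3_simps)
  then show False using nn by simp
qed

lemma model_point_unique:
  assumes "p \<in> hat_plane \<kappa>" "q \<in> hat_plane \<kappa>" "det3 a b c \<noteq> 0"
    and "\<And>v. v \<in> {a, b, c} \<Longrightarrow> v \<in> hat_plane \<kappa> \<and> model_dist \<kappa> p v = model_dist \<kappa> q v"
  shows "p = q"
proof -
  have m: "mu \<kappa> p v = mu \<kappa> q v" if "v \<in> {a, b, c}" for v
    using assms(4)[OF that] model_dist_props(1)[OF assms(1), of v] model_dist_props(1)[OF assms(2), of v] by simp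
  consider "\<kappa> > 0" | "\<kappa> = 0" | "\<kappa> < 0" by linarith
  then show ?thesis
  proof cases
    case 1
    have "(p - q) \<bullet> v = 0" if "v \<in> {a, b, c}" for v
      using m[OF that] assms(4)[OF that] assms(1,2) 1 by (simp add: mu_nonzero mform_def inner_diff_left)
    then show ?thesis using det3_zero_inner[OF assms(3), of "p - q"] by simp
  next
    case 2
    \<comment> \<open>The vertices have third coordinate 1, so the affine equation of the
      perpendicular bisector of \<open>p\<close> and \<open>q\<close> becomes linear once its
      constant is put into the third entry.\<close>
    define n where "n = (p - q) - axis 3 ((p \<bullet> p - q \<bullet> q) / 2)"
    have "n \<bullet> v = 0" if "v \<in> {a, b, c}" for v
    proof -
      have v: "v $ 3 = 1" using assms(4)[OF that] 2 by (simp add: hat_plane_def)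
      have "(p - v) \<bullet> (p - v) = (q - v) \<bullet> (q - v)" using m[OF that] 2 by (simp add: mu_def mform_def)
      then have e: "p \<bullet> p + q \<bullet> v * 2 = q \<bullet> q + p \<bullet> v * 2"
        by (simp add: inner_diff_left inner_diff_right inner_commute)
      have "n \<bullet> v = p \<bullet> v - q \<bullet> v - (p \<bullet> p - q \<bullet> q) / 2"
        by (simp add: n_def inner_diff_left inner_axis' v)
      then show ?thesis using e by simp
    qed
    then have n: "n = 0" using det3_zero_inner[OF assms(3), of n] by simp
    have "p $ i = q $ i" if "i \<noteq> 3" for i
      using arg_cong[OF n, of "\<lambda>v. v $ i"] that by (simp add: n_def axis_def)
    moreover have "p $ 3 = q $ 3" using assms(1,2) 2 by (simp add: hat_plane_def)
    ultimately show ?thesis by (auto simp: vec_eq_iff forall_3)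
  next
    case 3
    \<comment> \<open>The sign change in the third entry turns the Lorentz product with
      \<open>p - q\<close> into the Euclidean product with \<open>n\<close>.\<close>
    define n :: "real ^ 3" where "n = vector [p $ 1 - q $ 1, p $ 2 - q $ 2, q $ 3 - p $ 3]"
    have "n \<bullet> v = 0" if "v \<in> {a, b, c}" for v
      using m[OF that] assms(4)[OF that] assms(1,2) 3
      by (simp add: mu_nonzero mform_def lorentz_def n_def inner_vec_def sum_3 algebra_simps)
    then have n: "n = 0" using det3_zero_inner[OF assms(3), of n] by simp
    then have "n $ 1 = 0" "n $ 2 = 0" "n $ 3 = 0" by auto
    then show ?thesis by (simp add: n_def vec_eq_iff forall_3)
  qed
qed

lemma md_m_leI: "s \<le> t \<Longrightarrow> 0 \<le> s \<Longrightarrow> (\<kappa> > 0 \<Longrightarrow> t \<le> PP \<kappa>) \<Longrightarrow> md_m \<kappa> s \<le> md_m \<kappa> t"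
  using md_m_strict_mono[of s t \<kappa>] by (cases "s = t") auto

lemma md_m_leD: "md_m \<kappa> s \<le> md_m \<kappa> t \<Longrightarrow> 0 \<le> t \<Longrightarrow> (\<kappa> > 0 \<Longrightarrow> s \<le> PP \<kappa>) \<Longrightarrow> s \<le> t"
  using md_m_strict_mono[of t s \<kappa>] by (cases "t < s") auto

section \<open>Geodesic spaces of curvature bounded below\<close>

text \<open>The assumption \<open>copositive\<close> says that the matrix with entries \<open>S\<^sub>i * S\<^sub>j * cos\<close> of the comparison
  angles at \<open>x\<close> is copositive. For three directions this is the condition that the angle sum is
  at most \<open>2 * pi\<close>, but it is stable under limits and requires no distinctness.\<close>

locale cbb_geodesic =
  fixes \<kappa> :: real and T :: "'b::metric_space itself"
  assumes copositive: "\<And>(x::'b) a b c l1 l2 l3.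
      \<lbrakk>okp \<kappa> (peri x a b); okp \<kappa> (peri x b c); okp \<kappa> (peri x c a); okp \<kappa> (peri a b c);
       l1 \<ge> 0; l2 \<ge> 0; l3 \<ge> 0\<rbrakk> \<Longrightarrow>
      0 \<le> l1\<^sup>2 * (md_sin \<kappa> (dist x a))\<^sup>2 + l2\<^sup>2 * (md_sin \<kappa> (dist x b))\<^sup>2 + l3\<^sup>2 * (md_sin \<kappa> (dist x c))\<^sup>2
        + 2 * l1 * l2 * hk \<kappa> (dist x a) (dist x b) (dist a b)
        + 2 * l2 * l3 * hk \<kappa> (dist x b) (dist x c) (dist b c)
        + 2 * l3 * l1 * hk \<kappa> (dist x c) (dist x a) (dist c a)"
    and geodesic: "\<And>(a::'b) b s. 0 \<le> s \<Longrightarrow> s \<le> dist a b \<Longrightarrow> \<exists>p. dist a p = s \<and> dist p b = dist a b - s"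
begin

definition btw :: "'b \<Rightarrow> 'b \<Rightarrow> 'b \<Rightarrow> bool" where
  "btw a p b \<longleftrightarrow> dist a b = dist a p + dist p b"

lemma btw_commute: "btw a p b \<longleftrightarrow> btw b p a"
  by (auto simp: btw_def dist_commute)

lemma btw_peri_le: "btw a p b \<Longrightarrow> peri a p z \<le> peri a b z"
  using dist_triangle[of p z b] by (simp add: btw_def peri_def)

lemma peri_lipschitz: "peri p b c \<le> peri x b c + 2 * dist x p"
  using dist_triangle[of p b x] dist_triangle[of c p x] by (simp add: peri_def dist_commute)

lemma peri_ge: "2 * dist a b \<le> peri a b c"
  using dist_triangle[of a b c] by (simp add: peri_def dist_commute)

lemma okp_dist:
  assumes "okp \<kappa> (peri a b c)" "\<kappa> > 0"
  shows "dist a b < PP \<kappa>" "dist b c < PP \<kappa>" "dist a c < PP \<kappa>"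
  using okp_half[OF assms(1) _ assms(2)] peri_ge[of a b c] peri_ge[of b c a] peri_ge[of c a b]
  by (simp_all add: peri_def dist_commute)

text \<open>Comparison of the distance from \<open>z\<close> to a point of the side \<open>[a, b]\<close>; for \<open>\<kappa> = 0\<close> the right
  hand side is the one in Stewart's theorem.\<close>

lemma point_on_side:
  fixes a b p z :: 'b
  assumes "btw a p b" "okp \<kappa> (peri a b z)"
  shows "md_sin \<kappa> (dist a b) * md_m \<kappa> (dist p z) \<ge>
    md_sin \<kappa> (dist p b) * (md_m \<kappa> (dist a z) - md_m \<kappa> (dist a p))
    + md_sin \<kappa> (dist a p) * (md_m \<kappa> (dist b z) - md_m \<kappa> (dist p b))"
proof -
  let ?s = "dist a p" and ?t = "dist p b"
  let ?S = "md_sin \<kappa> ?s" and ?T = "md_sin \<kappa> ?t"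
  have L: "dist a b = ?s + ?t" using assms by (simp add: btw_def)
  have k1: "okp \<kappa> (peri p a b)" using okp_mono[OF assms(2)] L peri_ge[of a b z] by (simp add: peri_def dist_commute)
  have k2: "okp \<kappa> (peri p b z)" using okp_mono[OF assms(2)] L dist_triangle[of z p a] by (simp add: peri_def dist_commute)
  have k3: "okp \<kappa> (peri p z a)" using okp_mono[OF assms(2)] L dist_triangle[of z p b] by (simp add: peri_def dist_commute)
  have k4: "okp \<kappa> (peri a b z)" by fact
  have S: "?S \<ge> 0" "?T \<ge> 0"
    using okp_dist[OF k1] okp_dist[OF k2] by (auto intro!: md_sin_nonneg simp: dist_commute less_imp_le)
  define W where "W = ?T * hk \<kappa> ?s (dist p z) (dist a z) + ?S * hk \<kappa> ?t (dist p z) (dist b z)"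
  \<comment> \<open>At \<open>p\<close> the directions to \<open>a\<close> and \<open>b\<close> are
    opposite. With weight \<open>?T\<close> at \<open>a\<close> and \<open>?S\<close> at
    \<open>b\<close> the terms without \<open>z\<close> cancel, and only the weight \<open>e\<close>
    of \<open>z\<close> is left to vary.\<close>
  have fm: "0 \<le> e\<^sup>2 * (md_sin \<kappa> (dist p z))\<^sup>2 + 2 * e * W" if "e > 0" for e
  proof -
    have "hk \<kappa> (dist p a) (dist p b) (dist a b) = - ?S * ?T" using hk_sum[of \<kappa> ?s ?t] L by (simp add: dist_commute)
    moreover have "hk \<kappa> (dist p z) (dist p a) (dist z a) = hk \<kappa> ?s (dist p z) (dist a z)"
      by (simp add: dist_commute hk_commute)
    moreover have "hk \<kappa> (dist p b) (dist p z) (dist b z) = hk \<kappa> ?t (dist p z) (dist b z)"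
      by simp
    ultimately show ?thesis
      using copositive[OF k1 k2 k3 k4 S(2) S(1), of e] that by (simp add: W_def dist_commute) (simp add: power2_eq_square algebra_simps)
  qed
  have "W \<ge> 0"
  proof (rule ccontr)
    assume n: "\<not> W \<ge> 0"
    define Q where "Q = (md_sin \<kappa> (dist p z))\<^sup>2"
    have Q: "Q \<ge> 0" by (simp add: Q_def)
    \<comment> \<open>Small enough that \<open>e * Q \<le> - W\<close>, so that the linear term
      prevails if \<open>W\<close> is negative.\<close>
    define e where "e = - W / (Q + 1)"
    have e: "e > 0" using n Q by (simp add: e_def divide_neg_pos)
    have "e * (e * Q + 2 * W) \<ge> 0" using fm[OF e] unfolding Q_def[symmetric] by (simp add: power2_eq_square algebra_simps)
    then have "e * Q + 2 * W \<ge> 0" using e by (simp add: zero_le_mult_iff)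
    moreover have "e * Q \<le> - W" using n Q by (simp add: e_def field_simps)
    ultimately show False using n by linarith
  qed
  moreover have "W = md_m \<kappa> (dist p z) * md_sin \<kappa> (?s + ?t)
      - ?T * (md_m \<kappa> (dist a z) - md_m \<kappa> ?s) - ?S * (md_m \<kappa> (dist b z) - md_m \<kappa> ?t)"
    by (simp add: W_def hk_def md_sin_add md_cos_eq algebra_simps)
  ultimately show ?thesis using L by (simp add: mult.commute)
qed

end

text \<open>Stewart's theorem in the model plane: pair the relation of \<open>seg_rel\<close>,
  projected to the tangent plane at \<open>P\<close>, with the tangent vector towards
  \<open>Z\<close>.\<close>

lemma model_point_on_side:
  assumes "A \<in> hat_plane \<kappa>" "P \<in> hat_plane \<kappa>" "B \<in> hat_plane \<kappa>" "Z \<in> hat_plane \<kappa>"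
    and "model_dist \<kappa> A B = model_dist \<kappa> A P + model_dist \<kappa> P B"
  shows "md_sin \<kappa> (model_dist \<kappa> A B) * md_m \<kappa> (model_dist \<kappa> P Z) =
    md_sin \<kappa> (model_dist \<kappa> P B) * (md_m \<kappa> (model_dist \<kappa> A Z) - md_m \<kappa> (model_dist \<kappa> A P))
    + md_sin \<kappa> (model_dist \<kappa> A P) * (md_m \<kappa> (model_dist \<kappa> B Z) - md_m \<kappa> (model_dist \<kappa> P B))"
proof -
  let ?s = "model_dist \<kappa> A P" and ?t = "model_dist \<kappa> P B"
  let ?S = "md_sin \<kappa> ?s" and ?T = "md_sin \<kappa> ?t"
  have PA: "model_dist \<kappa> P A = ?s" using model_dist_commute assms by auto
  have "tg \<kappa> P (?T *\<^sub>R A + ?S *\<^sub>R B) = tg \<kappa> P (md_sin \<kappa> (model_dist \<kappa> A B) *\<^sub>R P)"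
    using seg_rel[OF assms(1,2,3,5)] by simp
  then have "?T *\<^sub>R tg \<kappa> P A + ?S *\<^sub>R tg \<kappa> P B = 0" using assms(2) by (simp add: tg_simps)
  then have "mform \<kappa> (?T *\<^sub>R tg \<kappa> P A + ?S *\<^sub>R tg \<kappa> P B) (tg \<kappa> P Z) = 0" by (simp add: mform_simps)
  then have "?T * hk \<kappa> ?s (model_dist \<kappa> P Z) (model_dist \<kappa> A Z) + ?S * hk \<kappa> ?t (model_dist \<kappa> P Z) (model_dist \<kappa> B Z) = 0"
    using tg_gram_hk assms PA by (simp add: mform_simps)
  moreover have "?T * hk \<kappa> ?s (model_dist \<kappa> P Z) (model_dist \<kappa> A Z) + ?S * hk \<kappa> ?t (model_dist \<kappa> P Z) (model_dist \<kappa> B Z)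
    = md_m \<kappa> (model_dist \<kappa> P Z) * md_sin \<kappa> (?s + ?t)
      - ?T * (md_m \<kappa> (model_dist \<kappa> A Z) - md_m \<kappa> ?s) - ?S * (md_m \<kappa> (model_dist \<kappa> B Z) - md_m \<kappa> ?t)"
    by (simp add: hk_def md_sin_add md_cos_eq algebra_simps)
  ultimately show ?thesis using assms(5) by (simp add: mult.commute)
qed

section \<open>Comparison along sides and at hinges\<close>

context cbb_geodesic begin

abbreviation N where "N \<equiv> hat_plane \<kappa>"
abbreviation \<delta> where "\<delta> \<equiv> model_dist \<kappa>"

text \<open>Below, capital letters denote points of the model plane; \<open>onseg a p b A P B\<close> says that \<open>p\<close>
  and \<open>P\<close> divide \<open>[a, b]\<close> and \<open>[A, B]\<close> in the same way.\<close>

definition onseg where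
  "onseg a p b A P B \<longleftrightarrow> A \<in> N \<and> P \<in> N \<and> B \<in> N \<and> btw a p b \<and> \<delta> A B = \<delta> A P + \<delta> P B \<and>
    dist a p = \<delta> A P \<and> dist p b = \<delta> P B"

lemma onseg_dist: "onseg a p b A P B \<Longrightarrow> dist a b = \<delta> A B"
  by (simp add: onseg_def btw_def)

lemma onseg_commute: "onseg a p b A P B \<Longrightarrow> onseg b p a B P A"
  unfolding onseg_def using model_dist_commute[of A \<kappa> P] model_dist_commute[of P \<kappa> B] model_dist_commute[of A \<kappa> B]
  by (auto simp: btw_commute[of b] dist_commute)

text \<open>The right hand side of \<open>point_on_side\<close> is monotone in the distances from
  the end points, and in the model plane there is equality. Hence lower bounds at the ends of a side
  pass to the points in between.\<close>

lemma side_ge: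
  assumes "onseg a p b A P B" "Z \<in> N" "\<delta> A Z \<le> dist a z" "\<delta> B Z \<le> dist b z" "okp \<kappa> (peri a b z)"
  shows "\<delta> P Z \<le> dist p z"
proof (cases "dist a b = 0")
  case True
  then have "dist a p = 0" "\<delta> A P = 0" using assms(1) zero_le_dist[of a p] zero_le_dist[of p b]
    unfolding onseg_def btw_def by linarith+
  moreover have "A \<in> N" "P \<in> N" using assms(1) unfolding onseg_def by blast+
  ultimately show ?thesis using assms(3) model_dist_eq_0[of A \<kappa> P] by simp
next
  case False
  have mem: "A \<in> N" "P \<in> N" "B \<in> N" and b: "btw a p b" and d: "dist a p = \<delta> A P" "dist p b = \<delta> P B" "dist a b = \<delta> A B"
    and eq: "\<delta> A B = \<delta> A P + \<delta> P B"
    using assms(1) onseg_dist[OF assms(1)] unfolding onseg_def by blast+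
  have okab: "\<kappa> > 0 \<Longrightarrow> dist a b < PP \<kappa>" and okaz: "\<kappa> > 0 \<Longrightarrow> dist a z < PP \<kappa>" and okbz: "\<kappa> > 0 \<Longrightarrow> dist b z < PP \<kappa>"
    using okp_dist[OF assms(5)] by auto
  have okpz: "\<kappa> > 0 \<Longrightarrow> dist p z < PP \<kappa>"
    using okp_dist(2)[of a p z] okp_mono[OF assms(5) btw_peri_le[OF b]] by auto
  have S: "md_sin \<kappa> (dist a b) > 0" by (rule md_sin_pos) (use False okab in auto)
  have S2: "md_sin \<kappa> (dist a p) \<ge> 0" "md_sin \<kappa> (dist p b) \<ge> 0" using d md_sin_model_nonneg mem by auto
  have m: "md_m \<kappa> (\<delta> A Z) \<le> md_m \<kappa> (dist a z)" "md_m \<kappa> (\<delta> B Z) \<le> md_m \<kappa> (dist b z)"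
    by (rule md_m_leI; use assms(2-4) mem model_dist_props(2) okaz okbz in \<open>simp add: less_imp_le\<close>)+
  have "md_sin \<kappa> (dist a b) * md_m \<kappa> (\<delta> P Z) =
    md_sin \<kappa> (dist p b) * (md_m \<kappa> (\<delta> A Z) - md_m \<kappa> (dist a p))
    + md_sin \<kappa> (dist a p) * (md_m \<kappa> (\<delta> B Z) - md_m \<kappa> (dist p b))"
    using model_point_on_side[OF mem assms(2) eq] d by simp
  also have "\<dots> \<le> md_sin \<kappa> (dist p b) * (md_m \<kappa> (dist a z) - md_m \<kappa> (dist a p))
    + md_sin \<kappa> (dist a p) * (md_m \<kappa> (dist b z) - md_m \<kappa> (dist p b))"
    using S2 m by (intro add_mono mult_left_mono) auto
  also have "\<dots> \<le> md_sin \<kappa> (dist a b) * md_m \<kappa> (dist p z)" by (rule point_on_side[OF b assms(5)])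
  finally have "md_m \<kappa> (\<delta> P Z) \<le> md_m \<kappa> (dist p z)" using S by simp
  then show ?thesis
    by (rule md_m_leD) (use assms(2) mem model_dist_props in simp_all)
qed

text \<open>The inequality of \<open>point_on_side\<close> solved for the distance from
  \<open>b\<close>: its coefficient is the sine of \<open>dist a p\<close>, which is positive as
  \<open>p \<noteq> a\<close>. Upper bounds thus travel outwards along a geodesic.\<close>

lemma side_le:
  assumes "onseg a p b A P B" "Z \<in> N" "\<delta> A Z \<le> dist a z" "dist p z \<le> \<delta> P Z" "okp \<kappa> (peri a b z)" "p \<noteq> a"
  shows "dist b z \<le> \<delta> B Z"
proof -
  have mem: "A \<in> N" "P \<in> N" "B \<in> N" and b: "btw a p b" and d: "dist a p = \<delta> A P" "dist p b = \<delta> P B" "dist a b = \<delta> A B"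
    and eq: "\<delta> A B = \<delta> A P + \<delta> P B"
    using assms(1) onseg_dist[OF assms(1)] unfolding onseg_def by blast+
  have okab: "\<kappa> > 0 \<Longrightarrow> dist a b < PP \<kappa>" and okaz: "\<kappa> > 0 \<Longrightarrow> dist a z < PP \<kappa>" and okbz: "\<kappa> > 0 \<Longrightarrow> dist b z < PP \<kappa>"
    using okp_dist[OF assms(5)] by auto
  have okpz: "\<kappa> > 0 \<Longrightarrow> dist p z < PP \<kappa>"
    using okp_dist(2)[of a p z] okp_mono[OF assms(5) btw_peri_le[OF b]] by auto
  have ap: "dist a p > 0" "dist a p \<le> dist a b" using assms(6) b by (auto simp: btw_def)
  have S: "md_sin \<kappa> (dist a b) > 0" "md_sin \<kappa> (dist a p) > 0"
    using md_sin_pos[of "dist a b" \<kappa>] md_sin_pos[of "dist a p" \<kappa>] ap okab by fastforce+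
  have S2: "md_sin \<kappa> (dist p b) \<ge> 0" using d md_sin_model_nonneg mem by auto
  have m: "md_m \<kappa> (\<delta> A Z) \<le> md_m \<kappa> (dist a z)" "md_m \<kappa> (dist p z) \<le> md_m \<kappa> (\<delta> P Z)"
    by (rule md_m_leI; use assms(2-4) mem model_dist_props(2,3) okaz okpz in \<open>simp add: less_imp_le\<close>)+
  have "md_sin \<kappa> (dist p b) * (md_m \<kappa> (dist a z) - md_m \<kappa> (dist a p))
    + md_sin \<kappa> (dist a p) * (md_m \<kappa> (dist b z) - md_m \<kappa> (dist p b)) \<le> md_sin \<kappa> (dist a b) * md_m \<kappa> (dist p z)"
    by (rule point_on_side[OF b assms(5)])
  also have "\<dots> \<le> md_sin \<kappa> (dist a b) * md_m \<kappa> (\<delta> P Z)" using S m by simp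
  also have "\<dots> = md_sin \<kappa> (dist p b) * (md_m \<kappa> (\<delta> A Z) - md_m \<kappa> (dist a p))
    + md_sin \<kappa> (dist a p) * (md_m \<kappa> (\<delta> B Z) - md_m \<kappa> (dist p b))"
    using model_point_on_side[OF mem assms(2) eq] d by simp
  also have "\<dots> \<le> md_sin \<kappa> (dist p b) * (md_m \<kappa> (dist a z) - md_m \<kappa> (dist a p))
    + md_sin \<kappa> (dist a p) * (md_m \<kappa> (\<delta> B Z) - md_m \<kappa> (dist p b))"
    using S2 S m by (intro add_mono mult_left_mono) auto
  finally have "md_m \<kappa> (dist b z) \<le> md_m \<kappa> (\<delta> B Z)" using S by simp
  then show ?thesis
    by (rule md_m_leD) (use assms(2) mem model_dist_props(2) okbz in \<open>simp_all add: less_imp_le\<close>)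
qed

text \<open>With the weights of the relation the Gram form at \<open>X\<close> vanishes, while the
  form at \<open>x\<close> is nonnegative and only grows if \<open>dist a c\<close> and
  \<open>dist b c\<close> are lowered to the model distances. So the remaining term cannot be
  smaller at \<open>x\<close> than at \<open>X\<close>, which bounds \<open>dist a b\<close> from
  above.\<close>

lemma hinge_ge_model:
  fixes x a b c :: 'b
  assumes mem: "X \<in> N" "A \<in> N" "B \<in> N" "C \<in> N"
    and x: "dist x a = \<delta> X A" "dist x b = \<delta> X B" "dist x c = \<delta> X C"
    and ge: "\<delta> A C \<le> dist a c" "\<delta> B C \<le> dist b c"
    and rel: "la *\<^sub>R A + lb *\<^sub>R B + lc *\<^sub>R C = r *\<^sub>R X" and l: "la \<ge> 0" "lb > 0" "lc \<ge> 0"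
    and ok: "okp \<kappa> (peri x a b)" "okp \<kappa> (peri x b c)" "okp \<kappa> (peri x c a)" "okp \<kappa> (peri a b c)"
  shows "dist a b \<le> \<delta> A B"
proof -
  let ?u = "tg \<kappa> X A" and ?v = "tg \<kappa> X B" and ?w = "tg \<kappa> X C"
  let ?g = "mform \<kappa>"
  have z: "la *\<^sub>R ?u + lb *\<^sub>R ?v + lc *\<^sub>R ?w = 0"
    using arg_cong[OF rel, of "tg \<kappa> X"] mem by (simp add: tg_simps)
  define D where "D = hk \<kappa> (dist x a) (dist x b) (dist a b) - ?g ?u ?v"
  have dok: "\<kappa> > 0 \<Longrightarrow> dist a c < PP \<kappa>" "\<kappa> > 0 \<Longrightarrow> dist b c < PP \<kappa>" "\<kappa> > 0 \<Longrightarrow> dist a b < PP \<kappa>"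
    using okp_dist[OF ok(4)] by auto
  have m: "md_m \<kappa> (\<delta> A C) \<le> md_m \<kappa> (dist a c)" "md_m \<kappa> (\<delta> B C) \<le> md_m \<kappa> (dist b c)"
    by (rule md_m_leI; use ge mem model_dist_props(2) dok in \<open>simp add: less_imp_le\<close>)+
  have kc: "hk \<kappa> (dist x b) (dist x c) (dist b c) \<le> ?g ?v ?w" "hk \<kappa> (dist x c) (dist x a) (dist c a) \<le> ?g ?w ?u"
    using m tg_gram_hk[OF mem(1,3,4)] tg_gram_hk[OF mem(1,4,2)] x model_dist_commute[OF mem(2,4)]
    by (auto simp: hk_def dist_commute)
  have n: "?g ?u ?u = (md_sin \<kappa> (dist x a))\<^sup>2" "?g ?v ?v = (md_sin \<kappa> (dist x b))\<^sup>2" "?g ?w ?w = (md_sin \<kappa> (dist x c))\<^sup>2"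
    using tg_norm mem x by auto
  \<comment> \<open>For \<open>la = 0\<close> the term of \<open>a\<close> and \<open>b\<close>
    would drop out, so the weight is raised to \<open>la + e\<close>. The form at \<open>X\<close>
    changes only in second order in \<open>e\<close>.\<close>
  have fm: "0 \<le> e\<^sup>2 * (md_sin \<kappa> (dist x a))\<^sup>2 + 2 * (la + e) * lb * D" if "e > 0" for e
  proof -
    let ?l = "la + e"
    have "0 \<le> ?l\<^sup>2 * (md_sin \<kappa> (dist x a))\<^sup>2 + lb\<^sup>2 * (md_sin \<kappa> (dist x b))\<^sup>2 + lc\<^sup>2 * (md_sin \<kappa> (dist x c))\<^sup>2
        + 2 * ?l * lb * hk \<kappa> (dist x a) (dist x b) (dist a b)
        + 2 * lb * lc * hk \<kappa> (dist x b) (dist x c) (dist b c)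
        + 2 * lc * ?l * hk \<kappa> (dist x c) (dist x a) (dist c a)"
      by (rule copositive[OF ok]) (use l that in auto)
    also have "\<dots> \<le> ?l\<^sup>2 * ?g ?u ?u + lb\<^sup>2 * ?g ?v ?v + lc\<^sup>2 * ?g ?w ?w
        + 2 * ?l * lb * (?g ?u ?v + D)
        + 2 * lb * lc * ?g ?v ?w + 2 * lc * ?l * ?g ?w ?u"
      unfolding n D_def by (intro add_mono mult_left_mono kc) (use l that in auto)
    also have "\<dots> = ?g (la *\<^sub>R ?u + lb *\<^sub>R ?v + lc *\<^sub>R ?w + e *\<^sub>R ?u) (la *\<^sub>R ?u + lb *\<^sub>R ?v + lc *\<^sub>R ?w + e *\<^sub>R ?u)
        + 2 * ?l * lb * D"
      by (simp add: mform_simps mform_commute[of \<kappa> ?v ?u] mform_commute[of \<kappa> ?w ?u] mform_commute[of \<kappa> ?w ?v]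
          power2_eq_square algebra_simps)
    also have "\<dots> = e\<^sup>2 * (md_sin \<kappa> (dist x a))\<^sup>2 + 2 * ?l * lb * D"
      unfolding z by (simp add: mform_simps n power2_eq_square)
    finally show ?thesis .
  qed
  have "D \<ge> 0"
  proof (rule ccontr)
    assume nD: "\<not> D \<ge> 0"
    define Q where "Q = (md_sin \<kappa> (dist x a))\<^sup>2"
    have Q: "Q \<ge> 0" by (simp add: Q_def)
    define e where "e = - (lb * D) / (Q + 1)"
    have lD: "lb * D < 0" using nD l by (simp add: mult_pos_neg)
    have e: "e > 0" using lD Q by (simp add: e_def divide_neg_pos)
    have "la * (lb * D) \<le> 0" using l lD by (simp add: mult_nonneg_nonpos)
    then have "e * (e * Q + 2 * (lb * D)) \<ge> 0" using fm[OF e] unfolding Q_def[symmetric] by (simp add: power2_eq_square algebra_simps)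
    then have "e * Q + 2 * (lb * D) \<ge> 0" using e by (simp add: zero_le_mult_iff)
    moreover have "e * Q \<le> - (lb * D)" using lD Q by (simp add: e_def field_simps)
    ultimately show False using lD by linarith
  qed
  then have "md_m \<kappa> (dist a b) \<le> md_m \<kappa> (\<delta> A B)"
    using tg_gram_hk[OF mem(1,2,3)] x by (simp add: D_def hk_def)
  then show ?thesis
    by (rule md_m_leD) (use mem model_dist_props(2) dok in \<open>simp_all add: less_imp_le\<close>)
qed

end

section \<open>Division points and tripods\<close>

context cbb_geodesic begin

lemma onseg_exists:
  assumes "A \<in> N" "B \<in> N" "P \<in> N" "dist a b = \<delta> A B" "\<delta> A B = \<delta> A P + \<delta> P B"
  obtains p where "onseg a p b A P B"
proof -
  have "0 \<le> \<delta> A P" "\<delta> A P \<le> dist a b" using assms model_dist_props(2)[of A \<kappa> P] model_dist_props(2)[of P \<kappa> B] by auto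
  then obtain p where "dist a p = \<delta> A P" "dist p b = dist a b - \<delta> A P" using geodesic by blast
  then show ?thesis using that[of p] assms by (simp add: onseg_def btw_def)
qed

lemma onseg_model_exists:
  assumes "A \<in> N" "B \<in> N" "dist a b = \<delta> A B" "\<kappa> > 0 \<Longrightarrow> dist a b < PP \<kappa>" "btw a p b"
  obtains P where "onseg a p b A P B"
proof (cases "dist a b = 0")
  case True
  then have "dist a p = 0" "dist p b = 0" using assms(5) zero_le_dist[of a p] zero_le_dist[of p b] unfolding btw_def by linarith+
  moreover have "A = B" using model_dist_eq_0[OF assms(1,2)] assms(3) True by simp
  ultimately show ?thesis using that[of A] assms by (simp add: onseg_def)
next
  case False
  have D: "0 < \<delta> A B" "\<kappa> > 0 \<Longrightarrow> \<delta> A B < PP \<kappa>" using False assms(3,4) zero_le_dist[of a b] by auto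
  have s: "0 \<le> dist a p" "dist a p \<le> \<delta> A B" using assms(3,5) zero_le_dist[of p b] zero_le_dist[of a p] unfolding btw_def by linarith+
  note m = mpt_props[OF assms(1,2) D s]
  show ?thesis using that[of "mpt \<kappa> A B (dist a p)"] m(1-3) assms by (simp add: onseg_def btw_def)
qed

lemma onseg_at:
  assumes "A \<in> N" "B \<in> N" "dist a b = \<delta> A B" "\<kappa> > 0 \<Longrightarrow> dist a b < PP \<kappa>" "0 \<le> s" "s \<le> dist a b"
  obtains p P where "onseg a p b A P B" "dist a p = s"
proof -
  obtain p where p: "dist a p = s" "dist p b = dist a b - s" using geodesic[OF assms(5,6)] by blast
  then have "btw a p b" by (simp add: btw_def)
  then obtain P where "onseg a p b A P B" using onseg_model_exists[OF assms(1-4)] by auto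
  then show ?thesis using that p by blast
qed

lemma onseg_D:
  assumes "onseg a p b A P B"
  shows "A \<in> N" "P \<in> N" "B \<in> N" "btw a p b" "\<delta> A B = \<delta> A P + \<delta> P B" "dist a p = \<delta> A P" "dist p b = \<delta> P B"
    "dist a b = \<delta> A B" "dist a b = dist a p + dist p b"
  using assms onseg_dist[OF assms] unfolding onseg_def btw_def by auto

lemma onseg_trans:
  assumes "onseg a p b A P B" "onseg a q p A Q P"
  shows "onseg a q b A Q B" "onseg q p b Q P B"
proof -
  note 1 = onseg_D[OF assms(1)] and 2 = onseg_D[OF assms(2)]
  have t: "\<delta> Q B \<le> \<delta> Q P + \<delta> P B" "\<delta> A B \<le> \<delta> A Q + \<delta> Q B" using model_dist_triangle 1 2 by blast+
  have t': "dist q b \<le> dist q p + dist p b" "dist a b \<le> dist a q + dist q b" using dist_triangle by blast+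
  show "onseg a q b A Q B" "onseg q p b Q P B"
    using 1 2 t t' unfolding onseg_def btw_def by auto
qed

lemma onseg_trans':
  assumes "onseg a p b A P B" "onseg p q b P Q B"
  shows "onseg a q b A Q B" "onseg a p q A P Q"
  using onseg_trans[OF onseg_commute[OF assms(1)] onseg_commute[OF assms(2)]] onseg_commute by blast+

lemma onseg_tg: "onseg a p b A P B \<Longrightarrow> md_sin \<kappa> (\<delta> A B) *\<^sub>R tg \<kappa> A P = md_sin \<kappa> (\<delta> A P) *\<^sub>R tg \<kappa> A B"
  using arg_cong[OF seg_rel[of A \<kappa> P B], of "tg \<kappa> A"] by (simp add: onseg_def tg_simps)

lemma onseg_peri_le: "onseg a p b A P B \<Longrightarrow> peri a p z \<le> peri a b z"
  using btw_peri_le onseg_D(4) by blast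

text \<open>Admissibility is known only for triangles with vertex \<open>x\<close>. Therefore
  \<open>hinge_ge_model\<close> is applied to a point \<open>s1\<close> of the leg so close to
  \<open>x\<close> that the perimeter of \<open>s1\<close>, \<open>b\<close>, \<open>c\<close> is
  controlled by that of \<open>x\<close>, \<open>b\<close>, \<open>c\<close>. The upper bounds
  obtained there travel from \<open>s1\<close> to \<open>s\<close> by \<open>side_le\<close>; the
  lower bounds are those of \<open>side_ge\<close>.\<close>

lemma tripod_side:
  assumes mem: "X \<in> N" "A \<in> N" "B \<in> N" "C \<in> N"
    and x: "dist x a = \<delta> X A" "dist x b = \<delta> X B" "dist x c = \<delta> X C"
    and o: "dist a b = \<delta> A B" "dist b c = \<delta> B C" "dist a c = \<delta> A C"
    and rel: "la *\<^sub>R A + lb *\<^sub>R B + lc *\<^sub>R C = r *\<^sub>R X" and l: "la \<ge> 0" "lb > 0" "lc > 0"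
    and ok: "okp \<kappa> (peri x a b)" "okp \<kappa> (peri x b c)" "okp \<kappa> (peri x a c)"
    and s: "onseg x s a X S A"
  shows "dist s b = \<delta> S B" "dist s c = \<delta> S C"
proof -
  note sD = onseg_D[OF s]
  have "dist s b = \<delta> S B \<and> dist s c = \<delta> S C"
  proof (cases "dist x s = 0")
    case True
    then have "s = x" "S = X" using sD(6) model_dist_eq_0[OF mem(1) sD(2)] by auto
    then show ?thesis using x by simp
  next
    case False
    have sge: "\<delta> S B \<le> dist s b" "\<delta> S C \<le> dist s c"
      using side_ge[OF s mem(3)] side_ge[OF s mem(4)] x o ok by auto
    obtain e where e: "e > 0" "\<And>q. q \<le> peri x b c + e \<Longrightarrow> okp \<kappa> q" using okp_slack[OF ok(2)] by metis
    define t where "t = min (e / 2) (dist x s)"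
    have t: "t > 0" "t \<le> dist x s" "2 * t \<le> e" using e(1) False by (auto simp: t_def min_def)
    have xs: "\<kappa> > 0 \<Longrightarrow> dist x s < PP \<kappa>" using okp_dist(1)[OF ok(1)] sD(9) zero_le_dist[of s a] by linarith
    obtain s1 S1 where s1: "onseg x s1 s X S1 S" "dist x s1 = t"
      using onseg_at[OF sD(1,2,6) xs] t by (metis less_imp_le)
    have s1a: "onseg x s1 a X S1 A" using onseg_trans[OF s s1(1)] by blast
    note s1D = onseg_D[OF s1(1)]
    have ge: "\<delta> S1 B \<le> dist s1 b" "\<delta> S1 C \<le> dist s1 c"
      using side_ge[OF s1a mem(3)] side_ge[OF s1a mem(4)] x o ok by auto
    define k where "k = md_sin \<kappa> (\<delta> X S1)"
    have k: "k > 0" unfolding k_def using md_sin_pos[of "\<delta> X S1" \<kappa>] s1D(6) s1(2) t xs by force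
    define m where "m = md_sin \<kappa> (\<delta> X A)"
    have m: "m \<ge> 0" unfolding m_def using md_sin_model_nonneg mem by blast
    \<comment> \<open>Eliminating \<open>A\<close> in favour of \<open>S1\<close> and
      \<open>X\<close> transports the relation to the shortened leg; the multiple of
      \<open>X\<close> is absorbed on the right.\<close>
    have "k *\<^sub>R A = m *\<^sub>R S1 - md_sin \<kappa> (\<delta> S1 A) *\<^sub>R X"
      using seg_rel[of X \<kappa> S1 A] onseg_D[OF s1a] by (simp add: k_def m_def algebra_simps)
    then have "(1 / k) *\<^sub>R (k *\<^sub>R A) = (1 / k) *\<^sub>R (m *\<^sub>R S1 - md_sin \<kappa> (\<delta> S1 A) *\<^sub>R X)" by (rule arg_cong)
    then have A: "A = (m / k) *\<^sub>R S1 - (md_sin \<kappa> (\<delta> S1 A) / k) *\<^sub>R X"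
      using k by (simp add: scaleR_diff_right)
    have rel': "(la * m / k) *\<^sub>R S1 + lb *\<^sub>R B + lc *\<^sub>R C = (r + la * md_sin \<kappa> (\<delta> S1 A) / k) *\<^sub>R X"
      using rel by (subst (asm) A) (simp add: algebra_simps)
    have rel'': "(la * m / k) *\<^sub>R S1 + lc *\<^sub>R C + lb *\<^sub>R B = (r + la * md_sin \<kappa> (\<delta> S1 A) / k) *\<^sub>R X"
      using rel' by (simp add: algebra_simps)
    have la': "la * m / k \<ge> 0" using l m k by simp
    have ok1: "okp \<kappa> (peri x s1 b)" "okp \<kappa> (peri x s1 c)"
      using okp_mono[OF ok(1) onseg_peri_le[OF s1a]] okp_mono[OF ok(3) onseg_peri_le[OF s1a]] by auto
    have ok2: "okp \<kappa> (peri s1 b c)" using e(2) peri_lipschitz[of s1 b c x] s1(2) t by simp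
    have okx: "okp \<kappa> (peri x c s1)" "okp \<kappa> (peri x b s1)" "okp \<kappa> (peri x c b)" "okp \<kappa> (peri s1 c b)"
      using ok1 ok2 ok(2) by (simp_all add: peri_def dist_commute algebra_simps)
    have le: "dist s1 b \<le> \<delta> S1 B"
      by (rule hinge_ge_model[OF mem(1) s1D(2) mem(3,4) s1D(6) x(2,3) ge(2) _ rel' la' l(2) less_imp_le[OF l(3)]
           ok1(1) ok(2) okx(1) ok2]) (simp add: o)
    have cb: "dist c b = \<delta> C B" using o(2) model_dist_commute[OF mem(3,4)] by (simp add: dist_commute)
    have le': "dist s1 c \<le> \<delta> S1 C"
      by (rule hinge_ge_model[OF mem(1) s1D(2) mem(4,3) s1D(6) x(3,2) ge(1) _ rel'' la' l(3) less_imp_le[OF l(2)]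
           ok1(2) okx(3) okx(2) okx(4)]) (simp add: cb)
    have ok3: "okp \<kappa> (peri x s b)" "okp \<kappa> (peri x s c)"
      using okp_mono[OF ok(1) onseg_peri_le[OF s]] okp_mono[OF ok(3) onseg_peri_le[OF s]] by auto
    have ne: "s1 \<noteq> x" using s1(2) t by auto
    have "dist s b \<le> \<delta> S B" using side_le[OF s1(1) mem(3) _ le ok3(1) ne] x by simp
    moreover have "dist s c \<le> \<delta> S C" using side_le[OF s1(1) mem(4) _ le' ok3(2) ne] x by simp
    ultimately show ?thesis using sge by simp
  qed
  then show "dist s b = \<delta> S B" "dist s c = \<delta> S C" by auto
qed

text \<open>An upper bound for one distance between the sides of a hinge propagates outwards; small
  steps keep all perimeters admissible.\<close>

lemma hinge_extend:
  assumes "onseg x b p X B P" "b \<noteq> x" "Q \<in> N" "dist x q = \<delta> X Q" "dist b q \<le> \<delta> B Q"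
    and ok: "okp \<kappa> (\<delta> X P + \<delta> P Q + \<delta> Q X)"
  shows "dist p q \<le> \<delta> P Q"
proof -
  note D = onseg_D[OF assms(1)]
  obtain e where e: "e > 0" "\<And>u. u \<le> \<delta> X P + \<delta> P Q + \<delta> Q X + e \<Longrightarrow> okp \<kappa> u" using okp_slack[OF ok] by metis
  have "\<delta> X P \<le> \<delta> X Q + \<delta> Q P" using model_dist_triangle D assms(3) by blast
  then have xp: "\<kappa> > 0 \<Longrightarrow> dist x p < PP \<kappa>"
    using okp_half[OF ok, of "\<delta> X P"] D(8) model_dist_commute[OF D(1) assms(3)] model_dist_commute[OF D(3) assms(3)] by simp
  \<comment> \<open>Here \<open>n\<close> bounds the number of steps of length \<open>e / 2\<close>
    from \<open>b\<close> to \<open>p\<close>.\<close>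
  have "\<forall>b B. onseg x b p X B P \<longrightarrow> b \<noteq> x \<longrightarrow> dist b q \<le> \<delta> B Q \<longrightarrow> dist b p \<le> real n * (e / 2) \<longrightarrow> dist p q \<le> \<delta> P Q" for n
  proof (induction n)
    case 0
    show ?case
    proof (intro allI impI)
      fix b B assume h: "onseg x b p X B P" "dist b q \<le> \<delta> B Q" "dist b p \<le> real 0 * (e / 2)"
      have "dist b p \<le> 0" using h(3) by simp
      then have "b = p" by simp
      moreover have "\<delta> B P = 0" using onseg_D(7)[OF h(1)] \<open>b = p\<close> by simp
      then have "B = P" using model_dist_eq_0 onseg_D[OF h(1)] by blast
      with \<open>b = p\<close> show "dist p q \<le> \<delta> P Q" using h by simp
    qed
  next
    case (Suc n)
    show ?case
    proof (intro allI impI)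
      fix b B assume h: "onseg x b p X B P" "b \<noteq> x" "dist b q \<le> \<delta> B Q" "dist b p \<le> real (Suc n) * (e / 2)"
      note bD = onseg_D[OF h(1)]
      define t where "t = min (e / 2) (dist b p)"
      have t: "0 \<le> t" "t \<le> dist b p" "2 * t \<le> e" using e(1) by (auto simp: t_def min_def)
      have bp: "\<kappa> > 0 \<Longrightarrow> dist b p < PP \<kappa>" using xp bD(9) zero_le_dist[of x b] by linarith
      obtain c C where c: "onseg b c p B C P" "dist b c = t" using onseg_at[OF bD(2,3,7) bp t(1,2)] by metis
      have xc: "onseg x c p X C P" "onseg x b c X B C" using onseg_trans'[OF h(1) c(1)] by auto
      have cx: "c \<noteq> x"
        using onseg_D(9)[OF xc(2)] h(2) zero_le_dist[of b c] by (metis add_nonneg_eq_0_iff dist_eq_0_iff zero_le_dist)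
      \<comment> \<open>The bound \<open>h(3)\<close> at \<open>b\<close> keeps the perimeter of
        \<open>x\<close>, \<open>c\<close>, \<open>q\<close> within \<open>2 * t\<close> of the
        model perimeter at \<open>P\<close>, so that \<open>side_le\<close> may take the next
        step.\<close>
      have "\<delta> B Q \<le> \<delta> B P + \<delta> P Q" using model_dist_triangle bD assms(3) by blast
      moreover have "dist x c = dist x b + t" using onseg_D(9)[OF xc(2)] c(2) by simp
      moreover have "dist c q \<le> dist b q + t" using dist_triangle[of c q b] c(2) by (simp add: dist_commute)
      moreover have "dist q x = \<delta> Q X" using assms(4) model_dist_commute[OF D(1) assms(3)] by (simp add: dist_commute)
      ultimately have "peri x c q \<le> \<delta> X P + \<delta> P Q + \<delta> Q X + e" using h(3) t bD(5,6) by (simp add: peri_def)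
      then have okc: "okp \<kappa> (peri x c q)" by (rule e(2))
      have "dist c q \<le> \<delta> C Q" by (rule side_le[OF xc(2) assms(3) _ h(3) okc h(2)]) (simp add: assms(4))
      moreover have "dist c p \<le> real n * (e / 2)"
        using onseg_D(9)[OF c(1)] c(2) h(4) e(1) by (auto simp: t_def min_def algebra_simps split: if_splits)
      ultimately show "dist p q \<le> \<delta> P Q" using Suc.IH xc(1) cx by blast
    qed
  qed
  moreover obtain n where "dist b p / (e / 2) \<le> real n" using real_arch_simple by blast
  then have "dist b p \<le> real n * (e / 2)" using e(1) by (simp add: field_simps)
  ultimately show ?thesis using assms by blast
qed

text \<open>One leg is extended after the other. The intermediate triangle \<open>X\<close>,
  \<open>Q\<close>, \<open>P1\<close> has at most the perimeter of \<open>X\<close>,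
  \<open>P\<close>, \<open>Q\<close>, so its admissibility is inherited.\<close>

lemma hinge_extend2:
  assumes p: "onseg x p1 p X P1 P" "p1 \<noteq> x" and q: "onseg x q1 q X Q1 Q" "q1 \<noteq> x"
    and le: "dist p1 q1 \<le> \<delta> P1 Q1" and ok: "okp \<kappa> (\<delta> X P + \<delta> P Q + \<delta> Q X)"
  shows "dist p q \<le> \<delta> P Q"
proof -
  note pD = onseg_D[OF p(1)] and qD = onseg_D[OF q(1)]
  have "\<delta> Q P1 \<le> \<delta> Q P + \<delta> P P1" using model_dist_triangle pD qD by blast
  then have "\<delta> X Q + \<delta> Q P1 + \<delta> P1 X \<le> \<delta> X P + \<delta> P Q + \<delta> Q X"
    using pD(5) model_dist_commute[OF pD(1) qD(3)] model_dist_commute[OF qD(3) pD(3)]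
      model_dist_commute[OF pD(1) pD(2)] model_dist_commute[OF pD(2) pD(3)] by simp
  then have ok1: "okp \<kappa> (\<delta> X Q + \<delta> Q P1 + \<delta> P1 X)" using okp_mono[OF ok] by blast
  have "dist q1 p1 \<le> \<delta> Q1 P1" using le model_dist_commute[OF pD(2) qD(2)] by (simp add: dist_commute)
  then have "dist q p1 \<le> \<delta> Q P1" by (rule hinge_extend[OF q(1,2) pD(2,6) _ ok1])
  then have "dist p1 q \<le> \<delta> P1 Q" using model_dist_commute[OF pD(2) qD(3)] by (simp add: dist_commute)
  then show ?thesis by (rule hinge_extend[OF p qD(3,8) _ ok])
qed

end

section \<open>Quadruples realized around a model point\<close>

context cbb_geodesic begin

text \<open>Equality in the angle sum in embedded form: modulo \<open>X\<close> the relation says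
  that the directions to \<open>Y\<close>, \<open>Z\<close>, \<open>W\<close> positively span the
  tangent plane at \<open>X\<close>. The factor \<open>r\<close> may have either sign;
  \<open>X\<close> lies inside the cone of the vertices for positive \<open>r\<close>. The relation
  persists when a vertex is replaced by a point of its leg.\<close>

definition xquad :: "'b \<Rightarrow> 'b \<Rightarrow> 'b \<Rightarrow> 'b \<Rightarrow> real^3 \<Rightarrow> real^3 \<Rightarrow> real^3 \<Rightarrow> real^3 \<Rightarrow> bool" where
  "xquad x y z w X Y Z W \<longleftrightarrow> X \<in> N \<and> Y \<in> N \<and> Z \<in> N \<and> W \<in> N \<and>
    dist x y = \<delta> X Y \<and> dist x z = \<delta> X Z \<and> dist x w = \<delta> X W \<and>
    dist y z = \<delta> Y Z \<and> dist z w = \<delta> Z W \<and> dist w y = \<delta> W Y \<and>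
    okp \<kappa> (peri x y z) \<and> okp \<kappa> (peri x z w) \<and> okp \<kappa> (peri x w y) \<and> det3 X Y Z \<noteq> 0 \<and>
    (\<exists>ly lz lw r. ly > 0 \<and> lz > 0 \<and> lw > 0 \<and> ly *\<^sub>R Y + lz *\<^sub>R Z + lw *\<^sub>R W = r *\<^sub>R X)"

lemma xquad_det:
  assumes "xquad x y z w X Y Z W"
  shows "det3 X Z W \<noteq> 0" "det3 X W Y \<noteq> 0"
proof -
  obtain ly lz lw r where l: "ly > 0" "lz > 0" "lw > 0" and rel: "ly *\<^sub>R Y + lz *\<^sub>R Z + lw *\<^sub>R W = r *\<^sub>R X"
    using assms unfolding xquad_def by blast
  have d: "det3 X Y Z \<noteq> 0" using assms unfolding xquad_def by blast
  have "det3 X Z (ly *\<^sub>R Y + lz *\<^sub>R Z + lw *\<^sub>R W) = 0" by (simp add: rel det3_simps)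
  moreover have "det3 X Z Y = - det3 X Y Z" by (simp add: det3_def cross3_def inner_vec_def sum_3 vector_3 algebra_simps)
  ultimately have 1: "lw * det3 X Z W = ly * det3 X Y Z" by (simp add: det3_simps)
  have "det3 X (ly *\<^sub>R Y + lz *\<^sub>R Z + lw *\<^sub>R W) Y = 0" by (simp add: rel det3_simps)
  moreover have "det3 X Z Y = - det3 X Y Z" by (simp add: det3_def cross3_def inner_vec_def sum_3 vector_3 algebra_simps)
  ultimately have 2: "lw * det3 X W Y = lz * det3 X Y Z" by (simp add: det3_simps)
  show "det3 X Z W \<noteq> 0" "det3 X W Y \<noteq> 0" using 1 2 l d by auto
qed

lemma xquad_rotate:
  assumes "xquad x y z w X Y Z W"
  shows "xquad x z w y X Z W Y"
proof -
  obtain ly lz lw r where "ly > 0" "lz > 0" "lw > 0" and "ly *\<^sub>R Y + lz *\<^sub>R Z + lw *\<^sub>R W = r *\<^sub>R X"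
    using assms unfolding xquad_def by blast
  then have "\<exists>ly' lz' lw' r. ly' > 0 \<and> lz' > 0 \<and> lw' > 0 \<and> ly' *\<^sub>R Z + lz' *\<^sub>R W + lw' *\<^sub>R Y = r *\<^sub>R X"
    by (intro exI[of _ lz] exI[of _ lw] exI[of _ ly] exI[of _ r]) (simp add: algebra_simps)
  then show ?thesis using assms xquad_det(1)[OF assms] unfolding xquad_def by blast
qed

lemma xquad_D:
  assumes "xquad x y z w X Y Z W"
  shows "X \<in> N" "Y \<in> N" "Z \<in> N" "W \<in> N"
    "dist x y = \<delta> X Y" "dist x z = \<delta> X Z" "dist x w = \<delta> X W"
    "dist y z = \<delta> Y Z" "dist z w = \<delta> Z W" "dist w y = \<delta> W Y"
    "okp \<kappa> (peri x y z)" "okp \<kappa> (peri x z w)" "okp \<kappa> (peri x w y)" "det3 X Y Z \<noteq> 0"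
    "\<exists>ly lz lw r. ly > 0 \<and> lz > 0 \<and> lw > 0 \<and> ly *\<^sub>R Y + lz *\<^sub>R Z + lw *\<^sub>R W = r *\<^sub>R X"
    "dist y w = \<delta> Y W"
  using assms model_dist_commute[of W \<kappa> Y] unfolding xquad_def by (auto simp: dist_commute)

lemma xquad_pos: assumes "xquad x y z w X Y Z W" shows "dist x y > 0" "dist x z > 0" "dist x w > 0"
proof -
  have "Y \<noteq> X" "Z \<noteq> X" "W \<noteq> X" using xquad_D(14)[OF assms] xquad_det(1)[OF assms] by (auto simp: det3_simps)
  then have "\<delta> X Y \<noteq> 0" "\<delta> X Z \<noteq> 0" "\<delta> X W \<noteq> 0" using model_dist_eq_0 xquad_D(1-4)[OF assms] by blast+
  then show "dist x y > 0" "dist x z > 0" "dist x w > 0" using xquad_D(5-7)[OF assms] zero_le_dist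
    by (metis order_le_less)+
qed

lemma xquad_okp: assumes "xquad x y z w X Y Z W" "\<kappa> > 0" shows "dist x y < PP \<kappa>" "dist x z < PP \<kappa>" "dist x w < PP \<kappa>"
  using okp_dist[OF xquad_D(11)[OF assms(1)] assms(2)] okp_dist[OF xquad_D(12)[OF assms(1)] assms(2)] by auto

text \<open>The distances are an instance of \<open>tripod_side\<close>. Expressing \<open>Y\<close>
  by \<open>S\<close> and \<open>X\<close> shows that the relation persists, so the three legs can
  be shortened one after the other.\<close>

lemma xquad_side:
  assumes q: "xquad x y z w X Y Z W" and s: "onseg x s y X S Y"
  shows "dist s z = \<delta> S Z" "dist s w = \<delta> S W" "s \<noteq> x \<Longrightarrow> xquad x s z w X S Z W"
proof -
  note D = xquad_D[OF q] and sD = onseg_D[OF s]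
  obtain ly lz lw r where l: "ly > 0" "lz > 0" "lw > 0" and rel: "ly *\<^sub>R Y + lz *\<^sub>R Z + lw *\<^sub>R W = r *\<^sub>R X"
    using D(15) by blast
  have ok: "okp \<kappa> (peri x y w)" using D(13) by (simp add: peri_def dist_commute algebra_simps)
  show sz: "dist s z = \<delta> S Z" and sw: "dist s w = \<delta> S W"
    using tripod_side[OF D(1-7) D(8,9,16) rel less_imp_le[OF l(1)] l(2,3) D(11,12) ok s] by auto
  assume sx: "s \<noteq> x"
  have ws: "dist w s = \<delta> W S" using sw model_dist_commute[OF sD(2) D(4)] by (simp add: dist_commute)
  define k where "k = md_sin \<kappa> (\<delta> X S)"
  define m where "m = md_sin \<kappa> (\<delta> X Y)"
  define n where "n = md_sin \<kappa> (\<delta> S Y)"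
  have xs: "dist x s > 0" "dist x s \<le> dist x y" using sx sD(9) by auto
  have k: "k > 0" unfolding k_def using md_sin_pos[of "dist x s" \<kappa>] sD(6) xs xquad_okp(1)[OF q] by fastforce
  have m: "m > 0" unfolding m_def using md_sin_pos[of "dist x y" \<kappa>] D(5) xquad_pos(1)[OF q] xquad_okp(1)[OF q] by fastforce
  have r1: "n *\<^sub>R X + k *\<^sub>R Y = m *\<^sub>R S"
    using seg_rel[OF sD(1,2,3,5)] by (simp add: k_def m_def n_def)
  have "m * det3 X S Z = det3 X (n *\<^sub>R X + k *\<^sub>R Y) Z" unfolding r1 by (simp add: det3_simps)
  also have "\<dots> = k * det3 X Y Z" by (simp add: det3_simps)
  finally have det: "det3 X S Z \<noteq> 0" using k m D(14) by auto
  have kY: "k *\<^sub>R Y = m *\<^sub>R S - n *\<^sub>R X" using r1 by (simp add: algebra_simps)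
  have "k *\<^sub>R (ly *\<^sub>R Y + lz *\<^sub>R Z + lw *\<^sub>R W) = ly *\<^sub>R (k *\<^sub>R Y) + (k * lz) *\<^sub>R Z + (k * lw) *\<^sub>R W"
    by (simp add: algebra_simps)
  then have "(ly * m) *\<^sub>R S + (k * lz) *\<^sub>R Z + (k * lw) *\<^sub>R W = (k * r + ly * n) *\<^sub>R X"
    unfolding rel kY by (simp add: algebra_simps)
  then have "\<exists>ly lz lw r. ly > 0 \<and> lz > 0 \<and> lw > 0 \<and> ly *\<^sub>R S + lz *\<^sub>R Z + lw *\<^sub>R W = r *\<^sub>R X"
    using k m l by (intro exI[of _ "ly * m"] exI[of _ "k * lz"] exI[of _ "k * lw"] exI[of _ "k * r + ly * n"]) simp
  moreover have "okp \<kappa> (peri x s z)" "okp \<kappa> (peri x w s)"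
    using okp_mono[OF D(11) onseg_peri_le[OF s]] okp_mono[OF ok onseg_peri_le[OF s]]
    by (simp_all add: peri_def dist_commute algebra_simps)
  ultimately show "xquad x s z w X S Z W"
    using D sD(1,2,6) sz ws det unfolding xquad_def by blast
qed

lemma peri_small:
  fixes x :: 'b
  assumes "dist x a \<le> r" "dist x b \<le> r" "dist x c \<le> r"
  shows "peri a b c \<le> 6 * r"
  using assms dist_triangle[of a b x] dist_triangle[of b c x] dist_triangle[of c a x]
  by (simp add: peri_def dist_commute)

text \<open>The fourth point \<open>v\<close>, half way between suitable points of \<open>[x, y]\<close> and \<open>[x, z]\<close>, lies in the
  direction opposite to the bisector of \<open>p\<close> and \<open>q\<close>.\<close>

lemma near_upper_pair:
  assumes q: "xquad x y z w X Y Z W"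
    and \<rho>: "\<rho> > 0" "\<rho> < dist x y" "\<rho> < dist x z" "okp \<kappa> (2 * dist x y + 2 * \<rho>)" "okp \<kappa> (2 * dist x z + 2 * \<rho>)"
      "okp \<kappa> (18 * \<rho>)"
    and p: "P \<in> N" "dist x p = \<delta> X P" "dist x p \<le> \<rho>" "\<delta> P Y \<le> dist p y" "\<delta> P Z \<le> dist p z"
    and q': "Q \<in> N" "dist x q = \<delta> X Q" "dist x q \<le> \<rho>" "\<delta> Q Y \<le> dist q y" "\<delta> Q Z \<le> dist q z"
    and ab: "a \<ge> 0" "b \<ge> 0" "tg \<kappa> X P + tg \<kappa> X Q + a *\<^sub>R tg \<kappa> X Y + b *\<^sub>R tg \<kappa> X Z = 0"
  shows "dist p q \<le> \<delta> P Q"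
proof -
  note D = xquad_D[OF q]
  \<comment> \<open>All auxiliary points stay within \<open>3 * \<rho>\<close> of \<open>x\<close>,
    and \<open>peri_small\<close> then bounds their perimeters by
    \<open>18 * \<rho>\<close>.\<close>
  have small: "okp \<kappa> (peri c d e)" if "dist x c \<le> 3 * \<rho>" "dist x d \<le> 3 * \<rho>" "dist x e \<le> 3 * \<rho>" for c d e
    using okp_mono[OF \<rho>(6)] peri_small[OF that] by simp
  have \<rho>P: "\<kappa> > 0 \<Longrightarrow> \<rho> < PP \<kappa>" using okp_half[OF \<rho>(6), of \<rho>] \<rho>(1) by simp
  define s0 where "s0 = md_sin \<kappa> \<rho>"
  have s0: "s0 > 0" unfolding s0_def by (rule md_sin_pos) (use \<rho> \<rho>P in auto)
  define Sy where "Sy = md_sin \<kappa> (dist x y)"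
  define Sz where "Sz = md_sin \<kappa> (dist x z)"
  have S: "Sy > 0" "Sz > 0" unfolding Sy_def Sz_def
    using md_sin_pos[OF xquad_pos(1)[OF q] xquad_okp(1)[OF q]] md_sin_pos[OF xquad_pos(2)[OF q] xquad_okp(2)[OF q]] by auto
  \<comment> \<open>A common factor that makes both \<open>\<eta> * (a * Sy)\<close> and
    \<open>\<eta> * (b * Sz)\<close> at most the sine of \<open>\<rho>\<close>. They become the
    sines of the distances of \<open>y1\<close> and \<open>z1\<close> from \<open>x\<close>, so that
    the tangent vectors are \<open>\<eta> * a\<close> and \<open>\<eta> * b\<close> times those of
    \<open>Y\<close> and \<open>Z\<close>.\<close>
  define \<eta> where "\<eta> = s0 / (a * Sy + b * Sz + 1)"
  have den: "a * Sy \<ge> 0" "b * Sz \<ge> 0" using ab S by auto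
  have \<eta>: "\<eta> > 0" unfolding \<eta>_def using s0 den by (intro divide_pos_pos) auto
  have e: "\<eta> * (a * Sy + b * Sz + 1) = s0" using den by (simp add: \<eta>_def)
  have "\<eta> * (a * Sy) \<le> \<eta> * (a * Sy + b * Sz + 1)" "\<eta> * (b * Sz) \<le> \<eta> * (a * Sy + b * Sz + 1)"
    using \<eta> den by (auto intro!: mult_left_mono)
  then have le: "\<eta> * (a * Sy) \<le> md_sin \<kappa> \<rho>" "\<eta> * (b * Sz) \<le> md_sin \<kappa> \<rho>" using e s0_def by auto
  obtain ty where ty: "0 \<le> ty" "ty \<le> \<rho>" "md_sin \<kappa> ty = \<eta> * (a * Sy)"
    using md_sin_surj_small[OF less_imp_le[OF \<rho>(1)] _ le(1)] \<eta> den(1) by (metis less_imp_le mult_nonneg_nonneg)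
  obtain tz where tz: "0 \<le> tz" "tz \<le> \<rho>" "md_sin \<kappa> tz = \<eta> * (b * Sz)"
    using md_sin_surj_small[OF less_imp_le[OF \<rho>(1)] _ le(2)] \<eta> den(2) by (metis less_imp_le mult_nonneg_nonneg)
  obtain y1 Y1 where y1: "onseg x y1 y X Y1 Y" "dist x y1 = ty"
    using onseg_at[OF D(1,2,5) xquad_okp(1)[OF q] ty(1)] ty(2) \<rho>(2) by (metis less_imp_le order_trans)
  obtain z1 Z1 where z1: "onseg x z1 z X Z1 Z" "dist x z1 = tz"
    using onseg_at[OF D(1,3,6) xquad_okp(2)[OF q] tz(1)] tz(2) \<rho>(3) by (metis less_imp_le order_trans)
  note y1D = onseg_D[OF y1(1)] and z1D = onseg_D[OF z1(1)]
  have q2: "xquad x z w y X Z W Y" by (rule xquad_rotate[OF q])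
  have z1y: "dist z1 y = \<delta> Z1 Y" by (rule xquad_side(2)[OF q2 z1(1)])
  have y1z1: "dist y1 z1 = \<delta> Y1 Z1"
  proof (cases "y1 = x")
    case True
    then have "Y1 = X" using model_dist_eq_0[OF D(1) y1D(2)] y1D(6) by simp
    then show ?thesis using True z1D(6) by simp
  next
    case False
    have "xquad x y1 z w X Y1 Z W" by (rule xquad_side(3)[OF q y1(1) False])
    then have "dist z1 y1 = \<delta> Z1 Y1" using xquad_side(2)[OF xquad_rotate z1(1)] by blast
    then show ?thesis using model_dist_commute[OF y1D(2) z1D(2)] by (simp add: dist_commute)
  qed
  have near1: "dist x y1 \<le> \<rho>" "dist x z1 \<le> \<rho>" using y1 z1 ty tz by auto
  have y1z1P: "\<kappa> > 0 \<Longrightarrow> dist y1 z1 < PP \<kappa>"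
    using okp_dist(1)[OF small[of y1 z1 x]] near1 \<rho>(1) by simp
  \<comment> \<open>The midpoint, because there both weights in \<open>seg_rel\<close> agree and
    \<open>Y1 + Z1\<close> is a positive multiple of \<open>V\<close>.\<close>
  obtain v V where v: "onseg y1 v z1 Y1 V Z1" "dist y1 v = dist y1 z1 / 2"
    by (rule onseg_at[OF y1D(2) z1D(2) y1z1 y1z1P, of "dist y1 z1 / 2"]) auto
  note vD = onseg_D[OF v(1)]
  have nearv: "dist x v \<le> 3 * \<rho>"
    using dist_triangle[of x v y1] dist_triangle[of y1 z1 x] near1 v(2) \<rho>(1) by (simp add: dist_commute)
  have xv: "dist x v = \<delta> X V"
  proof -
    consider "y1 = x" | "z1 = x" | "y1 \<noteq> x" "z1 \<noteq> x" by blast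
    then show ?thesis
    proof cases
      case 1
      then have "Y1 = X" using model_dist_eq_0[OF D(1) y1D(2)] y1D(6) by simp
      then show ?thesis using 1 vD(6) by simp
    next
      case 2
      then have "Z1 = X" using model_dist_eq_0[OF D(1) z1D(2)] z1D(6) by simp
      then show ?thesis using 2 vD(7) model_dist_commute[OF vD(2) D(1)] by (simp add: dist_commute)
    next
      case 3
      have y1y: "dist y1 y > 0" using y1D(9) y1(2) ty(2) \<rho>(2) by linarith
      have ylt: "dist y1 y \<le> dist x y" "dist x y1 \<le> dist x y" using y1D(9) by auto
      have "onseg y1 v z1 Y1 V Z1" by (rule v(1))
      \<comment> \<open>At \<open>Y1\<close> the directions to \<open>X\<close> and \<open>Y\<close>
        are opposite. This is a relation for \<open>tripod_side\<close> with apex \<open>y1\<close>,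
        where the leg that carries \<open>v\<close> has weight 0.\<close>
      have rel: "0 *\<^sub>R Z1 + md_sin \<kappa> (\<delta> Y1 Y) *\<^sub>R X + md_sin \<kappa> (\<delta> X Y1) *\<^sub>R Y = md_sin \<kappa> (\<delta> X Y) *\<^sub>R Y1"
        using seg_rel[OF y1D(1,2,3,5)] by simp
      have p1: "md_sin \<kappa> (\<delta> Y1 Y) > 0"
        unfolding y1D(7)[symmetric] by (rule md_sin_pos) (use y1y ylt xquad_okp(1)[OF q] in auto)
      have p2: "md_sin \<kappa> (\<delta> X Y1) > 0"
        unfolding y1D(6)[symmetric] by (rule md_sin_pos) (use 3 ylt xquad_okp(1)[OF q] in auto)
      have yx: "dist y1 x = \<delta> Y1 X" using y1D(6) model_dist_commute[OF y1D(1,2)] by (simp add: dist_commute)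
      have zx: "dist z1 x = \<delta> Z1 X" using z1D(6) model_dist_commute[OF z1D(1,2)] by (simp add: dist_commute)
      have okz: "okp \<kappa> (peri x y z1)"
        using okp_mono[OF D(11)] onseg_peri_le[OF z1(1), of y] by (simp add: peri_def dist_commute algebra_simps)
      have tri: "dist y1 z1 \<le> dist y1 y + dist y z1" "dist x z1 \<le> dist x y1 + dist y1 z1" "dist y z1 \<le> dist y y1 + dist y1 z1"
        using dist_triangle[of y1 z1 y] dist_triangle[of x z1 y1] dist_triangle[of y z1 y1] by auto
      have ok1: "okp \<kappa> (peri y1 z1 x)" "okp \<kappa> (peri y1 x y)" "okp \<kappa> (peri y1 z1 y)"
        by (rule okp_mono[OF okz]; use tri y1D(9) peri_ge[of x y z1] dist_triangle[of y1 z1 x] in \<open>simp add: peri_def dist_commute\<close>)+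
      have "dist v x = \<delta> V X"
        by (rule tripod_side(1)[OF y1D(2) z1D(2) D(1,2) y1z1 yx y1D(7) zx D(5) z1y rel order_refl p1 p2 ok1 v(1)])
      then show ?thesis using model_dist_commute[OF vD(2) D(1)] by (simp add: dist_commute)
    qed
  qed
  obtain k where k: "k > 0" "Y1 + Z1 = k *\<^sub>R V"
  proof (cases "dist y1 z1 = 0")
    case True
    then have "\<delta> Y1 V = 0" "\<delta> V Z1 = 0" using vD(6,7,9) v(2) True by linarith+
    then have "Y1 = V" "V = Z1" using model_dist_eq_0[OF vD(1,2)] model_dist_eq_0[OF vD(2,3)] by blast+
    then have "Y1 + Z1 = 2 *\<^sub>R V" by (simp add: scaleR_2)
    then show ?thesis using that[of 2] by simp
  next
    case False
    define h where "h = md_sin \<kappa> (dist y1 z1 / 2)"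
    have hd: "0 < dist y1 z1" using False zero_le_dist[of y1 z1] by linarith
    have "dist y1 z1 / 2 < PP \<kappa>" if "\<kappa> > 0" using y1z1P[OF that] hd by linarith
    then have h: "h > 0" unfolding h_def using hd by (intro md_sin_pos) auto
    have h2: "md_sin \<kappa> (dist y1 z1) > 0" by (rule md_sin_pos) (use False y1z1P in auto)
    have dd: "\<delta> Y1 V = dist y1 z1 / 2" "\<delta> V Z1 = dist y1 z1 / 2" using vD(6,7,9) v(2) by linarith+
    have e: "h *\<^sub>R (Y1 + Z1) = md_sin \<kappa> (dist y1 z1) *\<^sub>R V"
      using seg_rel[OF vD(1,2,3,5)] unfolding dd y1z1[symmetric] by (simp add: h_def scaleR_add_right)
    have "Y1 + Z1 = (1 / h) *\<^sub>R (h *\<^sub>R (Y1 + Z1))" using h by simp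
    then have "Y1 + Z1 = (md_sin \<kappa> (dist y1 z1) / h) *\<^sub>R V" unfolding e by simp
    then show ?thesis by (rule that[rotated]) (use h h2 in simp)
  qed
  have tgy: "tg \<kappa> X Y1 = (\<eta> * a) *\<^sub>R tg \<kappa> X Y"
  proof -
    have "Sy *\<^sub>R tg \<kappa> X Y1 = Sy *\<^sub>R ((\<eta> * a) *\<^sub>R tg \<kappa> X Y)"
      using onseg_tg[OF y1(1)] ty(3) y1(2) y1D(6) D(5) by (simp add: Sy_def algebra_simps)
    then show ?thesis by (rule scaleR_left_imp_eq[rotated]) (use S in simp)
  qed
  have tgz: "tg \<kappa> X Z1 = (\<eta> * b) *\<^sub>R tg \<kappa> X Z"
  proof -
    have "Sz *\<^sub>R tg \<kappa> X Z1 = Sz *\<^sub>R ((\<eta> * b) *\<^sub>R tg \<kappa> X Z)"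
      using onseg_tg[OF z1(1)] tz(3) z1(2) z1D(6) D(6) by (simp add: Sz_def algebra_simps)
    then show ?thesis by (rule scaleR_left_imp_eq[rotated]) (use S in simp)
  qed
  have "tg \<kappa> X (k *\<^sub>R V) = \<eta> *\<^sub>R (a *\<^sub>R tg \<kappa> X Y + b *\<^sub>R tg \<kappa> X Z)"
    unfolding k(2)[symmetric] by (simp add: tg_simps tgy tgz algebra_simps)
  then have "tg \<kappa> X (\<eta> *\<^sub>R P + \<eta> *\<^sub>R Q + k *\<^sub>R V) = \<eta> *\<^sub>R (tg \<kappa> X P + tg \<kappa> X Q + a *\<^sub>R tg \<kappa> X Y + b *\<^sub>R tg \<kappa> X Z)"
    by (simp add: tg_simps algebra_simps)
  then have "tg \<kappa> X (\<eta> *\<^sub>R P + \<eta> *\<^sub>R Q + k *\<^sub>R V) = 0" unfolding ab(3) by simp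
  then have rel: "\<eta> *\<^sub>R P + \<eta> *\<^sub>R Q + k *\<^sub>R V = lf \<kappa> X (\<eta> *\<^sub>R P + \<eta> *\<^sub>R Q + k *\<^sub>R V) *\<^sub>R X" by (rule tg_eq_0D)
  \<comment> \<open>Lower bounds pass from the vertices to \<open>y1\<close> and \<open>z1\<close>
    along the legs, and from there to \<open>v\<close> along their segment.\<close>
  have low: "\<delta> P' V \<le> dist p' v" if "P' \<in> N" "dist x p' = \<delta> X P'" "dist x p' \<le> \<rho>" "\<delta> P' Y \<le> dist p' y" "\<delta> P' Z \<le> dist p' z" for p' P'
  proof -
    have c: "\<delta> X P' = \<delta> P' X" "\<delta> P' Y = \<delta> Y P'" "\<delta> P' Z = \<delta> Z P'" "\<delta> P' V = \<delta> V P'"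
      by (rule model_dist_commute; use that(1) D(1-4) vD(2) in blast)+
    have okq: "okp \<kappa> (peri x y p')" "okp \<kappa> (peri x z p')"
      using okp_mono[OF \<rho>(4)] okp_mono[OF \<rho>(5)] that(3) dist_triangle[of y p' x] dist_triangle[of z p' x]
      by (simp_all add: peri_def dist_commute)
    have xp': "\<delta> X P' \<le> dist x p'" "\<delta> Y P' \<le> dist y p'" "\<delta> Z P' \<le> dist z p'"
      using that(2,4,5) c(2,3) by (simp_all add: dist_commute)
    have 1: "\<delta> Y1 P' \<le> dist y1 p'" by (rule side_ge[OF y1(1) that(1) xp'(1,2) okq(1)])
    have 2: "\<delta> Z1 P' \<le> dist z1 p'" by (rule side_ge[OF z1(1) that(1) xp'(1,3) okq(2)])
    have "okp \<kappa> (peri y1 z1 p')" by (rule small) (use near1 that \<rho>(1) in auto)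
    then have "\<delta> V P' \<le> dist v p'" by (rule side_ge[OF v(1) that(1) 1 2])
    then show ?thesis unfolding c(4) by (simp add: dist_commute)
  qed
  have 3: "dist x p \<le> 3 * \<rho>" "dist x q \<le> 3 * \<rho>" "dist x x \<le> 3 * \<rho>" using p(3) q'(3) \<rho>(1) by auto
  show ?thesis
    by (rule hinge_ge_model[OF D(1) p(1) q'(1) vD(2) p(2) q'(2) xv low[OF p] low[OF q'] rel less_imp_le[OF \<eta>] \<eta> less_imp_le[OF k(1)]])
      (rule small; use 3 nearv in linarith)+
qed

end

section \<open>Upper bounds near the center and along rays\<close>

context cbb_geodesic begin

text \<open>By the relation at \<open>X\<close> the three sectors spanned by two of the directions
  to \<open>Y\<close>, \<open>Z\<close>, \<open>W\<close> cover the tangent plane. The vector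
  opposite to the sum of the tangent vectors of \<open>P\<close> and \<open>Q\<close> lies in one of
  them, and \<open>near_upper_pair\<close> applies to this pair of vertices. The radius serves all
  \<open>p\<close> and \<open>q\<close> at once.\<close>

lemma near_upper:
  assumes q: "xquad x y z w X Y Z W"
  obtains \<rho> where "\<rho> > 0"
    "\<And>p q P Q. \<lbrakk>P \<in> N; dist x p = \<delta> X P; dist x p \<le> \<rho>; \<delta> P Y \<le> dist p y; \<delta> P Z \<le> dist p z; \<delta> P W \<le> dist p w;
      Q \<in> N; dist x q = \<delta> X Q; dist x q \<le> \<rho>; \<delta> Q Y \<le> dist q y; \<delta> Q Z \<le> dist q z; \<delta> Q W \<le> dist q w\<rbrakk>
      \<Longrightarrow> dist p q \<le> \<delta> P Q"
proof -
  note D = xquad_D[OF q]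
  note q2 = xquad_rotate[OF q] note q3 = xquad_rotate[OF q2]
  obtain e1 where e1: "e1 > 0" "\<And>u. u \<le> 2 * dist x y + e1 \<Longrightarrow> okp \<kappa> u"
    using okp_slack[OF okp_mono[OF D(11) peri_ge]] by blast
  obtain e2 where e2: "e2 > 0" "\<And>u. u \<le> 2 * dist x z + e2 \<Longrightarrow> okp \<kappa> u"
    using okp_slack[OF okp_mono[OF D(12) peri_ge]] by blast
  obtain e3 where e3: "e3 > 0" "\<And>u. u \<le> 2 * dist x w + e3 \<Longrightarrow> okp \<kappa> u"
    using okp_slack[OF okp_mono[OF D(13) peri_ge]] by blast
  have "okp \<kappa> 0" by (simp add: okp_def)
  then obtain e4 where e4: "e4 > 0" "\<And>u. u \<le> 0 + e4 \<Longrightarrow> okp \<kappa> u" using okp_slack by blast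
  define \<rho> where "\<rho> = Min {e1 / 2, e2 / 2, e3 / 2, e4 / 18, dist x y / 2, dist x z / 2, dist x w / 2}"
  have r: "\<rho> \<le> e1 / 2" "\<rho> \<le> e2 / 2" "\<rho> \<le> e3 / 2" "\<rho> \<le> e4 / 18" "\<rho> \<le> dist x y / 2" "\<rho> \<le> dist x z / 2" "\<rho> \<le> dist x w / 2"
    unfolding \<rho>_def by (intro Min_le; simp)+
  have r0: "\<rho> > 0" unfolding \<rho>_def using e1(1) e2(1) e3(1) e4(1) xquad_pos[OF q] by simp
  have rr: "\<rho> < dist x y" "\<rho> < dist x z" "\<rho> < dist x w" using r xquad_pos[OF q] by linarith+
  have rk: "okp \<kappa> (2 * dist x y + 2 * \<rho>)" "okp \<kappa> (2 * dist x z + 2 * \<rho>)" "okp \<kappa> (2 * dist x w + 2 * \<rho>)" "okp \<kappa> (18 * \<rho>)"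
    by (rule e1(2), use r in linarith) (rule e2(2), use r in linarith, rule e3(2), use r in linarith, rule e4(2), use r in linarith)
  obtain ly lz lw r where l: "ly > 0" "lz > 0" "lw > 0" and rel: "ly *\<^sub>R Y + lz *\<^sub>R Z + lw *\<^sub>R W = r *\<^sub>R X"
    using D(15) by blast
  have rel0: "ly *\<^sub>R tg \<kappa> X Y + lz *\<^sub>R tg \<kappa> X Z + lw *\<^sub>R tg \<kappa> X W = 0"
    using arg_cong[OF rel, of "tg \<kappa> X"] D(1) by (simp add: tg_simps)
  show ?thesis
  proof (rule that[OF r0])
    fix p q P Q
    assume p: "P \<in> N" "dist x p = \<delta> X P" "dist x p \<le> \<rho>" "\<delta> P Y \<le> dist p y" "\<delta> P Z \<le> dist p z" "\<delta> P W \<le> dist p w"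
      and q': "Q \<in> N" "dist x q = \<delta> X Q" "dist x q \<le> \<rho>" "\<delta> Q Y \<le> dist q y" "\<delta> Q Z \<le> dist q z" "\<delta> Q W \<le> dist q w"
    obtain \<alpha> \<beta> \<gamma> where v: "P + Q = \<alpha> *\<^sub>R X + \<beta> *\<^sub>R Y + \<gamma> *\<^sub>R Z" using det3_basis[OF D(14)] by blast
    have t0: "tg \<kappa> X P + tg \<kappa> X Q = \<beta> *\<^sub>R tg \<kappa> X Y + \<gamma> *\<^sub>R tg \<kappa> X Z"
      using arg_cong[OF v, of "tg \<kappa> X"] D(1) by (simp add: tg_simps)
    have t: "tg \<kappa> X P + tg \<kappa> X Q + (k * ly - \<beta>) *\<^sub>R tg \<kappa> X Y + (k * lz - \<gamma>) *\<^sub>R tg \<kappa> X Z + (k * lw) *\<^sub>R tg \<kappa> X W = 0" for k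
    proof -
      have "k *\<^sub>R (ly *\<^sub>R tg \<kappa> X Y + lz *\<^sub>R tg \<kappa> X Z + lw *\<^sub>R tg \<kappa> X W) = 0" by (simp add: rel0)
      then show ?thesis unfolding t0 by (simp add: algebra_simps)
    qed
    \<comment> \<open>The larger of the two ratios, if it is positive, is the multiple of the
      relation to be subtracted: one coordinate vanishes and the others get the right sign.\<close>
    consider "\<beta> \<le> 0" "\<gamma> \<le> 0" | "\<beta> / ly \<ge> \<gamma> / lz" "\<beta> / ly \<ge> 0" | "\<gamma> / lz \<ge> \<beta> / ly" "\<gamma> / lz \<ge> 0"
    proof -
      have "\<beta> / ly \<le> 0 \<longleftrightarrow> \<beta> \<le> 0" "\<gamma> / lz \<le> 0 \<longleftrightarrow> \<gamma> \<le> 0" using l by (simp_all add: divide_le_0_iff)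
      then show thesis using that by linarith
    qed
    then show "dist p q \<le> \<delta> P Q"
    proof cases
      case 1
      show ?thesis
        by (rule near_upper_pair[OF q r0 rr(1,2) rk(1,2,4) p(1-5) q'(1-5), of "- \<beta>" "- \<gamma>"]) (use 1 t[of 0] in auto)
    next
      case 2
      define k where "k = \<beta> / ly"
      have "k * ly = \<beta>" "\<gamma> / lz \<le> k" "k \<ge> 0" using 2 l by (simp_all add: k_def)
      then have "k * ly = \<beta>" "k * lz \<ge> \<gamma>" "k * lw \<ge> 0" using l by (simp_all add: pos_divide_le_eq)
      then show ?thesis using t[of k]
        by (intro near_upper_pair[OF q2 r0 rr(2,3) rk(2,3,4) p(1-3,5,6) q'(1-3,5,6), of "k * lz - \<gamma>" "k * lw"]) auto
    next
      case 3
      define k where "k = \<gamma> / lz"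
      have "k * lz = \<gamma>" "\<beta> / ly \<le> k" "k \<ge> 0" using 3 l by (simp_all add: k_def)
      then have "k * lz = \<gamma>" "k * ly \<ge> \<beta>" "k * lw \<ge> 0" using l by (simp_all add: pos_divide_le_eq)
      then show ?thesis using t[of k]
        by (intro near_upper_pair[OF q3 r0 rr(3,1) rk(3,1,4) p(1-3,6,4) q'(1-3,6,4), of "k * lw" "k * ly - \<beta>"])
          (auto simp: algebra_simps)
    qed
  qed
qed

text \<open>Only lower bounds are demanded at the vertices: they pass to all points of
  \<open>[x, p]\<close> by \<open>side_ge\<close>, and near \<open>x\<close> they already imply the
  upper bounds of \<open>near_upper\<close>.\<close>

definition above :: "'b \<Rightarrow> 'b \<Rightarrow> 'b \<Rightarrow> 'b \<Rightarrow> real^3 \<Rightarrow> real^3 \<Rightarrow> real^3 \<Rightarrow> real^3 \<Rightarrow> 'b \<Rightarrow> real^3 \<Rightarrow> bool" where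
  "above x y z w X Y Z W p P \<longleftrightarrow> P \<in> N \<and> dist x p = \<delta> X P \<and>
    \<delta> P Y \<le> dist p y \<and> \<delta> P Z \<le> dist p z \<and> \<delta> P W \<le> dist p w \<and>
    okp \<kappa> (peri x p y) \<and> okp \<kappa> (peri x p z) \<and> okp \<kappa> (peri x p w)"

text \<open>Both points are moved towards \<open>x\<close> until \<open>near_upper\<close> applies;
  the bound obtained there returns to the original points by \<open>hinge_extend2\<close>.\<close>

lemma above_upper:
  assumes q: "xquad x y z w X Y Z W" and p: "above x y z w X Y Z W p P" "above x y z w X Y Z W p' P'"
    and ok: "okp \<kappa> (\<delta> X P + \<delta> P P' + \<delta> P' X)"
  shows "dist p p' \<le> \<delta> P P'"
proof -
  note D = xquad_D[OF q]
  obtain \<rho> where \<rho>: "\<rho> > 0"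
    "\<And>p q P Q. \<lbrakk>P \<in> N; dist x p = \<delta> X P; dist x p \<le> \<rho>; \<delta> P Y \<le> dist p y; \<delta> P Z \<le> dist p z; \<delta> P W \<le> dist p w;
      Q \<in> N; dist x q = \<delta> X Q; dist x q \<le> \<rho>; \<delta> Q Y \<le> dist q y; \<delta> Q Z \<le> dist q z; \<delta> Q W \<le> dist q w\<rbrakk>
      \<Longrightarrow> dist p q \<le> \<delta> P Q" using near_upper[OF q] by blast
  have near: "\<exists>p1 P1. onseg x p1 p X P1 P \<and> p1 \<noteq> x \<and> dist x p1 \<le> \<rho> \<and>
      \<delta> P1 Y \<le> dist p1 y \<and> \<delta> P1 Z \<le> dist p1 z \<and> \<delta> P1 W \<le> dist p1 w"
    if a: "above x y z w X Y Z W p P" and ne: "p \<noteq> x" for p P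
  proof -
    have P: "P \<in> N" "dist x p = \<delta> X P" using a unfolding above_def by auto
    have xp: "\<kappa> > 0 \<Longrightarrow> dist x p < PP \<kappa>" using a okp_dist(1) unfolding above_def by blast
    obtain p1 P1 where p1: "onseg x p1 p X P1 P" "dist x p1 = min \<rho> (dist x p)"
      by (rule onseg_at[OF D(1) P xp, of "min \<rho> (dist x p)"]) (use \<rho>(1) in auto)
    have "\<delta> P1 Y \<le> dist p1 y" "\<delta> P1 Z \<le> dist p1 z" "\<delta> P1 W \<le> dist p1 w"
      using side_ge[OF p1(1), of _ y] side_ge[OF p1(1), of _ z] side_ge[OF p1(1), of _ w] a D unfolding above_def by auto
    moreover have "p1 \<noteq> x" using p1(2) ne \<rho>(1) by (auto simp: min_def split: if_splits)
    ultimately show ?thesis using p1 by fastforce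
  qed
  have P: "P \<in> N" "dist x p = \<delta> X P" "P' \<in> N" "dist x p' = \<delta> X P'" using p unfolding above_def by auto
  consider "p = x" | "p' = x" | "p \<noteq> x" "p' \<noteq> x" by blast
  then show ?thesis
  proof cases
    case 1
    then have "P = X" using model_dist_eq_0[OF D(1) P(1)] P(2) by simp
    then show ?thesis using 1 P by simp
  next
    case 2
    then have "P' = X" using model_dist_eq_0[OF D(1) P(3)] P(4) by simp
    then show ?thesis using 2 P model_dist_commute[OF D(1) P(1)] by (simp add: dist_commute)
  next
    case 3
    obtain p1 P1 where 1: "onseg x p1 p X P1 P" "p1 \<noteq> x" "dist x p1 \<le> \<rho>"
      "\<delta> P1 Y \<le> dist p1 y" "\<delta> P1 Z \<le> dist p1 z" "\<delta> P1 W \<le> dist p1 w" using near[OF p(1) 3(1)] by blast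
    obtain p2 P2 where 2: "onseg x p2 p' X P2 P'" "p2 \<noteq> x" "dist x p2 \<le> \<rho>"
      "\<delta> P2 Y \<le> dist p2 y" "\<delta> P2 Z \<le> dist p2 z" "\<delta> P2 W \<le> dist p2 w" using near[OF p(2) 3(2)] by blast
    have "dist p1 p2 \<le> \<delta> P1 P2"
      by (rule \<rho>(2)[OF onseg_D(2)[OF 1(1)] onseg_D(6)[OF 1(1)] 1(3-6) onseg_D(2)[OF 2(1)] onseg_D(6)[OF 2(1)] 2(3-6)])
    then show ?thesis by (rule hinge_extend2[OF 1(1,2) 2(1,2) _ ok])
  qed
qed

lemma above_unique:
  assumes q: "xquad x y z w X Y Z W" and p: "above x y z w X Y Z W p P" "above x y z w X Y Z W p' P"
  shows "p = p'"
proof -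
  have P: "P \<in> N" "dist x p = \<delta> X P" "okp \<kappa> (peri x p y)" using p unfolding above_def by auto
  have "okp \<kappa> (\<delta> X P + \<delta> P P + \<delta> P X)"
    using okp_mono[OF P(3)] peri_ge[of x p y] P model_dist_commute[OF xquad_D(1)[OF q] P(1)] by simp
  then show ?thesis using above_upper[OF q p] P by simp
qed

definition good :: "'b \<Rightarrow> 'b \<Rightarrow> 'b \<Rightarrow> 'b \<Rightarrow> real^3 \<Rightarrow> real^3 \<Rightarrow> real^3 \<Rightarrow> real^3 \<Rightarrow> 'b \<Rightarrow> real^3 \<Rightarrow> bool" where
  "good x y z w X Y Z W p P \<longleftrightarrow> P \<in> N \<and> dist p x = \<delta> P X \<and> dist p y = \<delta> P Y \<and> dist p z = \<delta> P Z \<and> dist p w = \<delta> P W"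

definition op_cone :: "real^3 \<Rightarrow> real^3 \<Rightarrow> real^3 \<Rightarrow> (real^3) set" where
  "op_cone Y Z W = {P \<in> N. \<exists>\<alpha> \<beta> \<gamma>. \<alpha> > 0 \<and> \<beta> > 0 \<and> \<gamma> > 0 \<and> P = \<alpha> *\<^sub>R Y + \<beta> *\<^sub>R Z + \<gamma> *\<^sub>R W}"

lemma op_cone_rotate: "op_cone Z W Y = op_cone Y Z W"
proof -
  have "op_cone Y Z W \<subseteq> op_cone Z W Y" for Y Z W
  proof
    fix P assume "P \<in> op_cone Y Z W"
    then obtain \<alpha> \<beta> \<gamma> where "P \<in> N" "\<alpha> > 0" "\<beta> > 0" "\<gamma> > 0" "P = \<alpha> *\<^sub>R Y + \<beta> *\<^sub>R Z + \<gamma> *\<^sub>R W" unfolding op_cone_def by blast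
    then show "P \<in> op_cone Z W Y" unfolding op_cone_def
      by (intro CollectI conjI exI[of _ \<beta>] exI[of _ \<gamma>] exI[of _ \<alpha>]) (auto simp: algebra_simps)
  qed
  then show ?thesis by blast
qed

lemma good_rotate: "good x y z w X Y Z W p P \<longleftrightarrow> good x z w y X Z W Y p P"
  unfolding good_def by blast

lemma okp_exact:
  assumes "A \<in> N" "B \<in> N" "C \<in> N" "n \<bullet> A > 0" "n \<bullet> B > 0" "n \<bullet> C > 0" "dist a b = \<delta> A B" "dist b c = \<delta> B C" "dist c a = \<delta> C A"
  shows "okp \<kappa> (peri a b c)"
  using okp_halfspace[OF assms(1-6)] assms(7-9) by (simp add: peri_def)

lemma good_above:
  assumes q: "xquad x y z w X Y Z W" and g: "good x y z w X Y Z W p P"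
    and n: "n \<bullet> X > 0" "n \<bullet> Y > 0" "n \<bullet> Z > 0" "n \<bullet> W > 0" "n \<bullet> P > 0"
  shows "above x y z w X Y Z W p P"
proof -
  note D = xquad_D[OF q]
  have P: "P \<in> N" "dist p x = \<delta> P X" "dist p y = \<delta> P Y" "dist p z = \<delta> P Z" "dist p w = \<delta> P W" using g unfolding good_def by auto
  have xp: "dist x p = \<delta> X P" using P model_dist_commute[OF D(1) P(1)] by (simp add: dist_commute)
  have c: "dist y x = \<delta> Y X" "dist z x = \<delta> Z X" "dist w x = \<delta> W X"
    using D model_dist_commute by (auto simp: dist_commute)
  show ?thesis unfolding above_def
    using okp_exact[OF D(1) P(1) D(2) n(1,5,2) xp P(3) c(1)] okp_exact[OF D(1) P(1) D(3) n(1,5,3) xp P(4) c(2)]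
      okp_exact[OF D(1) P(1) D(4) n(1,5,4) xp P(5) c(3)] P xp by simp
qed

end

text \<open>Radial projection to the model plane. For \<kappa> < 0 the combination is timelike since
  \<open>lf \<kappa> A B\<close>, a hyperbolic cosine, is at least 1; on a sphere it suffices that
  it is nonzero.\<close>

lemma hat_plane_normalize:
  assumes "A \<in> hat_plane \<kappa>" "B \<in> hat_plane \<kappa>" "a \<ge> 0" "b \<ge> 0" "a + b > 0" "a *\<^sub>R A + b *\<^sub>R B \<noteq> 0"
  obtains k S where "k > 0" "S \<in> hat_plane \<kappa>" "k *\<^sub>R S = a *\<^sub>R A + b *\<^sub>R B"
proof -
  let ?v = "a *\<^sub>R A + b *\<^sub>R B"
  have main: "\<exists>k>0. (1 / k) *\<^sub>R ?v \<in> hat_plane \<kappa>"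
  proof (cases "\<kappa> = 0")
    case True
    have "(1 / (a + b)) *\<^sub>R ?v \<in> hat_plane \<kappa>" using True assms
      by (simp add: hat_plane_def add_divide_distrib[symmetric])
    then show ?thesis using assms(5) by blast
  next
    case False
    define q where "q = \<kappa> * mform \<kappa> ?v ?v"
    have lab: "lf \<kappa> A B \<ge> 1" if "\<kappa> < 0"
    proof -
      have "cosh (sqrt (- \<kappa>) * model_dist \<kappa> A B) \<ge> 1" by (rule cosh_real_ge_1)
      then show ?thesis using that lf_cos[OF assms(1,2)] by (simp add: md_cos_def)
    qed
    have q: "q > 0"
    proof (cases "\<kappa> > 0")
      case True
      then show ?thesis using assms(6) by (simp add: q_def mform_def)
    next
      case F: False
      then have k: "\<kappa> < 0" using False by simp
      have "q = a\<^sup>2 + b\<^sup>2 + 2 * a * b * lf \<kappa> A B"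
        using mform_self[OF False assms(1)] mform_self[OF False assms(2)] False mform_commute[of \<kappa> A B]
        by (simp add: q_def lf_def mform_simps power2_eq_square algebra_simps)
      moreover have "2 * a * b * lf \<kappa> A B \<ge> 2 * a * b * 0" using assms lab[OF k] by (intro mult_left_mono) auto
      moreover have "a\<^sup>2 + b\<^sup>2 > 0" using assms(3-5) by (simp add: sum_power2_gt_zero_iff)
      ultimately show ?thesis by simp
    qed
    have s: "sqrt q > 0" "sqrt q * sqrt q = q" using q by auto
    have gen: "mform \<kappa> (c *\<^sub>R v) (c *\<^sub>R v) = c * c * mform \<kappa> v v" for c v by (simp add: mform_simps)
    have mm: "mform \<kappa> ((1 / sqrt q) *\<^sub>R ?v) ((1 / sqrt q) *\<^sub>R ?v) = 1 / \<kappa>"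
    proof -
      have "mform \<kappa> ((1 / sqrt q) *\<^sub>R ?v) ((1 / sqrt q) *\<^sub>R ?v) = mform \<kappa> ?v ?v / (sqrt q * sqrt q)"
        using gen[of "1 / sqrt q" ?v] by simp
      also have "mform \<kappa> ?v ?v = q / \<kappa>" unfolding q_def using False by simp
      also have "q / \<kappa> / (sqrt q * sqrt q) = 1 / \<kappa>" unfolding s(2) using q by simp
      finally show ?thesis .
    qed
    have "(1 / sqrt q) *\<^sub>R ?v \<in> hat_plane \<kappa>"
    proof (cases "\<kappa> > 0")
      case True
      then show ?thesis using mm by (simp add: hat_plane_pos mform_def)
    next
      case F: False
      then have k: "\<kappa> < 0" using False by simp
      have "b * lf \<kappa> A B \<ge> b * 1" using assms lab[OF k] by (intro mult_left_mono) auto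
      then have "lf \<kappa> A ?v > 0" using assms by (simp add: lf_simps)
      then have "lf \<kappa> A ((1 / sqrt q) *\<^sub>R ?v) > 0" unfolding lf_simps(3)[of _ _ _ ?v] using s by simp
      then show ?thesis by (rule hat_plane_negI[OF k assms(1) mm])
    qed
    then show ?thesis using s by blast
  qed
  then obtain k where "k > 0" "(1 / k) *\<^sub>R ?v \<in> hat_plane \<kappa>" by blast
  then show ?thesis using that[of k "(1 / k) *\<^sub>R ?v"] by (simp del: scaleR_add_right)
qed

section \<open>The region when the center lies inside the small triangle\<close>

context cbb_geodesic begin

definition smallquad :: "'b \<Rightarrow> 'b \<Rightarrow> 'b \<Rightarrow> 'b \<Rightarrow> real^3 \<Rightarrow> real^3 \<Rightarrow> real^3 \<Rightarrow> real^3 \<Rightarrow> bool" where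
  "smallquad x y z w X Y Z W \<longleftrightarrow> xquad x y z w X Y Z W \<and> X \<in> op_cone Y Z W"

lemma smallquad_rotate: "smallquad x y z w X Y Z W \<Longrightarrow> smallquad x z w y X Z W Y"
  using xquad_rotate op_cone_rotate unfolding smallquad_def by blast

lemma smallquad_det:
  assumes "smallquad x y z w X Y Z W" shows "det3 Y Z W \<noteq> 0"
proof -
  obtain a b c where X: "c > 0" "X = a *\<^sub>R Y + b *\<^sub>R Z + c *\<^sub>R W" using assms unfolding smallquad_def op_cone_def by blast
  have "det3 X Y Z = c * det3 W Y Z" unfolding X(2) by (simp add: det3_simps)
  moreover have "det3 X Y Z \<noteq> 0" using assms xquad_D(14) unfolding smallquad_def by blast
  ultimately show ?thesis using det3_cyclic(2)[of W Y Z] det3_cyclic(1)[of W Y Z] by auto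
qed

text \<open>The sum of the dual basis. Being positive on the whole cone, it provides the half space
  for \<open>okp_halfspace\<close>.\<close>

lemma basis_functional:
  assumes "det3 Y Z W \<noteq> 0" obtains n where "n \<bullet> Y = 1" "n \<bullet> Z = 1" "n \<bullet> W = 1"
proof -
  let ?n = "(1 / det3 Y Z W) *\<^sub>R (cross3 Z W + cross3 W Y + cross3 Y Z)"
  have "(cross3 Z W + cross3 W Y + cross3 Y Z) \<bullet> Y = det3 Y Z W" "(cross3 Z W + cross3 W Y + cross3 Y Z) \<bullet> Z = det3 Y Z W"
    "(cross3 Z W + cross3 W Y + cross3 Y Z) \<bullet> W = det3 Y Z W"
    by (simp_all add: det3_def cross3_def inner_vec_def sum_3 vector_3 algebra_simps)
  then show ?thesis using that[of ?n] assms by (simp add: inner_scaleR_left)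
qed

text \<open>\<open>P\<close> lies in the triangle \<open>X\<close>, \<open>Y\<close>,
  \<open>Z\<close> and is reached in two moves: from \<open>X\<close> along \<open>[X, Y]\<close> to
  \<open>S\<close>, and from \<open>S\<close> along \<open>[S, Z]\<close>. At \<open>S\<close> the
  vertices \<open>X\<close> and \<open>Y\<close> are in opposite directions, so
  \<open>tripod_side\<close> applies there again. The lower bound ranges over all good pairs, so
  that points of different subtriangles can be compared later.\<close>

lemma good_in_cone:
  assumes q: "smallquad x y z w X Y Z W" and P: "P \<in> N" "P = a *\<^sub>R X + b *\<^sub>R Y + c *\<^sub>R Z" "a > 0" "b \<ge> 0" "c \<ge> 0"
    and n: "n \<bullet> Y = 1" "n \<bullet> Z = 1" "n \<bullet> W = 1"
  shows "\<exists>p. good x y z w X Y Z W p P \<and>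
    (\<forall>q Q. good x y z w X Y Z W q Q \<and> n \<bullet> Q > 0 \<longrightarrow> \<delta> P Q \<le> dist p q)"
proof -
  have xq: "xquad x y z w X Y Z W" using q unfolding smallquad_def by blast
  note D = xquad_D[OF xq]
  have c: "dist y x = \<delta> Y X" "dist z x = \<delta> Z X" "dist w x = \<delta> W X" "dist z y = \<delta> Z Y" "dist w z = \<delta> W Z"
    using D(5-9) model_dist_commute[OF D(1,2)] model_dist_commute[OF D(1,3)] model_dist_commute[OF D(1,4)]
      model_dist_commute[OF D(2,3)] model_dist_commute[OF D(3,4)] by (simp_all add: dist_commute)
  obtain ly lz lw where l: "ly > 0" "lz > 0" "lw > 0" and X: "X = ly *\<^sub>R Y + lz *\<^sub>R Z + lw *\<^sub>R W"
    using q unfolding smallquad_def op_cone_def by blast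
  have "n \<bullet> X = ly + lz + lw" unfolding X by (simp add: inner_add_right n)
  then have nX: "n \<bullet> X > 0" using l by simp
  have n': "n \<bullet> Y > 0" "n \<bullet> Z > 0" "n \<bullet> W > 0" using n by auto
  have nv: "n \<bullet> (a *\<^sub>R X + b *\<^sub>R Y) > 0" using nX n P by (simp add: inner_add_right add_pos_nonneg)
  then have v0: "a *\<^sub>R X + b *\<^sub>R Y \<noteq> 0" by auto
  have "a + b > 0" using P by simp
  then obtain k S where k: "k > 0" "S \<in> N" "k *\<^sub>R S = a *\<^sub>R X + b *\<^sub>R Y"
    using hat_plane_normalize[OF D(1,2) less_imp_le[OF P(3)] P(4) _ v0] by blast
  have "k * (n \<bullet> S) > 0" using nv unfolding k(3)[symmetric] by simp
  then have nS: "n \<bullet> S > 0" using k(1) by (simp add: zero_less_mult_iff)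
  have "n \<bullet> P > 0" using nv n P by (simp add: inner_add_right add_pos_nonneg)
  note nP = this
  have "S = (1 / k) *\<^sub>R (k *\<^sub>R S)" using k(1) by simp
  then have S: "S = (a / k) *\<^sub>R X + (b / k) *\<^sub>R Y" unfolding k(3) by (simp add: scaleR_add_right)
  have "\<delta> X Y = \<delta> X S + \<delta> S Y" by (rule cone_between[OF D(1) k(2) D(2) S]) (use P k(1) in auto)
  then obtain s where s: "onseg x s y X S Y" using onseg_exists[OF D(1,2) k(2) D(5)] by blast
  note sD = onseg_D[OF s]
  have sz: "dist s z = \<delta> S Z" "dist s w = \<delta> S W" using xquad_side[OF xq s] by auto
  have "P = k *\<^sub>R S + c *\<^sub>R Z" using P(2) k(3) by simp
  then have "\<delta> S Z = \<delta> S P + \<delta> P Z" by (rule cone_between[OF k(2) P(1) D(3)]) (use P k(1) in auto)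
  then obtain p where p: "onseg s p z S P Z" using onseg_exists[OF k(2) D(3) P(1) sz(1)] by blast
  note pD = onseg_D[OF p]
  have sx: "dist s x = \<delta> S X" using sD(6) model_dist_commute[OF D(1) k(2)] by (simp add: dist_commute)
  have zs: "dist z s = \<delta> Z S" using sz(1) model_dist_commute[OF k(2) D(3)] by (simp add: dist_commute)
  have ys: "dist y s = \<delta> Y S" using sD(7) model_dist_commute[OF k(2) D(2)] by (simp add: dist_commute)
  have ws: "dist w s = \<delta> W S" using sz(2) model_dist_commute[OF k(2) D(4)] by (simp add: dist_commute)
  have gS: "good x y z w X Y Z W s S" using sD(7) sx sz k(2) unfolding good_def by blast
  have gp: "good x y z w X Y Z W p P"
  \<comment> \<open>For \<open>b = 0\<close> the point \<open>S\<close> is \<open>X\<close>, and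
    \<open>xquad_side\<close> at \<open>x\<close> takes the place of \<open>tripod_side\<close> at
    \<open>s\<close>, which asks for a positive weight at \<open>Y\<close>.\<close>
  proof (cases "b = 0")
    case True
    then have "S = X" using hat_plane_scale[OF D(1) k(2), of "a / k"] S P(3) k(1) by simp
    then have "s = x" using sD(6) D(1) by simp
    have p': "onseg x p z X P Z" using p unfolding \<open>S = X\<close> \<open>s = x\<close> .
    have "dist p w = \<delta> P W" "dist p y = \<delta> P Y" using xquad_side(1,2)[OF xquad_rotate[OF xq] p'] by auto
    moreover have "dist p x = \<delta> P X" using onseg_D(6)[OF p'] model_dist_commute[OF D(1) P(1)] by (simp add: dist_commute)
    ultimately show ?thesis using P(1) pD(7) unfolding good_def by blast
  next
    case False
    then have b: "b > 0" using P(4) by simp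
    have ok: "okp \<kappa> (peri s z x)" "okp \<kappa> (peri s x y)" "okp \<kappa> (peri s z y)" "okp \<kappa> (peri s y w)" "okp \<kappa> (peri s z w)"
      using okp_exact[OF k(2) D(3,1) nS n'(2) nX sz(1) c(2) sD(6)]
        okp_exact[OF k(2) D(1,2) nS nX n'(1) sx D(5) ys] okp_exact[OF k(2) D(3,2) nS n'(2,1) sz(1) c(4) ys]
        okp_exact[OF k(2) D(2,4) nS n'(1,3) sD(7) D(16) ws] okp_exact[OF k(2) D(3,4) nS n'(2,3) sz(1) D(9) ws] by auto
    have r1: "0 *\<^sub>R Z + a *\<^sub>R X + b *\<^sub>R Y = k *\<^sub>R S" using k(3) by simp
    have 1: "dist p x = \<delta> P X" "dist p y = \<delta> P Y"
      using tripod_side[OF k(2) D(3,1,2) sz(1) sx sD(7) c(2) D(5) c(4) r1 order_refl P(3) b ok(1-3) p] by auto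
    \<comment> \<open>Substituting \<open>X\<close> gives a relation at \<open>S\<close> between the
      three vertices, from which the distance to \<open>w\<close> is obtained.\<close>
    have r2: "(a * lz) *\<^sub>R Z + (a * ly + b) *\<^sub>R Y + (a * lw) *\<^sub>R W = k *\<^sub>R S"
      unfolding k(3) X by (simp add: algebra_simps)
    have pos: "a * lz \<ge> 0" "a * ly + b > 0" "a * lw > 0" using P(3) b l by (auto intro: add_pos_pos)
    have 2: "dist p w = \<delta> P W"
      using tripod_side(2)[OF k(2) D(3,2,4) sz(1) sD(7) sz(2) c(4) D(16) D(9) r2 pos ok(3,4,5) p] .
    show ?thesis using 1 2 P(1) pD(7) unfolding good_def by blast
  qed
  have low: "\<delta> P Q \<le> dist p q" if g: "good x y z w X Y Z W q Q" and nQ: "n \<bullet> Q > 0" for q Q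
  proof -
    have Q: "Q \<in> N" "dist q x = \<delta> Q X" "dist q y = \<delta> Q Y" "dist q z = \<delta> Q Z" using g unfolding good_def by auto
    have Q': "dist x q = \<delta> X Q" "dist y q = \<delta> Y Q" "dist z q = \<delta> Z Q"
      using Q model_dist_commute[OF Q(1)] D(1-3) by (simp_all add: dist_commute)
    \<comment> \<open>This upper bound is what makes the perimeter of \<open>s\<close>,
      \<open>z\<close>, \<open>q\<close> admissible for the comparison along
      \<open>[s, z]\<close>.\<close>
    have "dist s q \<le> \<delta> S Q"
      by (rule above_upper[OF xq good_above[OF xq gS nX n' nS] good_above[OF xq g nX n' nQ]
         okp_halfspace[OF D(1) k(2) Q(1) nX nS nQ]])
    moreover have "\<delta> S Q \<le> dist s q"
      by (rule side_ge[OF s Q(1) _ _ okp_exact[OF D(1,2) Q(1) nX n'(1) nQ D(5) Q'(2) Q(2)]]) (simp_all add: Q')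
    ultimately have sq: "dist s q = \<delta> S Q" by simp
    then have qs: "dist q s = \<delta> Q S" using model_dist_commute[OF k(2) Q(1)] by (simp add: dist_commute)
    show ?thesis
      by (rule side_ge[OF p Q(1) _ _ okp_exact[OF k(2) D(3) Q(1) nS n'(2) nQ sz(1) Q'(3) qs]]) (simp_all add: sq Q')
  qed
  show ?thesis using gp low by blast
qed

text \<open>The cone is the union of the three cones with \<open>X\<close> and two of the vertices:
  subtract from \<open>P\<close> the largest multiple \<open>t\<close> of \<open>X\<close> that
  leaves nonnegative coordinates. The vertex whose coordinate becomes 0 decides the rotation of the
  quadruple.\<close>

lemma good_exists:
  assumes q: "smallquad x y z w X Y Z W" and P: "P \<in> op_cone Y Z W"
    and n: "n \<bullet> Y = 1" "n \<bullet> Z = 1" "n \<bullet> W = 1"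
  shows "\<exists>p. good x y z w X Y Z W p P \<and>
    (\<forall>q Q. good x y z w X Y Z W q Q \<and> n \<bullet> Q > 0 \<longrightarrow> \<delta> P Q \<le> dist p q)"
proof -
  obtain ly lz lw where l: "ly > 0" "lz > 0" "lw > 0" and X: "X = ly *\<^sub>R Y + lz *\<^sub>R Z + lw *\<^sub>R W"
    using q unfolding smallquad_def op_cone_def by blast
  obtain \<alpha> \<beta> \<gamma> where a: "\<alpha> > 0" "\<beta> > 0" "\<gamma> > 0" and PP: "P = \<alpha> *\<^sub>R Y + \<beta> *\<^sub>R Z + \<gamma> *\<^sub>R W" and PN: "P \<in> N"
    using P unfolding op_cone_def by blast
  have e: "P = t *\<^sub>R X + (\<alpha> - t * ly) *\<^sub>R Y + (\<beta> - t * lz) *\<^sub>R Z + (\<gamma> - t * lw) *\<^sub>R W" for t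
    unfolding PP X by (simp add: algebra_simps)
  note q2 = smallquad_rotate[OF q] note q3 = smallquad_rotate[OF q2]
  consider "\<gamma> / lw \<le> \<alpha> / ly" "\<gamma> / lw \<le> \<beta> / lz" | "\<alpha> / ly \<le> \<beta> / lz" "\<alpha> / ly \<le> \<gamma> / lw" | "\<beta> / lz \<le> \<alpha> / ly" "\<beta> / lz \<le> \<gamma> / lw"
    by linarith
  then show ?thesis
  proof cases
    case 1
    define t where "t = \<gamma> / lw"
    have "t > 0" "t * lw = \<gamma>" "t \<le> \<alpha> / ly" "t \<le> \<beta> / lz" using 1 a l by (simp_all add: t_def)
    then have t: "t > 0" "t * lw = \<gamma>" "t * ly \<le> \<alpha>" "t * lz \<le> \<beta>" using l by (simp_all add: pos_le_divide_eq)
    show ?thesis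
      by (rule good_in_cone[OF q PN, of t "\<alpha> - t * ly" "\<beta> - t * lz"]) (use t n e[of t] in auto)
  next
    case 2
    define t where "t = \<alpha> / ly"
    have "t > 0" "t * ly = \<alpha>" "t \<le> \<gamma> / lw" "t \<le> \<beta> / lz" using 2 a l by (simp_all add: t_def)
    then have t: "t > 0" "t * ly = \<alpha>" "t * lw \<le> \<gamma>" "t * lz \<le> \<beta>" using l by (simp_all add: pos_le_divide_eq)
    have "\<exists>p. good x z w y X Z W Y p P \<and> (\<forall>q Q. good x z w y X Z W Y q Q \<and> n \<bullet> Q > 0 \<longrightarrow> \<delta> P Q \<le> dist p q)"
      by (rule good_in_cone[OF q2 PN, of t "\<beta> - t * lz" "\<gamma> - t * lw"]) (use t n e[of t] in auto)
    then show ?thesis unfolding good_rotate[of x y z w X Y Z W] .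
  next
    case 3
    define t where "t = \<beta> / lz"
    have "t > 0" "t * lz = \<beta>" "t \<le> \<gamma> / lw" "t \<le> \<alpha> / ly" using 3 a l by (simp_all add: t_def)
    then have t: "t > 0" "t * lz = \<beta>" "t * lw \<le> \<gamma>" "t * ly \<le> \<alpha>" using l by (simp_all add: pos_le_divide_eq)
    have "\<exists>p. good x w y z X W Y Z p P \<and> (\<forall>q Q. good x w y z X W Y Z q Q \<and> n \<bullet> Q > 0 \<longrightarrow> \<delta> P Q \<le> dist p q)"
      by (rule good_in_cone[OF q3 PN, of t "\<gamma> - t * lw" "\<alpha> - t * ly"]) (use t n e[of t] in \<open>auto simp: algebra_simps\<close>)
    then show ?thesis unfolding good_rotate[of x y z w X Y Z W] good_rotate[of x z w y X Z W Y] .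
  qed
qed

lemma op_cone_functional: "P \<in> op_cone Y Z W \<Longrightarrow> n \<bullet> Y = 1 \<Longrightarrow> n \<bullet> Z = 1 \<Longrightarrow> n \<bullet> W = 1 \<Longrightarrow> n \<bullet> P > 0"
  unfolding op_cone_def by (auto simp: inner_add_right intro!: add_pos_pos)

theorem small_region:
  assumes q: "smallquad x y z w X Y Z W"
  obtains f where "\<And>P. P \<in> op_cone Y Z W \<Longrightarrow> good x y z w X Y Z W (f P) P"
    "\<And>P Q. P \<in> op_cone Y Z W \<Longrightarrow> Q \<in> op_cone Y Z W \<Longrightarrow> dist (f P) (f Q) = \<delta> P Q"
proof -
  obtain n where n: "n \<bullet> Y = 1" "n \<bullet> Z = 1" "n \<bullet> W = 1" by (rule basis_functional[OF smallquad_det[OF q]])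
  have xq: "xquad x y z w X Y Z W" using q unfolding smallquad_def by blast
  have n': "n \<bullet> Y > 0" "n \<bullet> Z > 0" "n \<bullet> W > 0" using n by auto
  have nX: "n \<bullet> X > 0" using q op_cone_functional n unfolding smallquad_def by blast
  obtain f where f: "\<And>P. P \<in> op_cone Y Z W \<Longrightarrow> good x y z w X Y Z W (f P) P \<and>
    (\<forall>q Q. good x y z w X Y Z W q Q \<and> n \<bullet> Q > 0 \<longrightarrow> \<delta> P Q \<le> dist (f P) q)"
    using good_exists[OF q _ n] by metis
  show ?thesis
  proof (rule that)
    show "good x y z w X Y Z W (f P) P" if "P \<in> op_cone Y Z W" for P using f that by blast
    fix P Q assume P: "P \<in> op_cone Y Z W" and Q: "Q \<in> op_cone Y Z W"
    have nn: "n \<bullet> P > 0" "n \<bullet> Q > 0" using op_cone_functional[OF P n] op_cone_functional[OF Q n] by auto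
    have g: "good x y z w X Y Z W (f P) P" "good x y z w X Y Z W (f Q) Q" using f P Q by auto
    have mem: "P \<in> N" "Q \<in> N" using P Q unfolding op_cone_def by auto
    have "dist (f P) (f Q) \<le> \<delta> P Q"
      by (rule above_upper[OF xq good_above[OF xq g(1) nX n' nn(1)] good_above[OF xq g(2) nX n' nn(2)]
         okp_halfspace[OF xquad_D(1)[OF xq] mem nX nn]])
    moreover have "\<delta> P Q \<le> dist (f P) (f Q)" using f[OF P] g(2) nn(2) by blast
    ultimately show "dist (f P) (f Q) = \<delta> P Q" by simp
  qed
qed

end

section \<open>Suspensions\<close>

context cbb_geodesic begin

lemma mpt_eventually_cone:
  assumes P: "P \<in> op_cone Y Z W" and A: "A \<in> N" "0 < \<delta> P A" "\<kappa> > 0 \<Longrightarrow> \<delta> P A < PP \<kappa>"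
    and det: "det3 Y Z W \<noteq> 0" and e: "\<epsilon> > 0"
  obtains t where "0 < t" "t \<le> \<epsilon>" "t < \<delta> P A" "mpt \<kappa> P A t \<in> op_cone Y Z W"
proof -
  obtain p1 p2 p3 where p: "p1 > 0" "p2 > 0" "p3 > 0" and PE: "P = p1 *\<^sub>R Y + p2 *\<^sub>R Z + p3 *\<^sub>R W" and PN: "P \<in> N"
    using P unfolding op_cone_def by blast
  obtain a1 a2 a3 where AE: "A = a1 *\<^sub>R Y + a2 *\<^sub>R Z + a3 *\<^sub>R W" using det3_basis[OF det] by blast
  let ?D = "\<delta> P A"
  have S: "md_sin \<kappa> ?D > 0" using A(2,3) by (rule md_sin_pos)
  define c where "c p a s = (md_sin \<kappa> (?D - s) / md_sin \<kappa> ?D) * p + (md_sin \<kappa> s / md_sin \<kappa> ?D) * a" for p a s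
  have ev: "eventually (\<lambda>s. c p a s > 0) (at_right 0)" if "p > 0" for p a
  proof -
    have "((\<lambda>s. c p a s) \<longlongrightarrow> (md_sin \<kappa> (?D - 0) / md_sin \<kappa> ?D) * p + (md_sin \<kappa> 0 / md_sin \<kappa> ?D) * a) (at_right 0)"
      unfolding c_def by (intro tendsto_intros) (use S in auto)
    then have "((\<lambda>s. c p a s) \<longlongrightarrow> p) (at_right 0)" using S by simp
    then show ?thesis using that by (rule order_tendstoD)
  qed
  have "eventually (\<lambda>s::real. s < min \<epsilon> ?D) (at_right 0)"
    by (rule order_tendstoD(2)[OF tendsto_ident_at]) (use e A(2) in simp)
  moreover have "eventually (\<lambda>s::real. s > 0) (at_right 0)" by (rule eventually_at_right_less)
  ultimately have "eventually (\<lambda>s. c p1 a1 s > 0 \<and> c p2 a2 s > 0 \<and> c p3 a3 s > 0 \<and> s < min \<epsilon> ?D \<and> s > 0) (at_right 0)"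
    using ev[OF p(1), of a1] ev[OF p(2), of a2] ev[OF p(3), of a3] by eventually_elim auto
  then obtain t where t: "c p1 a1 t > 0" "c p2 a2 t > 0" "c p3 a3 t > 0" "t < min \<epsilon> ?D" "t > 0"
    using eventually_happens'[OF trivial_limit_at_right_real] by blast
  define u v where "u = md_sin \<kappa> (?D - t) / md_sin \<kappa> ?D" and "v = md_sin \<kappa> t / md_sin \<kappa> ?D"
  have "mpt \<kappa> P A t = u *\<^sub>R P + v *\<^sub>R A" by (simp add: mpt_def u_def v_def)
  also have "\<dots> = u *\<^sub>R (p1 *\<^sub>R Y + p2 *\<^sub>R Z + p3 *\<^sub>R W) + v *\<^sub>R (a1 *\<^sub>R Y + a2 *\<^sub>R Z + a3 *\<^sub>R W)"
    by (simp only: PE[symmetric] AE[symmetric])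
  also have "\<dots> = (u * p1 + v * a1) *\<^sub>R Y + (u * p2 + v * a2) *\<^sub>R Z + (u * p3 + v * a3) *\<^sub>R W"
    by (simp add: algebra_simps)
  also have "\<dots> = c p1 a1 t *\<^sub>R Y + c p2 a2 t *\<^sub>R Z + c p3 a3 t *\<^sub>R W"
    by (simp add: c_def u_def v_def)
  finally have "mpt \<kappa> P A t = c p1 a1 t *\<^sub>R Y + c p2 a2 t *\<^sub>R Z + c p3 a3 t *\<^sub>R W" .
  moreover have "mpt \<kappa> P A t \<in> N" using mpt_props(1)[OF PN A] t by simp
  ultimately have "mpt \<kappa> P A t \<in> op_cone Y Z W" using t unfolding op_cone_def by blast
  then show ?thesis using that t by simp
qed

lemma op_cone_mpt:
  assumes "P \<in> op_cone Y Z W" "A \<in> op_cone Y Z W" "0 < \<delta> P A" "\<kappa> > 0 \<Longrightarrow> \<delta> P A < PP \<kappa>" "0 \<le> t" "t < \<delta> P A"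
  shows "mpt \<kappa> P A t \<in> op_cone Y Z W"
proof -
  obtain p1 p2 p3 where p: "p1 > 0" "p2 > 0" "p3 > 0" and PE: "P = p1 *\<^sub>R Y + p2 *\<^sub>R Z + p3 *\<^sub>R W" and PN: "P \<in> N"
    using assms(1) unfolding op_cone_def by blast
  obtain a1 a2 a3 where a: "a1 > 0" "a2 > 0" "a3 > 0" and AE: "A = a1 *\<^sub>R Y + a2 *\<^sub>R Z + a3 *\<^sub>R W" and AN: "A \<in> N"
    using assms(2) unfolding op_cone_def by blast
  define c where "c = md_sin \<kappa> (\<delta> P A - t) / md_sin \<kappa> (\<delta> P A)"
  define d where "d = md_sin \<kappa> t / md_sin \<kappa> (\<delta> P A)"
  have S: "md_sin \<kappa> (\<delta> P A) > 0" using assms(3,4) by (rule md_sin_pos)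
  have "md_sin \<kappa> (\<delta> P A - t) > 0" by (rule md_sin_pos) (use assms(4-6) in auto)
  then have c: "c > 0" using S by (simp add: c_def)
  have "md_sin \<kappa> t \<ge> 0" by (rule md_sin_nonneg) (use assms(4-6) in auto)
  then have d: "d \<ge> 0" using S by (simp add: d_def)
  have "mpt \<kappa> P A t = c *\<^sub>R P + d *\<^sub>R A" by (simp add: mpt_def c_def d_def)
  also have "\<dots> = (c * p1 + d * a1) *\<^sub>R Y + (c * p2 + d * a2) *\<^sub>R Z + (c * p3 + d * a3) *\<^sub>R W"
    unfolding PE AE by (simp add: algebra_simps)
  finally have "mpt \<kappa> P A t = (c * p1 + d * a1) *\<^sub>R Y + (c * p2 + d * a2) *\<^sub>R Z + (c * p3 + d * a3) *\<^sub>R W" .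
  moreover have "c * p1 + d * a1 > 0" "c * p2 + d * a2 > 0" "c * p3 + d * a3 > 0" using p a c d by (simp_all add: add_pos_nonneg)
  moreover have "mpt \<kappa> P A t \<in> N" using mpt_props(1)[OF PN AN assms(3,4)] assms(5,6) by simp
  ultimately show ?thesis unfolding op_cone_def by blast
qed

lemma model_dist_pos: "A \<in> N \<Longrightarrow> B \<in> N \<Longrightarrow> A \<noteq> B \<Longrightarrow> 0 < \<delta> A B"
proof -
  assume A: "A \<in> N" "B \<in> N" "A \<noteq> B"
  then have "\<delta> A B \<noteq> 0" using model_dist_eq_0 by blast
  then show "0 < \<delta> A B" using model_dist_props(2)[OF A(1,2)] by simp
qed

lemma onseg_mpt:
  assumes "dist a b = \<delta> A B" "A \<in> N" "B \<in> N" "0 < \<delta> A B" "\<kappa> > 0 \<Longrightarrow> \<delta> A B < PP \<kappa>" "0 \<le> t" "t \<le> \<delta> A B"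
    "dist a p = t" "dist p b = \<delta> A B - t"
  shows "onseg a p b A (mpt \<kappa> A B t) B"
  using mpt_props[OF assms(2-7)] assms by (simp add: onseg_def btw_def)

lemma det3_parallel:
  assumes "A \<in> N" "B \<in> N" "\<kappa> > 0" "\<And>C. det3 A B C = 0"
  shows "B = A \<or> B = - A"
proof -
  have "cross3 A B \<bullet> cross3 A B = det3 A B (cross3 A B)"
    by (simp add: det3_def cross3_def inner_vec_def sum_3 vector_3 algebra_simps)
  then have "cross3 A B = 0" using assms(4) by simp
  moreover have "A \<noteq> 0" using assms(1,3) by (auto simp: hat_plane_pos)
  ultimately have "\<exists>c. B = c *\<^sub>R A" by (simp add: cross_eq_0 collinear_lemma) auto
  then obtain c where c: "B = c *\<^sub>R A" by blast
  have "c\<^sup>2 = 1" using assms(1-3) by (simp add: hat_plane_pos c power2_eq_square)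
  then have "c = 1 \<or> c = - 1" by (simp add: power2_eq_1_iff)
  then show ?thesis using c by auto
qed

text \<open>A space containing two points at distance \<open>pi / sqrt \<kappa>\<close> behaves like a suspension: the
  meridians through a spherical disc around one of them span a whole sphere.\<close>

lemma suspension_extension:
  fixes f :: "real^3 \<Rightarrow> 'b" and e y0 :: 'b
  assumes k: "\<kappa> > 0" and det: "det3 Y Z W \<noteq> 0" and Y0: "Y0 \<in> op_cone Y Z W"
    and f: "\<And>A B. A \<in> op_cone Y Z W \<Longrightarrow> B \<in> op_cone Y Z W \<Longrightarrow> dist (f A) (f B) = \<delta> A B" and fY: "f Y0 = y0"
    and ye: "dist y0 e = PP \<kappa>" and fe: "\<And>A. A \<in> op_cone Y Z W \<Longrightarrow> dist (f A) e = PP \<kappa> - \<delta> Y0 A"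
  obtains F where "\<And>A B. A \<in> N \<Longrightarrow> B \<in> N \<Longrightarrow> A \<noteq> - Y0 \<Longrightarrow> B \<noteq> - Y0 \<Longrightarrow> dist (F A) (F B) = \<delta> A B"
    "\<And>A. A \<in> op_cone Y Z W \<Longrightarrow> F A = f A"
proof -
  let ?C = "op_cone Y Z W"
  define E where "E = - Y0"
  have Y0N: "Y0 \<in> N" using Y0 unfolding op_cone_def by blast
  have CN: "A \<in> N" if "A \<in> ?C" for A using that unfolding op_cone_def by blast
  have EN: "E \<in> N" and dE: "\<delta> A E = PP \<kappa> - \<delta> A Y0" if "A \<in> N" for A
    using model_antipode[OF k that Y0N] unfolding E_def by auto
  have lt: "\<delta> Y0 A < PP \<kappa>" if "A \<in> N" "A \<noteq> - Y0" for A using model_dist_less_PP[OF Y0N that k] .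
  have E_notin: "- Y0 \<notin> ?C"
  proof
    assume m: "- Y0 \<in> ?C"
    obtain n where n: "n \<bullet> Y = 1" "n \<bullet> Z = 1" "n \<bullet> W = 1" by (rule basis_functional[OF det])
    show False using op_cone_functional[OF m n] op_cone_functional[OF Y0 n] by simp
  qed
  \<comment> \<open>\<open>G a A\<close> places \<open>a\<close> on the meridian from
    \<open>y0\<close> to \<open>e\<close> through some \<open>f A0\<close>, at the height of
    \<open>A\<close>.\<close>
  define G where "G a A \<longleftrightarrow> (\<exists>A0\<in>?C. A0 \<noteq> Y0 \<and> onseg y0 (f A0) a Y0 A0 A \<and> onseg (f A0) a e A0 A E)" for a A
  have GI: "\<exists>a. G a A" if A: "A \<in> N" "A \<noteq> Y0" "A \<noteq> - Y0" for A
  proof -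
    have D: "0 < \<delta> Y0 A" "\<kappa> > 0 \<Longrightarrow> \<delta> Y0 A < PP \<kappa>" using model_dist_pos[OF Y0N A(1)] A lt by auto
    obtain t where t: "0 < t" "t \<le> 1" "t < \<delta> Y0 A" "mpt \<kappa> Y0 A t \<in> ?C"
      by (rule mpt_eventually_cone[OF Y0 A(1) D det zero_less_one])
    define A0 where "A0 = mpt \<kappa> Y0 A t"
    have A0: "A0 \<in> ?C" "A0 \<in> N" using t CN unfolding A0_def by auto
    note m = mpt_props(2,3)[OF Y0N A(1) D less_imp_le[OF t(1)] less_imp_le[OF t(3)], folded A0_def]
    have ne: "A0 \<noteq> Y0" using m(1) t(1) model_dist_self[OF Y0N] by auto
    have a0Y: "\<delta> A0 Y0 = \<delta> Y0 A0" "\<delta> A Y0 = \<delta> Y0 A" using model_dist_commute Y0N A0 A(1) by auto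
    have d1: "dist (f A0) e = \<delta> A0 E" using fe[OF A0(1)] dE[OF A0(2)] a0Y by simp
    have d2: "\<delta> A0 E = \<delta> A0 A + \<delta> A E" using dE[OF A0(2)] dE[OF A(1)] a0Y m by simp
    obtain a where a: "onseg (f A0) a e A0 A E" using onseg_exists[OF A0(2) EN[OF A(1)] A(1) d1 d2] by blast
    note aD = onseg_D[OF a]
    have ya0: "dist y0 (f A0) = \<delta> Y0 A0" using f[OF Y0 A0(1)] fY by simp
    \<comment> \<open>As \<open>dist y0 e\<close> is \<open>PP \<kappa>\<close>, the path through
      \<open>e\<close> bounds \<open>dist y0 a\<close> from below; the path through
      \<open>f A0\<close> bounds it from above.\<close>
    have "dist y0 a \<ge> \<delta> Y0 A" using dist_triangle[of y0 e a] aD(7) dE[OF A(1)] a0Y ye by simp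
    moreover have "dist y0 a \<le> \<delta> Y0 A" using dist_triangle[of y0 a "f A0"] aD(6) ya0 m by simp
    ultimately have "onseg y0 (f A0) a Y0 A0 A" using Y0N A0 A(1) ya0 aD(6) m unfolding onseg_def btw_def by simp
    then show ?thesis using a A0 ne unfolding G_def by blast
  qed
  have upper: "dist a b \<le> \<delta> A B" if a: "G a A" and b: "G b B" and ok: "okp \<kappa> (\<delta> Y0 A + \<delta> A B + \<delta> B Y0)" for a b A B
  proof -
    obtain A0 where A0: "A0 \<in> ?C" "A0 \<noteq> Y0" "onseg y0 (f A0) a Y0 A0 A" using a unfolding G_def by blast
    obtain B0 where B0: "B0 \<in> ?C" "B0 \<noteq> Y0" "onseg y0 (f B0) b Y0 B0 B" using b unfolding G_def by blast
    have "dist y0 (f A0) > 0" "dist y0 (f B0) > 0"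
      using model_dist_pos[OF Y0N CN[OF A0(1)]] model_dist_pos[OF Y0N CN[OF B0(1)]] A0(2) B0(2)
        onseg_D(6)[OF A0(3)] onseg_D(6)[OF B0(3)] by auto
    then have ne: "f A0 \<noteq> y0" "f B0 \<noteq> y0" by auto
    show ?thesis by (rule hinge_extend2[OF A0(3) ne(1) B0(3) ne(2) _ ok]) (simp add: f[OF A0(1) B0(1)])
  qed
  have generic: "dist a b = \<delta> A B" if a: "G a A" and b: "G b B" and d: "det3 Y0 A B \<noteq> 0" for a b A B
  proof -
    obtain A0 where A0: "A0 \<in> ?C" "A0 \<noteq> Y0" "onseg y0 (f A0) a Y0 A0 A" "onseg (f A0) a e A0 A E" using a unfolding G_def by blast
    obtain B0 where B0: "B0 \<in> ?C" "B0 \<noteq> Y0" "onseg y0 (f B0) b Y0 B0 B" "onseg (f B0) b e B0 B E" using b unfolding G_def by blast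
    note aD = onseg_D[OF A0(3)] and bD = onseg_D[OF B0(3)] and aeD = onseg_D[OF A0(4)] and beD = onseg_D[OF B0(4)]
    have "dist a b \<le> \<delta> A B" by (rule upper[OF a b okp_independent[OF Y0N aD(3) bD(3) d]])
    moreover have "\<delta> A B \<le> dist a b"
    proof -
      have scal: "\<exists>c d. d \<noteq> 0 \<and> A0' = c *\<^sub>R Y0 + d *\<^sub>R A'"
        if o: "onseg y0 (f A0') a' Y0 A0' A'" and ne: "A0' \<noteq> Y0" "A' \<noteq> - Y0" for a' A' A0'
      proof -
        note oD = onseg_D[OF o]
        have 1: "md_sin \<kappa> (\<delta> Y0 A0') > 0"
        proof (rule md_sin_pos)
          show "0 < \<delta> Y0 A0'" using model_dist_pos[OF Y0N oD(2)] ne(1) by auto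
          show "\<delta> Y0 A0' < PP \<kappa>" using lt[OF oD(3) ne(2)] oD(5) model_dist_props(2)[OF oD(2,3)] by simp
        qed
        have 2: "md_sin \<kappa> (\<delta> Y0 A') > 0"
        proof (rule md_sin_pos)
          show "0 < \<delta> Y0 A'" using model_dist_pos[OF Y0N oD(2)] ne(1) oD(5) model_dist_props(2)[OF oD(2,3)] by auto
          show "\<delta> Y0 A' < PP \<kappa>" by (rule lt[OF oD(3) ne(2)])
        qed
        let ?s = "md_sin \<kappa> (\<delta> Y0 A')"
        have "A0' = (1 / ?s) *\<^sub>R (?s *\<^sub>R A0')" using 2 by simp
        also have "\<dots> = (md_sin \<kappa> (\<delta> A0' A') / ?s) *\<^sub>R Y0 + (md_sin \<kappa> (\<delta> Y0 A0') / ?s) *\<^sub>R A'"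
          unfolding seg_rel[OF oD(1,2,3,5), symmetric] by (simp add: scaleR_add_right)
        finally show ?thesis using 1 2 by (intro exI[of _ "md_sin \<kappa> (\<delta> A0' A') / ?s"] exI[of _ "md_sin \<kappa> (\<delta> Y0 A0') / ?s"]) simp
      qed
      have nE: "A \<noteq> - Y0" "B \<noteq> - Y0" using d by (auto simp: det3_simps)
      obtain c1 d1 where A0e: "d1 \<noteq> 0" "A0 = c1 *\<^sub>R Y0 + d1 *\<^sub>R A" using scal[OF A0(3,2) nE(1)] by blast
      obtain c2 d2 where B0e: "d2 \<noteq> 0" "B0 = c2 *\<^sub>R Y0 + d2 *\<^sub>R B" using scal[OF B0(3,2) nE(2)] by blast
      have "det3 A Y0 B = - det3 Y0 A B" by (simp add: det3_def cross3_def inner_vec_def sum_3 vector_3 algebra_simps)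
      \<comment> \<open>Up to multiples of \<open>Y0\<close> and nonzero factors, \<open>A0\<close>
        and \<open>B0\<close> are \<open>A\<close> and \<open>B\<close>. Independence makes the
        triangle with \<open>e\<close> admissible, and the lower bound follows by comparing along
        the two meridians in turn.\<close>
      then have "det3 A0 E B0 \<noteq> 0" using d A0e(1) B0e(1) unfolding A0e(2) B0e(2) E_def by (simp add: det3_simps)
      then have "okp \<kappa> (\<delta> A0 E + \<delta> E B0 + \<delta> B0 A0)" by (rule okp_independent[OF aeD(1,3) beD(1)])
      moreover have "dist e (f B0) = \<delta> E B0" using beD(8) model_dist_commute[OF beD(1,3)] by (simp add: dist_commute)
      ultimately have ok: "okp \<kappa> (peri (f A0) e (f B0))" using aeD(8) f[OF B0(1) A0(1)] by (simp add: peri_def)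
      have "\<delta> A B0 \<le> dist a (f B0)"
        by (rule side_ge[OF A0(4) beD(1) _ _ ok]) (simp_all add: f A0 B0 \<open>dist e (f B0) = \<delta> E B0\<close>)
      moreover have "okp \<kappa> (peri (f B0) e a)"
      proof (rule okp_mono[OF ok])
        show "peri (f B0) e a \<le> peri (f A0) e (f B0)"
          using onseg_peri_le[OF onseg_commute[OF A0(4)], of "f B0"] by (simp add: peri_def dist_commute algebra_simps)
      qed
      moreover have "\<delta> E A = dist e a" using aeD(7) model_dist_commute[OF aeD(2,3)] by (simp add: dist_commute)
      ultimately have "\<delta> B A \<le> dist b a"
        using side_ge[OF B0(4) aD(3)] model_dist_commute[OF aD(3) beD(1)] by (simp add: dist_commute)
      then show ?thesis using model_dist_commute[OF aD(3) bD(3)] by (simp add: dist_commute)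
    qed
    ultimately show ?thesis by simp
  qed
  define F where "F A = (if A = Y0 then y0 else SOME a. G a A)" for A
  have FG: "G (F A) A" if "A \<in> N" "A \<noteq> Y0" "A \<noteq> - Y0" for A
    using someI_ex[OF GI[OF that]] that(2) unfolding F_def by simp
  have iso: "dist (F A) (F B) = \<delta> A B" if A: "A \<in> N" "A \<noteq> Y0" "A \<noteq> - Y0" and B: "B \<in> N" "B \<noteq> Y0" "B \<noteq> - Y0" for A B
  proof (cases "det3 Y0 A B = 0")
    case False
    then show ?thesis using generic FG A B by blast
  next
    case True
    \<comment> \<open>If \<open>A\<close> and \<open>B\<close> lie on one great circle through
      \<open>Y0\<close>, the perimeters may be critical. \<open>A\<close> is then moved slightly
      towards a point \<open>C\<close> off the circle, which makes the generic case available up to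
      an error of \<open>2 * t\<close>.\<close>
    have "\<exists>C\<in>N. det3 Y0 A C \<noteq> 0"
    proof (rule ccontr)
      assume "\<not> ?thesis"
      then have z: "det3 Y0 A C = 0" if "C \<in> N" for C using that by blast
      have "det3 Y0 A C = 0" for C
      proof (cases "C = 0")
        case False
        define r where "r = sqrt (\<kappa> * (C \<bullet> C))"
        have q: "\<kappa> * (C \<bullet> C) > 0" using k False by simp
        then have r: "r > 0" "r * r = \<kappa> * (C \<bullet> C)" by (simp_all add: r_def)
        have "((1 / r) *\<^sub>R C) \<bullet> ((1 / r) *\<^sub>R C) = (C \<bullet> C) / (r * r)" by simp
        also have "\<dots> = 1 / \<kappa>" unfolding r(2) using k False by simp
        finally have "(1 / r) *\<^sub>R C \<in> N" unfolding hat_plane_pos[OF k] .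
        from z[OF this] show ?thesis using r(1) by (simp add: det3_simps)
      qed (simp add: det3_simps)
      then show False using det3_parallel[OF Y0N A(1) k] A by blast
    qed
    then obtain C where C: "C \<in> N" "det3 Y0 A C \<noteq> 0" by blast
    have CA: "C \<noteq> A" "C \<noteq> - A" using C(2) by (auto simp: det3_simps)
    have D: "0 < \<delta> A C" "\<kappa> > 0 \<Longrightarrow> \<delta> A C < PP \<kappa>" using model_dist_pos[OF A(1) C(1)] model_dist_less_PP[OF A(1) C(1) CA(2)] CA(1) by auto
    obtain b1 b2 b3 where "B = b1 *\<^sub>R Y0 + b2 *\<^sub>R A + b3 *\<^sub>R C" using det3_basis[OF C(2)] by blast
    moreover from this have "b3 = 0" using True C(2) by (simp add: det3_simps)
    ultimately have BE: "B = b1 *\<^sub>R Y0 + b2 *\<^sub>R A" by simp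
    have b2: "b2 \<noteq> 0"
    proof
      assume "b2 = 0"
      then have "det3 Y0 B v = 0" for v by (simp add: BE det3_simps)
      then show False using det3_parallel[OF Y0N B(1) k] B by blast
    qed
    have est: "\<bar>dist (F A) (F B) - \<delta> A B\<bar> \<le> 2 * t" if t: "0 < t" "t \<le> \<delta> A C" for t
    proof -
      define A' where "A' = mpt \<kappa> A C t"
      note m = mpt_props(1-3)[OF A(1) C(1) D less_imp_le[OF t(1)] t(2), folded A'_def]
      define c d where "c = md_sin \<kappa> (\<delta> A C - t) / md_sin \<kappa> (\<delta> A C)" and "d = md_sin \<kappa> t / md_sin \<kappa> (\<delta> A C)"
      have A'E: "A' = c *\<^sub>R A + d *\<^sub>R C" by (simp add: A'_def mpt_def c_def d_def)
      have "md_sin \<kappa> (\<delta> A C) > 0" using D by (rule md_sin_pos)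
      moreover have "md_sin \<kappa> t > 0" by (rule md_sin_pos) (use t D(2)[OF k] in auto)
      ultimately have d: "d > 0" by (simp add: d_def)
      have 1: "det3 Y0 A A' \<noteq> 0" using C(2) d by (simp add: A'E det3_simps)
      then have 2: "det3 Y0 A' A \<noteq> 0" by (simp add: det3_def cross3_def inner_vec_def sum_3 vector_3 algebra_simps)
      then have 3: "det3 Y0 A' B \<noteq> 0" using b2 by (simp add: BE det3_simps)
      have ne: "A' \<noteq> Y0" "A' \<noteq> - Y0" using 1 by (auto simp: det3_simps)
      have "dist (F A) (F A') = t" using generic[OF FG[OF A] FG[OF m(1) ne] 1] m(2) by simp
      moreover have "dist (F A') (F B) = \<delta> A' B" by (rule generic[OF FG[OF m(1) ne] FG[OF B] 3])
      moreover have "\<bar>\<delta> A' B - \<delta> A B\<bar> \<le> t"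
        using model_dist_triangle[OF A(1) m(1) B(1)] model_dist_triangle[OF m(1) A(1) B(1)] m(2) model_dist_commute[OF A(1) m(1)] by simp
      ultimately show ?thesis
        using dist_triangle[of "F A" "F B" "F A'"] dist_triangle[of "F A'" "F B" "F A"] by (simp add: dist_commute)
    qed
    have "\<bar>dist (F A) (F B) - \<delta> A B\<bar> \<le> 0 + \<epsilon>" if e: "\<epsilon> > 0" for \<epsilon>
    proof -
      have "min (\<epsilon> / 2) (\<delta> A C) > 0" using e D by simp
      from est[OF this] show ?thesis by simp
    qed
    then have "\<bar>dist (F A) (F B) - \<delta> A B\<bar> \<le> 0" by (rule field_le_epsilon)
    then show ?thesis by simp
  qed
  have isoY: "dist y0 (F A) = \<delta> Y0 A" if "A \<in> N" "A \<noteq> Y0" "A \<noteq> - Y0" for A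
    using FG[OF that] onseg_D(8) unfolding G_def by blast
  show ?thesis
  proof (rule that)
    fix A B assume AB: "A \<in> N" "B \<in> N" "A \<noteq> - Y0" "B \<noteq> - Y0"
    have FY: "F Y0 = y0" by (simp add: F_def)
    show "dist (F A) (F B) = \<delta> A B"
    proof (cases "A = Y0")
      case True
      then show ?thesis using isoY[of B] AB FY Y0N by (cases "B = Y0") auto
    next
      case False
      show ?thesis
      proof (cases "B = Y0")
        case True
        then show ?thesis using isoY[of A] AB FY False model_dist_commute[OF AB(1) Y0N] by (simp add: dist_commute)
      next
        case F: False
        show ?thesis by (rule iso) (use AB False F in auto)
      qed
    qed
  next
    fix A assume A: "A \<in> ?C"
    show "F A = f A"
    proof (cases "A = Y0")
      case True
      then show ?thesis by (simp add: F_def fY)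
    next
      case False
      have A': "A \<in> N" "A \<noteq> - Y0" using CN[OF A] A E_notin by auto
      obtain A0 where A0: "A0 \<in> ?C" "A0 \<noteq> Y0" "onseg y0 (f A0) (F A) Y0 A0 A" using FG[OF A'(1) False A'(2)] unfolding G_def by blast
      note aD = onseg_D[OF A0(3)]
      \<comment> \<open>\<open>f A\<close> continues the same geodesic from \<open>y0\<close>
        through \<open>f A0\<close> as \<open>F A\<close> does, to the same model point, so they
        agree by \<open>hinge_extend2\<close>.\<close>
      have o: "onseg y0 (f A0) (f A) Y0 A0 A"
        using aD f[OF Y0 A] f[OF A0(1) A] fY unfolding onseg_def btw_def by simp
      have "dist y0 (f A0) > 0" using model_dist_pos[OF Y0N aD(2)] A0(2) aD(6) by auto
      then have ne: "f A0 \<noteq> y0" by auto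
      have ok: "okp \<kappa> (\<delta> Y0 A + \<delta> A A + \<delta> A Y0)"
        using lt[OF A'] k model_dist_commute[OF Y0N A'(1)] A'(1) by (simp add: okp_def)
      have "dist (F A) (f A) \<le> \<delta> A A"
        by (rule hinge_extend2[OF A0(3) ne o ne _ ok]) (use aD(2) in simp)
      then show ?thesis using A' by simp
    qed
  qed
qed

end

section \<open>The region when the center lies outside the small triangle\<close>

context cbb_geodesic begin

lemma det3_diff:
  "det3 (u - v) b c = det3 u b c - det3 v b c" "det3 b (u - v) c = det3 b u c - det3 b v c"
  "det3 b c (u - v) = det3 b c u - det3 b c v"
  by (simp_all add: det3_def cross3_def inner_vec_def sum_3 vector_3 algebra_simps)

lemma xquad_near_legs:
  assumes q: "xquad x y z w X Y Z W" and z1: "onseg x z1 z X Z1 Z" "z1 \<noteq> x" and w1: "onseg x w1 w X W1 W" "w1 \<noteq> x"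
  shows "xquad x y z1 w1 X Y Z1 W1" "dist w1 z = \<delta> W1 Z"
proof -
  have "xquad x z1 w y X Z1 W Y" using xquad_side(3)[OF xquad_rotate[OF q] z1] .
  then have "xquad x w y z1 X W Y Z1" by (rule xquad_rotate)
  then have "xquad x w1 y z1 X W1 Y Z1" using xquad_side(3) w1 by blast
  then show "xquad x y z1 w1 X Y Z1 W1" by (rule xquad_rotate)
  show "dist w1 z = \<delta> W1 Z" using xquad_side(2)[OF xquad_rotate[OF xquad_rotate[OF q]] w1(1)] .
qed

lemma scaled_point: "k *\<^sub>R S = (v :: real^3) \<Longrightarrow> k \<noteq> 0 \<Longrightarrow> S = (1 / k) *\<^sub>R v"
proof -
  assume k: "k *\<^sub>R S = v" "k \<noteq> 0"
  have "S = (1 / k) *\<^sub>R (k *\<^sub>R S)" using k(2) by simp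
  then show "S = (1 / k) *\<^sub>R v" unfolding k(1) .
qed

text \<open>Writing \<open>Z\<close> and \<open>W\<close> by points \<open>Z1\<close>,
  \<open>W1\<close> at distance \<open>t\<close> from \<open>X\<close> subtracts
  \<open>lz * rz + lw * rw\<close> from the coefficient of \<open>X\<close>, which is the sine of
  \<open>t\<close>. For small \<open>t\<close> the difference is negative, and \<open>X\<close>
  becomes a positive combination of \<open>Y\<close>, \<open>Z1\<close>, \<open>W1\<close>.\<close>

lemma large_near_legs:
  assumes q: "xquad x y z w X Y Z W"
    and l: "ly > 0" "lz > 0" "lw > 0" and X: "X + ly *\<^sub>R Y + lz *\<^sub>R Z + lw *\<^sub>R W = 0"
  obtains z1 w1 Z1 W1 where "onseg x z1 z X Z1 Z" "z1 \<noteq> x" "z1 \<noteq> z" "onseg x w1 w X W1 W" "w1 \<noteq> x" "w1 \<noteq> w"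
    "smallquad x y z1 w1 X Y Z1 W1"
proof -
  note D = xquad_D[OF q]
  have pos: "dist x z > 0" "dist x w > 0" using xquad_pos[OF q] by auto
  have "((\<lambda>s. lz * md_sin \<kappa> (\<delta> X Z - s) - md_sin \<kappa> s) \<longlongrightarrow> lz * md_sin \<kappa> (\<delta> X Z - 0) - md_sin \<kappa> 0) (at_right 0)"
    by (intro tendsto_intros)
  moreover have Sz: "md_sin \<kappa> (\<delta> X Z) > 0" using md_sin_pos[OF pos(1) xquad_okp(2)[OF q]] D(6) by simp
  have Sw: "md_sin \<kappa> (\<delta> X W) > 0" using md_sin_pos[OF pos(2) xquad_okp(3)[OF q]] D(7) by simp
  have "0 < lz * md_sin \<kappa> (\<delta> X Z - 0) - md_sin \<kappa> 0" using l Sz by simp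
  ultimately have ev1: "eventually (\<lambda>s. 0 < lz * md_sin \<kappa> (\<delta> X Z - s) - md_sin \<kappa> s) (at_right 0)" by (rule order_tendstoD(1))
  have ev2: "eventually (\<lambda>s::real. s < min (dist x z) (dist x w)) (at_right 0)"
    by (rule order_tendstoD(2)[OF tendsto_ident_at]) (use pos in simp)
  have ev3: "eventually (\<lambda>s::real. s > 0) (at_right 0)" by (rule eventually_at_right_less)
  have "eventually (\<lambda>s. 0 < lz * md_sin \<kappa> (\<delta> X Z - s) - md_sin \<kappa> s \<and> s < min (dist x z) (dist x w) \<and> s > 0) (at_right 0)"
    using ev1 ev2 ev3 by eventually_elim auto
  then obtain t where t: "0 < lz * md_sin \<kappa> (\<delta> X Z - t) - md_sin \<kappa> t" "t < min (dist x z) (dist x w)" "t > 0"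
    using eventually_happens'[OF trivial_limit_at_right_real] by blast
  have tz: "t \<le> dist x z" "t \<le> dist x w" using t by auto
  obtain z1 Z1 where z1: "onseg x z1 z X Z1 Z" "dist x z1 = t"
    using onseg_at[OF D(1,3,6) xquad_okp(2)[OF q] less_imp_le[OF t(3)] tz(1)] by blast
  obtain w1 W1 where w1: "onseg x w1 w X W1 W" "dist x w1 = t"
    using onseg_at[OF D(1,4,7) xquad_okp(3)[OF q] less_imp_le[OF t(3)] tz(2)] by blast
  note zD = onseg_D[OF z1(1)] and wD = onseg_D[OF w1(1)]
  have ne: "z1 \<noteq> x" "w1 \<noteq> x" "z1 \<noteq> z" "w1 \<noteq> w" using z1(2) w1(2) t by auto
  have xq: "xquad x y z1 w1 X Y Z1 W1" by (rule xquad_near_legs[OF q z1(1) ne(1) w1(1) ne(2)])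
  define S where "S = md_sin \<kappa> t"
  have S: "S > 0" unfolding S_def by (rule md_sin_pos) (use t xquad_okp(2)[OF q] in force)+
  define sz sw where "sz = md_sin \<kappa> (\<delta> X Z)" and "sw = md_sin \<kappa> (\<delta> X W)"
  define rz rw where "rz = md_sin \<kappa> (\<delta> X Z - t)" and "rw = md_sin \<kappa> (\<delta> X W - t)"
  have Z1: "\<delta> Z1 Z = \<delta> X Z - t" "\<delta> X Z1 = t" "\<delta> W1 W = \<delta> X W - t" "\<delta> X W1 = t" using zD(5,6) z1(2) wD(5,6) w1(2) by auto
  have sZ: "S *\<^sub>R Z = sz *\<^sub>R Z1 - rz *\<^sub>R X" using seg_rel[OF zD(1,2,3,5)] unfolding Z1 by (simp add: S_def sz_def rz_def algebra_simps)
  have sW: "S *\<^sub>R W = sw *\<^sub>R W1 - rw *\<^sub>R X" using seg_rel[OF wD(1,2,3,5)] unfolding Z1 by (simp add: S_def sw_def rw_def algebra_simps)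
  have rw: "rw \<ge> 0" unfolding rw_def
    by (rule md_sin_nonneg) (use t D(7) xquad_okp(3)[OF q] in force)+
  have rz: "lz * rz - S > 0" using t(1) by (simp add: rz_def S_def)
  define c where "c = lz * rz + lw * rw - S"
  have "lw * rw \<ge> 0" using l rw by simp
  then have c: "c > 0" using rz by (simp add: c_def)
  have "S *\<^sub>R (X + ly *\<^sub>R Y + lz *\<^sub>R Z + lw *\<^sub>R W) = S *\<^sub>R X + (S * ly) *\<^sub>R Y + lz *\<^sub>R (S *\<^sub>R Z) + lw *\<^sub>R (S *\<^sub>R W)"
    by (simp add: algebra_simps)
  then have "c *\<^sub>R X = (S * ly) *\<^sub>R Y + (lz * sz) *\<^sub>R Z1 + (lw * sw) *\<^sub>R W1"
    unfolding X sZ sW c_def by (simp add: algebra_simps)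
  then have "X = (1 / c) *\<^sub>R ((S * ly) *\<^sub>R Y + (lz * sz) *\<^sub>R Z1 + (lw * sw) *\<^sub>R W1)" by (rule scaled_point) (use c in simp)
  then have "X = (S * ly / c) *\<^sub>R Y + (lz * sz / c) *\<^sub>R Z1 + (lw * sw / c) *\<^sub>R W1" by (simp add: scaleR_add_right)
  moreover have "S * ly / c > 0" "lz * sz / c > 0" "lw * sw / c > 0" using S l c Sz Sw by (simp_all add: sz_def sw_def)
  ultimately have "X \<in> op_cone Y Z1 W1" using D(1) unfolding op_cone_def by blast
  then have "smallquad x y z1 w1 X Y Z1 W1" using xq unfolding smallquad_def by blast
  then show ?thesis using that z1(1) w1(1) ne by blast
qed

text \<open>On a sphere the fourth point may lie outside the small triangle. Sliding \<open>y\<close> towards \<open>x\<close>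
  one meets a point \<open>y0\<close> for which \<open>y0, z, w\<close> lie on a great circle; then the point \<open>e\<close> of
  \<open>[z, w]\<close> antipodal to \<open>Y0\<close> makes the space a suspension.\<close>

lemma large_region:
  assumes q: "xquad x y z w X Y Z W" and k: "\<kappa> > 0"
    and l: "ly > 0" "lz > 0" "lw > 0" and X: "X + ly *\<^sub>R Y + lz *\<^sub>R Z + lw *\<^sub>R W = 0"
  obtains F E a b where "E \<in> N" "a > 0" "b > 0" "E = a *\<^sub>R Z + b *\<^sub>R W"
    "\<And>A B. A \<in> N \<Longrightarrow> B \<in> N \<Longrightarrow> A \<noteq> E \<Longrightarrow> B \<noteq> E \<Longrightarrow> dist (F A) (F B) = \<delta> A B"
    "F X = x" "F Y = y" "F Z = z" "F W = w"
proof -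
  note D = xquad_D[OF q]
  have detX: "det3 X Y Z \<noteq> 0" "det3 X Z W \<noteq> 0" "det3 X W Y \<noteq> 0" using D(14) xquad_det[OF q] by auto
  have Xe: "X = - (ly *\<^sub>R Y + lz *\<^sub>R Z + lw *\<^sub>R W)" using X by (simp add: eq_neg_iff_add_eq_0 algebra_simps)
  have det: "det3 Y Z W \<noteq> 0"
  proof
    assume "det3 Y Z W = 0"
    moreover have "det3 (X + ly *\<^sub>R Y + lz *\<^sub>R Z + lw *\<^sub>R W) Z W = det3 X Z W + ly * det3 Y Z W" by (simp add: det3_simps)
    ultimately have "det3 X Z W = 0" unfolding X by (simp add: det3_simps)
    then show False using detX by blast
  qed
  have v0: "lz *\<^sub>R Z + lw *\<^sub>R W \<noteq> 0"
  proof
    assume z: "lz *\<^sub>R Z + lw *\<^sub>R W = 0"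
    have "det3 Y (lz *\<^sub>R Z + lw *\<^sub>R W) W = lz * det3 Y Z W" by (simp add: det3_simps)
    then show False unfolding z using det l by (simp add: det3_simps)
  qed
  have "lz + lw > 0" using l by simp
  then obtain k0 E where k0: "k0 > 0" and EN: "E \<in> N" and E: "k0 *\<^sub>R E = lz *\<^sub>R Z + lw *\<^sub>R W"
    using hat_plane_normalize[OF D(3,4) less_imp_le[OF l(2)] less_imp_le[OF l(3)] _ v0] by blast
  have k00: "k0 \<noteq> 0" using k0 by simp
  have Eeq: "E = (lz / k0) *\<^sub>R Z + (lw / k0) *\<^sub>R W"
    using scaled_point[OF E k00] by (simp add: scaleR_add_right)
  \<comment> \<open>By the relation, \<open>- E\<close> is a positive combination of
    \<open>X\<close> and \<open>Y\<close>: the segments \<open>[Z, W]\<close> and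
    \<open>[X, Y]\<close> pass through antipodal points.\<close>
  define Y0 where "Y0 = - E"
  have Y0N: "Y0 \<in> N" using model_antipode(1)[OF k EN EN] by (simp add: Y0_def)
  have EY: "E = - Y0" by (simp add: Y0_def)
  have kY0: "k0 *\<^sub>R Y0 = X + ly *\<^sub>R Y"
    unfolding Y0_def scaleR_minus_right E Xe by (simp add: algebra_simps)
  have Y0eq: "Y0 = (1 / k0) *\<^sub>R X + (ly / k0) *\<^sub>R Y"
    using scaled_point[OF kY0 k00] by (simp add: scaleR_add_right)
  have dE: "\<delta> A E = PP \<kappa> - \<delta> A Y0" if "A \<in> N" for A using model_antipode(2)[OF k that Y0N] EY by simp
  have "\<delta> X Y = \<delta> X Y0 + \<delta> Y0 Y" by (rule cone_between[OF D(1) Y0N D(2) Y0eq]) (use k0 l in auto)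
  then obtain y0 where y0: "onseg x y0 y X Y0 Y" using onseg_exists[OF D(1,2) Y0N D(5)] by blast
  note yD = onseg_D[OF y0]
  have "k0 * det3 X Y0 Z = det3 X (k0 *\<^sub>R Y0) Z" by (simp add: det3_simps)
  also have "\<dots> = ly * det3 X Y Z" unfolding kY0 by (simp add: det3_simps)
  finally have dXY0Z: "det3 X Y0 Z \<noteq> 0" using detX(1) l by auto
  have "k0 * det3 X W Y0 = det3 X W (k0 *\<^sub>R Y0)" by (simp add: det3_simps)
  also have "\<dots> = ly * det3 X W Y" unfolding kY0 by (simp add: det3_simps)
  finally have dXWY0: "det3 X W Y0 \<noteq> 0" using detX(3) l by auto
  have "k0 * det3 Y0 Y Z = det3 (k0 *\<^sub>R Y0) Y Z" by (simp add: det3_simps)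
  also have "\<dots> = det3 X Y Z" unfolding kY0 by (simp add: det3_simps)
  finally have dY0YZ: "det3 Y0 Y Z \<noteq> 0" using detX(1) by auto
  have Y0ne: "Y0 \<noteq> X" "Y0 \<noteq> Y" "Y0 \<noteq> Z" "Y0 \<noteq> - Z" "Y0 \<noteq> -X"
    using dXY0Z dY0YZ by (auto simp: det3_simps)
  have y0x: "y0 \<noteq> x" using model_dist_pos[OF D(1) Y0N] Y0ne(1) yD(6) by auto
  have y0y: "dist y0 y > 0" using model_dist_pos[OF Y0N D(2)] Y0ne(2) yD(7) by auto
  have y0z: "dist y0 z = \<delta> Y0 Z" and y0w: "dist y0 w = \<delta> Y0 W" using xquad_side(1,2)[OF q y0] by auto
  have "\<delta> Z W = \<delta> Z E + \<delta> E W" by (rule cone_between[OF D(3) EN D(4) Eeq]) (use k0 l in auto)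
  then obtain e where e: "onseg z e w Z E W" using onseg_exists[OF D(3,4) EN D(9)] by blast
  note eD = onseg_D[OF e]
  have up: "dist y0 e \<le> PP \<kappa>"
    using dist_triangle[of y0 e z] y0z eD(6) dE[OF D(3)] model_dist_commute[OF D(3) Y0N] by (simp add: dist_commute)
  \<comment> \<open>The triangle \<open>z\<close>, \<open>w\<close>, \<open>y0\<close> has critical
    perimeter, since its model lies on a great circle. A point \<open>b\<close> of
    \<open>[y0, y]\<close> slightly off \<open>y0\<close> has an admissible triangle with
    \<open>z\<close> and \<open>w\<close>, and \<open>t\<close> tends to 0.\<close>
  have "PP \<kappa> \<le> dist y0 e + \<epsilon>" if \<epsilon>: "\<epsilon> > 0" for \<epsilon>
  proof -
    define t where "t = min (\<epsilon> / 2) (dist y0 y)"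
    have t: "0 < t" "t \<le> dist y0 y" "2 * t \<le> \<epsilon>" using \<epsilon> y0y by (auto simp: t_def min_def)
    have y0P: "\<kappa> > 0 \<Longrightarrow> dist y0 y < PP \<kappa>" using xquad_okp(1)[OF q] yD(9) zero_le_dist[of x y0] by linarith
    obtain b B where b: "onseg y0 b y Y0 B Y" "dist y0 b = t" using onseg_at[OF Y0N D(2) yD(7) y0P less_imp_le[OF t(1)] t(2)] by blast
    note bD = onseg_D[OF b(1)]
    have xb: "onseg x b y X B Y" using onseg_trans'(1)[OF y0 b(1)] .
    have bz: "dist b z = \<delta> B Z" "dist b w = \<delta> B W" using xquad_side(1,2)[OF q xb] by auto
    have BN: "B \<in> N" using bD by blast
    define s1 s2 s3 where "s1 = md_sin \<kappa> (\<delta> B Y)" and "s2 = md_sin \<kappa> (\<delta> Y0 B)" and "s3 = md_sin \<kappa> (\<delta> Y0 Y)"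
    have r: "s1 *\<^sub>R Y0 + s2 *\<^sub>R Y = s3 *\<^sub>R B" using seg_rel[OF bD(1,2,3,5)] by (simp add: s1_def s2_def s3_def)
    have s2: "s2 > 0" unfolding s2_def bD(6)[symmetric] b(2) by (rule md_sin_pos) (use t y0P[OF k] in auto)
    have "k0 * det3 Z W Y0 = - det3 Z W (lz *\<^sub>R Z + lw *\<^sub>R W)" unfolding E[symmetric] by (simp add: Y0_def det3_simps)
    then have z0: "det3 Z W Y0 = 0" using k0 by (simp add: det3_simps)
    have "s3 * det3 Z W B = det3 Z W (s1 *\<^sub>R Y0 + s2 *\<^sub>R Y)" unfolding r by (simp add: det3_simps)
    also have "\<dots> = s2 * det3 Z W Y" by (simp add: det3_simps z0)
    also have "det3 Z W Y = det3 Y Z W" by (rule det3_cyclic(1))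
    finally have dd: "det3 Z W B \<noteq> 0" using s2 det by auto
    have bz': "dist b z = \<delta> B Z" "dist w b = \<delta> W B" using bz model_dist_commute[OF BN D(4)] by (simp_all add: dist_commute)
    have "okp \<kappa> (\<delta> Z W + \<delta> W B + \<delta> B Z)" by (rule okp_independent[OF D(3,4) BN dd])
    then have ok: "okp \<kappa> (peri z w b)" using bz' D(9) by (simp add: peri_def)
    have "\<delta> E B \<le> dist e b"
      by (rule side_ge[OF e BN _ _ ok]) (use bz' bz(1) model_dist_commute[OF D(3) BN] in \<open>simp_all add: dist_commute\<close>)
    moreover have "\<delta> E B = PP \<kappa> - t"
      using dE[OF BN] model_dist_commute[OF EN BN] model_dist_commute[OF BN Y0N] bD(6) b(2) by simp
    moreover have "dist e b \<le> dist y0 e + t" using dist_triangle[of e b y0] b(2) by (simp add: dist_commute)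
    ultimately show ?thesis using t(3) by simp
  qed
  then have "PP \<kappa> \<le> dist y0 e" by (rule field_le_epsilon)
  then have ye: "dist y0 e = PP \<kappa>" using up by simp
  obtain z1 w1 Z1 W1 where z1: "onseg x z1 z X Z1 Z" "z1 \<noteq> x" "z1 \<noteq> z" and w1: "onseg x w1 w X W1 W" "w1 \<noteq> x" "w1 \<noteq> w"
    and sq: "smallquad x y z1 w1 X Y Z1 W1" by (rule large_near_legs[OF q l X])
  let ?C = "op_cone Y Z1 W1"
  have xq: "xquad x y z1 w1 X Y Z1 W1" and XC: "X \<in> ?C" using sq unfolding smallquad_def by auto
  note zD = onseg_D[OF z1(1)] and wD = onseg_D[OF w1(1)]
  have det1: "det3 Y Z1 W1 \<noteq> 0" by (rule smallquad_det[OF sq])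
  obtain n where n: "n \<bullet> Y = 1" "n \<bullet> Z1 = 1" "n \<bullet> W1 = 1" by (rule basis_functional[OF det1])
  have n': "n \<bullet> Y > 0" "n \<bullet> Z1 > 0" "n \<bullet> W1 > 0" using n by auto
  have nC: "n \<bullet> A > 0" if "A \<in> ?C" for A using op_cone_functional[OF that n] .
  have CN: "A \<in> N" if "A \<in> ?C" for A using that unfolding op_cone_def by blast
  have Y0C: "Y0 \<in> ?C"
  proof -
    obtain a b c where abc: "a > 0" "b > 0" "c > 0" "X = a *\<^sub>R Y + b *\<^sub>R Z1 + c *\<^sub>R W1" using XC unfolding op_cone_def by blast
    have "Y0 = (1 / k0) *\<^sub>R (a *\<^sub>R Y + b *\<^sub>R Z1 + c *\<^sub>R W1) + (ly / k0) *\<^sub>R Y" using Y0eq abc(4) by simp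
    then have "Y0 = (a / k0 + ly / k0) *\<^sub>R Y + (b / k0) *\<^sub>R Z1 + (c / k0) *\<^sub>R W1" by (simp add: algebra_simps)
    moreover have "a / k0 + ly / k0 > 0" "b / k0 > 0" "c / k0 > 0" using abc k0 l by (simp_all add: add_pos_pos)
    ultimately show ?thesis using Y0N unfolding op_cone_def by blast
  qed
  obtain f where f: "\<And>P. P \<in> ?C \<Longrightarrow> good x y z1 w1 X Y Z1 W1 (f P) P"
    "\<And>P Q. P \<in> ?C \<Longrightarrow> Q \<in> ?C \<Longrightarrow> dist (f P) (f Q) = \<delta> P Q" using small_region[OF sq] by blast
  have above_f: "above x y z1 w1 X Y Z1 W1 (f P) P" if "P \<in> ?C" for P
    by (rule good_above[OF xq f(1)[OF that] nC[OF XC] n' nC[OF that]])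
  have fX: "f X = x" using f(1)[OF XC] D(1) unfolding good_def by simp
  have y0x': "dist y0 x = \<delta> Y0 X" using yD(6) model_dist_commute[OF D(1) Y0N] by (simp add: dist_commute)
  have y01: "dist y0 z1 = \<delta> Y0 Z1" "dist y0 w1 = \<delta> Y0 W1" using xquad_side(1,2)[OF xq y0] by auto
  have "good x y z1 w1 X Y Z1 W1 y0 Y0" unfolding good_def using Y0N y0x' yD(7) y01 by blast
  then have above_y0: "above x y z1 w1 X Y Z1 W1 y0 Y0" using good_above[OF xq _ nC[OF XC] n' nC[OF Y0C]] by blast
  have fY0: "f Y0 = y0" by (rule above_unique[OF xq above_f[OF Y0C] above_y0])
  have okxyz: "okp \<kappa> (peri x y z)" by (rule D(11))
  have ok3: "okp \<kappa> (peri y0 z x)" "okp \<kappa> (peri y0 x y)" "okp \<kappa> (peri y0 z y)"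
    using okp_mono[OF okxyz] onseg_peri_le[OF y0, of z] onseg_peri_le[OF onseg_commute[OF y0], of z] peri_ge[of x y z] yD(9)
    by (simp_all add: peri_def dist_commute algebra_simps)
  have zx: "dist z x = \<delta> Z X" "dist z y = \<delta> Z Y" using D(6,8) model_dist_commute[OF D(1,3)] model_dist_commute[OF D(2,3)] by (simp_all add: dist_commute)
  have rY0: "0 *\<^sub>R Z + 1 *\<^sub>R X + ly *\<^sub>R Y = k0 *\<^sub>R Y0" using kY0 by simp
  \<comment> \<open>The segment \<open>[y0, z]\<close> has to start inside the image of
    \<open>f\<close>. Its point \<open>zt\<close> satisfies the lower bounds of \<open>above\<close>
    at \<open>Zt\<close>, hence equals \<open>f Zt\<close> by \<open>above_unique\<close>; closeness
    to \<open>y0\<close> keeps its perimeters with \<open>x\<close> admissible.\<close>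
  have zt_ex: "\<exists>Zt\<in>?C. Zt \<noteq> Y0 \<and> onseg y0 (f Zt) z Y0 Zt Z"
  proof -
    have oka: "okp \<kappa> (peri x y0 y)" "okp \<kappa> (peri x y0 z1)" "okp \<kappa> (peri x y0 w1)" using above_y0 unfolding above_def by auto
    obtain e1 where e1: "e1 > 0" "\<And>u. u \<le> peri x y0 y + e1 \<Longrightarrow> okp \<kappa> u" using okp_slack[OF oka(1)] by blast
    obtain e2 where e2: "e2 > 0" "\<And>u. u \<le> peri x y0 z1 + e2 \<Longrightarrow> okp \<kappa> u" using okp_slack[OF oka(2)] by blast
    obtain e3 where e3: "e3 > 0" "\<And>u. u \<le> peri x y0 w1 + e3 \<Longrightarrow> okp \<kappa> u" using okp_slack[OF oka(3)] by blast
    define \<epsilon> where "\<epsilon> = min (e1 / 2) (min (e2 / 2) (e3 / 2))"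
    have \<epsilon>: "\<epsilon> > 0" "2 * \<epsilon> \<le> e1" "2 * \<epsilon> \<le> e2" "2 * \<epsilon> \<le> e3" using e1(1) e2(1) e3(1) by (auto simp: \<epsilon>_def min_def)
    have ZY: "Z \<noteq> - Y0" using Y0ne(4) by auto
    have DZ: "0 < \<delta> Y0 Z" "\<kappa> > 0 \<Longrightarrow> \<delta> Y0 Z < PP \<kappa>"
      using model_dist_pos[OF Y0N D(3)] model_dist_less_PP[OF Y0N D(3) ZY] Y0ne(3) by auto
    obtain t where t: "0 < t" "t \<le> \<epsilon>" "t < \<delta> Y0 Z" "mpt \<kappa> Y0 Z t \<in> ?C"
      by (rule mpt_eventually_cone[OF Y0C D(3) DZ det1 \<epsilon>(1)])
    define Zt where "Zt = mpt \<kappa> Y0 Z t"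
    have ZtC: "Zt \<in> ?C" using t by (simp add: Zt_def)
    obtain zt where zt: "dist y0 zt = t" "dist zt z = dist y0 z - t" using geodesic[of t y0 z] t y0z by auto
    have o: "onseg y0 zt z Y0 Zt Z"
      unfolding Zt_def by (rule onseg_mpt[OF y0z Y0N D(3) DZ]) (use t zt y0z in auto)
    note oD = onseg_D[OF o]
    have ZtN: "Zt \<in> N" using oD by blast
    have ztx: "dist zt x = \<delta> Zt X" "dist zt y = \<delta> Zt Y"
      using tripod_side[OF Y0N D(3,1,2) y0z y0x' yD(7) zx(1) D(5) zx(2) rY0 order_refl zero_less_one l(1) ok3 o] by auto
    have xzt: "dist x zt = \<delta> X Zt" using ztx(1) model_dist_commute[OF D(1) ZtN] by (simp add: dist_commute)
    have okz: "okp \<kappa> (peri x z zt)"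
      using okp_mono[OF ok3(1)] onseg_peri_le[OF onseg_commute[OF o], of x] by (simp add: peri_def dist_commute algebra_simps)
    have g1: "\<delta> Z1 Zt \<le> dist z1 zt"
      by (rule side_ge[OF z1(1) ZtN _ _ okz]) (use xzt oD(7) model_dist_commute[OF ZtN D(3)] in \<open>simp_all add: dist_commute\<close>)
    have w1z: "dist w1 z = \<delta> W1 Z" by (rule xquad_near_legs(2)[OF q z1(1,2) w1(1,2)])
    have dW: "det3 Y0 Z W1 \<noteq> 0"
    proof -
      define s1 s2 s3 where "s1 = md_sin \<kappa> (\<delta> W1 W)" and "s2 = md_sin \<kappa> (\<delta> X W1)" and "s3 = md_sin \<kappa> (\<delta> X W)"
      have r: "s1 *\<^sub>R X + s2 *\<^sub>R W = s3 *\<^sub>R W1" using seg_rel[OF wD(1,2,3,5)] by (simp add: s1_def s2_def s3_def)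
      have s1: "s1 > 0" unfolding s1_def wD(7)[symmetric]
      proof (rule md_sin_pos)
        show "0 < dist w1 w" using w1(3) by simp
        show "dist w1 w < PP \<kappa>" using wD(9) xquad_okp(3)[OF q k] zero_le_dist[of x w1] by linarith
      qed
      have "k0 * det3 Y0 Z W = - det3 (lz *\<^sub>R Z + lw *\<^sub>R W) Z W" unfolding E[symmetric] by (simp add: Y0_def det3_simps)
      then have z0: "det3 Y0 Z W = 0" using k0 by (simp add: det3_simps)
      have "s3 * det3 Y0 Z W1 = det3 Y0 Z (s1 *\<^sub>R X + s2 *\<^sub>R W)" unfolding r by (simp add: det3_simps)
      also have "\<dots> = s1 * det3 Y0 Z X" by (simp add: det3_simps z0)
      also have "det3 Y0 Z X = det3 X Y0 Z" by (rule det3_cyclic(1))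
      finally show ?thesis using s1 dXY0Z by auto
    qed
    have w1y0: "dist w1 y0 = \<delta> W1 Y0" using y01(2) model_dist_commute[OF Y0N wD(2)] by (simp add: dist_commute)
    have zw1: "dist z w1 = \<delta> Z W1" using w1z model_dist_commute[OF D(3) wD(2)] by (simp add: dist_commute)
    have okw: "okp \<kappa> (peri y0 z w1)"
      using okp_independent[OF Y0N D(3) wD(2) dW] y0z zw1 w1y0 by (simp add: peri_def)
    have g2: "\<delta> Zt W1 \<le> dist zt w1"
      by (rule side_ge[OF o wD(2) _ _ okw]) (simp_all add: y01 zw1)
    have per: "peri x zt c \<le> peri x y0 c + 2 * t" for c
      using peri_lipschitz[of zt x c y0] zt(1) by (simp add: peri_def dist_commute algebra_simps)
    have okt: "okp \<kappa> (peri x zt y)" "okp \<kappa> (peri x zt z1)" "okp \<kappa> (peri x zt w1)"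
      by (rule e1(2), use per[of y] t(2) \<epsilon> in linarith) (rule e2(2), use per[of z1] t(2) \<epsilon> in linarith,
          rule e3(2), use per[of w1] t(2) \<epsilon> in linarith)
    have "above x y z1 w1 X Y Z1 W1 zt Zt"
      unfolding above_def using ZtN xzt ztx g1 g2 okt model_dist_commute[OF ZtN zD(2)] by (simp add: dist_commute)
    then have "f Zt = zt" using above_unique[OF xq above_f[OF ZtC]] by blast
    moreover have "Zt \<noteq> Y0" using oD(6) zt(1) t(1) Y0N by auto
    ultimately show ?thesis using ZtC o by auto
  qed
  then obtain Zt where Zt: "Zt \<in> ?C" "Zt \<noteq> Y0" "onseg y0 (f Zt) z Y0 Zt Z" by blast
  have dZE: "\<delta> Z E > 0"
  proof (rule model_dist_pos[OF D(3) EN])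
    show "Z \<noteq> E" using Y0ne(4) EY by auto
  qed
  have ye': "onseg y0 z e Y0 Z E"
    using Y0N D(3) EN y0z eD(6) ye dE[OF Y0N] dE[OF D(3)] model_dist_commute[OF Y0N D(3)]
    unfolding onseg_def btw_def by simp
  \<comment> \<open>The hinge at \<open>y0\<close> cannot be opened up to \<open>e\<close>, as the
    triangle \<open>Y0\<close>, \<open>E\<close>, \<open>A0\<close> has critical perimeter. It is
    opened up to a point \<open>e'\<close> of \<open>[z, e]\<close> close to \<open>e\<close>, with
    an error of \<open>2 * \<eta>\<close>.\<close>
  have feg: "dist e (f A0) \<le> PP \<kappa> - \<delta> Y0 A0" if A0: "A0 \<in> ?C" "det3 Y0 Z A0 \<noteq> 0" for A0
  proof -
    have A0N: "A0 \<in> N" using CN[OF A0(1)] .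
    have "dist e (f A0) \<le> PP \<kappa> - \<delta> Y0 A0 + \<epsilon>" if \<epsilon>: "\<epsilon> > 0" for \<epsilon>
    proof -
      define \<eta> where "\<eta> = min (\<epsilon> / 2) (\<delta> Z E)"
      have \<eta>: "0 < \<eta>" "\<eta> \<le> \<delta> Z E" "2 * \<eta> \<le> \<epsilon>" using \<epsilon> dZE by (auto simp: \<eta>_def min_def)
      have ezd: "dist e z = \<delta> E Z" "\<delta> E Z = \<delta> Z E" using eD(6) model_dist_commute[OF D(3) EN] by (simp_all add: dist_commute)
      have \<eta>z: "\<eta> \<le> dist e z" unfolding ezd by (rule \<eta>(2))
      have ezP: "dist e z < PP \<kappa>" unfolding ezd dE[OF D(3)] using model_dist_pos[OF D(3) Y0N] Y0ne(3) by auto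
      obtain e' E' where e': "onseg e e' z E E' Z" "dist e e' = \<eta>"
        using onseg_at[OF EN D(3) ezd(1) ezP less_imp_le[OF \<eta>(1)] \<eta>z] by blast
      have ze: "onseg z e' e Z E' E" by (rule onseg_commute[OF e'(1)])
      note zeD = onseg_D[OF ze]
      have y0e: "onseg y0 e' e Y0 E' E" "onseg y0 z e' Y0 Z E'" using onseg_trans'[OF ye' ze] by auto
      have yt: "onseg y0 (f Zt) e' Y0 Zt E'" using onseg_trans[OF y0e(2) Zt(3)] by blast
      have ne: "f Zt \<noteq> y0" using onseg_D(6)[OF Zt(3)] model_dist_pos[OF Y0N CN[OF Zt(1)]] Zt(2) by auto
      have ya: "dist y0 (f A0) = \<delta> Y0 A0" using f(2)[OF Y0C A0(1)] fY0 by simp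
      have E'e: "\<delta> E' E = \<eta>" using zeD(7) e'(2) by (simp add: dist_commute)
      define s1 s2 s3 where "s1 = md_sin \<kappa> (\<delta> E' E)" and "s2 = md_sin \<kappa> (\<delta> Z E')" and "s3 = md_sin \<kappa> (\<delta> Z E)"
      have r: "s1 *\<^sub>R Z + s2 *\<^sub>R E = s3 *\<^sub>R E'" using seg_rel[OF zeD(1,2,3,5)] by (simp add: s1_def s2_def s3_def)
      have s1: "s1 > 0" unfolding s1_def E'e by (rule md_sin_pos) (use \<eta> ezP ezd in auto)
      have "s3 * det3 Y0 E' A0 = det3 Y0 (s1 *\<^sub>R Z + s2 *\<^sub>R E) A0" unfolding r by (simp add: det3_simps)
      also have "\<dots> = s1 * det3 Y0 Z A0" by (simp add: EY det3_simps det3_diff)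
      finally have dd: "det3 Y0 E' A0 \<noteq> 0" using s1 A0(2) by auto
      have "dist e' (f A0) \<le> \<delta> E' A0"
        by (rule hinge_extend[OF yt ne A0N ya _ okp_independent[OF Y0N zeD(2) A0N dd]]) (simp add: f(2)[OF Zt(1) A0(1)])
      moreover have "\<delta> E' A0 \<le> \<delta> E' E + \<delta> E A0" by (rule model_dist_triangle[OF zeD(2) EN A0N])
      moreover have "\<delta> E A0 = PP \<kappa> - \<delta> Y0 A0" using dE[OF A0N] model_dist_commute[OF EN A0N] model_dist_commute[OF Y0N A0N] by simp
      moreover have "dist e (f A0) \<le> \<eta> + dist e' (f A0)" using dist_triangle[of e "f A0" e'] e'(2) by simp
      ultimately show ?thesis using E'e \<eta>(3) by simp
    qed
    then show ?thesis by (rule field_le_epsilon)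
  qed
  have fe: "dist (f A0) e = PP \<kappa> - \<delta> Y0 A0" if A0: "A0 \<in> ?C" for A0
  proof -
    have A0N: "A0 \<in> N" using CN[OF A0] .
    have "dist e (f A0) \<le> PP \<kappa> - \<delta> Y0 A0"
    proof (cases "det3 Y0 Z A0 = 0")
      case False
      then show ?thesis using feg A0 by blast
    next
      case True
      have dX: "det3 Y0 Z X \<noteq> 0" using dXY0Z by (subst det3_cyclic(1))
      then have AX: "A0 \<noteq> X" using True by auto
      have "X \<noteq> - A0" using nC[OF A0] nC[OF XC] by auto
      then have P: "0 < \<delta> A0 X" "\<kappa> > 0 \<Longrightarrow> \<delta> A0 X < PP \<kappa>"
        using model_dist_pos[OF A0N D(1) AX] model_dist_less_PP[OF A0N D(1)] by auto
      have "dist e (f A0) \<le> PP \<kappa> - \<delta> Y0 A0 + \<epsilon>" if \<epsilon>: "\<epsilon> > 0" for \<epsilon>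
      proof -
        define t where "t = min (\<epsilon> / 2) (\<delta> A0 X / 2)"
        have t: "0 < t" "t < \<delta> A0 X" "2 * t \<le> \<epsilon>" using \<epsilon> P(1) by (auto simp: t_def min_def)
        \<comment> \<open>Moved towards \<open>X\<close>, the point \<open>A0\<close> leaves the
          great circle through \<open>Y0\<close> and \<open>Z\<close>.\<close>
        define A' where "A' = mpt \<kappa> A0 X t"
        have A': "A' \<in> ?C" unfolding A'_def by (rule op_cone_mpt[OF A0 XC P less_imp_le[OF t(1)] t(2)])
        have dA: "\<delta> A0 A' = t" unfolding A'_def by (rule mpt_props(2)[OF A0N D(1) P less_imp_le[OF t(1)] less_imp_le[OF t(2)]])
        have "md_sin \<kappa> (\<delta> A0 X) > 0" using P by (rule md_sin_pos)
        moreover have "md_sin \<kappa> t > 0" by (rule md_sin_pos) (use t P(2) in auto)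
        ultimately have "det3 Y0 Z A' \<noteq> 0" using dX True by (simp add: A'_def mpt_def det3_simps)
        then have "dist e (f A') \<le> PP \<kappa> - \<delta> Y0 A'" using feg A' by blast
        moreover have "dist (f A') (f A0) = t" using f(2)[OF A0 A'] dA by (simp add: dist_commute)
        moreover have "\<delta> Y0 A0 \<le> \<delta> Y0 A' + t"
          using model_dist_triangle[OF Y0N CN[OF A'] A0N] dA model_dist_commute[OF A0N CN[OF A']] by simp
        ultimately show ?thesis using dist_triangle[of e "f A0" "f A'"] t(3) by simp
      qed
      then show ?thesis by (rule field_le_epsilon)
    qed
    moreover have "dist e (f A0) \<ge> PP \<kappa> - \<delta> Y0 A0"
      using dist_triangle[of y0 e "f A0"] ye f(2)[OF Y0C A0] fY0 by (simp add: dist_commute)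
    ultimately show ?thesis by (simp add: dist_commute)
  qed
  obtain F where F: "\<And>A B. A \<in> N \<Longrightarrow> B \<in> N \<Longrightarrow> A \<noteq> - Y0 \<Longrightarrow> B \<noteq> - Y0 \<Longrightarrow> dist (F A) (F B) = \<delta> A B"
    "\<And>A. A \<in> ?C \<Longrightarrow> F A = f A"
    using suspension_extension[OF k det1 Y0C f(2) fY0 ye fe] by blast
  have FX: "F X = x" using F(2)[OF XC] fX by simp
  \<comment> \<open>The small region reaches only the beginning of the legs. Both \<open>v\<close>
    and \<open>F V\<close> continue the geodesic from \<open>x\<close> through \<open>f V2\<close>
    to the same model point \<open>V\<close>, so they agree.\<close>
  have ext: "F V = v"
    if V: "V \<in> N" "V \<noteq> - Y0" and o: "onseg x v1 v X V1 V" "v1 \<noteq> x" and V2: "V2 \<in> ?C" "V2 \<noteq> X"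
      "\<delta> X V1 = \<delta> X V2 + \<delta> V2 V1" "dist (f V2) v1 = \<delta> V2 V1" "\<kappa> > 0 \<Longrightarrow> dist x v < PP \<kappa>" for V v v1 V1 V2
  proof -
    have V2N: "V2 \<in> N" using CN[OF V2(1)] .
    note vD = onseg_D[OF o(1)]
    have xf: "dist x (f V2) = \<delta> X V2" using f(2)[OF XC V2(1)] fX by simp
    have "onseg x (f V2) v1 X V2 V1" using D(1) V2N vD V2 xf unfolding onseg_def btw_def by simp
    then have o2: "onseg x (f V2) v X V2 V" using onseg_trans[OF o(1)] by blast
    note o2D = onseg_D[OF o2]
    have V2ne: "V2 \<noteq> - Y0" "X \<noteq> - Y0" using nC[OF V2(1)] nC[OF Y0C] nC[OF XC] by auto
    have o3: "onseg x (f V2) (F V) X V2 V"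
      using F(1)[OF D(1) V(1) V2ne(2) V(2)] F(1)[OF V2N V(1) V2ne(1) V(2)] F(2)[OF V2(1)] FX o2D xf
      unfolding onseg_def btw_def by simp
    have ne: "f V2 \<noteq> x" using xf model_dist_pos[OF D(1) V2N] V2(2) by auto
    have ok: "okp \<kappa> (\<delta> X V + \<delta> V V + \<delta> V X)"
      using V2(5) k vD(8) model_dist_commute[OF D(1) V(1)] V(1) by (simp add: okp_def)
    have "dist v (F V) \<le> \<delta> V V" by (rule hinge_extend2[OF o2 ne o3 ne _ ok]) (simp add: V2N)
    then show ?thesis using V by simp
  qed
  have mid: "\<exists>V2\<in>?C. V2 \<noteq> X \<and> \<delta> X V1 = \<delta> X V2 + \<delta> V2 V1" if V: "V1 \<in> N" "V1 \<noteq> X" "\<kappa> > 0 \<Longrightarrow> \<delta> X V1 < PP \<kappa>" for V1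
  proof -
    have P: "0 < \<delta> X V1" using model_dist_pos[OF D(1) V(1)] V(2) by auto
    obtain t where t: "0 < t" "t \<le> 1" "t < \<delta> X V1" "mpt \<kappa> X V1 t \<in> ?C"
      by (rule mpt_eventually_cone[OF XC V(1) P V(3) det1 zero_less_one])
    note m = mpt_props(2,3)[OF D(1) V(1) P V(3) less_imp_le[OF t(1)] less_imp_le[OF t(3)]]
    have "mpt \<kappa> X V1 t \<noteq> X" using m(1) t(1) D(1) by auto
    then show ?thesis using t m by (intro bexI[of _ "mpt \<kappa> X V1 t"]) auto
  qed
  have FY: "F Y = y"
  proof -
    have ne: "y \<noteq> x" "Y \<noteq> X" using xquad_pos(1)[OF q] D(5) D(1) by auto
    obtain V2 where V2: "V2 \<in> ?C" "V2 \<noteq> X" "\<delta> X Y = \<delta> X V2 + \<delta> V2 Y" using mid[OF D(2) ne(2)] xquad_okp(1)[OF q] unfolding D(5) by blast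
    have o: "onseg x y y X Y Y" using D unfolding onseg_def btw_def by simp
    have "Y \<noteq> - Y0" using dY0YZ by (auto simp: det3_simps)
    then show ?thesis using ext[OF D(2) _ o ne(1) V2] f(1)[OF V2(1)] xquad_okp(1)[OF q] unfolding good_def by blast
  qed
  have FZ: "F Z = z"
  proof -
    have ne: "Z1 \<noteq> X" using z1(2) zD(6) D(1) by auto
    have "\<kappa> > 0 \<Longrightarrow> \<delta> X Z1 < PP \<kappa>" using xquad_okp(2)[OF q] zD(6,9) zero_le_dist[of z1 z] by linarith
    then obtain V2 where V2: "V2 \<in> ?C" "V2 \<noteq> X" "\<delta> X Z1 = \<delta> X V2 + \<delta> V2 Z1" using mid[OF zD(2) ne] by blast
    have "Z \<noteq> - Y0" using Y0ne(4) by auto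
    then show ?thesis using ext[OF D(3) _ z1(1,2) V2] f(1)[OF V2(1)] xquad_okp(2)[OF q] unfolding good_def by blast
  qed
  have FW: "F W = w"
  proof -
    have ne: "W1 \<noteq> X" using w1(2) wD(6) D(1) by auto
    have "\<kappa> > 0 \<Longrightarrow> \<delta> X W1 < PP \<kappa>" using xquad_okp(3)[OF q] wD(6,9) zero_le_dist[of w1 w] by linarith
    then obtain V2 where V2: "V2 \<in> ?C" "V2 \<noteq> X" "\<delta> X W1 = \<delta> X V2 + \<delta> V2 W1" using mid[OF wD(2) ne] by blast
    have "W \<noteq> - Y0" using dXWY0 by (auto simp: det3_simps)
    then show ?thesis using ext[OF D(4) _ w1(1,2) V2] f(1)[OF V2(1)] xquad_okp(3)[OF q] unfolding good_def by blast
  qed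
  show ?thesis
    by (rule that[OF EN _ _ Eeq F(1) FX FY FZ FW]) (use k0 l EY in auto)
qed

end

section \<open>Ultrapowers of metric spaces\<close>

definition nat_ultrafilter :: "nat filter \<Rightarrow> bool" where
  "nat_ultrafilter U \<longleftrightarrow> U \<noteq> bot \<and> U \<le> sequentially \<and> (\<forall>P. eventually P U \<or> eventually (\<lambda>n. \<not> P n) U)"

text \<open>Zorn's lemma for the reversed order gives a minimal proper filter below
  \<open>sequentially\<close>. The infimum of a chain is proper because each of its events is an
  event of a member; by minimality the restriction to an event is either improper or the filter
  itself.\<close>

lemma nat_ultrafilter_exists: "\<exists>U. nat_ultrafilter U"
proof -
  define A where "A = {F :: nat filter. F \<noteq> bot \<and> F \<le> sequentially}"
  have "\<exists>m\<in>A. \<forall>a\<in>A. a \<le> m \<longrightarrow> a = m"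
  proof (rule predicate_Zorn)
    show "partial_order_on A (relation_of (\<lambda>x y. y \<le> x) A)"
      by (rule partial_order_on_relation_ofI) auto
    fix C assume C: "C \<in> Chains (relation_of (\<lambda>x y. y \<le> x) A)"
    have CA: "C \<subseteq> A" and lin: "F \<in> C \<Longrightarrow> G \<in> C \<Longrightarrow> F \<le> G \<or> G \<le> F" for F G
      using C unfolding Chains_def relation_of_def by auto
    show "\<exists>u\<in>A. \<forall>a\<in>C. u \<le> a"
    proof (cases "C = {}")
      case True
      have "sequentially \<in> A" by (simp add: A_def)
      then show ?thesis using True by blast
    next
      case False
      have ev: "eventually P (Inf C) \<longleftrightarrow> (\<exists>b\<in>C. eventually P b)" for P
      proof (rule eventually_Inf_base[OF False])
        fix F G assume "F \<in> C" "G \<in> C"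
        then show "\<exists>x\<in>C. x \<le> inf F G" using lin[of F G] by (metis inf.absorb1 inf.absorb2 order_refl)
      qed
      have "Inf C \<noteq> bot" using ev[of "\<lambda>_. False"] CA unfolding A_def by (auto simp: trivial_limit_def)
      moreover have "Inf C \<le> sequentially" using False CA unfolding A_def by (auto intro: Inf_lower2)
      ultimately have "Inf C \<in> A" by (simp add: A_def)
      then show ?thesis by (meson Inf_lower)
    qed
  qed
  then obtain U where U: "U \<noteq> bot" "U \<le> sequentially" and max: "\<And>F. F \<noteq> bot \<Longrightarrow> F \<le> sequentially \<Longrightarrow> F \<le> U \<Longrightarrow> F = U"
    unfolding A_def by auto
  have "eventually P U \<or> eventually (\<lambda>n. \<not> P n) U" for P
  proof (rule disjCI)
    assume n: "\<not> eventually (\<lambda>n. \<not> P n) U"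
    let ?F = "inf U (principal {n. P n})"
    have "?F \<noteq> bot" using n by (simp add: trivial_limit_def eventually_inf_principal)
    then have "?F = U" by (rule max) (use U in \<open>auto intro: le_infI1\<close>)
    moreover have "eventually P ?F" by (simp add: eventually_inf_principal)
    ultimately show "eventually P U" by simp
  qed
  then show ?thesis using U unfolding nat_ultrafilter_def by blast
qed

definition ultra :: "nat filter" where "ultra = (SOME U. nat_ultrafilter U)"

lemma ultra: "ultra \<noteq> bot" "ultra \<le> sequentially" "eventually P ultra \<or> eventually (\<lambda>n. \<not> P n) ultra"
proof -
  have "nat_ultrafilter ultra" unfolding ultra_def by (rule someI_ex[OF nat_ultrafilter_exists])
  then show "ultra \<noteq> bot" "ultra \<le> sequentially" "eventually P ultra \<or> eventually (\<lambda>n. \<not> P n) ultra"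
    unfolding nat_ultrafilter_def by blast+
qed

text \<open>Compactness gives a cluster point. An ultrafilter without the preimage of a
  neighbourhood contains its complement, so the cluster point is a limit.\<close>

lemma ultra_convergent:
  fixes f :: "nat \<Rightarrow> real"
  assumes "bounded (range f)"
  shows "\<exists>l. (f \<longlongrightarrow> l) ultra"
proof -
  let ?K = "closure (range f)"
  have "compact ?K" using assms by (simp add: compact_closure)
  moreover have "filtermap f ultra \<noteq> bot" using ultra(1) by (simp add: filtermap_bot_iff)
  moreover have "eventually (\<lambda>x. x \<in> ?K) (filtermap f ultra)"
    using closure_subset[of "range f"] by (auto simp: eventually_filtermap intro!: always_eventually)
  ultimately obtain l where l: "inf (nhds l) (filtermap f ultra) \<noteq> bot" unfolding compact_filter by blast
  have "(f \<longlongrightarrow> l) ultra"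
  proof (rule topological_tendstoI)
    fix S assume S: "open S" "l \<in> S"
    show "eventually (\<lambda>n. f n \<in> S) ultra"
    proof (rule ccontr)
      assume "\<not> ?thesis"
      then have "eventually (\<lambda>n. f n \<notin> S) ultra" using ultra(3)[of "\<lambda>n. f n \<in> S"] by blast
      then have "eventually (\<lambda>x. x \<notin> S) (filtermap f ultra)" by (simp add: eventually_filtermap)
      moreover have "eventually (\<lambda>x. x \<in> S) (nhds l)" using S by (rule eventually_nhds_in_open)
      ultimately have "eventually (\<lambda>x. False) (inf (nhds l) (filtermap f ultra))"
        unfolding eventually_inf by blast
      then show False using l by (simp add: trivial_limit_def)
    qed
  qed
  then show ?thesis by blast
qed

lemma bounded_dist_range:
  fixes s t :: "nat \<Rightarrow> 'a::metric_space"
  assumes "bounded (range s)" "bounded (range t)"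
  shows "bounded (range (\<lambda>n. dist (s n) (t n)))"
proof -
  obtain a B where a: "\<And>n. dist a (s n) \<le> B" using assms(1) unfolding bounded_def by auto
  obtain C where C: "\<And>n. dist a (t n) \<le> C" using assms(2) unfolding bounded_any_center[where a = a] by auto
  have "\<bar>dist (s n) (t n)\<bar> \<le> B + C" for n using dist_triangle3[of "s n" "t n" a] a[of n] C[of n] by simp
  then show ?thesis unfolding bounded_iff by auto
qed

\<comment> \<open>A partial quotient: the relation is reflexive exactly on bounded sequences, whose
  mutual distances are bounded and so have limits along \<open>ultra\<close>.\<close>
quotient_type (overloaded) 'a upower = "nat \<Rightarrow> 'a::metric_space" /
  partial: "\<lambda>s t. bounded (range s) \<and> bounded (range t) \<and> ((\<lambda>n. dist (s n) (t n)) \<longlongrightarrow> 0) ultra"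
proof (rule part_equivpI)
  show "\<exists>s :: nat \<Rightarrow> 'a. bounded (range s) \<and> bounded (range s) \<and> ((\<lambda>n. dist (s n) (s n)) \<longlongrightarrow> 0) ultra"
    by (rule exI[of _ "\<lambda>_. undefined"]) simp
  show "symp (\<lambda>s t :: nat \<Rightarrow> 'a. bounded (range s) \<and> bounded (range t) \<and> ((\<lambda>n. dist (s n) (t n)) \<longlongrightarrow> 0) ultra)"
    by (auto simp: symp_def dist_commute)
  show "transp (\<lambda>s t :: nat \<Rightarrow> 'a. bounded (range s) \<and> bounded (range t) \<and> ((\<lambda>n. dist (s n) (t n)) \<longlongrightarrow> 0) ultra)"
  proof (rule transpI, safe)
    fix s t u :: "nat \<Rightarrow> 'a"
    assume 1: "((\<lambda>n. dist (s n) (t n)) \<longlongrightarrow> 0) ultra" "((\<lambda>n. dist (t n) (u n)) \<longlongrightarrow> 0) ultra"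
    show "((\<lambda>n. dist (s n) (u n)) \<longlongrightarrow> 0) ultra"
    proof (rule tendsto_sandwich[OF _ _ tendsto_const])
      show "((\<lambda>n. dist (s n) (t n) + dist (t n) (u n)) \<longlongrightarrow> 0) ultra" using tendsto_add[OF 1] by simp
    qed (auto simp: dist_triangle)
  qed
qed

lemma ultra_dist_limit_cong:
  fixes s t s' t' :: "nat \<Rightarrow> 'a::metric_space"
  assumes "((\<lambda>n. dist (s n) (s' n)) \<longlongrightarrow> 0) ultra" "((\<lambda>n. dist (t n) (t' n)) \<longlongrightarrow> 0) ultra"
    "((\<lambda>n. dist (s n) (t n)) \<longlongrightarrow> l) ultra"
  shows "((\<lambda>n. dist (s' n) (t' n)) \<longlongrightarrow> l) ultra"
proof -
  have "((\<lambda>n. dist (s' n) (t' n) - dist (s n) (t n)) \<longlongrightarrow> 0) ultra"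
  proof (rule Lim_null_comparison)
    show "((\<lambda>n. dist (s n) (s' n) + dist (t n) (t' n)) \<longlongrightarrow> 0) ultra" using tendsto_add[OF assms(1,2)] by simp
    have "\<bar>dist (s' n) (t' n) - dist (s n) (t n)\<bar> \<le> dist (s n) (s' n) + dist (t n) (t' n)" for n
      using dist_triangle[of "s' n" "t' n" "s n"] dist_triangle[of "s n" "t' n" "t n"]
        dist_triangle[of "s n" "t n" "s' n"] dist_triangle[of "s' n" "t n" "t' n"] by (simp add: dist_commute)
    then show "\<forall>\<^sub>F n in ultra. norm (dist (s' n) (t' n) - dist (s n) (t n)) \<le> dist (s n) (s' n) + dist (t n) (t' n)" by simp
  qed
  from tendsto_add[OF this assms(3)] show ?thesis by simp
qed

lift_definition upower_dist :: "'a::metric_space upower \<Rightarrow> 'a upower \<Rightarrow> real" is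
  "\<lambda>s t. Lim ultra (\<lambda>n. dist (s n) (t n))"
proof safe
  fix s s' t t' :: "nat \<Rightarrow> 'a"
  assume b: "bounded (range s)" "bounded (range s')" "bounded (range t)" "bounded (range t')"
    and c: "((\<lambda>n. dist (s n) (s' n)) \<longlongrightarrow> 0) ultra" "((\<lambda>n. dist (t n) (t' n)) \<longlongrightarrow> 0) ultra"
  obtain l where l: "((\<lambda>n. dist (s n) (t n)) \<longlongrightarrow> l) ultra" using ultra_convergent[OF bounded_dist_range[OF b(1,3)]] by blast
  show "Lim ultra (\<lambda>n. dist (s n) (t n)) = Lim ultra (\<lambda>n. dist (s' n) (t' n))"
    using tendsto_Lim[OF ultra(1) l] tendsto_Lim[OF ultra(1) ultra_dist_limit_cong[OF c l]] by simp
qed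

definition ucls :: "(nat \<Rightarrow> 'a::metric_space) \<Rightarrow> 'a upower" where "ucls = abs_upower"

lemma upower_dist_limit:
  assumes "bounded (range s)" "bounded (range t)"
  shows "((\<lambda>n. dist (s n) (t n)) \<longlongrightarrow> upower_dist (ucls s) (ucls t)) ultra"
proof -
  obtain l where l: "((\<lambda>n. dist (s n) (t n)) \<longlongrightarrow> l) ultra" using ultra_convergent[OF bounded_dist_range[OF assms]] by blast
  have "upower_dist (ucls s) (ucls t) = Lim ultra (\<lambda>n. dist (s n) (t n))"
    unfolding ucls_def by (rule upower_dist.abs_eq) (use assms in auto)
  then show ?thesis using l tendsto_Lim[OF ultra(1) l] by simp
qed

lemma upower_cases:
  obtains s where "bounded (range s)" "u = ucls s"
proof -
  have Q: "Quotient3 (\<lambda>s t :: nat \<Rightarrow> 'a. bounded (range s) \<and> bounded (range t) \<and> ((\<lambda>n. dist (s n) (t n)) \<longlongrightarrow> 0) ultra)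
      abs_upower rep_upower" by (rule Quotient3_upower)
  have "u = ucls (rep_upower u)" unfolding ucls_def using Quotient3_abs_rep[OF Q] by simp
  moreover have "bounded (range (rep_upower u))" using Quotient3_rep_reflp[OF Q] by blast
  ultimately show ?thesis using that by blast
qed

lemma ucls_eq:
  assumes "bounded (range s)" "bounded (range t)" "((\<lambda>n. dist (s n) (t n)) \<longlongrightarrow> 0) ultra"
  shows "ucls s = ucls t"
  unfolding ucls_def by (rule Quotient3_rel_abs[OF Quotient3_upower]) (use assms in auto)

instantiation upower :: (metric_space) metric_space
begin

definition dist_upower :: "'a upower \<Rightarrow> 'a upower \<Rightarrow> real" where "dist_upower = upower_dist"

definition uniformity_upower :: "('a upower \<times> 'a upower) filter" where
  "uniformity_upower = (INF e\<in>{0 <..}. principal {(x, y). dist x y < e})"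

definition open_upower :: "'a upower set \<Rightarrow> bool" where
  "open_upower U \<longleftrightarrow> (\<forall>x\<in>U. eventually (\<lambda>(x', y). x' = x \<longrightarrow> y \<in> U) uniformity)"

instance
proof
  fix x y :: "'a upower"
  obtain s where s: "bounded (range s)" "x = ucls s" by (rule upower_cases)
  obtain t where t: "bounded (range t)" "y = ucls t" by (rule upower_cases)
  note st = upower_dist_limit[OF s(1) t(1), folded s(2) t(2)]
  show "dist x y = 0 \<longleftrightarrow> x = y"
  proof
    assume "dist x y = 0"
    then show "x = y" unfolding s(2) t(2) using ucls_eq[OF s(1) t(1)] st[unfolded s(2) t(2)] by (simp add: dist_upower_def)
  next
    assume "x = y"
    then have "upower_dist x y = 0"
      using upower_dist_limit[OF s(1) s(1), folded s(2)] ultra(1) by (simp add: tendsto_const_iff)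
    then show "dist x y = 0" by (simp add: dist_upower_def)
  qed
  fix z :: "'a upower"
  obtain r where r: "bounded (range r)" "z = ucls r" by (rule upower_cases)
  note sr = upower_dist_limit[OF s(1) r(1), folded s(2) r(2)] and tr = upower_dist_limit[OF t(1) r(1), folded t(2) r(2)]
  show "dist x y \<le> dist x z + dist y z"
    unfolding dist_upower_def
    by (rule tendsto_le[OF ultra(1) tendsto_add[OF sr tr] st]) (simp add: dist_triangle2)
qed (simp_all add: uniformity_upower_def open_upower_def)

end

lemma upower_limit:
  assumes "bounded (range s)" "bounded (range t)"
  shows "((\<lambda>n. dist (s n) (t n)) \<longlongrightarrow> dist (ucls s) (ucls t)) ultra"
  using upower_dist_limit[OF assms] by (simp add: dist_upower_def)

definition uemb :: "'a::metric_space \<Rightarrow> 'a upower" where "uemb a = ucls (\<lambda>_. a)"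

lemma dist_uemb [simp]: "dist (uemb a) (uemb b) = dist a b"
proof -
  have "((\<lambda>n::nat. dist a b) \<longlongrightarrow> dist (uemb a) (uemb b)) ultra" unfolding uemb_def by (rule upower_limit) auto
  then show ?thesis using ultra(1) by (simp add: tendsto_const_iff)
qed

lemma ultra_small: "((\<lambda>n. 1 / real (Suc n)) \<longlongrightarrow> 0) ultra"
  using tendsto_mono[OF ultra(2)] LIMSEQ_inverse_real_of_nat by (auto simp: inverse_eq_divide)

text \<open>A point of the ultrapower that is determined by finitely many distances to points of a
  complete space lies in that space: otherwise reindexing a representing sequence would produce
  a second point with the same distances.\<close>

lemma upower_determined:
  fixes u :: "'a::metric_space upower"
  assumes compl: "complete (UNIV :: 'a set)" and G: "finite G"
    and det: "\<And>v. (\<And>g. g \<in> G \<Longrightarrow> dist v (uemb g) = dist u (uemb g)) \<Longrightarrow> v = u"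
  shows "\<exists>a. u = uemb a"
proof -
  have "\<exists>a. \<forall>e>0. dist u (uemb a) < e"
  proof (rule ccontr)
    assume not0: "\<not> ?thesis"
    \<comment> \<open>If points of the space came arbitrarily close to \<open>u\<close>, they would
      form a Cauchy sequence, and by completeness \<open>u\<close> would be its limit.\<close>
    have "\<exists>e>0. \<forall>a. e \<le> dist u (uemb a)"
    proof (rule ccontr)
      assume "\<not> ?thesis"
      then have "\<exists>a. dist u (uemb a) < 1 / real (Suc n)" for n by (metis not_le of_nat_0_less_iff zero_less_Suc zero_less_divide_1_iff)
      then obtain a where a: "\<And>n. dist u (uemb (a n)) < 1 / real (Suc n)" by metis
      have "Cauchy a"
      proof (rule metric_CauchyI)
        fix e :: real assume e: "e > 0"
        then obtain M where M: "1 / real (Suc M) < e / 2" using nat_approx_posE[of "e / 2"] by auto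
        have "dist (a m) (a n) < e" if "m \<ge> M" "n \<ge> M" for m n
        proof -
          have "1 / real (Suc m) \<le> 1 / real (Suc M)" "1 / real (Suc n) \<le> 1 / real (Suc M)" using that by (auto simp: frac_le)
          moreover have "dist (uemb (a m)) (uemb (a n)) \<le> dist u (uemb (a m)) + dist u (uemb (a n))" by (rule dist_triangle3)
          ultimately show ?thesis using a[of m] a[of n] M by simp
        qed
        then show "\<exists>M. \<forall>m\<ge>M. \<forall>n\<ge>M. dist (a m) (a n) < e" by blast
      qed
      then obtain l where l: "a \<longlonglongrightarrow> l" using compl unfolding complete_def by auto
      have "dist u (uemb l) < e" if e: "e > 0" for e
      proof -
        obtain M where M: "1 / real (Suc M) < e / 2" using nat_approx_posE[of "e / 2"] e by auto
        obtain K where K: "\<And>n. n \<ge> K \<Longrightarrow> dist (a n) l < e / 2" using l e unfolding lim_sequentially by (meson half_gt_zero)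
        let ?n = "max M K"
        have "1 / real (Suc ?n) \<le> 1 / real (Suc M)" by (simp add: frac_le)
        moreover have "dist u (uemb l) \<le> dist u (uemb (a ?n)) + dist (uemb (a ?n)) (uemb l)" by (rule dist_triangle)
        ultimately show ?thesis using a[of ?n] K[of ?n] M by simp
      qed
      then show False using not0 by blast
    qed
    then obtain e where e: "e > 0" "\<And>a. e \<le> dist u (uemb a)" by blast
    obtain s where s: "bounded (range s)" "u = ucls s" by (rule upower_cases)
    have lim: "((\<lambda>m. dist (s m) g) \<longlongrightarrow> dist u (uemb g)) ultra" for g
      unfolding s(2) uemb_def by (rule upower_limit[OF s(1)]) auto
    \<comment> \<open>Such an \<open>m\<close> exists since both conditions hold for almost all
      \<open>m\<close>: the distance from \<open>u\<close> to \<open>uemb (s n)\<close> is at least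
      \<open>e\<close>, and the distances to \<open>G\<close> converge to those of
      \<open>u\<close>.\<close>
    have "\<exists>m. dist (s m) (s n) > e / 2 \<and> (\<forall>g\<in>G. \<bar>dist (s m) g - dist u (uemb g)\<bar> < 1 / real (Suc n))" for n
    proof -
      have "eventually (\<lambda>m. dist (s m) (s n) > e / 2) ultra"
        using order_tendstoD(1)[OF lim[of "s n"], of "e / 2"] e(1) e(2)[of "s n"] by simp
      moreover have "eventually (\<lambda>m. \<bar>dist (s m) g - dist u (uemb g)\<bar> < 1 / real (Suc n)) ultra" for g
        using tendstoD[OF lim[of g], of "1 / real (Suc n)"] by (simp add: dist_real_def)
      then have "eventually (\<lambda>m. \<forall>g\<in>G. \<bar>dist (s m) g - dist u (uemb g)\<bar> < 1 / real (Suc n)) ultra"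
        using G by (simp add: eventually_ball_finite)
      ultimately have "eventually (\<lambda>m. dist (s m) (s n) > e / 2 \<and> (\<forall>g\<in>G. \<bar>dist (s m) g - dist u (uemb g)\<bar> < 1 / real (Suc n))) ultra"
        by (rule eventually_conj)
      then show ?thesis using eventually_happens'[OF ultra(1)] by blast
    qed
    then obtain m where m: "\<And>n. dist (s (m n)) (s n) > e / 2" "\<And>n g. g \<in> G \<Longrightarrow> \<bar>dist (s (m n)) g - dist u (uemb g)\<bar> < 1 / real (Suc n)"
      by metis
    define t where "t n = s (m n)" for n
    have t: "bounded (range t)" using s(1) by (rule bounded_subset) (auto simp: t_def)
    have "dist (ucls t) (uemb g) = dist u (uemb g)" if "g \<in> G" for g
    proof -
      have "((\<lambda>n. dist (t n) g) \<longlongrightarrow> dist (ucls t) (uemb g)) ultra" unfolding uemb_def by (rule upower_limit[OF t]) auto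
      moreover have "((\<lambda>n. dist (t n) g - dist u (uemb g)) \<longlongrightarrow> 0) ultra"
        by (rule Lim_null_comparison[OF _ ultra_small]) (use m(2)[OF that] in \<open>auto simp: t_def intro!: always_eventually less_imp_le\<close>)
      then have "((\<lambda>n. dist (t n) g) \<longlongrightarrow> dist u (uemb g)) ultra" by (simp add: Lim_null[symmetric])
      ultimately show ?thesis using tendsto_unique[OF ultra(1)] by blast
    qed
    then have "ucls t = u" by (rule det)
    then have "((\<lambda>n. dist (t n) (s n)) \<longlongrightarrow> 0) ultra" using upower_limit[OF t s(1)] s(2) by simp
    then have "0 \<ge> e / 2"
      by (rule tendsto_lowerbound[OF _ _ ultra(1)]) (use m(1) in \<open>auto simp: t_def intro!: always_eventually less_imp_le\<close>)
    then show False using e by simp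
  qed
  then obtain a where "\<And>e. e > 0 \<Longrightarrow> dist u (uemb a) < e" by blast
  then have "dist u (uemb a) \<le> 0" using field_le_epsilon[of "dist u (uemb a)" 0] by fastforce
  then show ?thesis by auto
qed

section \<open>From the angle condition to copositivity in the ultrapower\<close>

lemma peri_hk_abs:
  fixes x a b :: "'a::metric_space"
  assumes "okp \<kappa> (peri x a b)"
  shows "\<bar>hk \<kappa> (dist x a) (dist x b) (dist a b)\<bar> \<le> md_sin \<kappa> (dist x a) * md_sin \<kappa> (dist x b)"
proof (rule hk_bounds)
  show "okp \<kappa> (dist x a + dist x b + dist a b)" using assms by (simp add: peri_def dist_commute algebra_simps)
qed (use dist_triangle[of a b x] dist_triangle[of x a b] dist_triangle[of x b a] in \<open>auto simp: dist_commute\<close>)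

lemma peri_dist_less:
  fixes x a b :: "'a::metric_space"
  assumes "okp \<kappa> (peri x a b)" "\<kappa> > 0"
  shows "dist x a < PP \<kappa>" "dist x b < PP \<kappa>"
proof -
  have "2 * dist x a \<le> peri x a b" "2 * dist x b \<le> peri x a b"
    using dist_triangle[of x a b] dist_triangle[of x b a] by (simp_all add: peri_def dist_commute)
  then show "dist x a < PP \<kappa>" "dist x b < PP \<kappa>" using okp_half[OF assms(1) _ assms(2)] by blast+
qed

lemma hk_zero: "hk \<kappa> r r 0 = (md_sin \<kappa> r)\<^sup>2" "hk \<kappa> 0 r r = 0" "hk \<kappa> r 0 r = 0"
  by (simp_all add: hk_def md_sin_sq) (simp add: power2_eq_square)

lemma cos_comparison_angle:
  fixes x a b :: "'a::metric_space"
  assumes "okp \<kappa> (peri x a b)" "x \<noteq> a" "x \<noteq> b"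
  shows "md_sin \<kappa> (dist x a) * md_sin \<kappa> (dist x b) * cos (comparison_angle \<kappa> x a b) = hk \<kappa> (dist x a) (dist x b) (dist a b)"
    and "0 \<le> comparison_angle \<kappa> x a b" "comparison_angle \<kappa> x a b \<le> pi"
proof -
  define A B H where "A = md_sin \<kappa> (dist x a)" and "B = md_sin \<kappa> (dist x b)" and "H = hk \<kappa> (dist x a) (dist x b) (dist a b)"
  have A: "A > 0" unfolding A_def by (rule md_sin_pos) (use assms peri_dist_less[OF assms(1)] in auto)
  have B: "B > 0" unfolding B_def by (rule md_sin_pos) (use assms peri_dist_less[OF assms(1)] in auto)
  have "\<bar>H\<bar> \<le> A * B" using peri_hk_abs[OF assms(1)] by (simp add: H_def A_def B_def)
  then have b: "-1 \<le> H / (A * B)" "H / (A * B) \<le> 1" using A B by (auto simp: abs_le_iff pos_le_divide_eq pos_divide_le_eq)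
  have e: "comparison_angle \<kappa> x a b = arccos (H / (A * B))"
  proof (cases "\<kappa> = 0")
    case True
    have "((dist x a)\<^sup>2 + (dist x b)\<^sup>2 - (dist a b)\<^sup>2) / (2 * dist x a * dist x b) = H / (A * B)"
    proof -
      have "(dist x a)\<^sup>2 + (dist x b)\<^sup>2 - (dist a b)\<^sup>2 = 2 * H"
        using True by (simp add: H_def hk_def md_m_def add_divide_distrib diff_divide_distrib)
      moreover have "A = dist x a" "B = dist x b" using True by (simp_all add: A_def B_def md_sin_def)
      ultimately show ?thesis by simp
    qed
    then show ?thesis using True by (simp add: comparison_angle_def)
  next
    case False
    have "md_cos \<kappa> (dist a b) - md_cos \<kappa> (dist x a) * md_cos \<kappa> (dist x b) = \<kappa> * H"
      by (simp add: H_def hk_def md_cos_eq algebra_simps)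
    then show ?thesis using False by (simp add: comparison_angle_def A_def B_def)
  qed
  show "md_sin \<kappa> (dist x a) * md_sin \<kappa> (dist x b) * cos (comparison_angle \<kappa> x a b) = hk \<kappa> (dist x a) (dist x b) (dist a b)"
    unfolding e using b A B by (simp flip: A_def B_def H_def)
  show "0 \<le> comparison_angle \<kappa> x a b" "comparison_angle \<kappa> x a b \<le> pi" unfolding e using b arccos_bounded[of "H / (A * B)"] by auto
qed

lemma quadratic_form2_nonneg:
  fixes K :: real
  assumes "l \<ge> 0" "m \<ge> 0" "\<bar>K\<bar> \<le> A * B"
  shows "0 \<le> l\<^sup>2 * A\<^sup>2 + m\<^sup>2 * B\<^sup>2 + 2 * l * m * K"
proof -
  have "2 * l * m * K \<ge> 2 * l * m * (- (A * B))" using assms by (intro mult_left_mono) auto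
  moreover have "(l * A - m * B)\<^sup>2 = l\<^sup>2 * A\<^sup>2 + m\<^sup>2 * B\<^sup>2 + 2 * l * m * (- (A * B))" by (simp add: power2_eq_square algebra_simps)
  ultimately show ?thesis using zero_le_power2[of "l * A - m * B"] by linarith
qed

text \<open>For distinct points this is \<open>arccos_copositive\<close> with the weights multiplied
  by the sines. If \<open>x\<close> coincides with another point, the terms of that point vanish; if
  two other points coincide, their weights add up. Either way a form in two directions remains,
  which is nonnegative as a cosine is at least -1.\<close>

lemma curvature_ge_copositive:
  fixes x a b c :: "'a::metric_space"
  assumes curv: "curvature_ge TYPE('a) \<kappa>"
    and ok: "okp \<kappa> (peri x a b)" "okp \<kappa> (peri x b c)" "okp \<kappa> (peri x c a)" "okp \<kappa> (peri a b c)"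
    and l: "l1 \<ge> 0" "l2 \<ge> 0" "l3 \<ge> 0"
  shows "0 \<le> l1\<^sup>2 * (md_sin \<kappa> (dist x a))\<^sup>2 + l2\<^sup>2 * (md_sin \<kappa> (dist x b))\<^sup>2 + l3\<^sup>2 * (md_sin \<kappa> (dist x c))\<^sup>2
        + 2 * l1 * l2 * hk \<kappa> (dist x a) (dist x b) (dist a b)
        + 2 * l2 * l3 * hk \<kappa> (dist x b) (dist x c) (dist b c)
        + 2 * l3 * l1 * hk \<kappa> (dist x c) (dist x a) (dist c a)" (is "0 \<le> ?F")
proof -
  define A B C where "A = md_sin \<kappa> (dist x a)" and "B = md_sin \<kappa> (dist x b)" and "C = md_sin \<kappa> (dist x c)"
  define H1 H2 H3 where "H1 = hk \<kappa> (dist x a) (dist x b) (dist a b)" and "H2 = hk \<kappa> (dist x b) (dist x c) (dist b c)"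
    and "H3 = hk \<kappa> (dist x c) (dist x a) (dist c a)"
  have F: "?F = l1\<^sup>2 * A\<^sup>2 + l2\<^sup>2 * B\<^sup>2 + l3\<^sup>2 * C\<^sup>2 + 2 * l1 * l2 * H1 + 2 * l2 * l3 * H2 + 2 * l3 * l1 * H3"
    by (simp add: A_def B_def C_def H1_def H2_def H3_def)
  have h: "\<bar>H1\<bar> \<le> A * B" "\<bar>H2\<bar> \<le> B * C" "\<bar>H3\<bar> \<le> C * A"
    using peri_hk_abs[OF ok(1)] peri_hk_abs[OF ok(2)] peri_hk_abs[OF ok(3)] by (simp_all add: A_def B_def C_def H1_def H2_def H3_def)
  note q2 = quadratic_form2_nonneg
  consider "x = a" | "x = b" | "x = c" | "x \<noteq> a" "a = b" | "x \<noteq> b" "b = c" | "x \<noteq> c" "c = a" | "distinct [x, a, b, c]" by auto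
  then show ?thesis
  proof cases
    case 1
    then have z: "A = 0" "H1 = 0" "H3 = 0" by (simp_all add: A_def H1_def H3_def hk_zero dist_commute)
    show ?thesis unfolding F z using q2[OF l(2,3) h(2)] by simp
  next
    case 2
    then have z: "B = 0" "H1 = 0" "H2 = 0" by (simp_all add: B_def H1_def H2_def hk_zero dist_commute)
    show ?thesis unfolding F z using q2[OF l(3,1) h(3)] by simp
  next
    case 3
    then have z: "C = 0" "H2 = 0" "H3 = 0" by (simp_all add: C_def H2_def H3_def hk_zero dist_commute)
    show ?thesis unfolding F z using q2[OF l(1,2) h(1)] by simp
  next
    case 4
    then have z: "B = A" "H1 = A\<^sup>2" "H2 = H3" by (simp_all add: A_def B_def H1_def H2_def H3_def hk_zero hk_commute dist_commute)
    have "0 \<le> (l1 + l2)\<^sup>2 * A\<^sup>2 + l3\<^sup>2 * C\<^sup>2 + 2 * (l1 + l2) * l3 * H3"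
      using q2[of "l1 + l2" l3 H3 A C] l h(3) by (simp add: mult.commute)
    then show ?thesis unfolding F z by (simp add: power2_eq_square algebra_simps)
  next
    case 5
    then have z: "C = B" "H2 = B\<^sup>2" "H3 = H1" by (simp_all add: B_def C_def H1_def H2_def H3_def hk_zero hk_commute dist_commute)
    have "0 \<le> (l2 + l3)\<^sup>2 * B\<^sup>2 + l1\<^sup>2 * A\<^sup>2 + 2 * (l2 + l3) * l1 * H1"
      using q2[of "l2 + l3" l1 H1 B A] l h(1) by (simp add: mult.commute)
    then show ?thesis unfolding F z by (simp add: power2_eq_square algebra_simps)
  next
    case 6
    then have z: "C = A" "H3 = A\<^sup>2" "H2 = H1" by (simp_all add: A_def C_def H1_def H2_def H3_def hk_zero hk_commute dist_commute)
    have "0 \<le> (l3 + l1)\<^sup>2 * A\<^sup>2 + l2\<^sup>2 * B\<^sup>2 + 2 * (l3 + l1) * l2 * H1"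
      using q2[of "l3 + l1" l2 H1 A B] l h(1) by (simp add: mult.commute)
    then show ?thesis unfolding F z by (simp add: power2_eq_square algebra_simps)
  next
    case 7
    then have ne: "x \<noteq> a" "x \<noteq> b" "x \<noteq> c" and quad: "quadruple x a b c" by (auto simp: quadruple_def)
    have "quadruple_size x a b c < 2 * pi / sqrt \<kappa>" if "\<kappa> > 0"
      unfolding quadruple_size_def using ok that by (simp add: okp_def)
    then have "angle_sum \<kappa> x a b c \<le> 2 * pi" using curv quad unfolding curvature_ge_def by blast
    then have s: "comparison_angle \<kappa> x a b + comparison_angle \<kappa> x b c + comparison_angle \<kappa> x c a \<le> 2 * pi"
      by (simp add: angle_sum_def)
    note 1 = cos_comparison_angle[OF ok(1) ne(1,2), folded A_def B_def H1_def]
    note 2 = cos_comparison_angle[OF ok(2) ne(2,3), folded B_def C_def H2_def]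
    note 3 = cos_comparison_angle[OF ok(3) ne(3,1), folded C_def A_def H3_def]
    have nn: "A \<ge> 0" "B \<ge> 0" "C \<ge> 0" unfolding A_def B_def C_def
      by (rule md_sin_nonneg, simp, use peri_dist_less[OF ok(1)] peri_dist_less[OF ok(2)] in \<open>simp add: less_imp_le\<close>)+
    have "0 \<le> (l1 * A)\<^sup>2 + (l2 * B)\<^sup>2 + (l3 * C)\<^sup>2
        + 2 * (l1 * A) * (l2 * B) * cos (comparison_angle \<kappa> x a b)
        + 2 * (l2 * B) * (l3 * C) * cos (comparison_angle \<kappa> x b c)
        + 2 * (l3 * C) * (l1 * A) * cos (comparison_angle \<kappa> x c a)"
      by (rule arccos_copositive) (use 1(2,3) 2(2,3) 3(2,3) s l nn in auto)
    also have "\<dots> = ?F" unfolding F 1(1)[symmetric] 2(1)[symmetric] 3(1)[symmetric]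
      by (simp add: power2_eq_square algebra_simps)
    finally show ?thesis .
  qed
qed

lemma length_space_near_geodesic:
  fixes a b :: "'a::metric_space"
  assumes len: "length_space TYPE('a)" and r: "0 \<le> r" "r \<le> dist a b" and e: "\<epsilon> > 0"
  shows "\<exists>p. dist a p = r \<and> dist p b \<le> dist a b - r + \<epsilon>"
proof -
  have "(INF g \<in> {g. path g \<and> pathstart g = a \<and> pathfinish g = b}. path_length g) = ennreal (dist a b)"
    using len unfolding length_space_def by simp
  also have "\<dots> < ennreal (dist a b + \<epsilon>)" using e by (simp add: ennreal_less_iff)
  finally obtain g where g: "path g" "pathstart g = a" "pathfinish g = b" and pl: "path_length g < ennreal (dist a b + \<epsilon>)"
    unfolding INF_less_iff by blast
  have cont: "continuous_on {0..1} (\<lambda>t. dist a (g t))" using g(1) unfolding path_def by (intro continuous_intros)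
  have "\<exists>t\<ge>0. t \<le> 1 \<and> dist a (g t) = r"
    by (rule IVT') (use g r cont in \<open>auto simp: pathstart_def pathfinish_def\<close>)
  then obtain t where t: "0 \<le> t" "t \<le> 1" "dist a (g t) = r" by blast
  \<comment> \<open>The partition 0, \<open>t\<close>, 1 into two intervals, continued by the
    constant 1 to a monotone sequence.\<close>
  define T :: "nat \<Rightarrow> real" where "T i = (if i = 0 then 0 else if i = 1 then t else 1)" for i
  have T: "mono T" "range T \<subseteq> {0..1}" using t by (auto simp: T_def mono_def)
  have "ennreal (\<Sum>i<2. dist (g (T i)) (g (T (Suc i)))) \<le> path_length g"
    unfolding path_length_def using T by (intro SUP_upper2[of "(2, T)"]) auto
  also have "(\<Sum>i<2. dist (g (T i)) (g (T (Suc i)))) = dist a (g t) + dist (g t) b"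
    using g by (simp add: T_def numeral_2_eq_2 pathstart_def pathfinish_def)
  finally have "ennreal (dist a (g t) + dist (g t) b) < ennreal (dist a b + \<epsilon>)" using pl by (rule le_less_trans)
  then have "dist a (g t) + dist (g t) b < dist a b + \<epsilon>" by (subst (asm) ennreal_less_iff) auto
  then show ?thesis using t(3) by (intro exI[of _ "g t"]) auto
qed

lemma tendsto_hk [tendsto_intros]:
  "(f \<longlongrightarrow> a) F \<Longrightarrow> (g \<longlongrightarrow> b) F \<Longrightarrow> (h \<longlongrightarrow> c) F \<Longrightarrow> ((\<lambda>x. hk \<kappa> (f x) (g x) (h x)) \<longlongrightarrow> hk \<kappa> a b c) F"
  unfolding hk_def by (intro tendsto_intros)

text \<open>The admissibility conditions are strict, hence inherited by almost all entries of
  representing sequences, and the form is continuous. Points between two given ones are classes of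
  almost intermediate points, with errors tending to 0.\<close>

lemma upower_cbb_geodesic:
  assumes "alexandrov_space TYPE('a::metric_space) \<kappa>"
  shows "cbb_geodesic TYPE('a upower) \<kappa>"
proof
  have curv: "curvature_ge TYPE('a) \<kappa>" and len: "length_space TYPE('a)" using assms by (auto simp: alexandrov_space_def)
  fix x a b c :: "'a upower" and l1 l2 l3 :: real
  assume ok: "okp \<kappa> (peri x a b)" "okp \<kappa> (peri x b c)" "okp \<kappa> (peri x c a)" "okp \<kappa> (peri a b c)"
    and l: "l1 \<ge> 0" "l2 \<ge> 0" "l3 \<ge> 0"
  obtain x' where x': "bounded (range x')" "x = ucls x'" by (rule upower_cases)
  obtain a' where a': "bounded (range a')" "a = ucls a'" by (rule upower_cases)
  obtain b' where b': "bounded (range b')" "b = ucls b'" by (rule upower_cases)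
  obtain c' where c': "bounded (range c')" "c = ucls c'" by (rule upower_cases)
  note lim = upower_limit[OF x'(1) a'(1), folded x'(2) a'(2)] upower_limit[OF x'(1) b'(1), folded x'(2) b'(2)]
    upower_limit[OF x'(1) c'(1), folded x'(2) c'(2)] upower_limit[OF a'(1) b'(1), folded a'(2) b'(2)]
    upower_limit[OF b'(1) c'(1), folded b'(2) c'(2)] upower_limit[OF c'(1) a'(1), folded c'(2) a'(2)]
  have oklim: "eventually (\<lambda>n. okp \<kappa> (f n)) ultra" if "(f \<longlongrightarrow> p) ultra" "okp \<kappa> p" for f p
  proof (cases "\<kappa> > 0")
    case True
    then show ?thesis using order_tendstoD(2)[OF that(1)] that(2) by (simp add: okp_def)
  qed (simp add: okp_def)
  have p: "((\<lambda>n. peri (x' n) (a' n) (b' n)) \<longlongrightarrow> peri x a b) ultra" "((\<lambda>n. peri (x' n) (b' n) (c' n)) \<longlongrightarrow> peri x b c) ultra"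
    "((\<lambda>n. peri (x' n) (c' n) (a' n)) \<longlongrightarrow> peri x c a) ultra" "((\<lambda>n. peri (a' n) (b' n) (c' n)) \<longlongrightarrow> peri a b c) ultra"
    unfolding peri_def dist_commute[of _ "x' _"] dist_commute[of _ x] by (intro tendsto_intros lim)+
  show "0 \<le> l1\<^sup>2 * (md_sin \<kappa> (dist x a))\<^sup>2 + l2\<^sup>2 * (md_sin \<kappa> (dist x b))\<^sup>2 + l3\<^sup>2 * (md_sin \<kappa> (dist x c))\<^sup>2
        + 2 * l1 * l2 * hk \<kappa> (dist x a) (dist x b) (dist a b)
        + 2 * l2 * l3 * hk \<kappa> (dist x b) (dist x c) (dist b c)
        + 2 * l3 * l1 * hk \<kappa> (dist x c) (dist x a) (dist c a)"
  proof (rule tendsto_lowerbound[OF _ _ ultra(1)])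
    show "((\<lambda>n. l1\<^sup>2 * (md_sin \<kappa> (dist (x' n) (a' n)))\<^sup>2 + l2\<^sup>2 * (md_sin \<kappa> (dist (x' n) (b' n)))\<^sup>2 + l3\<^sup>2 * (md_sin \<kappa> (dist (x' n) (c' n)))\<^sup>2
        + 2 * l1 * l2 * hk \<kappa> (dist (x' n) (a' n)) (dist (x' n) (b' n)) (dist (a' n) (b' n))
        + 2 * l2 * l3 * hk \<kappa> (dist (x' n) (b' n)) (dist (x' n) (c' n)) (dist (b' n) (c' n))
        + 2 * l3 * l1 * hk \<kappa> (dist (x' n) (c' n)) (dist (x' n) (a' n)) (dist (c' n) (a' n)))
      \<longlongrightarrow> l1\<^sup>2 * (md_sin \<kappa> (dist x a))\<^sup>2 + l2\<^sup>2 * (md_sin \<kappa> (dist x b))\<^sup>2 + l3\<^sup>2 * (md_sin \<kappa> (dist x c))\<^sup>2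
        + 2 * l1 * l2 * hk \<kappa> (dist x a) (dist x b) (dist a b)
        + 2 * l2 * l3 * hk \<kappa> (dist x b) (dist x c) (dist b c)
        + 2 * l3 * l1 * hk \<kappa> (dist x c) (dist x a) (dist c a)) ultra"
      by (intro tendsto_intros lim)
    show "\<forall>\<^sub>F n in ultra. 0 \<le> l1\<^sup>2 * (md_sin \<kappa> (dist (x' n) (a' n)))\<^sup>2 + l2\<^sup>2 * (md_sin \<kappa> (dist (x' n) (b' n)))\<^sup>2 + l3\<^sup>2 * (md_sin \<kappa> (dist (x' n) (c' n)))\<^sup>2
        + 2 * l1 * l2 * hk \<kappa> (dist (x' n) (a' n)) (dist (x' n) (b' n)) (dist (a' n) (b' n))
        + 2 * l2 * l3 * hk \<kappa> (dist (x' n) (b' n)) (dist (x' n) (c' n)) (dist (b' n) (c' n))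
        + 2 * l3 * l1 * hk \<kappa> (dist (x' n) (c' n)) (dist (x' n) (a' n)) (dist (c' n) (a' n))"
      using oklim[OF p(1) ok(1)] oklim[OF p(2) ok(2)] oklim[OF p(3) ok(3)] oklim[OF p(4) ok(4)]
      by eventually_elim (rule curvature_ge_copositive[OF curv _ _ _ _ l])
  qed
next
  have len: "length_space TYPE('a)" using assms by (auto simp: alexandrov_space_def)
  fix a b :: "'a upower" and r :: real
  assume r: "0 \<le> r" "r \<le> dist a b"
  obtain a' where a': "bounded (range a')" "a = ucls a'" by (rule upower_cases)
  obtain b' where b': "bounded (range b')" "b = ucls b'" by (rule upower_cases)
  note lab = upower_limit[OF a'(1) b'(1), folded a'(2) b'(2)]
  \<comment> \<open>The minimum, since single entries may be at a distance less than
    \<open>r\<close>; its limit is \<open>r\<close>.\<close>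
  define q where "q n = min r (dist (a' n) (b' n))" for n
  have "\<exists>p. dist (a' n) p = q n \<and> dist p (b' n) \<le> dist (a' n) (b' n) - q n + 1 / real (Suc n)" for n
    by (rule length_space_near_geodesic[OF len]) (use r in \<open>auto simp: q_def\<close>)
  then obtain p where p: "\<And>n. dist (a' n) (p n) = q n" "\<And>n. dist (p n) (b' n) \<le> dist (a' n) (b' n) - q n + 1 / real (Suc n)"
    by metis
  have pb: "bounded (range p)"
  proof -
    obtain z B where B: "\<And>n. dist z (a' n) \<le> B" using a'(1) unfolding bounded_def by auto
    have "dist z (p n) \<le> B + r" for n using dist_triangle[of z "p n" "a' n"] B[of n] p(1)[of n] by (simp add: q_def)
    then show ?thesis unfolding bounded_def by blast
  qed
  note lap = upower_limit[OF a'(1) pb, folded a'(2)] and lpb = upower_limit[OF pb b'(1), folded b'(2)]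
  have "(q \<longlongrightarrow> min r (dist a b)) ultra" unfolding q_def by (intro tendsto_intros lab)
  then have q: "(q \<longlongrightarrow> r) ultra" using r by (simp add: min_def)
  have 1: "dist a (ucls p) = r" using tendsto_unique[OF ultra(1) lap[unfolded p(1)] q] .
  have "dist (ucls p) b \<le> dist a b - r + 0"
    by (rule tendsto_le[OF ultra(1) tendsto_add[OF tendsto_diff[OF lab q] ultra_small] lpb]) (use p(2) in auto)
  then have "dist (ucls p) b = dist a b - r" using dist_triangle[of a b "ucls p"] 1 by simp
  then show "\<exists>p. dist a p = r \<and> dist p b = dist a b - r" using 1 by blast
qed

section \<open>Triangular regions\<close>

text \<open>The coordinate of \<open>v\<close> at \<open>a\<close> in the basis \<open>a\<close>,
  \<open>b\<close>, \<open>c\<close>, by Cramer's rule. The other two coordinates arise by cyclic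
  rotation of the arguments.\<close>

definition crd :: "real^3 \<Rightarrow> real^3 \<Rightarrow> real^3 \<Rightarrow> real^3 \<Rightarrow> real" where
  "crd a b c v = det3 v b c / det3 a b c"

text \<open>\<open>tri_int s\<close> is the interior of the region bounded by the triangle \<open>a b c\<close> that contains the
  barycenter (\<open>s = True\<close>) or does not contain it (\<open>s = False\<close>, of interest only on spheres).\<close>

definition tri_int :: "real \<Rightarrow> bool \<Rightarrow> real^3 \<Rightarrow> real^3 \<Rightarrow> real^3 \<Rightarrow> (real^3) set" where
  "tri_int \<kappa> s a b c = {p \<in> hat_plane \<kappa>.
    if s then crd a b c p > 0 \<and> crd b c a p > 0 \<and> crd c a b p > 0
    else crd a b c p < 0 \<or> crd b c a p < 0 \<or> crd c a b p < 0}"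

definition tri_reg :: "real \<Rightarrow> bool \<Rightarrow> real^3 \<Rightarrow> real^3 \<Rightarrow> real^3 \<Rightarrow> (real^3) set" where
  "tri_reg \<kappa> s a b c = {p \<in> hat_plane \<kappa>.
    if s then crd a b c p \<ge> 0 \<and> crd b c a p \<ge> 0 \<and> crd c a b p \<ge> 0
    else crd a b c p \<le> 0 \<or> crd b c a p \<le> 0 \<or> crd c a b p \<le> 0}"

text \<open>A center of \<open>tri_int s\<close>, with respect to which it is star shaped.\<close>

definition tri_center :: "real \<Rightarrow> bool \<Rightarrow> real^3 \<Rightarrow> real^3 \<Rightarrow> real^3 \<Rightarrow> real^3 \<Rightarrow> bool" where
  "tri_center \<kappa> s a b c o' \<longleftrightarrow> o' \<in> hat_plane \<kappa> \<and>
    (if s then crd a b c o' > 0 \<and> crd b c a o' > 0 \<and> crd c a b o' > 0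
     else crd a b c o' < 0 \<and> crd b c a o' < 0 \<and> crd c a b o' < 0)"

lemma crd_linear:
  "crd a b c (u + v) = crd a b c u + crd a b c v" "crd a b c (r *\<^sub>R u) = r * crd a b c u"
  "crd a b c (- u) = - crd a b c u"
  by (simp_all add: crd_def det3_simps add_divide_distrib)

lemma crd_basis:
  assumes "det3 a b c \<noteq> 0"
  shows "crd a b c a = 1" "crd a b c b = 0" "crd a b c c = 0" "crd b c a a = 0" "crd b c a b = 1" "crd b c a c = 0"
    "crd c a b a = 0" "crd c a b b = 0" "crd c a b c = 1"
  using assms by (simp_all add: crd_def det3_simps det3_cyclic(1)[of b c a] det3_cyclic(2)[of c a b])

lemma crd_expand:
  assumes "det3 a b c \<noteq> 0"
  shows "v = crd a b c v *\<^sub>R a + crd b c a v *\<^sub>R b + crd c a b v *\<^sub>R c"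
proof -
  have "det3 v c a = det3 a v c" "det3 v a b = det3 a b v" "det3 b c a = det3 a b c" "det3 c a b = det3 a b c"
    using det3_cyclic by metis+
  then show ?thesis using det3_basis[OF assms, of v] by (simp add: crd_def)
qed

lemma crd_combination:
  assumes "det3 a b c \<noteq> 0" "v = \<alpha> *\<^sub>R a + \<beta> *\<^sub>R b + \<gamma> *\<^sub>R c"
  shows "crd a b c v = \<alpha>" "crd b c a v = \<beta>" "crd c a b v = \<gamma>"
  unfolding assms(2) by (simp_all add: crd_linear crd_basis[OF assms(1)])

lemma tri_int_center: "tri_center \<kappa> s a b c p \<Longrightarrow> p \<in> tri_int \<kappa> s a b c"
  by (auto simp: tri_center_def tri_int_def split: if_splits)

lemma tri_int_subset: "tri_int \<kappa> s a b c \<subseteq> tri_reg \<kappa> s a b c"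
  by (auto simp: tri_int_def tri_reg_def split: if_splits)

lemma tri_center_antipode:
  assumes "tri_center \<kappa> s a b c p" "q \<in> tri_reg \<kappa> s a b c" shows "q \<noteq> - p"
  using assms by (auto simp: tri_center_def tri_reg_def crd_linear split: if_splits)

text \<open>The points of the geodesic are combinations of \<open>p\<close> and \<open>q\<close>
  with nonnegative weights. All three coordinates of a center have the same strict sign, so
  whichever coordinate of \<open>q\<close> has this sign weakly gets it strictly before the
  end.\<close>

lemma tri_star:
  assumes o: "tri_center \<kappa> s a b c p" and q: "q \<in> tri_reg \<kappa> s a b c" "p \<noteq> q"
    and t: "0 \<le> t" "t < model_dist \<kappa> p q \<or> t \<le> model_dist \<kappa> p q \<and> q \<in> tri_int \<kappa> s a b c"
  shows "mpt \<kappa> p q t \<in> tri_int \<kappa> s a b c"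
proof -
  let ?D = "model_dist \<kappa> p q"
  have mem: "p \<in> hat_plane \<kappa>" "q \<in> hat_plane \<kappa>" using o q by (auto simp: tri_center_def tri_reg_def)
  have "?D \<noteq> 0" using model_dist_eq_0[OF mem] q(2) by blast
  then have D: "0 < ?D" using model_dist_props(2)[OF mem] by simp
  have DP: "\<kappa> > 0 \<Longrightarrow> ?D < PP \<kappa>" using model_dist_less_PP[OF mem tri_center_antipode[OF o q(1)]] .
  have tD: "t \<le> ?D" using t by auto
  have S: "md_sin \<kappa> ?D > 0" using D DP by (rule md_sin_pos)
  define u where "u = md_sin \<kappa> (?D - t) / md_sin \<kappa> ?D"
  define v where "v = md_sin \<kappa> t / md_sin \<kappa> ?D"
  have "md_sin \<kappa> (?D - t) \<ge> 0" "md_sin \<kappa> t \<ge> 0"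
    using md_sin_nonneg[of "?D - t" \<kappa>] md_sin_nonneg[of t \<kappa>] t(1) tD DP by fastforce+
  then have uv: "u \<ge> 0" "v \<ge> 0" using S by (simp_all add: u_def v_def)
  have u0: "u > 0" if "t < ?D"
  proof -
    have "md_sin \<kappa> (?D - t) > 0" by (rule md_sin_pos) (use that t(1) DP in auto)
    then show ?thesis using S by (simp add: u_def)
  qed
  have v1: "v = 1" "u = 0" if "t = ?D" using that S by (simp_all add: u_def v_def)
  have e: "mpt \<kappa> p q t = u *\<^sub>R p + v *\<^sub>R q" by (simp add: mpt_def u_def v_def)
  have N: "mpt \<kappa> p q t \<in> hat_plane \<kappa>" by (rule mpt_props(1)[OF mem D DP t(1) tD])
  consider "t = ?D" "q \<in> tri_int \<kappa> s a b c" | "t < ?D" using t(2) tD by fastforce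
  then show ?thesis
  proof cases
    case 1
    then show ?thesis using e v1 by simp
  next
    case 2
    have pos: "u * x + v * y > 0" if "x > 0" "y \<ge> 0" for x y using that u0[OF 2] uv by (simp add: add_pos_nonneg)
    have neg: "u * x + v * y < 0" if "x < 0" "y \<le> 0" for x y
    proof -
      have "u * (- x) + v * (- y) > 0" by (rule pos) (use that in auto)
      then show ?thesis by simp
    qed
    show ?thesis
    proof (cases s)
      case True
      then show ?thesis using o q(1) N by (auto simp: tri_center_def tri_reg_def tri_int_def e crd_linear intro!: pos)
    next
      case False
      then show ?thesis using o q(1) N by (auto simp: tri_center_def tri_reg_def tri_int_def e crd_linear intro: neg)
    qed
  qed
qed

section \<open>Uniqueness near the center and along rays\<close>

context cbb_geodesic begin

lemma op_cone_tri_int: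
  assumes "det3 Y Z W \<noteq> 0" shows "op_cone Y Z W = tri_int \<kappa> True Y Z W"
proof
  show "op_cone Y Z W \<subseteq> tri_int \<kappa> True Y Z W"
    unfolding op_cone_def tri_int_def using crd_combination[OF assms] by auto
  show "tri_int \<kappa> True Y Z W \<subseteq> op_cone Y Z W"
  proof
    fix P assume "P \<in> tri_int \<kappa> True Y Z W"
    then show "P \<in> op_cone Y Z W" using crd_expand[OF assms, of P] unfolding op_cone_def tri_int_def by auto
  qed
qed

lemma near_unique:
  assumes q: "xquad x y z w X Y Z W"
  obtains \<rho> where "\<rho> > 0" "\<And>p p' P. \<delta> X P \<le> \<rho> \<Longrightarrow> good x y z w X Y Z W p P \<Longrightarrow> good x y z w X Y Z W p' P \<Longrightarrow> p = p'"
proof -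
  note D = xquad_D[OF q]
  obtain \<rho> where \<rho>: "\<rho> > 0"
    "\<And>p q P Q. \<lbrakk>P \<in> N; dist x p = \<delta> X P; dist x p \<le> \<rho>; \<delta> P Y \<le> dist p y; \<delta> P Z \<le> dist p z; \<delta> P W \<le> dist p w;
      Q \<in> N; dist x q = \<delta> X Q; dist x q \<le> \<rho>; \<delta> Q Y \<le> dist q y; \<delta> Q Z \<le> dist q z; \<delta> Q W \<le> dist q w\<rbrakk>
      \<Longrightarrow> dist p q \<le> \<delta> P Q" using near_upper[OF q] by blast
  show ?thesis
  proof (rule that[OF \<rho>(1)])
    fix p p' P assume r: "\<delta> X P \<le> \<rho>" and g: "good x y z w X Y Z W p P" "good x y z w X Y Z W p' P"
    have P: "P \<in> N" using g unfolding good_def by blast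
    have x: "dist x v = \<delta> X P" if "good x y z w X Y Z W v P" for v
      using that model_dist_commute[OF D(1) P] unfolding good_def by (simp add: dist_commute)
    have "dist p p' \<le> \<delta> P P"
      by (rule \<rho>(2)) (use P r g x[OF g(1)] x[OF g(2)] in \<open>auto simp: good_def\<close>)
    then show "p = p'" using P by simp
  qed
qed

text \<open>Two continuations of one geodesic form a hinge of angle 0, to which
  \<open>hinge_extend2\<close> applies with the same model point on both legs: geodesics do not
  branch.\<close>

lemma ray_unique:
  assumes "onseg x p1 p X P1 P" "onseg x p1 p' X P1 P" "p1 \<noteq> x" "\<kappa> > 0 \<Longrightarrow> \<delta> X P < PP \<kappa>"
  shows "p = p'"
proof -
  note D = onseg_D[OF assms(1)]
  have ok: "okp \<kappa> (\<delta> X P + \<delta> P P + \<delta> P X)"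
  proof (cases "\<kappa> > 0")
    case True
    then show ?thesis using assms(4)[OF True] model_dist_commute[OF D(1,3)] D(3) by (simp add: okp_def)
  qed (simp add: okp_def)
  have "dist p p' \<le> \<delta> P P"
    by (rule hinge_extend2[OF assms(1,3,2,3) _ ok]) (use D(2) in simp)
  then show ?thesis using D(3) by simp
qed

end

section \<open>Triangular regions as components of the complement of a triangle\<close>

definition lift_vec :: "real \<Rightarrow> real^3" where "lift_vec \<kappa> = (if \<kappa> = 0 then axis 3 1 else 0)"

lemma hat_eq: "hat \<kappa> p = p + lift_vec \<kappa>"
  by (simp add: hat_def lift_vec_def)

lemma hat_mem: "hat \<kappa> p \<in> hat_plane \<kappa> \<longleftrightarrow> p \<in> model_plane \<kappa>"
  by (simp add: hat_def hat_plane_def model_plane_def axis_def)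

lemma hat_inverse: "hat \<kappa> (P - lift_vec \<kappa>) = P"
  by (simp add: hat_eq)

lemma model_dist_hat [simp]: "model_dist \<kappa> (hat \<kappa> p) (hat \<kappa> q) = model_dist \<kappa> p q"
  by (simp add: model_dist_def hat_def)

text \<open>\<open>seg_rel\<close> gives one direction and \<open>cone_between\<close> the other.
  This translates the metric definition of the sides into signs of coordinates.\<close>

lemma model_segment_iff:
  assumes "a \<in> model_plane \<kappa>" "b \<in> model_plane \<kappa>" "\<kappa> > 0 \<Longrightarrow> model_dist \<kappa> a b < PP \<kappa>"
  shows "u \<in> model_segment \<kappa> a b \<longleftrightarrow> u \<in> model_plane \<kappa> \<and> (\<exists>\<sigma> \<tau>. \<sigma> \<ge> 0 \<and> \<tau> \<ge> 0 \<and> hat \<kappa> u = \<sigma> *\<^sub>R hat \<kappa> a + \<tau> *\<^sub>R hat \<kappa> b)"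
proof -
  let ?A = "hat \<kappa> a" and ?B = "hat \<kappa> b" and ?U = "hat \<kappa> u"
  have mem: "?A \<in> hat_plane \<kappa>" "?B \<in> hat_plane \<kappa>" using assms by (simp_all add: hat_mem)
  have "\<exists>\<sigma> \<tau>. \<sigma> \<ge> 0 \<and> \<tau> \<ge> 0 \<and> ?U = \<sigma> *\<^sub>R ?A + \<tau> *\<^sub>R ?B"
    if u: "u \<in> model_plane \<kappa>" and d: "model_dist \<kappa> ?A ?B = model_dist \<kappa> ?A ?U + model_dist \<kappa> ?U ?B"
  proof -
    have U: "?U \<in> hat_plane \<kappa>" using u by (simp add: hat_mem)
    show ?thesis
    proof (cases "model_dist \<kappa> ?A ?B = 0")
      case True
      then have "model_dist \<kappa> ?A ?U = 0" using d model_dist_props(2)[OF mem(1) U] model_dist_props(2)[OF U mem(2)] by linarith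
      then have "?U = ?A" using model_dist_eq_0[OF mem(1) U] by simp
      then have "?U = 1 *\<^sub>R ?A + 0 *\<^sub>R ?B" by simp
      then show ?thesis by (metis zero_le_one order_refl)
    next
      case False
      then have D: "0 < model_dist \<kappa> ?A ?B" using model_dist_props(2)[OF mem] by simp
      let ?s = "md_sin \<kappa> (model_dist \<kappa> ?A ?B)"
      have s: "?s > 0" using D assms(3) by (intro md_sin_pos) auto
      have "?U = (1 / ?s) *\<^sub>R (?s *\<^sub>R ?U)" using s by simp
      also have "\<dots> = (md_sin \<kappa> (model_dist \<kappa> ?U ?B) / ?s) *\<^sub>R ?A + (md_sin \<kappa> (model_dist \<kappa> ?A ?U) / ?s) *\<^sub>R ?B"
        unfolding seg_rel[OF mem(1) U mem(2) d, symmetric] by (simp add: scaleR_add_right)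
      finally show ?thesis
        using s md_sin_model_nonneg[OF U mem(2)] md_sin_model_nonneg[OF mem(1) U] by (metis divide_nonneg_pos)
    qed
  qed
  moreover have "model_dist \<kappa> ?A ?B = model_dist \<kappa> ?A ?U + model_dist \<kappa> ?U ?B"
    if "u \<in> model_plane \<kappa>" "\<sigma> \<ge> 0" "\<tau> \<ge> 0" "?U = \<sigma> *\<^sub>R ?A + \<tau> *\<^sub>R ?B" for \<sigma> \<tau>
  proof -
    have "?U \<in> hat_plane \<kappa>" using that(1) by (simp only: hat_mem)
    then show ?thesis by (rule cone_between[OF mem(1) _ mem(2) that(4,2,3)])
  qed
  ultimately show ?thesis unfolding model_segment_def model_dist_hat by blast
qed

lemma cone_coordinates:
  fixes v u w :: "real^3"
  assumes "\<And>\<sigma> \<tau>. v = \<sigma> *\<^sub>R u + \<tau> *\<^sub>R w \<Longrightarrow> x = \<sigma> \<and> y = \<tau> \<and> z = 0" "z = 0 \<Longrightarrow> v = x *\<^sub>R u + y *\<^sub>R w"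
  shows "(\<exists>\<sigma> \<tau>. \<sigma> \<ge> 0 \<and> \<tau> \<ge> 0 \<and> v = \<sigma> *\<^sub>R u + \<tau> *\<^sub>R w) \<longleftrightarrow> x \<ge> 0 \<and> y \<ge> 0 \<and> z = (0::real)"
proof
  assume "\<exists>\<sigma> \<tau>. \<sigma> \<ge> 0 \<and> \<tau> \<ge> 0 \<and> v = \<sigma> *\<^sub>R u + \<tau> *\<^sub>R w"
  then obtain \<sigma> \<tau> where "\<sigma> \<ge> 0" "\<tau> \<ge> 0" "v = \<sigma> *\<^sub>R u + \<tau> *\<^sub>R w" by blast
  then show "x \<ge> 0 \<and> y \<ge> 0 \<and> z = 0" using assms(1)[of \<sigma> \<tau>] by simp
next
  assume "x \<ge> 0 \<and> y \<ge> 0 \<and> z = 0"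
  then show "\<exists>\<sigma> \<tau>. \<sigma> \<ge> 0 \<and> \<tau> \<ge> 0 \<and> v = \<sigma> *\<^sub>R u + \<tau> *\<^sub>R w"
    using assms(2) by (intro exI[of _ x] exI[of _ y]) simp
qed

lemma continuous_crd_hat: "continuous_on S (\<lambda>p. crd u v w (hat \<kappa> p))"
  unfolding crd_def det3_def hat_eq divide_inverse by (intro continuous_intros)

lemma continuous_on_md_sin [continuous_intros]: "continuous_on S f \<Longrightarrow> continuous_on S (\<lambda>x. md_sin \<kappa> (f x))"
  by (rule continuous_on_compose2[of UNIV "md_sin \<kappa>"])
    (auto intro!: continuous_at_imp_continuous_on intro: DERIV_isCont DERIV_md_sin)

lemma continuous_mpt: "continuous_on S (\<lambda>t. mpt \<kappa> P Q t)"
  unfolding mpt_def divide_inverse by (intro continuous_intros)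

lemma model_dist_positive: "A \<in> hat_plane \<kappa> \<Longrightarrow> B \<in> hat_plane \<kappa> \<Longrightarrow> A \<noteq> B \<Longrightarrow> 0 < model_dist \<kappa> A B"
proof -
  assume A: "A \<in> hat_plane \<kappa>" "B \<in> hat_plane \<kappa>" "A \<noteq> B"
  then have "model_dist \<kappa> A B \<noteq> 0" using model_dist_eq_0 by blast
  then show "0 < model_dist \<kappa> A B" using model_dist_props(2)[OF A(1,2)] by simp
qed

locale model_triangle =
  fixes \<kappa> :: real and a b c :: "real^3"
  assumes plane: "a \<in> model_plane \<kappa>" "b \<in> model_plane \<kappa>" "c \<in> model_plane \<kappa>"
    and indep: "det3 (hat \<kappa> a) (hat \<kappa> b) (hat \<kappa> c) \<noteq> 0"
    and sides: "\<kappa> > 0 \<Longrightarrow> model_dist \<kappa> a b < PP \<kappa>" "\<kappa> > 0 \<Longrightarrow> model_dist \<kappa> b c < PP \<kappa>" "\<kappa> > 0 \<Longrightarrow> model_dist \<kappa> c a < PP \<kappa>"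
begin

abbreviation "A \<equiv> hat \<kappa> a"
abbreviation "B \<equiv> hat \<kappa> b"
abbreviation "C \<equiv> hat \<kappa> c"
abbreviation "M \<equiv> model_plane \<kappa>"
abbreviation "tri \<equiv> geodesic_triangle \<kappa> a b c"

definition "c1 p = crd A B C (hat \<kappa> p)"
definition "c2 p = crd B C A (hat \<kappa> p)"
definition "c3 p = crd C A B (hat \<kappa> p)"
definition "MI s = {p \<in> M. hat \<kappa> p \<in> tri_int \<kappa> s A B C}"
definition "MR s = {p \<in> M. hat \<kappa> p \<in> tri_reg \<kappa> s A B C}"

lemma crd_expand': "hat \<kappa> p = c1 p *\<^sub>R A + c2 p *\<^sub>R B + c3 p *\<^sub>R C"
  unfolding c1_def c2_def c3_def by (rule crd_expand[OF indep])

lemma triangle_eq: "tri = {p \<in> M. c1 p \<ge> 0 \<and> c2 p \<ge> 0 \<and> c3 p \<ge> 0 \<and> (c1 p = 0 \<or> c2 p = 0 \<or> c3 p = 0)}"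
proof -
  have 1: "p \<in> model_segment \<kappa> a b \<longleftrightarrow> p \<in> M \<and> c1 p \<ge> 0 \<and> c2 p \<ge> 0 \<and> c3 p = 0" for p
  proof -
    have "c1 p = \<sigma> \<and> c2 p = \<tau> \<and> c3 p = 0" if "hat \<kappa> p = \<sigma> *\<^sub>R A + \<tau> *\<^sub>R B" for \<sigma> \<tau>
      using crd_combination[OF indep, of "hat \<kappa> p" \<sigma> \<tau> 0] that by (simp add: c1_def c2_def c3_def)
    moreover have "hat \<kappa> p = c1 p *\<^sub>R A + c2 p *\<^sub>R B" if "c3 p = 0" using crd_expand'[of p] that by simp
    ultimately have "(\<exists>\<sigma> \<tau>. \<sigma> \<ge> 0 \<and> \<tau> \<ge> 0 \<and> hat \<kappa> p = \<sigma> *\<^sub>R A + \<tau> *\<^sub>R B) \<longleftrightarrow> c1 p \<ge> 0 \<and> c2 p \<ge> 0 \<and> c3 p = 0"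
      by (rule cone_coordinates)
    moreover have "p \<in> model_segment \<kappa> a b \<longleftrightarrow> p \<in> M \<and> (\<exists>\<sigma> \<tau>. \<sigma> \<ge> 0 \<and> \<tau> \<ge> 0 \<and> hat \<kappa> p = \<sigma> *\<^sub>R A + \<tau> *\<^sub>R B)"
      by (rule model_segment_iff[OF plane(1,2) sides(1)])
    ultimately show ?thesis by simp
  qed
  have 2: "p \<in> model_segment \<kappa> b c \<longleftrightarrow> p \<in> M \<and> c2 p \<ge> 0 \<and> c3 p \<ge> 0 \<and> c1 p = 0" for p
  proof -
    have "c2 p = \<sigma> \<and> c3 p = \<tau> \<and> c1 p = 0" if "hat \<kappa> p = \<sigma> *\<^sub>R B + \<tau> *\<^sub>R C" for \<sigma> \<tau>
      using crd_combination[OF indep, of "hat \<kappa> p" 0 \<sigma> \<tau>] that by (simp add: c1_def c2_def c3_def)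
    moreover have "hat \<kappa> p = c2 p *\<^sub>R B + c3 p *\<^sub>R C" if "c1 p = 0" using crd_expand'[of p] that by simp
    ultimately have "(\<exists>\<sigma> \<tau>. \<sigma> \<ge> 0 \<and> \<tau> \<ge> 0 \<and> hat \<kappa> p = \<sigma> *\<^sub>R B + \<tau> *\<^sub>R C) \<longleftrightarrow> c2 p \<ge> 0 \<and> c3 p \<ge> 0 \<and> c1 p = 0"
      by (rule cone_coordinates)
    moreover have "p \<in> model_segment \<kappa> b c \<longleftrightarrow> p \<in> M \<and> (\<exists>\<sigma> \<tau>. \<sigma> \<ge> 0 \<and> \<tau> \<ge> 0 \<and> hat \<kappa> p = \<sigma> *\<^sub>R B + \<tau> *\<^sub>R C)"
      by (rule model_segment_iff[OF plane(2,3) sides(2)])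
    ultimately show ?thesis by simp
  qed
  have 3: "p \<in> model_segment \<kappa> c a \<longleftrightarrow> p \<in> M \<and> c3 p \<ge> 0 \<and> c1 p \<ge> 0 \<and> c2 p = 0" for p
  proof -
    have "c3 p = \<sigma> \<and> c1 p = \<tau> \<and> c2 p = 0" if "hat \<kappa> p = \<sigma> *\<^sub>R C + \<tau> *\<^sub>R A" for \<sigma> \<tau>
      using crd_combination[OF indep, of "hat \<kappa> p" \<tau> 0 \<sigma>] that by (simp add: c1_def c2_def c3_def)
    moreover have "hat \<kappa> p = c3 p *\<^sub>R C + c1 p *\<^sub>R A" if "c2 p = 0" using crd_expand'[of p] that by simp
    ultimately have "(\<exists>\<sigma> \<tau>. \<sigma> \<ge> 0 \<and> \<tau> \<ge> 0 \<and> hat \<kappa> p = \<sigma> *\<^sub>R C + \<tau> *\<^sub>R A) \<longleftrightarrow> c3 p \<ge> 0 \<and> c1 p \<ge> 0 \<and> c2 p = 0"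
      by (rule cone_coordinates)
    moreover have "p \<in> model_segment \<kappa> c a \<longleftrightarrow> p \<in> M \<and> (\<exists>\<sigma> \<tau>. \<sigma> \<ge> 0 \<and> \<tau> \<ge> 0 \<and> hat \<kappa> p = \<sigma> *\<^sub>R C + \<tau> *\<^sub>R A)"
      by (rule model_segment_iff[OF plane(3,1) sides(3)])
    ultimately show ?thesis by simp
  qed
  show ?thesis unfolding geodesic_triangle_def using 1 2 3 by auto
qed

lemma MI_iff: "p \<in> MI True \<longleftrightarrow> p \<in> M \<and> c1 p > 0 \<and> c2 p > 0 \<and> c3 p > 0"
  "p \<in> MI False \<longleftrightarrow> p \<in> M \<and> (c1 p < 0 \<or> c2 p < 0 \<or> c3 p < 0)"
  by (auto simp: MI_def tri_int_def c1_def c2_def c3_def hat_mem)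

lemma MR_iff: "p \<in> MR True \<longleftrightarrow> p \<in> M \<and> c1 p \<ge> 0 \<and> c2 p \<ge> 0 \<and> c3 p \<ge> 0"
  "p \<in> MR False \<longleftrightarrow> p \<in> M \<and> (c1 p \<le> 0 \<or> c2 p \<le> 0 \<or> c3 p \<le> 0)"
  by (auto simp: MR_def tri_reg_def c1_def c2_def c3_def hat_mem)

lemma MI_union: "M - tri = MI True \<union> MI False"
  unfolding triangle_eq by (auto simp: MI_iff)

lemma continuous_coords: "continuous_on S c1" "continuous_on S c2" "continuous_on S c3"
  unfolding c1_def[abs_def] c2_def[abs_def] c3_def[abs_def] by (rule continuous_crd_hat)+

text \<open>Off the triangle either all three coordinates are positive or one of them is negative;
  as the coordinates are continuous, these two conditions are open.\<close>

lemma connected_side: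
  assumes "connected K" "K \<subseteq> M - tri" shows "K \<subseteq> MI True \<or> K \<subseteq> MI False"
proof -
  let ?U = "{p. 0 < c1 p} \<inter> {p. 0 < c2 p} \<inter> {p. 0 < c3 p}" and ?V = "{p. c1 p < 0} \<union> {p. c2 p < 0} \<union> {p. c3 p < 0}"
  have "open ?U" "open ?V"
    by (intro open_Int open_Un open_Collect_less continuous_coords continuous_on_const)+
  moreover have "?U \<inter> ?V \<inter> K = {}" "K \<subseteq> ?U \<union> ?V" using assms(2) unfolding MI_union by (auto simp: MI_iff)
  ultimately consider "?U \<inter> K = {}" | "?V \<inter> K = {}" using connectedD[OF assms(1), of ?U ?V] by blast
  then show ?thesis
  proof cases
    case 1
    have "x \<in> MI False" if x: "x \<in> K" for x
    proof -
      have "x \<notin> MI True" using 1 x by (auto simp: MI_iff)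
      then show ?thesis using assms(2) x unfolding MI_union by blast
    qed
    then show ?thesis by blast
  next
    case 2
    have "x \<in> MI True" if x: "x \<in> K" for x
    proof -
      have "x \<notin> MI False" using 2 x by (auto simp: MI_iff)
      then show ?thesis using assms(2) x unfolding MI_union by blast
    qed
    then show ?thesis by blast
  qed
qed

lemma closed_plane: "closed M"
proof -
  consider "\<kappa> > 0" | "\<kappa> = 0" | "\<kappa> < 0" by linarith
  then show ?thesis
  proof cases
    case 2
    have "M = {p. p $ 3 = 0}" using 2 by (simp add: model_plane_def)
    then show ?thesis by (simp add: closed_Collect_eq continuous_on_component)
  next
    case 3
    \<comment> \<open>The weak inequality describes the same sheet and makes it closed: a point with
      third coordinate 0 has a nonnegative Lorentz square.\<close>
    have "M = {p. lorentz p p = 1 / \<kappa>} \<inter> {p. 0 \<le> p $ 3}"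
    proof -
      have "p $ 3 \<noteq> 0" if "lorentz p p = 1 / \<kappa>" for p
      proof
        assume "p $ 3 = 0"
        then have "lorentz p p \<ge> 0" by (simp add: lorentz_def)
        moreover have "1 / \<kappa> < 0" using 3 by simp
        ultimately show False using that by linarith
      qed
      then show ?thesis using 3 by (auto simp: model_plane_def order_le_less)
    qed
    then show ?thesis unfolding lorentz_def
      by (auto intro!: closed_Int closed_Collect_eq closed_Collect_le continuous_intros)
  qed (simp add: model_plane_def)
qed

text \<open>Geodesics from the center stay inside by \<open>tri_star\<close>. On a sphere they are
  well defined since the antipode of the center lies in neither the open nor the closed
  region.\<close>

lemma connected_MI:
  assumes o: "tri_center \<kappa> s A B C P"
  shows "connected (MI s)"
proof -
  have P: "P \<in> hat_plane \<kappa>" using o by (simp add: tri_center_def)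
  have o': "P - lift_vec \<kappa> \<in> MI s" using tri_int_center[OF o] P hat_mem[of \<kappa> "P - lift_vec \<kappa>"]
    by (simp add: MI_def hat_inverse)
  have "path_component (MI s) (P - lift_vec \<kappa>) q" if q: "q \<in> MI s" for q
  proof (cases "P = hat \<kappa> q")
    case True
    then have "q = P - lift_vec \<kappa>" by (simp add: hat_eq)
    then show ?thesis using o' by (simp add: path_component_refl)
  next
    case False
    let ?Q = "hat \<kappa> q" and ?D = "model_dist \<kappa> P (hat \<kappa> q)"
    have Q: "?Q \<in> tri_int \<kappa> s A B C" "?Q \<in> hat_plane \<kappa>" using q by (auto simp: MI_def hat_mem)
    have D: "0 < ?D" using model_dist_positive[OF P Q(2) False] .
    have DP: "\<kappa> > 0 \<Longrightarrow> ?D < PP \<kappa>"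
      using model_dist_less_PP[OF P Q(2) tri_center_antipode[OF o subsetD[OF tri_int_subset Q(1)]]] .
    have S: "md_sin \<kappa> ?D > 0" using D DP by (rule md_sin_pos)
    define g where "g t = mpt \<kappa> P ?Q (t * ?D) - lift_vec \<kappa>" for t
    have "path g" unfolding path_def g_def
      by (intro continuous_intros continuous_on_compose2[OF continuous_mpt _ subset_UNIV])
    moreover have "path_image g \<subseteq> MI s"
    proof
      fix u assume "u \<in> path_image g"
      then obtain t where t: "0 \<le> t" "t \<le> 1" "u = g t" unfolding path_image_def by auto
      have tD: "0 \<le> t * ?D" "t * ?D \<le> ?D" using t D by (auto simp: mult_left_le_one_le)
      have "mpt \<kappa> P ?Q (t * ?D) \<in> tri_int \<kappa> s A B C"
        using tri_star[OF o subsetD[OF tri_int_subset Q(1)] False tD(1)] Q(1) tD(2) by blast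
      moreover from this have "mpt \<kappa> P ?Q (t * ?D) \<in> hat_plane \<kappa>" by (simp add: tri_int_def)
      ultimately show "u \<in> MI s" using hat_mem[of \<kappa> u] by (simp add: t(3) g_def MI_def hat_inverse)
    qed
    moreover have "pathstart g = P - lift_vec \<kappa>" using S by (simp add: pathstart_def g_def mpt_def)
    moreover have "pathfinish g = q" using S by (simp add: pathfinish_def g_def mpt_def hat_eq)
    ultimately show ?thesis unfolding path_component_def by blast
  qed
  then have "path_connected (MI s)" unfolding path_connected_component
    by (meson path_component_sym path_component_trans)
  then show ?thesis by (rule path_connected_imp_connected)
qed

lemma component_MI:
  assumes o: "tri_center \<kappa> s A B C P" and p: "p \<in> MI s"
  shows "connected_component_set (M - tri) p = MI s"
proof
  have sub: "MI s \<subseteq> M - tri" unfolding MI_union by (cases s) auto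
  show "MI s \<subseteq> connected_component_set (M - tri) p"
    by (rule connected_component_maximal[OF p connected_MI[OF o] sub])
  have "p \<in> M - tri" using p sub by blast
  then have pin: "p \<in> connected_component_set (M - tri) p" using connected_component_refl by simp
  have disj: "MI True \<inter> MI False = {}" by (auto simp: MI_iff)
  have "p \<notin> MI (\<not> s)" using disj p by (cases s) auto
  moreover have "connected_component_set (M - tri) p \<subseteq> MI s \<or> connected_component_set (M - tri) p \<subseteq> MI (\<not> s)"
    using connected_side[OF connected_connected_component connected_component_subset, of p] by (cases s) auto
  ultimately show "connected_component_set (M - tri) p \<subseteq> MI s" using subsetD[OF _ pin] by metis
qed

text \<open>Each point of the closed region is the end of a geodesic from the center whose earlier
  points are in the open region.\<close>

lemma closure_MI:
  assumes o: "tri_center \<kappa> s A B C P"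
  shows "closure (MI s) = MR s"
proof
  have "closed (MR s)"
  proof (cases s)
    case True
    have "MR s = M \<inter> {p. 0 \<le> c1 p} \<inter> {p. 0 \<le> c2 p} \<inter> {p. 0 \<le> c3 p}" using True by (auto simp: MR_iff)
    then show ?thesis by (simp add: closed_Int closed_plane closed_Collect_le continuous_coords)
  next
    case False
    have "MR s = M \<inter> ({p. c1 p \<le> 0} \<union> {p. c2 p \<le> 0} \<union> {p. c3 p \<le> 0})" using False by (auto simp: MR_iff)
    then show ?thesis by (simp add: closed_Int closed_Un closed_plane closed_Collect_le continuous_coords)
  qed
  moreover have "MI s \<subseteq> MR s" using tri_int_subset[of \<kappa> s A B C] by (auto simp: MI_def MR_def)
  ultimately show "closure (MI s) \<subseteq> MR s" by (simp add: closure_minimal)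
  have P: "P \<in> hat_plane \<kappa>" using o by (simp add: tri_center_def)
  show "MR s \<subseteq> closure (MI s)"
  proof
    fix q assume q: "q \<in> MR s"
    let ?Q = "hat \<kappa> q" and ?D = "model_dist \<kappa> P (hat \<kappa> q)"
    have Q: "?Q \<in> tri_reg \<kappa> s A B C" "?Q \<in> hat_plane \<kappa>" using q by (auto simp: MR_def hat_mem)
    show "q \<in> closure (MI s)"
    proof (cases "P = ?Q")
      case True
      then have "q \<in> MI s" using tri_int_center[OF o] q by (simp add: MI_def MR_def)
      then show ?thesis using closure_subset by blast
    next
      case False
      have D: "0 < ?D" using model_dist_positive[OF P Q(2) False] .
      have DP: "\<kappa> > 0 \<Longrightarrow> ?D < PP \<kappa>" using model_dist_less_PP[OF P Q(2) tri_center_antipode[OF o Q(1)]] .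
      have S: "md_sin \<kappa> ?D > 0" using D DP by (rule md_sin_pos)
      define u where "u n = ?D * (1 - 1 / real (Suc n))" for n
      have un: "0 \<le> u n" "u n < ?D" for n using D by (auto simp: u_def field_simps)
      have in_MI: "mpt \<kappa> P ?Q (u n) - lift_vec \<kappa> \<in> MI s" for n
      proof -
        have "mpt \<kappa> P ?Q (u n) \<in> tri_int \<kappa> s A B C" by (rule tri_star[OF o Q(1) False un(1)]) (use un in auto)
        moreover from this have "mpt \<kappa> P ?Q (u n) \<in> hat_plane \<kappa>" by (simp add: tri_int_def)
        ultimately show ?thesis using hat_mem[of \<kappa> "mpt \<kappa> P ?Q (u n) - lift_vec \<kappa>"] by (simp add: MI_def hat_inverse)
      qed
      have "(\<lambda>n. 1 / real (Suc n)) \<longlonglongrightarrow> 0" using LIMSEQ_inverse_real_of_nat by (simp add: inverse_eq_divide)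
      then have "u \<longlonglongrightarrow> ?D * (1 - 0)" unfolding u_def by (intro tendsto_intros)
      then have "u \<longlonglongrightarrow> ?D" by simp
      then have "(\<lambda>n. mpt \<kappa> P ?Q (u n)) \<longlonglongrightarrow> mpt \<kappa> P ?Q ?D"
        by (rule isCont_tendsto_compose[rotated]) (use continuous_mpt[where P=P and Q="?Q" and S=UNIV and \<kappa>=\<kappa>] in \<open>simp add: continuous_on_eq_continuous_at\<close>)
      then have "(\<lambda>n. mpt \<kappa> P ?Q (u n) - lift_vec \<kappa>) \<longlonglongrightarrow> mpt \<kappa> P ?Q ?D - lift_vec \<kappa>" by (intro tendsto_intros)
      moreover have "mpt \<kappa> P ?Q ?D - lift_vec \<kappa> = q" using S by (simp add: mpt_def hat_eq)
      ultimately show ?thesis unfolding closure_sequential using in_MI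
        by (intro exI[of _ "\<lambda>n. mpt \<kappa> P ?Q (u n) - lift_vec \<kappa>"]) simp
    qed
  qed
qed

lemma bounded_MI:
  assumes "s \<or> \<kappa> > 0" shows "bounded (MI s)"
proof (cases "\<kappa> > 0")
  case True
  have "MI s \<subseteq> sphere 0 (1 / sqrt \<kappa>)" using True by (auto simp: MI_def model_plane_def)
  then show ?thesis using bounded_subset bounded_sphere by blast
next
  case False
  then have s: "s" and k: "\<kappa> \<le> 0" using assms by auto
  have mem: "A \<in> hat_plane \<kappa>" "B \<in> hat_plane \<kappa>" "C \<in> hat_plane \<kappa>" using plane by (simp_all add: hat_mem)
  have "norm p \<le> norm A + norm B + norm C + norm (lift_vec \<kappa>)" if p: "p \<in> MI s" for p
  proof -
    have c: "p \<in> M" "c1 p > 0" "c2 p > 0" "c3 p > 0" using p s MI_iff(1) by auto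
    let ?P = "hat \<kappa> p"
    have P: "?P \<in> hat_plane \<kappa>" using c(1) by (simp add: hat_mem)
    have ge1: "lf \<kappa> u v \<ge> 1" if "u \<in> hat_plane \<kappa>" "v \<in> hat_plane \<kappa>" for u v
      using lf_cos[OF that] k by (cases "\<kappa> = 0") (simp_all add: md_cos_def cosh_real_ge_1)
    have expand: "lf \<kappa> v ?P = c1 p * lf \<kappa> v A + c2 p * lf \<kappa> v B + c3 p * lf \<kappa> v C" for v
      by (subst crd_expand'[of p]) (simp add: lf_simps)
    \<comment> \<open>For \<kappa> \<le> 0 the values of \<open>lf\<close> between points of the
      plane are at least 1. Hence the coordinates of an inner point, being positive, are at most
      1.\<close>
    have one: "1 = c1 p * lf \<kappa> A ?P + c2 p * lf \<kappa> B ?P + c3 p * lf \<kappa> C ?P"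
      using expand[of ?P] lf_self[OF P] lf_commute[OF P] mem by simp
    have ge: "x * lf \<kappa> v ?P \<ge> x" if "x > 0" "v \<in> hat_plane \<kappa>" for x v
      using mult_left_mono[OF ge1[OF that(2) P], of x] that(1) by simp
    have "c1 p \<le> 1" "c2 p \<le> 1" "c3 p \<le> 1"
      using one ge[OF c(2) mem(1)] ge[OF c(3) mem(2)] ge[OF c(4) mem(3)] c by linarith+
    then have le: "norm (c1 p *\<^sub>R A) \<le> norm A" "norm (c2 p *\<^sub>R B) \<le> norm B" "norm (c3 p *\<^sub>R C) \<le> norm C"
      using c by (simp_all add: mult_left_le_one_le)
    have "p = hat \<kappa> p - lift_vec \<kappa>" by (simp add: hat_eq)
    also have "\<dots> = c1 p *\<^sub>R A + c2 p *\<^sub>R B + c3 p *\<^sub>R C - lift_vec \<kappa>" by (simp only: crd_expand'[of p])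
    finally have e: "p = c1 p *\<^sub>R A + c2 p *\<^sub>R B + c3 p *\<^sub>R C - lift_vec \<kappa>" .
    have "norm p \<le> norm (c1 p *\<^sub>R A + c2 p *\<^sub>R B + c3 p *\<^sub>R C) + norm (lift_vec \<kappa>)"
      by (subst e) (rule norm_triangle_ineq4)
    also have "norm (c1 p *\<^sub>R A + c2 p *\<^sub>R B + c3 p *\<^sub>R C) \<le> norm (c1 p *\<^sub>R A) + norm (c2 p *\<^sub>R B) + norm (c3 p *\<^sub>R C)"
      using norm_triangle_ineq[of "c1 p *\<^sub>R A + c2 p *\<^sub>R B" "c3 p *\<^sub>R C"] norm_triangle_ineq[of "c1 p *\<^sub>R A" "c2 p *\<^sub>R B"] by linarith
    finally show ?thesis using le by linarith
  qed
  then show ?thesis unfolding bounded_iff by blast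
qed

text \<open>For \<open>\<kappa> \<le> 0\<close> a geodesic ray from the center through a point outside the triangle stays outside.\<close>

lemma unbounded_outside:
  assumes k: "\<kappa> \<le> 0" and o: "tri_center \<kappa> True A B C P" and p: "p \<in> MI False"
  shows "\<not> bounded (connected_component_set (M - tri) p)"
proof -
  let ?Q = "hat \<kappa> p" and ?D = "model_dist \<kappa> P (hat \<kappa> p)"
  have P: "P \<in> hat_plane \<kappa>" and Q: "?Q \<in> hat_plane \<kappa>" using o p by (auto simp: tri_center_def MI_def hat_mem)
  have "P \<noteq> ?Q" using o p by (auto simp: tri_center_def MI_def tri_int_def)
  then have D: "0 < ?D" by (rule model_dist_positive[OF P Q])
  have k': "\<not> \<kappa> > 0" using k by simp
  define t where "t = (1 / md_sin \<kappa> ?D) *\<^sub>R tg \<kappa> P ?Q"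
  have t: "mpt \<kappa> P ?Q r = gexp \<kappa> P t r" "lf \<kappa> P t = 0" "mform \<kappa> t t = 1" "gexp \<kappa> P t ?D = ?Q" for r
    using mpt_gexp[OF P Q D] k' unfolding t_def by auto
  have S: "md_sin \<kappa> ?D > 0" by (rule md_sin_pos) (use D k in auto)
  define g where "g r = gexp \<kappa> P t r - lift_vec \<kappa>" for r
  have gN: "gexp \<kappa> P t r \<in> hat_plane \<kappa>" for r by (rule gexp_mem(1)[OF P t(2,3)])
  \<comment> \<open>Beyond \<open>?Q\<close> the weight \<open>u\<close> of the center is
    nonpositive, so a coordinate that is negative at \<open>?Q\<close> stays negative.\<close>
  have gMI: "g r \<in> MI False" if r: "r \<ge> ?D" for r
  proof -
    have Sr: "md_sin \<kappa> r > 0" by (rule md_sin_pos) (use D k r in auto)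
    have "md_sin \<kappa> (r - ?D) \<ge> 0" by (rule md_sin_nonneg) (use k r in auto)
    moreover have "md_sin \<kappa> (?D - r) = - md_sin \<kappa> (r - ?D)" using md_minus(2)[of \<kappa> "r - ?D"] by simp
    ultimately have m: "md_sin \<kappa> (?D - r) \<le> 0" by simp
    define u v where "u = md_sin \<kappa> (?D - r) / md_sin \<kappa> ?D" and "v = md_sin \<kappa> r / md_sin \<kappa> ?D"
    have u: "u \<le> 0" using S m by (simp add: u_def divide_nonpos_pos)
    have v: "v > 0" using Sr S by (simp add: v_def)
    have e: "gexp \<kappa> P t r = u *\<^sub>R P + v *\<^sub>R ?Q"
      using t(1)[of r] by (simp add: mpt_def u_def v_def)
    have neg: "u * x + v * y < 0" if "x > 0" "y < 0" for x y
      using mult_nonpos_nonneg[OF u less_imp_le[OF that(1)]] mult_pos_neg[OF v that(2)] by linarith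
    have "crd A B C ?Q < 0 \<or> crd B C A ?Q < 0 \<or> crd C A B ?Q < 0" using p by (simp add: MI_def tri_int_def)
    moreover have "crd A B C P > 0" "crd B C A P > 0" "crd C A B P > 0" using o by (simp_all add: tri_center_def)
    ultimately have "crd A B C (u *\<^sub>R P + v *\<^sub>R ?Q) < 0 \<or> crd B C A (u *\<^sub>R P + v *\<^sub>R ?Q) < 0 \<or> crd C A B (u *\<^sub>R P + v *\<^sub>R ?Q) < 0"
      unfolding crd_linear using neg by blast
    then have "gexp \<kappa> P t r \<in> tri_int \<kappa> False A B C" using gN[of r] unfolding tri_int_def e by simp
    then show ?thesis using gN[of r] hat_mem[of \<kappa> "g r"] by (simp add: g_def MI_def hat_inverse)
  qed
  have cont: "continuous_on {?D..} g"
    unfolding g_def t(1)[symmetric] by (intro continuous_intros continuous_mpt)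
  have "connected (g ` {?D..})" using cont by (rule connected_continuous_image) (simp add: convex_connected)
  moreover have "p \<in> g ` {?D..}" using t(4) by (intro image_eqI[of _ _ ?D]) (simp_all add: g_def hat_eq)
  moreover have "g ` {?D..} \<subseteq> M - tri" using gMI unfolding MI_union by auto
  ultimately have sub: "g ` {?D..} \<subseteq> connected_component_set (M - tri) p" by (intro connected_component_maximal)
  have "\<not> bounded (g ` {?D..})"
  proof
    assume "bounded (g ` {?D..})"
    then obtain K where K: "\<And>r. r \<ge> ?D \<Longrightarrow> norm (g r) \<le> K" unfolding bounded_iff by auto
    show False
    proof (cases "\<kappa> = 0")
      case True
      have e: "g r = (P - lift_vec \<kappa>) + r *\<^sub>R t" for r using True by (simp add: g_def gexp_def md_cos_def md_sin_def)
      have nt: "norm t = 1" using t(3) True by (simp add: mform_def norm_eq_1)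
      define r where "r = max ?D (K + norm (P - lift_vec \<kappa>) + 1)"
      have "r = norm (r *\<^sub>R t)" using nt D by (simp add: r_def)
      also have "r *\<^sub>R t = g r - (P - lift_vec \<kappa>)" by (simp add: e)
      also have "norm \<dots> \<le> norm (g r) + norm (P - lift_vec \<kappa>)" by (rule norm_triangle_ineq4)
      also have "\<dots> \<le> K + norm (P - lift_vec \<kappa>)" using K[of r] by (simp add: r_def)
      finally show False by (simp add: r_def)
    next
      case False
      then have kn: "\<kappa> < 0" using k by simp
      \<comment> \<open>A linear functional is bounded on bounded sets, whereas
        \<open>lf \<kappa> P\<close> grows along the ray as a hyperbolic cosine of the arc
        length.\<close>
      have lin: "linear (lf \<kappa> P)" by (rule linearI) (simp_all add: lf_simps)
      obtain L where L: "\<And>v. norm (lf \<kappa> P v) \<le> L * norm v" using linear_bounded[OF lin] by blast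
      have "r \<le> \<bar>L\<bar> * \<bar>K\<bar>" if "r \<ge> max 1 (sqrt (- \<kappa>) * ?D)" for r
      proof -
        let ?r = "r / sqrt (- \<kappa>)"
        have rD: "?r \<ge> ?D" using that kn by (simp add: pos_le_divide_eq mult.commute)
        have "r \<le> sinh r" using real_le_x_sinh[of r] that by (simp add: sinh_field_def exp_minus)
        also have "\<dots> \<le> cosh r" using sinh_less_cosh_real[of r] by simp
        also have "\<dots> = lf \<kappa> P (g ?r)" using gexp_mem(2)[OF P t(2,3), of ?r] kn by (simp add: g_def lift_vec_def md_cos_def)
        also have "\<dots> \<le> L * norm (g ?r)" using L[of "g ?r"] by simp
        also have "\<dots> \<le> \<bar>L\<bar> * \<bar>K\<bar>" using K[OF rD] by (intro mult_mono) auto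
        finally show ?thesis .
      qed
      from this[of "max (max 1 (sqrt (- \<kappa>) * ?D)) (\<bar>L\<bar> * \<bar>K\<bar> + 1)"] show False by auto
    qed
  qed
  then show ?thesis using sub bounded_subset by blast
qed

lemma tri_center_opposite:
  assumes "\<kappa> > 0" "tri_center \<kappa> s A B C P" shows "tri_center \<kappa> (\<not> s) A B C (- P)"
  using assms model_antipode(1)[OF assms(1), of P P] by (auto simp: tri_center_def crd_linear)

text \<open>On a sphere the antipode of a center is a center of the other side, so both components
  are treated alike; for \<kappa> \<le> 0 the outer component is unbounded.\<close>

theorem triangular_region_iff:
  assumes o: "tri_center \<kappa> s A B C P" "s \<or> \<kappa> > 0"
  shows "is_triangular_region \<kappa> a b c R \<longleftrightarrow> R = MR True \<or> \<kappa> > 0 \<and> R = MR False"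
proof -
  have oT: "\<exists>P. tri_center \<kappa> True A B C P" using o tri_center_opposite[of s P] by (cases s) auto
  have oF: "\<exists>P. tri_center \<kappa> False A B C P" if "\<kappa> > 0" using o tri_center_opposite[of s P] that by (cases s) auto
  have comp: "MI s \<in> components (M - tri)" if "tri_center \<kappa> s A B C P" for s P
  proof -
    have "P - lift_vec \<kappa> \<in> MI s" using tri_int_center[OF that] that hat_mem[of \<kappa> "P - lift_vec \<kappa>"]
      by (simp add: MI_def hat_inverse tri_center_def)
    moreover from this have "P - lift_vec \<kappa> \<in> M - tri" unfolding MI_union by (cases s) auto
    ultimately show ?thesis using component_MI[OF that] by (metis componentsI)
  qed
  show ?thesis
  proof
    assume "is_triangular_region \<kappa> a b c R"
    then obtain K where K: "K \<in> components (M - tri)" "bounded K" "R = closure K" unfolding is_triangular_region_def by blast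
    obtain p where p: "p \<in> M - tri" "K = connected_component_set (M - tri) p" using K(1) by (rule componentsE)
    consider "p \<in> MI True" | "p \<in> MI False" using p(1) unfolding MI_union by blast
    then show "R = MR True \<or> \<kappa> > 0 \<and> R = MR False"
    proof cases
      case 1
      then show ?thesis using oT component_MI closure_MI K(3) p(2) by metis
    next
      case 2
      have "\<kappa> > 0" using unbounded_outside[OF _ _ 2] oT K(2) p(2) by (metis not_le)
      then show ?thesis using oF component_MI[OF _ 2] closure_MI K(3) p(2) by metis
    qed
  next
    assume "R = MR True \<or> \<kappa> > 0 \<and> R = MR False"
    then show "is_triangular_region \<kappa> a b c R"
      unfolding is_triangular_region_def using oT oF comp bounded_MI closure_MI by metis
  qed
qed

end

section \<open>The model configuration\<close>

lemma md_cos_hk: "md_cos \<kappa> c = md_cos \<kappa> a * md_cos \<kappa> b + \<kappa> * hk \<kappa> a b c"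
  by (simp add: md_cos_eq hk_def algebra_simps)

text \<open>Leibniz' formula for the squared distance from an affine combination, valid for any
  bilinear form. It yields the distances from the center in the flat case.\<close>

lemma mform_combination3:
  fixes A B C P :: "real^3" and \<kappa> :: real
  defines "q u v \<equiv> mform \<kappa> (u - v) (u - v)"
  assumes s: "a + b + c = 1" and P: "P = a *\<^sub>R A + b *\<^sub>R B + c *\<^sub>R C"
  shows "q P U = a * q A U + b * q B U + c * q C U - (a * b * q A B + b * c * q B C + c * a * q C A)"
proof -
  have 1: "P - U = a *\<^sub>R (A - U) + b *\<^sub>R (B - U) + c *\<^sub>R (C - U)"
  proof -
    have "U = (a + b + c) *\<^sub>R U" using s by simp
    then show ?thesis unfolding P by (simp add: algebra_simps)
  qed
  define x y z where "x = A - U" and "y = B - U" and "z = C - U"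
  have 2: "A - B = x - y" "B - C = y - z" "C - A = z - x" by (simp_all add: x_def y_def z_def)
  have comm: "mform \<kappa> y x = mform \<kappa> x y" "mform \<kappa> z x = mform \<kappa> x z" "mform \<kappa> z y = mform \<kappa> y z"
    using mform_commute by blast+
  define xx yy zz xy yz xz where "xx = mform \<kappa> x x" and "yy = mform \<kappa> y y" and "zz = mform \<kappa> z z"
    and "xy = mform \<kappa> x y" and "yz = mform \<kappa> y z" and "xz = mform \<kappa> x z"
  have c: "c = 1 - a - b" using s by simp
  show ?thesis unfolding q_def 1 2 x_def[symmetric] y_def[symmetric] z_def[symmetric]
    apply (simp add: mform_simps comm flip: xx_def yy_def zz_def xy_def yz_def xz_def)
    unfolding c by (simp add: algebra_simps)
qed

text \<open>The weights of the barycenter are the sines of the opposite angles.\<close>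

lemma angle_sum_relation:
  fixes \<alpha> \<beta> \<gamma> :: real
  assumes "\<alpha> + \<beta> + \<gamma> = 2 * pi"
  shows "sin \<beta> + cos \<alpha> * sin \<gamma> + cos \<gamma> * sin \<alpha> = 0"
proof -
  have "\<alpha> + \<gamma> = 2 * pi - \<beta>" using assms by simp
  then have "sin (\<alpha> + \<gamma>) = sin (2 * pi - \<beta>)" by simp
  also have "\<dots> = - sin \<beta>" by (simp add: sin_diff)
  finally show ?thesis by (simp add: sin_add algebra_simps)
qed

text \<open>For angle pi, \<open>md_m\<close> agrees at \<open>dist a b\<close> and at
  \<open>dist x a + dist x b\<close>. By strict monotonicity the arguments agree and
  \<open>x\<close> is between \<open>a\<close> and \<open>b\<close>; on a sphere a sum beyond
  \<open>PP \<kappa>\<close> is excluded by reflection and the bound on the perimeter.\<close>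

lemma hinge_angle_less_pi:
  fixes x a b :: "'a::metric_space"
  assumes ok: "okp \<kappa> (peri x a b)" and ne: "x \<noteq> a" "x \<noteq> b" and x: "x \<notin> metric_interval a b"
  shows "comparison_angle \<kappa> x a b < pi"
proof (rule ccontr)
  assume "\<not> ?thesis"
  then have "comparison_angle \<kappa> x a b = pi" using cos_comparison_angle(3)[OF ok ne] by simp
  then have "hk \<kappa> (dist x a) (dist x b) (dist a b) = hk \<kappa> (dist x a) (dist x b) (dist x a + dist x b)"
    using cos_comparison_angle(1)[OF ok ne] by (simp add: hk_sum)
  then have m: "md_m \<kappa> (dist a b) = md_m \<kappa> (dist x a + dist x b)" by (simp add: hk_def)
  have ab: "dist a b \<le> dist x a + dist x b" using dist_triangle3[of a b x] .
  have p: "peri x a b = dist x a + dist x b + dist a b" by (simp add: peri_def dist_commute)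
  have "dist a b = dist x a + dist x b"
  proof (cases "\<kappa> > 0 \<and> dist x a + dist x b > PP \<kappa>")
    case True
    then have k: "\<kappa> > 0" by blast
    have "2 * dist a b \<le> peri x a b" using ab p by simp
    then have l: "dist a b < PP \<kappa>" using okp_half[OF ok _ k] by blast
    have "dist a b < 2 * pi / sqrt \<kappa> - (dist x a + dist x b)" using ok k p by (simp add: okp_def)
    then have "md_m \<kappa> (dist a b) < md_m \<kappa> (2 * pi / sqrt \<kappa> - (dist x a + dist x b))"
      by (rule md_m_strict_mono[rotated]) (use True in auto)
    then show ?thesis using m md_m_reflect(1)[OF k] by simp
  next
    case False
    show ?thesis
    proof (rule ccontr)
      assume "dist a b \<noteq> dist x a + dist x b"
      then have "dist a b < dist x a + dist x b" using ab by simp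
      then have "md_m \<kappa> (dist a b) < md_m \<kappa> (dist x a + dist x b)"
        by (rule md_m_strict_mono[rotated]) (use False in auto)
      then show False using m by simp
    qed
  qed
  then show False using x by (simp add: metric_interval_def dist_commute)
qed

text \<open>A vanishing positive combination would put \<open>- C\<close> on the segment
  \<open>[A, B]\<close> and make the perimeter critical.\<close>

lemma nonzero_combination:
  assumes N: "A \<in> hat_plane \<kappa>" "B \<in> hat_plane \<kappa>" "C \<in> hat_plane \<kappa>" and pos: "a > 0" "b > 0" "c > 0"
    and ok: "okp \<kappa> (model_dist \<kappa> A B + model_dist \<kappa> B C + model_dist \<kappa> C A)" and k: "\<kappa> > 0"
  shows "a *\<^sub>R A + b *\<^sub>R B + c *\<^sub>R C \<noteq> 0"
proof
  assume z: "a *\<^sub>R A + b *\<^sub>R B + c *\<^sub>R C = 0"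
  have "c *\<^sub>R (- C) = a *\<^sub>R A + b *\<^sub>R B"
  proof -
    have "a *\<^sub>R A + b *\<^sub>R B = - (c *\<^sub>R C)" using z by (simp only: eq_neg_iff_add_eq_0)
    then show ?thesis by simp
  qed
  then have "(1 / c) *\<^sub>R (c *\<^sub>R (- C)) = (1 / c) *\<^sub>R (a *\<^sub>R A + b *\<^sub>R B)" by simp
  then have e: "- C = (a / c) *\<^sub>R A + (b / c) *\<^sub>R B" using pos by (simp add: scaleR_add_right)
  have mC: "- C \<in> hat_plane \<kappa>" using model_antipode(1)[OF k N(1,3)] .
  have "model_dist \<kappa> A B = model_dist \<kappa> A (- C) + model_dist \<kappa> (- C) B"
    by (rule cone_between[OF N(1) mC N(2) e]) (use pos in auto)
  moreover have "model_dist \<kappa> A (- C) = PP \<kappa> - model_dist \<kappa> C A"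
    using model_antipode(2)[OF k N(1,3)] model_dist_commute[OF N(1,3)] by simp
  moreover have "model_dist \<kappa> (- C) B = PP \<kappa> - model_dist \<kappa> B C"
    using model_antipode(2)[OF k N(2,3)] model_dist_commute[OF mC N(2)] by simp
  ultimately show False using ok k by (simp add: okp_def)
qed

text \<open>Strictness in Cauchy-Schwarz makes the tangent vectors towards \<open>Y\<close> and
  \<open>Z\<close> independent, so in a relation between \<open>X\<close>, \<open>Y\<close>,
  \<open>Z\<close> only \<open>X\<close> can have a nonzero coefficient.\<close>

lemma hinge_independent:
  assumes N: "X \<in> hat_plane \<kappa>" "Y \<in> hat_plane \<kappa>" "Z \<in> hat_plane \<kappa>"
    and g: "\<bar>mform \<kappa> (tg \<kappa> X Y) (tg \<kappa> X Z)\<bar> < md_sin \<kappa> (model_dist \<kappa> X Y) * md_sin \<kappa> (model_dist \<kappa> X Z)"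
  shows "det3 X Y Z \<noteq> 0"
proof
  assume det: "det3 X Y Z = 0"
  let ?u = "tg \<kappa> X Y" and ?v = "tg \<kappa> X Z"
  let ?s = "md_sin \<kappa> (model_dist \<kappa> X Y)" and ?t = "md_sin \<kappa> (model_dist \<kappa> X Z)"
  define h where "h = mform \<kappa> ?u ?v"
  have n: "mform \<kappa> ?u ?u = ?s\<^sup>2" "mform \<kappa> ?v ?v = ?t\<^sup>2" using tg_norm N by auto
  have h2: "h\<^sup>2 < (?s * ?t)\<^sup>2"
  proof -
    have "\<bar>h\<bar> < \<bar>?s * ?t\<bar>" using g by (simp add: h_def)
    then show ?thesis by (metis abs_le_square_iff not_le)
  qed
  have zero: "\<beta> = 0 \<and> \<gamma> = 0" if r: "\<alpha> *\<^sub>R X + \<beta> *\<^sub>R Y + \<gamma> *\<^sub>R Z = 0" for \<alpha> \<beta> \<gamma>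
  proof -
    have t: "\<beta> *\<^sub>R ?u + \<gamma> *\<^sub>R ?v = 0" using arg_cong[OF r, of "tg \<kappa> X"] N by (simp add: tg_simps)
    have 1: "\<beta> * ?s\<^sup>2 + \<gamma> * h = 0" using arg_cong[OF t, of "mform \<kappa> ?u"] by (simp add: mform_simps n h_def)
    have 2: "\<beta> * h + \<gamma> * ?t\<^sup>2 = 0" using arg_cong[OF t, of "mform \<kappa> ?v"] mform_commute[of \<kappa> ?v ?u] by (simp add: mform_simps n h_def)
    have "\<beta> * ((?s * ?t)\<^sup>2 - h\<^sup>2) = ?t\<^sup>2 * (\<beta> * ?s\<^sup>2 + \<gamma> * h) - h * (\<beta> * h + \<gamma> * ?t\<^sup>2)" by algebra
    then have "\<beta> = 0" using 1 2 h2 by simp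
    moreover have "\<gamma> * ((?s * ?t)\<^sup>2 - h\<^sup>2) = ?s\<^sup>2 * (\<beta> * h + \<gamma> * ?t\<^sup>2) - h * (\<beta> * ?s\<^sup>2 + \<gamma> * h)" by algebra
    then have "\<gamma> = 0" using 1 2 h2 by simp
    ultimately show ?thesis by simp
  qed
  \<comment> \<open>If the determinant vanishes, Cramer's rule gives such a relation for every
    \<open>p\<close>. Its coefficient at \<open>Z\<close> is \<open>det3 X Y p\<close>, and so
    \<open>X\<close> and \<open>Y\<close> are parallel.\<close>
  have e: "det3 p Y Z *\<^sub>R X + det3 X p Z *\<^sub>R Y + det3 X Y p *\<^sub>R Z = 0" for p
    using det3_expand[of X Y Z p] det by simp
  have "det3 X Y p = 0" for p using zero[OF e] by blast
  then have "det3 X Y (cross3 X Y) = 0" by blast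
  then have "cross3 X Y \<bullet> cross3 X Y = 0" by (simp add: det3_def cross3_def inner_vec_def sum_3 vector_3 algebra_simps)
  then have c: "cross3 X Y = 0" by simp
  have X0: "X \<noteq> 0" using lf_self[OF N(1)] by (auto simp: lf_simps)
  then have "\<exists>c. Y = c *\<^sub>R X" using c by (simp add: cross_eq_0 collinear_lemma) auto
  then have "?u = 0" using tg_eq_0_iff[OF N(1)] by blast
  then have "?s = 0" using n(1) by (simp add: mform_simps)
  then show False using g by simp
qed

text \<open>The model point \<open>X\<close> corresponding to \<open>x\<close>; \<open>r < 0\<close> happens on spheres, when \<open>X\<close> lies outside
  the small triangle.\<close>

lemma model_center_exists:
  fixes x y z w :: "'a::metric_space"
  assumes quad: "quadruple x y z w"
    and ok: "okp \<kappa> (peri x y z)" "okp \<kappa> (peri x z w)" "okp \<kappa> (peri x w y)" "okp \<kappa> (peri y z w)"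
    and x: "x \<notin> metric_interval y z \<union> metric_interval z w \<union> metric_interval w y"
    and sum: "comparison_angle \<kappa> x y z + comparison_angle \<kappa> x z w + comparison_angle \<kappa> x w y = 2 * pi"
    and N: "Y \<in> hat_plane \<kappa>" "Z \<in> hat_plane \<kappa>" "W \<in> hat_plane \<kappa>"
    and d: "model_dist \<kappa> Y Z = dist y z" "model_dist \<kappa> Z W = dist z w" "model_dist \<kappa> W Y = dist w y"
  obtains X ly lz lw r where "X \<in> hat_plane \<kappa>" "ly > 0" "lz > 0" "lw > 0" "r \<noteq> 0" "\<kappa> \<le> 0 \<Longrightarrow> r > 0"
    "ly *\<^sub>R Y + lz *\<^sub>R Z + lw *\<^sub>R W = r *\<^sub>R X"
    "model_dist \<kappa> X Y = dist x y" "model_dist \<kappa> X Z = dist x z" "model_dist \<kappa> X W = dist x w" "det3 X Y Z \<noteq> 0"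
proof -
  have ne: "x \<noteq> y" "x \<noteq> z" "x \<noteq> w" using quad by (auto simp: quadruple_def)
  define \<alpha> \<beta> \<gamma> where "\<alpha> = comparison_angle \<kappa> x y z" and "\<beta> = comparison_angle \<kappa> x z w" and "\<gamma> = comparison_angle \<kappa> x w y"
  have lt: "\<alpha> < pi" "\<beta> < pi" "\<gamma> < pi"
    unfolding \<alpha>_def \<beta>_def \<gamma>_def using hinge_angle_less_pi[OF ok(1) ne(1,2)] hinge_angle_less_pi[OF ok(2) ne(2,3)]
      hinge_angle_less_pi[OF ok(3) ne(3,1)] x by auto
  have s2: "\<alpha> + \<beta> + \<gamma> = 2 * pi" using sum by (simp add: \<alpha>_def \<beta>_def \<gamma>_def)
  then have gt: "\<alpha> > 0" "\<beta> > 0" "\<gamma> > 0" using lt by linarith+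
  have sn: "sin \<alpha> > 0" "sin \<beta> > 0" "sin \<gamma> > 0" using gt lt by (auto intro: sin_gt_zero)
  define Sy Sz Sw where "Sy = md_sin \<kappa> (dist x y)" and "Sz = md_sin \<kappa> (dist x z)" and "Sw = md_sin \<kappa> (dist x w)"
  define Cy Cz Cw where "Cy = md_cos \<kappa> (dist x y)" and "Cz = md_cos \<kappa> (dist x z)" and "Cw = md_cos \<kappa> (dist x w)"
  have Sp: "Sy > 0" "Sz > 0" "Sw > 0" unfolding Sy_def Sz_def Sw_def
    using ne peri_dist_less[OF ok(1)] peri_dist_less[OF ok(2)] by (auto intro!: md_sin_pos)
  define Kyz Kzw Kwy where "Kyz = hk \<kappa> (dist x y) (dist x z) (dist y z)" and "Kzw = hk \<kappa> (dist x z) (dist x w) (dist z w)"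
    and "Kwy = hk \<kappa> (dist x w) (dist x y) (dist w y)"
  have K: "Kyz = Sy * Sz * cos \<alpha>" "Kzw = Sz * Sw * cos \<beta>" "Kwy = Sw * Sy * cos \<gamma>"
    using cos_comparison_angle(1)[OF ok(1) ne(1,2)] cos_comparison_angle(1)[OF ok(2) ne(2,3)] cos_comparison_angle(1)[OF ok(3) ne(3,1)]
    by (simp_all add: Kyz_def Kzw_def Kwy_def Sy_def Sz_def Sw_def \<alpha>_def \<beta>_def \<gamma>_def)
  define ly lz lw where "ly = sin \<beta> / Sy" and "lz = sin \<gamma> / Sz" and "lw = sin \<alpha> / Sw"
  have l: "ly > 0" "lz > 0" "lw > 0" using sn Sp by (simp_all add: ly_def lz_def lw_def)
  have lS: "ly * Sy = sin \<beta>" "lz * Sz = sin \<gamma>" "lw * Sw = sin \<alpha>" using Sp by (simp_all add: ly_def lz_def lw_def)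
  have ker: "ly * Sy\<^sup>2 + lz * Kyz + lw * Kwy = 0" "ly * Kyz + lz * Sz\<^sup>2 + lw * Kzw = 0" "ly * Kwy + lz * Kzw + lw * Sw\<^sup>2 = 0"
  proof -
    have "ly * Sy\<^sup>2 + lz * Kyz + lw * Kwy = Sy * (ly * Sy + cos \<alpha> * (lz * Sz) + cos \<gamma> * (lw * Sw))"
      by (simp add: K power2_eq_square algebra_simps)
    then show "ly * Sy\<^sup>2 + lz * Kyz + lw * Kwy = 0" using angle_sum_relation[OF s2] by (simp add: lS)
    have "ly * Kyz + lz * Sz\<^sup>2 + lw * Kzw = Sz * (lz * Sz + cos \<beta> * (lw * Sw) + cos \<alpha> * (ly * Sy))"
      by (simp add: K power2_eq_square algebra_simps)
    moreover have "lz * Sz + cos \<beta> * (lw * Sw) + cos \<alpha> * (ly * Sy) = 0" unfolding lS by (rule angle_sum_relation) (use s2 in simp)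
    ultimately show "ly * Kyz + lz * Sz\<^sup>2 + lw * Kzw = 0" by simp
    have "ly * Kwy + lz * Kzw + lw * Sw\<^sup>2 = Sw * (lw * Sw + cos \<gamma> * (ly * Sy) + cos \<beta> * (lz * Sz))"
      by (simp add: K power2_eq_square algebra_simps)
    moreover have "lw * Sw + cos \<gamma> * (ly * Sy) + cos \<beta> * (lz * Sz) = 0" unfolding lS by (rule angle_sum_relation) (use s2 in simp)
    ultimately show "ly * Kwy + lz * Kzw + lw * Sw\<^sup>2 = 0" by simp
  qed
  define V where "V = ly *\<^sub>R Y + lz *\<^sub>R Z + lw *\<^sub>R W"
  define r where "r = ly * Cy + lz * Cz + lw * Cw"
  have self: "(md_cos \<kappa> t)\<^sup>2 + \<kappa> * (md_sin \<kappa> t)\<^sup>2 = 1" for t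
    unfolding md_sin_sq by (simp add: md_cos_eq power2_eq_square algebra_simps)
  have selfC: "Cy\<^sup>2 + \<kappa> * Sy\<^sup>2 = 1" "Cz\<^sup>2 + \<kappa> * Sz\<^sup>2 = 1" "Cw\<^sup>2 + \<kappa> * Sw\<^sup>2 = 1"
    using self by (simp_all add: Cy_def Cz_def Cw_def Sy_def Sz_def Sw_def)
  have comm: "model_dist \<kappa> Z Y = dist y z" "model_dist \<kappa> W Z = dist z w" "model_dist \<kappa> Y W = dist w y"
    using d model_dist_commute[OF N(1,2)] model_dist_commute[OF N(2,3)] model_dist_commute[OF N(3,1)] by simp_all
  have cyz: "md_cos \<kappa> (dist y z) = Cy * Cz + \<kappa> * Kyz" "md_cos \<kappa> (dist z w) = Cz * Cw + \<kappa> * Kzw" "md_cos \<kappa> (dist w y) = Cw * Cy + \<kappa> * Kwy"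
    by (simp_all add: Cy_def Cz_def Cw_def Kyz_def Kzw_def Kwy_def flip: md_cos_hk)
  \<comment> \<open>The kernel relations remove the \<open>hk\<close> terms, so that
    \<open>lf\<close> at each vertex takes on \<open>V\<close> the value \<open>r\<close> times the
    cosine of the distance from \<open>x\<close>. Thus \<open>V / r\<close> is the point
    sought.\<close>
  have lfV: "lf \<kappa> Y V = Cy * r" "lf \<kappa> Z V = Cz * r" "lf \<kappa> W V = Cw * r"
  proof -
    have "lf \<kappa> Y V = ly * 1 + lz * (Cy * Cz + \<kappa> * Kyz) + lw * (Cw * Cy + \<kappa> * Kwy)"
      using lf_cos[OF N(1,2)] lf_cos[OF N(1,3)] N d comm cyz by (simp add: V_def lf_simps)
    also have "\<dots> = Cy * r + \<kappa> * (ly * Sy\<^sup>2 + lz * Kyz + lw * Kwy)"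
      unfolding selfC(1)[symmetric] by (simp add: r_def power2_eq_square algebra_simps)
    finally show "lf \<kappa> Y V = Cy * r" using ker by simp
    have "lf \<kappa> Z V = ly * (Cy * Cz + \<kappa> * Kyz) + lz * 1 + lw * (Cz * Cw + \<kappa> * Kzw)"
      using lf_cos[OF N(2,1)] lf_cos[OF N(2,3)] N d comm cyz by (simp add: V_def lf_simps)
    also have "\<dots> = Cz * r + \<kappa> * (ly * Kyz + lz * Sz\<^sup>2 + lw * Kzw)"
      unfolding selfC(2)[symmetric] by (simp add: r_def power2_eq_square algebra_simps)
    finally show "lf \<kappa> Z V = Cz * r" using ker by simp
    have "lf \<kappa> W V = ly * (Cw * Cy + \<kappa> * Kwy) + lz * (Cz * Cw + \<kappa> * Kzw) + lw * 1"
      using lf_cos[OF N(3,1)] lf_cos[OF N(3,2)] N d comm cyz by (simp add: V_def lf_simps)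
    also have "\<dots> = Cw * r + \<kappa> * (ly * Kwy + lz * Kzw + lw * Sw\<^sup>2)"
      unfolding selfC(3)[symmetric] by (simp add: r_def power2_eq_square algebra_simps)
    finally show "lf \<kappa> W V = Cw * r" using ker by simp
  qed
  have gVV: "\<kappa> * mform \<kappa> V V = r\<^sup>2" if "\<kappa> \<noteq> 0"
  proof -
    have "\<kappa> * mform \<kappa> V V = ly * lf \<kappa> Y V + lz * lf \<kappa> Z V + lw * lf \<kappa> W V"
      using that by (subst (2) V_def) (simp add: lf_def mform_simps algebra_simps)
    then show ?thesis using lfV by (simp add: r_def power2_eq_square algebra_simps)
  qed
  have rpos: "r > 0" if "\<kappa> \<le> 0"
    unfolding r_def using md_cos_pos_nonpos[OF that] l by (simp add: Cy_def Cz_def Cw_def add_pos_pos)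
  \<comment> \<open>Only the sphere is at stake, as \<open>r\<close> is positive otherwise. There
    \<open>r = 0\<close> would make \<open>V\<close> vanish, against the bound on the perimeter of
    \<open>y\<close>, \<open>z\<close>, \<open>w\<close>.\<close>
  have r0: "r \<noteq> 0"
  proof
    assume r: "r = 0"
    then have k: "\<kappa> > 0" using rpos by force
    then have "V = 0" using gVV r by (simp add: mform_def)
    then show False using nonzero_combination[OF N l _ k] ok(4) d by (simp add: V_def peri_def)
  qed
  define X where "X = (1 / r) *\<^sub>R V"
  have rX: "ly *\<^sub>R Y + lz *\<^sub>R Z + lw *\<^sub>R W = r *\<^sub>R X" using r0 by (simp add: X_def V_def)
  have lfX: "lf \<kappa> Y X = Cy" "lf \<kappa> Z X = Cz" "lf \<kappa> W X = Cw" using lfV r0 by (simp_all add: X_def lf_simps)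
  have XN: "X \<in> hat_plane \<kappa>"
  proof (cases "\<kappa> = 0")
    case True
    then show ?thesis using lfX(1) by (simp add: lf_def hat_plane_def Cy_def md_cos_def)
  next
    case False
    have "mform \<kappa> X X = mform \<kappa> V V / r\<^sup>2" by (simp add: X_def mform_simps power2_eq_square)
    also have "\<dots> = 1 / \<kappa>" using gVV[OF False] r0 False by (simp add: field_simps)
    finally have mm: "mform \<kappa> X X = 1 / \<kappa>" .
    show ?thesis
    proof (cases "\<kappa> > 0")
      case True
      then show ?thesis using mm by (simp add: hat_plane_pos mform_def)
    next
      case F: False
      then have k: "\<kappa> < 0" using False by simp
      have "lf \<kappa> Y X > 0" unfolding lfX Cy_def by (rule md_cos_pos_nonpos) (use k in simp)
      then show ?thesis by (rule hat_plane_negI[OF k N(1) mm])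
    qed
  qed
  have dist_from: "model_dist \<kappa> X A = t" if A: "A \<in> hat_plane \<kappa>" and m: "mu \<kappa> X A = md_m \<kappa> t" and t: "0 \<le> t" "\<kappa> > 0 \<Longrightarrow> t < PP \<kappa>" for A t
    by (rule model_dist_eqI[OF XN A m t(1)]) (use t(2) in force)
  have mus: "mu \<kappa> X Y = md_m \<kappa> (dist x y) \<and> mu \<kappa> X Z = md_m \<kappa> (dist x z) \<and> mu \<kappa> X W = md_m \<kappa> (dist x w)"
  proof (cases "\<kappa> = 0")
    case False
    then show ?thesis using lfX lf_mu[OF N(1) XN] lf_mu[OF N(2) XN] lf_mu[OF N(3) XN]
      by (simp add: Cy_def Cz_def Cw_def md_cos_eq mu_commute[of \<kappa> X])
  next
    case True
    have C1: "Cy = 1" "Cz = 1" "Cw = 1" using True by (simp_all add: Cy_def Cz_def Cw_def md_cos_def)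
    define my mz mw where "my = md_m \<kappa> (dist x y)" and "mz = md_m \<kappa> (dist x z)" and "mw = md_m \<kappa> (dist x w)"
    have mm: "mu \<kappa> Y Z = my + mz - Kyz" "mu \<kappa> Z W = mz + mw - Kzw" "mu \<kappa> W Y = mw + my - Kwy"
      using True model_dist_props(1)[OF N(1,2)] model_dist_props(1)[OF N(2,3)] model_dist_props(1)[OF N(3,1)] d
      by (simp_all add: my_def mz_def mw_def Kyz_def Kzw_def Kwy_def hk_def)
    have SS: "Sy\<^sup>2 = 2 * my" "Sz\<^sup>2 = 2 * mz" "Sw\<^sup>2 = 2 * mw"
      using True by (simp_all add: Sy_def Sz_def Sw_def my_def mz_def mw_def md_sin_sq)
    have rs: "r = ly + lz + lw" using C1 by (simp add: r_def)
    define a b c where "a = ly / r" and "b = lz / r" and "c = lw / r"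
    have abc: "a + b + c = 1" using r0 rs by (simp add: a_def b_def c_def add_divide_distrib[symmetric])
    have Xe: "X = a *\<^sub>R Y + b *\<^sub>R Z + c *\<^sub>R W" by (simp add: X_def V_def a_def b_def c_def scaleR_add_right)
    have kr: "a * (2 * my) + b * Kyz + c * Kwy = 0" "a * Kyz + b * (2 * mz) + c * Kzw = 0" "a * Kwy + b * Kzw + c * (2 * mw) = 0"
      using ker unfolding SS a_def b_def c_def by (simp_all add: add_divide_distrib[symmetric])
    have q0: "mu \<kappa> u u = 0" for u by (simp add: mu_def mform_simps)
    \<comment> \<open>In the flat case \<open>lf\<close> contains no distances; they come from
      Leibniz' formula, with the weights normalized to sum 1.\<close>
    have f: "mu \<kappa> X U = a * mu \<kappa> Y U + b * mu \<kappa> Z U + c * mu \<kappa> W U - (a * b * mu \<kappa> Y Z + b * c * mu \<kappa> Z W + c * a * mu \<kappa> W Y)" for U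
      using mform_combination3[OF abc Xe, of \<kappa> U] unfolding mu_def by (simp add: field_simps)
    define T where "T = a * b * (my + mz - Kyz) + b * c * (mz + mw - Kzw) + c * a * (mw + my - Kwy)"
    have cc: "c = 1 - a - b" using abc by simp
    have T: "T = a * my + b * mz + c * mw"
    proof -
      have "T = (a + b + c) * (a * my + b * mz + c * mw)
         - (a * (a * (2 * my) + b * Kyz + c * Kwy) + b * (a * Kyz + b * (2 * mz) + c * Kzw) + c * (a * Kwy + b * Kzw + c * (2 * mw))) / 2"
        unfolding T_def by (simp add: field_simps)
      then show ?thesis unfolding kr abc by simp
    qed
    have 1: "mu \<kappa> X Y = b * (my + mz - Kyz) + c * (mw + my - Kwy) - T"
      using f[of Y] mm mu_commute[of \<kappa> Z Y] by (simp add: q0 T_def)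
    have 2: "mu \<kappa> X Z = a * (my + mz - Kyz) + c * (mz + mw - Kzw) - T"
      using f[of Z] mm mu_commute[of \<kappa> W Z] by (simp add: q0 T_def)
    have 3: "mu \<kappa> X W = a * (mw + my - Kwy) + b * (mz + mw - Kzw) - T"
      using f[of W] mm mu_commute[of \<kappa> Y W] by (simp add: q0 T_def)
    have "mu \<kappa> X Y = (a + b + c) * my - (a * (2 * my) + b * Kyz + c * Kwy)" unfolding 1 T by (simp add: algebra_simps)
    moreover have "mu \<kappa> X Z = (a + b + c) * mz - (a * Kyz + b * (2 * mz) + c * Kzw)" unfolding 2 T by (simp add: algebra_simps)
    moreover have "mu \<kappa> X W = (a + b + c) * mw - (a * Kwy + b * Kzw + c * (2 * mw))" unfolding 3 T by (simp add: algebra_simps)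
    ultimately show ?thesis unfolding kr abc by (simp add: my_def mz_def mw_def)
  qed
  have dX: "model_dist \<kappa> X Y = dist x y" "model_dist \<kappa> X Z = dist x z" "model_dist \<kappa> X W = dist x w"
    using dist_from[OF N(1) _ zero_le_dist peri_dist_less(1)[OF ok(1)]] dist_from[OF N(2) _ zero_le_dist peri_dist_less(2)[OF ok(1)]]
      dist_from[OF N(3) _ zero_le_dist peri_dist_less(2)[OF ok(2)]] mus by auto
  have "\<bar>cos \<alpha>\<bar> < 1"
  proof -
    have "cos pi < cos \<alpha>" "cos \<alpha> < cos 0" by (rule cos_monotone_0_pi; use gt lt in simp)+
    then show ?thesis by (simp add: abs_less_iff)
  qed
  then have "\<bar>Kyz\<bar> < Sy * Sz" using Sp by (simp add: K abs_mult)
  moreover have "mform \<kappa> (tg \<kappa> X Y) (tg \<kappa> X Z) = Kyz" using tg_gram_hk[OF XN N(1,2)] dX d by (simp add: Kyz_def)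
  ultimately have "det3 X Y Z \<noteq> 0" using hinge_independent[OF XN N(1,2)] dX by (simp add: Sy_def Sz_def)
  then show ?thesis using that[OF XN l r0 rpos rX dX] by blast
qed

context cbb_geodesic begin

lemma xquadI:
  assumes "X \<in> N" "Y \<in> N" "Z \<in> N" "W \<in> N" "dist x y = \<delta> X Y" "dist x z = \<delta> X Z" "dist x w = \<delta> X W"
    "dist y z = \<delta> Y Z" "dist z w = \<delta> Z W" "dist w y = \<delta> W Y"
    "okp \<kappa> (peri x y z)" "okp \<kappa> (peri x z w)" "okp \<kappa> (peri x w y)" "det3 X Y Z \<noteq> 0"
    "ly > 0" "lz > 0" "lw > 0" "ly *\<^sub>R Y + lz *\<^sub>R Z + lw *\<^sub>R W = r *\<^sub>R X"
  shows "xquad x y z w X Y Z W"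
  unfolding xquad_def using assms by blast

end

text \<open>The coordinates of \<open>X\<close> are the weights divided by \<open>r\<close>, all
  positive or all negative. So the sign of \<open>r\<close> selects the region of which
  \<open>X\<close> is a center.\<close>

lemma center_coordinates:
  assumes det: "det3 X Y Z \<noteq> 0" and X: "X \<in> hat_plane \<kappa>" and l: "ly > 0" "lz > 0" "lw > 0" and r: "r \<noteq> 0"
    and e: "ly *\<^sub>R Y + lz *\<^sub>R Z + lw *\<^sub>R W = r *\<^sub>R X"
  shows "det3 Y Z W \<noteq> 0" "tri_center \<kappa> (r > 0) Y Z W X"
proof -
  have "det3 Y Z (ly *\<^sub>R Y + lz *\<^sub>R Z + lw *\<^sub>R W) = lw * det3 Y Z W" by (simp add: det3_simps)
  moreover have "det3 Y Z (r *\<^sub>R X) = r * det3 X Y Z" using det3_cyclic(1)[of X Y Z] det3_cyclic(2)[of X Y Z] by (simp add: det3_simps)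
  ultimately have "lw * det3 Y Z W = r * det3 X Y Z" unfolding e by simp
  then show d: "det3 Y Z W \<noteq> 0" using r det by auto
  have "X = (1 / r) *\<^sub>R (ly *\<^sub>R Y + lz *\<^sub>R Z + lw *\<^sub>R W)" unfolding e using r by simp
  then have "X = (ly / r) *\<^sub>R Y + (lz / r) *\<^sub>R Z + (lw / r) *\<^sub>R W" by (simp add: scaleR_add_right)
  note c = crd_combination[OF d this]
  show "tri_center \<kappa> (r > 0) Y Z W X"
  proof (cases "r > 0")
    case True
    then show ?thesis using l X by (simp add: tri_center_def c)
  next
    case False
    then have "r < 0" using r by simp
    then show ?thesis using l X by (simp add: tri_center_def c divide_pos_neg)
  qed
qed

section \<open>The open region in the geodesic space\<close>

context cbb_geodesic begin

text \<open>For negative \<open>r\<close> the relation divided by \<open>- r\<close> is the one of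
  \<open>large_region\<close>. The exceptional point \<open>E\<close> of its map has coordinate 0 at
  \<open>Y\<close> and positive coordinates at \<open>Z\<close> and \<open>W\<close>: it is an inner
  point of a side, neither in the open region nor a vertex.\<close>

lemma open_region_exists:
  assumes q: "xquad x y z w X Y Z W" and l: "ly > 0" "lz > 0" "lw > 0" and r: "r \<noteq> 0" "\<kappa> \<le> 0 \<Longrightarrow> r > 0"
    and e: "ly *\<^sub>R Y + lz *\<^sub>R Z + lw *\<^sub>R W = r *\<^sub>R X"
  obtains F where "\<And>P. P \<in> tri_int \<kappa> (r > 0) Y Z W \<Longrightarrow> good x y z w X Y Z W (F P) P"
    "\<And>P Q. P \<in> tri_int \<kappa> (r > 0) Y Z W \<Longrightarrow> Q \<in> tri_int \<kappa> (r > 0) Y Z W \<Longrightarrow> dist (F P) (F Q) = \<delta> P Q"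
proof (cases "r > 0")
  case True
  note c = center_coordinates[OF xquad_D(14)[OF q] xquad_D(1)[OF q] l r(1) e]
  have o: "op_cone Y Z W = tri_int \<kappa> (r > 0) Y Z W" using op_cone_tri_int[OF c(1)] True by simp
  have sq: "smallquad x y z w X Y Z W" unfolding smallquad_def o using q tri_int_center[OF c(2)] by (rule conjI)
  show ?thesis
  proof (rule small_region[OF sq])
    fix f assume f: "\<And>P. P \<in> op_cone Y Z W \<Longrightarrow> good x y z w X Y Z W (f P) P"
      "\<And>P Q. P \<in> op_cone Y Z W \<Longrightarrow> Q \<in> op_cone Y Z W \<Longrightarrow> dist (f P) (f Q) = \<delta> P Q"
    show ?thesis by (rule that[of f]) (use f o in blast)+
  qed
next
  case False
  then have rn: "r < 0" using r by simp
  then have k: "\<kappa> > 0" using r(2) by force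
  note c = center_coordinates[OF xquad_D(14)[OF q] xquad_D(1)[OF q] l r(1) e]
  note D = xquad_D[OF q]
  have X: "X + (ly / - r) *\<^sub>R Y + (lz / - r) *\<^sub>R Z + (lw / - r) *\<^sub>R W = 0"
  proof -
    have "X + (ly / - r) *\<^sub>R Y + (lz / - r) *\<^sub>R Z + (lw / - r) *\<^sub>R W
      = (1 / r) *\<^sub>R (r *\<^sub>R X - (ly *\<^sub>R Y + lz *\<^sub>R Z + lw *\<^sub>R W))" using r(1) by (simp add: algebra_simps)
    also have "r *\<^sub>R X - (ly *\<^sub>R Y + lz *\<^sub>R Z + lw *\<^sub>R W) = 0" by (simp only: e diff_self)
    finally show ?thesis by simp
  qed
  have l': "ly / - r > 0" "lz / - r > 0" "lw / - r > 0" using l rn by (simp_all add: divide_pos_neg)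
  show ?thesis
  proof (rule large_region[OF q k l' X])
    fix F E a b assume E: "E \<in> N" "a > 0" "b > 0" "E = a *\<^sub>R Z + b *\<^sub>R W"
      and iso: "\<And>A B. A \<in> N \<Longrightarrow> B \<in> N \<Longrightarrow> A \<noteq> E \<Longrightarrow> B \<noteq> E \<Longrightarrow> dist (F A) (F B) = \<delta> A B"
      and F: "F X = x" "F Y = y" "F Z = z" "F W = w"
    have "E = 0 *\<^sub>R Y + a *\<^sub>R Z + b *\<^sub>R W" using E(4) by simp
    note cE = crd_combination[OF c(1) this]
    note bs = crd_basis[OF c(1)]
    have nE: "P \<noteq> E" if "P \<in> tri_int \<kappa> False Y Z W" for P
      using that cE E(2,3) by (auto simp: tri_int_def)
    have vE: "X \<noteq> E" "Y \<noteq> E" "Z \<noteq> E" "W \<noteq> E"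
    proof -
      have "X \<in> tri_int \<kappa> False Y Z W" using tri_int_center[OF c(2)] False by simp
      then show "X \<noteq> E" by (rule nE)
      show "Y \<noteq> E" using bs(1) cE(1) by force
      show "Z \<noteq> E" using bs(8) cE(3) E(3) by force
      show "W \<noteq> E" using bs(6) cE(2) E(2) by force
    qed
    have mem: "P \<in> N" if "P \<in> tri_int \<kappa> False Y Z W" for P using that by (simp add: tri_int_def)
    show ?thesis
    proof (rule that[of F])
      fix P assume "P \<in> tri_int \<kappa> (r > 0) Y Z W"
      then have P: "P \<in> N" "P \<noteq> E" using False nE mem by auto
      show "good x y z w X Y Z W (F P) P" unfolding good_def
        using iso[OF P(1) D(1) P(2) vE(1)] iso[OF P(1) D(2) P(2) vE(2)] iso[OF P(1) D(3) P(2) vE(3)] iso[OF P(1) D(4) P(2) vE(4)] P(1)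
        unfolding F by blast
    next
      fix P Q assume "P \<in> tri_int \<kappa> (r > 0) Y Z W" "Q \<in> tri_int \<kappa> (r > 0) Y Z W"
      then have "P \<in> N" "P \<noteq> E" "Q \<in> N" "Q \<noteq> E" using False nE mem by auto
      then show "dist (F P) (F Q) = \<delta> P Q" using iso by blast
    qed
  qed
qed

end

lemma tri_reg_mem: "P \<in> tri_reg \<kappa> s A B C \<Longrightarrow> P \<in> hat_plane \<kappa>"
  by (simp add: tri_reg_def)

lemma tri_ray_point:
  assumes o: "tri_center \<kappa> s A B C X" and P: "P \<in> tri_reg \<kappa> s A B C" and r: "0 < \<rho>" "\<rho> < model_dist \<kappa> X P"
  shows "mpt \<kappa> X P \<rho> \<in> tri_int \<kappa> s A B C" "model_dist \<kappa> X (mpt \<kappa> X P \<rho>) = \<rho>"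
    "model_dist \<kappa> (mpt \<kappa> X P \<rho>) P = model_dist \<kappa> X P - \<rho>" "\<kappa> > 0 \<Longrightarrow> model_dist \<kappa> X P < PP \<kappa>"
proof -
  have X: "X \<in> hat_plane \<kappa>" using o by (simp add: tri_center_def)
  have PN: "P \<in> hat_plane \<kappa>" using P by (rule tri_reg_mem)
  have D: "0 < model_dist \<kappa> X P" using r by simp
  have ne: "X \<noteq> P" using D X by auto
  have lt: "\<kappa> > 0 \<Longrightarrow> model_dist \<kappa> X P < PP \<kappa>" by (rule model_dist_less_PP[OF X PN tri_center_antipode[OF o P]])
  show "\<kappa> > 0 \<Longrightarrow> model_dist \<kappa> X P < PP \<kappa>" by (rule lt)
  show "mpt \<kappa> X P \<rho> \<in> tri_int \<kappa> s A B C" by (rule tri_star[OF o P ne less_imp_le[OF r(1)] disjI1[OF r(2)]])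
  show "model_dist \<kappa> X (mpt \<kappa> X P \<rho>) = \<rho>" by (rule mpt_props(2)[OF X PN D lt less_imp_le[OF r(1)] less_imp_le[OF r(2)]])
  show "model_dist \<kappa> (mpt \<kappa> X P \<rho>) P = model_dist \<kappa> X P - \<rho>"
    by (rule mpt_props(3)[OF X PN D lt less_imp_le[OF r(1)] less_imp_le[OF r(2)]])
qed

section \<open>Points and maps determined by distances\<close>

context cbb_geodesic begin

lemma ray_determined:
  fixes x p1 v v' :: 'b
  assumes o: "tri_center \<kappa> s A B C X" and P: "P \<in> tri_reg \<kappa> s A B C" and r: "0 < \<rho>" "\<rho> < \<delta> X P"
    and p1: "dist x p1 = \<rho>" and v: "dist x v = \<delta> X P" "dist p1 v = \<delta> (mpt \<kappa> X P \<rho>) P"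
    and v': "dist x v' = \<delta> X P" "dist p1 v' = \<delta> (mpt \<kappa> X P \<rho>) P"
  shows "v = v'"
proof -
  note R = tri_ray_point[OF o P r]
  have mem: "X \<in> N" "mpt \<kappa> X P \<rho> \<in> N" "P \<in> N" using o tri_reg_mem[OF P] R(1) by (simp_all add: tri_center_def tri_int_def)
  have on: "onseg x p1 u X (mpt \<kappa> X P \<rho>) P" if "dist x u = \<delta> X P" "dist p1 u = \<delta> (mpt \<kappa> X P \<rho>) P" for u
    unfolding onseg_def btw_def using mem that p1 R(2,3) by simp
  have ne: "p1 \<noteq> x" using p1 r by auto
  show ?thesis by (rule ray_unique[OF on[OF v] on[OF v'] ne R(4)])
qed

lemma region_points_embedded:
  fixes \<iota> :: "'c \<Rightarrow> 'b"
  assumes det: "\<And>u G. finite G \<Longrightarrow> (\<And>v. (\<And>g. g \<in> G \<Longrightarrow> dist v (\<iota> g) = dist u (\<iota> g)) \<Longrightarrow> v = u) \<Longrightarrow> \<exists>a. u = \<iota> a"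
    and q: "xquad (\<iota> x) (\<iota> y) (\<iota> z) (\<iota> w) X Y Z W" and o: "tri_center \<kappa> s Y Z W X"
    and good: "\<And>P. P \<in> tri_int \<kappa> s Y Z W \<Longrightarrow> good (\<iota> x) (\<iota> y) (\<iota> z) (\<iota> w) X Y Z W (F P) P"
    and iso: "\<And>P Q. P \<in> tri_int \<kappa> s Y Z W \<Longrightarrow> Q \<in> tri_int \<kappa> s Y Z W \<Longrightarrow> dist (F P) (F Q) = \<delta> P Q"
    and P: "P \<in> tri_int \<kappa> s Y Z W"
  shows "\<exists>a. F P = \<iota> a"
proof -
  obtain \<rho> where \<rho>: "\<rho> > 0" and near: "\<And>p p' P. \<delta> X P \<le> \<rho> \<Longrightarrow> good (\<iota> x) (\<iota> y) (\<iota> z) (\<iota> w) X Y Z W p P \<Longrightarrow>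
      good (\<iota> x) (\<iota> y) (\<iota> z) (\<iota> w) X Y Z W p' P \<Longrightarrow> p = p'" using near_unique[OF q] by blast
  have emb: "\<exists>a. F Q = \<iota> a" if Q: "Q \<in> tri_int \<kappa> s Y Z W" "\<delta> X Q \<le> \<rho>" for Q
  proof (rule det[of "{x, y, z, w}"])
    fix v assume v: "\<And>g. g \<in> {x, y, z, w} \<Longrightarrow> dist v (\<iota> g) = dist (F Q) (\<iota> g)"
    have "good (\<iota> x) (\<iota> y) (\<iota> z) (\<iota> w) X Y Z W v Q" using good[OF Q(1)] v unfolding good_def by simp
    then show "v = F Q" using near[OF Q(2)] good[OF Q(1)] by blast
  qed simp
  show ?thesis
  proof (cases "\<delta> X P \<le> \<rho>")
    case True
    then show ?thesis using emb P by blast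
  next
    case False
    then have r: "\<rho> < \<delta> X P" by simp
    have P': "P \<in> tri_reg \<kappa> s Y Z W" by (rule subsetD[OF tri_int_subset P])
    let ?P1 = "mpt \<kappa> X P \<rho>"
    note R = tri_ray_point[OF o P' \<rho> r]
    \<comment> \<open>The point on the ray at distance \<open>\<rho>\<close> is already known to
      come from the small space, so it can serve as a reference point for
      \<open>F P\<close>.\<close>
    obtain p1 where p1: "F ?P1 = \<iota> p1" using emb[OF R(1)] R(2) by auto
    have mem: "X \<in> N" "?P1 \<in> N" "P \<in> N" using o P R(1) by (simp_all add: tri_center_def tri_int_def)
    have 1: "dist (\<iota> x) (\<iota> p1) = \<rho>" using good[OF R(1)] R(2) model_dist_commute[OF mem(1,2)]
      unfolding good_def p1 by (simp add: dist_commute)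
    have 2: "dist (\<iota> x) (F P) = \<delta> X P" using good[OF P] model_dist_commute[OF mem(1,3)]
      unfolding good_def by (simp add: dist_commute)
    have 3: "dist (\<iota> p1) (F P) = \<delta> ?P1 P" using iso[OF R(1) P] unfolding p1 .
    show ?thesis
    proof (rule det[of "{x, p1}"])
      fix v assume v: "\<And>g. g \<in> {x, p1} \<Longrightarrow> dist v (\<iota> g) = dist (F P) (\<iota> g)"
      have "dist (\<iota> x) v = \<delta> X P" "dist (\<iota> p1) v = \<delta> ?P1 P" using v[of x] v[of p1] 2 3 by (simp_all add: dist_commute)
      then show "v = F P" by (rule ray_determined[OF o P' \<rho> r 1 _ _ 2 3])
    qed simp
  qed
qed

lemma region_map_unique:
  assumes q: "xquad x y z w X Y Z W" and o: "tri_center \<kappa> s Y Z W X"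
    and f: "\<And>P Q. P \<in> tri_reg \<kappa> s Y Z W \<Longrightarrow> Q \<in> tri_reg \<kappa> s Y Z W \<Longrightarrow> dist (f P) (f Q) = \<delta> P Q"
      "f X = x" "f Y = y" "f Z = z" "f W = w"
    and g: "\<And>P Q. P \<in> tri_reg \<kappa> s Y Z W \<Longrightarrow> Q \<in> tri_reg \<kappa> s Y Z W \<Longrightarrow> dist (g P) (g Q) = \<delta> P Q"
      "g X = x" "g Y = y" "g Z = z" "g W = w"
    and verts: "{Y, Z, W} \<subseteq> tri_reg \<kappa> s Y Z W" and P: "P \<in> tri_reg \<kappa> s Y Z W"
  shows "f P = g P"
proof -
  obtain \<rho> where \<rho>: "\<rho> > 0" and near: "\<And>p p' P. \<delta> X P \<le> \<rho> \<Longrightarrow> good x y z w X Y Z W p P \<Longrightarrow> good x y z w X Y Z W p' P \<Longrightarrow> p = p'"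
    using near_unique[OF q] by blast
  have X: "X \<in> tri_reg \<kappa> s Y Z W" by (rule subsetD[OF tri_int_subset tri_int_center[OF o]])
  have V: "Y \<in> tri_reg \<kappa> s Y Z W" "Z \<in> tri_reg \<kappa> s Y Z W" "W \<in> tri_reg \<kappa> s Y Z W" using verts by auto
  have gd: "good x y z w X Y Z W (f Q) Q" "good x y z w X Y Z W (g Q) Q" if Q: "Q \<in> tri_reg \<kappa> s Y Z W" for Q
    using f(1)[OF Q X] f(1)[OF Q V(1)] f(1)[OF Q V(2)] f(1)[OF Q V(3)] g(1)[OF Q X] g(1)[OF Q V(1)] g(1)[OF Q V(2)] g(1)[OF Q V(3)]
      tri_reg_mem[OF Q] unfolding good_def f(2-5) g(2-5) by blast+
  show ?thesis
  proof (cases "\<delta> X P \<le> \<rho>")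
    case True
    then show ?thesis using near gd[OF P] by blast
  next
    case False
    then have r: "\<rho> < \<delta> X P" by simp
    let ?P1 = "mpt \<kappa> X P \<rho>"
    note R = tri_ray_point[OF o P \<rho> r]
    have P1: "?P1 \<in> tri_reg \<kappa> s Y Z W" by (rule subsetD[OF tri_int_subset R(1)])
    have e: "f ?P1 = g ?P1" by (rule near[OF eq_refl[OF R(2)] gd[OF P1]])
    have d: "dist x (f ?P1) = \<rho>" using f(1)[OF X P1] R(2) unfolding f(2) by simp
    show ?thesis
      using ray_determined[OF o P \<rho> r d _ _ _ _, of "f P" "g P"] f(1)[OF X P] f(1)[OF P1 P] g(1)[OF X P] g(1)[OF P1 P]
      unfolding f(2) g(2) e by blast
  qed
qed

end

text \<open>Extension by limits, with \<open>model_dist\<close> in place of a metric on the domain.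
  The second conclusion identifies the extension at a point by distances from the original image; it
  will fix the center and the vertices.\<close>

lemma isometry_extend:
  fixes f :: "real^3 \<Rightarrow> 'c::metric_space"
  assumes compl: "complete (UNIV :: 'c set)" and R: "R \<subseteq> hat_plane \<kappa>" "S \<subseteq> R"
    and approx: "\<And>P. P \<in> R \<Longrightarrow> \<exists>u. (\<forall>n. u n \<in> S) \<and> (\<lambda>n. model_dist \<kappa> (u n) P) \<longlonglongrightarrow> 0"
    and iso: "\<And>P Q. P \<in> S \<Longrightarrow> Q \<in> S \<Longrightarrow> dist (f P) (f Q) = model_dist \<kappa> P Q"
  obtains g where "\<And>P Q. P \<in> R \<Longrightarrow> Q \<in> R \<Longrightarrow> dist (g P) (g Q) = model_dist \<kappa> P Q"
    "\<And>P p. P \<in> R \<Longrightarrow> (\<And>Q. Q \<in> S \<Longrightarrow> dist (f Q) p = model_dist \<kappa> Q P) \<Longrightarrow> g P = p"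
proof -
  let ?d = "model_dist \<kappa>"
  have "\<exists>u. \<forall>P. P \<in> R \<longrightarrow> (\<forall>n. u P n \<in> S) \<and> (\<lambda>n. ?d (u P n) P) \<longlonglongrightarrow> 0" using approx by (intro choice) blast
  then obtain u where u: "\<And>P n. P \<in> R \<Longrightarrow> u P n \<in> S" "\<And>P. P \<in> R \<Longrightarrow> (\<lambda>n. ?d (u P n) P) \<longlonglongrightarrow> 0" by blast
  have N: "P \<in> hat_plane \<kappa>" if "P \<in> R" for P using R that by blast
  have uR: "u P n \<in> R" if "P \<in> R" for P n using u(1)[OF that] R by blast
  have lim2: "(\<lambda>n. ?d (u P n) (u Q n)) \<longlonglongrightarrow> ?d P Q" if P: "P \<in> R" and Q: "Q \<in> R" for P Q
  proof (rule tendsto_sandwich)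
    have t: "(\<lambda>n. ?d (u P n) P + ?d (u Q n) Q) \<longlonglongrightarrow> 0 + 0" by (intro tendsto_add u(2) P Q)
    show "(\<lambda>n. ?d P Q - (?d (u P n) P + ?d (u Q n) Q)) \<longlonglongrightarrow> ?d P Q" using tendsto_diff[OF tendsto_const t, of "?d P Q"] by simp
    show "(\<lambda>n. ?d P Q + (?d (u P n) P + ?d (u Q n) Q)) \<longlonglongrightarrow> ?d P Q" using tendsto_add[OF tendsto_const t, of "?d P Q"] by simp
    have b: "?d P Q \<le> ?d (u P n) P + ?d (u P n) (u Q n) + ?d (u Q n) Q" "?d (u P n) (u Q n) \<le> ?d (u P n) P + ?d P Q + ?d (u Q n) Q" for n
    proof -
      note m = N[OF P] N[OF Q] N[OF uR[OF P, of n]] N[OF uR[OF Q, of n]]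
      have c: "?d P (u P n) = ?d (u P n) P" "?d Q (u Q n) = ?d (u Q n) Q"
        by (rule model_dist_commute[OF m(1,3)], rule model_dist_commute[OF m(2,4)])
      show "?d P Q \<le> ?d (u P n) P + ?d (u P n) (u Q n) + ?d (u Q n) Q"
        using model_dist_triangle[OF m(1,3,2)] model_dist_triangle[OF m(3,4,2)] c by linarith
      show "?d (u P n) (u Q n) \<le> ?d (u P n) P + ?d P Q + ?d (u Q n) Q"
        using model_dist_triangle[OF m(3,1,4)] model_dist_triangle[OF m(1,2,4)] c by linarith
    qed
    show "\<forall>\<^sub>F n in sequentially. ?d P Q - (?d (u P n) P + ?d (u Q n) Q) \<le> ?d (u P n) (u Q n)"
      using b(1) by (intro always_eventually allI) (simp add: algebra_simps)
    show "\<forall>\<^sub>F n in sequentially. ?d (u P n) (u Q n) \<le> ?d P Q + (?d (u P n) P + ?d (u Q n) Q)"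
      using b(2) by (intro always_eventually allI) (simp add: algebra_simps)
  qed
  have "\<exists>p. (\<lambda>n. f (u P n)) \<longlonglongrightarrow> p" if P: "P \<in> R" for P
  proof -
    have "Cauchy (\<lambda>n. f (u P n))"
    proof (rule metric_CauchyI)
      fix e :: real assume e: "0 < e"
      have "\<forall>\<^sub>F n in sequentially. ?d (u P n) P < e / 2" using order_tendstoD(2)[OF u(2)[OF P], of "e / 2"] e by simp
      then obtain n0 where n0: "\<And>n. n \<ge> n0 \<Longrightarrow> ?d (u P n) P < e / 2" unfolding eventually_sequentially by blast
      have "dist (f (u P m)) (f (u P n)) < e" if "m \<ge> n0" "n \<ge> n0" for m n
      proof -
        note mm = N[OF uR[OF P, of m]] N[OF P] N[OF uR[OF P, of n]]
        show ?thesis using model_dist_triangle[OF mm] model_dist_commute[OF mm(2,3)] n0[OF that(1)] n0[OF that(2)]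
            iso[OF u(1)[OF P] u(1)[OF P], of m n] by linarith
      qed
      then show "\<exists>n0. \<forall>m\<ge>n0. \<forall>n\<ge>n0. dist (f (u P m)) (f (u P n)) < e" by blast
    qed
    then show ?thesis using compl unfolding complete_def by blast
  qed
  then have "\<exists>g. \<forall>P. P \<in> R \<longrightarrow> (\<lambda>n. f (u P n)) \<longlonglongrightarrow> g P" by (intro choice) blast
  then obtain g where g: "\<And>P. P \<in> R \<Longrightarrow> (\<lambda>n. f (u P n)) \<longlonglongrightarrow> g P" by blast
  show ?thesis
  proof (rule that[of g])
    fix P Q assume P: "P \<in> R" and Q: "Q \<in> R"
    have "(\<lambda>n. dist (f (u P n)) (f (u Q n))) \<longlonglongrightarrow> dist (g P) (g Q)" by (intro tendsto_dist g P Q)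
    moreover have "dist (f (u P n)) (f (u Q n)) = ?d (u P n) (u Q n)" for n by (rule iso[OF u(1)[OF P] u(1)[OF Q]])
    ultimately have "(\<lambda>n. ?d (u P n) (u Q n)) \<longlonglongrightarrow> dist (g P) (g Q)" by simp
    then show "dist (g P) (g Q) = ?d P Q" using lim2[OF P Q] by (rule LIMSEQ_unique)
  next
    fix P p assume P: "P \<in> R" and p: "\<And>Q. Q \<in> S \<Longrightarrow> dist (f Q) p = ?d Q P"
    have "(\<lambda>n. dist (f (u P n)) p) \<longlonglongrightarrow> dist (g P) p" by (intro tendsto_dist g P tendsto_const)
    moreover have "dist (f (u P n)) p = ?d (u P n) P" for n by (rule p[OF u(1)[OF P]])
    ultimately have "(\<lambda>n. ?d (u P n) P) \<longlonglongrightarrow> dist (g P) p" by simp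
    from LIMSEQ_unique[OF this u(2)[OF P]] have "dist (g P) p = 0" .
    then show "g P = p" by simp
  qed
qed

lemma tri_reg_approx:
  assumes o: "tri_center \<kappa> s A B C X" and P: "P \<in> tri_reg \<kappa> s A B C"
  shows "\<exists>u. (\<forall>n. u n \<in> tri_int \<kappa> s A B C) \<and> (\<lambda>n. model_dist \<kappa> (u n) P) \<longlonglongrightarrow> 0"
proof (cases "X = P")
  case True
  then have "model_dist \<kappa> X P = 0" using tri_reg_mem[OF P] by simp
  then show ?thesis using tri_int_center[OF o] by (intro exI[of _ "\<lambda>_. X"]) simp
next
  case False
  have X: "X \<in> hat_plane \<kappa>" using o by (simp add: tri_center_def)
  let ?D = "model_dist \<kappa> X P"
  have D: "0 < ?D" by (rule model_dist_positive[OF X tri_reg_mem[OF P] False])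
  \<comment> \<open>The second \<open>Suc\<close> keeps \<open>r 0\<close> positive, as
    \<open>tri_ray_point\<close> demands.\<close>
  define r where "r n = ?D * (1 - 1 / real (Suc (Suc n)))" for n
  have rn: "0 < r n" "r n < ?D" for n
  proof -
    have "?D * (1 / real (Suc (Suc n))) > 0" "?D * (1 - 1 / real (Suc (Suc n))) > 0" using D by (intro mult_pos_pos; simp)+
    then show "0 < r n" "r n < ?D" by (simp_all add: r_def right_diff_distrib)
  qed
  have "(\<lambda>n. 1 / real (Suc n)) \<longlonglongrightarrow> 0" using LIMSEQ_inverse_real_of_nat by (simp add: inverse_eq_divide)
  then have "(\<lambda>n. 1 / real (Suc (Suc n))) \<longlonglongrightarrow> 0" by (rule LIMSEQ_Suc)
  then have "(\<lambda>n. ?D * (1 / real (Suc (Suc n)))) \<longlonglongrightarrow> ?D * 0" by (intro tendsto_mult tendsto_const)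
  moreover have "model_dist \<kappa> (mpt \<kappa> X P (r n)) P = ?D * (1 / real (Suc (Suc n)))" for n
    using tri_ray_point(3)[OF o P rn] by (simp add: r_def algebra_simps)
  ultimately show ?thesis using tri_ray_point(1)[OF o P rn]
    by (intro exI[of _ "\<lambda>n. mpt \<kappa> X P (r n)"]) simp
qed

lemma continuous_model_dist:
  assumes q: "q \<in> model_plane \<kappa>"
  shows "continuous_on (model_plane \<kappa>) (\<lambda>p. model_dist \<kappa> p q)"
proof -
  have cos: "lf \<kappa> (hat \<kappa> p) (hat \<kappa> q) = md_cos \<kappa> (model_dist \<kappa> p q)" if "p \<in> model_plane \<kappa>" for p
    using lf_cos[of "hat \<kappa> p" \<kappa> "hat \<kappa> q"] that q by (simp add: hat_mem)
  consider "\<kappa> > 0" | "\<kappa> = 0" | "\<kappa> < 0" by linarith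
  then show ?thesis
  proof cases
    case 1
    have b: "- 1 \<le> \<kappa> * (p \<bullet> q) \<and> \<kappa> * (p \<bullet> q) \<le> 1" if "p \<in> model_plane \<kappa>" for p
      using cos[OF that] 1 by (simp add: lf_def mform_def hat_def md_cos_def inner_commute)
    have "continuous_on (model_plane \<kappa>) (\<lambda>p. arccos (\<kappa> * (p \<bullet> q)))"
      by (rule continuous_on_arccos) (use b in \<open>auto intro!: continuous_intros\<close>)
    then show ?thesis using 1 unfolding model_dist_def divide_inverse by (simp add: continuous_on_mult_right)
  next
    case 2
    then show ?thesis unfolding model_dist_def by (auto intro!: continuous_intros)
  next
    case 3
    have b: "1 \<le> \<kappa> * lorentz p q" if "p \<in> model_plane \<kappa>" for p
      using cos[OF that] 3 cosh_real_ge_1[of "sqrt (- \<kappa>) * model_dist \<kappa> p q"]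
      by (simp add: lf_def mform_def hat_def md_cos_def lorentz_def mult.commute)
    have "continuous_on (model_plane \<kappa>) (\<lambda>p. arcosh (\<kappa> * lorentz p q))"
      by (rule continuous_on_compose2[OF continuous_on_arcosh[OF order_refl]])
        (use b in \<open>auto simp: lorentz_def intro!: continuous_intros\<close>)
    then show ?thesis using 3 unfolding model_dist_def divide_inverse by (simp add: continuous_on_mult_right)
  qed
qed

text \<open>\<open>model_dist\<close> is continuous for the ambient topology of
  \<open>real ^ 3\<close>. In this way compactness of a region passes to its image, which is
  therefore closed.\<close>

lemma isometry_continuous:
  fixes f :: "real^3 \<Rightarrow> 'c::metric_space"
  assumes R: "R \<subseteq> model_plane \<kappa>" and iso: "\<And>p q. p \<in> R \<Longrightarrow> q \<in> R \<Longrightarrow> dist (f p) (f q) = model_dist \<kappa> p q"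
  shows "continuous_on R f"
  unfolding continuous_on_def
proof
  fix q assume q: "q \<in> R"
  have "continuous_on R (\<lambda>p. model_dist \<kappa> p q)" by (rule continuous_on_subset[OF continuous_model_dist R]) (use q R in blast)
  then have "((\<lambda>p. model_dist \<kappa> p q) \<longlongrightarrow> model_dist \<kappa> q q) (at q within R)" using q unfolding continuous_on_def by blast
  moreover have "model_dist \<kappa> q q = 0" using iso[OF q q] by simp
  ultimately have "((\<lambda>p. model_dist \<kappa> p q) \<longlongrightarrow> 0) (at q within R)" by simp
  moreover have "\<forall>\<^sub>F p in at q within R. model_dist \<kappa> p q = dist (f p) (f q)"
    unfolding eventually_at_filter by (intro always_eventually) (use iso[OF _ q] in auto)
  ultimately have "((\<lambda>p. dist (f p) (f q)) \<longlongrightarrow> 0) (at q within R)" by (rule Lim_transform_eventually)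
  then show "(f \<longlongrightarrow> f q) (at q within R)" by (rule tendsto_dist_iff[THEN iffD2])
qed

context cbb_geodesic begin

text \<open>The map of the open region takes values in the range of \<open>\<iota>\<close> and is
  pulled back along it. The boundary is added in the small space, which is complete, and the
  distances to the open copy identify the images of the vertices.\<close>

lemma closed_region_exists:
  fixes \<iota> :: "'c::metric_space \<Rightarrow> 'b"
  assumes compl: "complete (UNIV :: 'c set)" and emb: "\<And>a b. dist (\<iota> a) (\<iota> b) = dist a b"
    and det: "\<And>u G. finite G \<Longrightarrow> (\<And>v. (\<And>g. g \<in> G \<Longrightarrow> dist v (\<iota> g) = dist u (\<iota> g)) \<Longrightarrow> v = u) \<Longrightarrow> \<exists>a. u = \<iota> a"
    and q: "xquad (\<iota> x) (\<iota> y) (\<iota> z) (\<iota> w) X Y Z W" and l: "ly > 0" "lz > 0" "lw > 0" and r: "r \<noteq> 0" "\<kappa> \<le> 0 \<Longrightarrow> r > 0"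
    and e: "ly *\<^sub>R Y + lz *\<^sub>R Z + lw *\<^sub>R W = r *\<^sub>R X"
    and verts: "{Y, Z, W} \<subseteq> tri_reg \<kappa> (r > 0) Y Z W"
  obtains g where "\<And>P Q. P \<in> tri_reg \<kappa> (r > 0) Y Z W \<Longrightarrow> Q \<in> tri_reg \<kappa> (r > 0) Y Z W \<Longrightarrow> dist (g P) (g Q) = \<delta> P Q"
    "g X = x" "g Y = y" "g Z = z" "g W = w"
proof -
  let ?S = "tri_int \<kappa> (r > 0) Y Z W" and ?R = "tri_reg \<kappa> (r > 0) Y Z W"
  have o: "tri_center \<kappa> (r > 0) Y Z W X" by (rule center_coordinates(2)[OF xquad_D(14)[OF q] xquad_D(1)[OF q] l r(1) e])
  obtain F where good: "\<And>P. P \<in> ?S \<Longrightarrow> good (\<iota> x) (\<iota> y) (\<iota> z) (\<iota> w) X Y Z W (F P) P"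
    and F: "\<And>P Q. P \<in> ?S \<Longrightarrow> Q \<in> ?S \<Longrightarrow> dist (F P) (F Q) = \<delta> P Q"
    using open_region_exists[OF q l r e] by blast
  have "\<exists>f. \<forall>P. P \<in> ?S \<longrightarrow> F P = \<iota> (f P)"
    using region_points_embedded[OF det q o good F] by (intro choice) blast
  then obtain f where f: "\<And>P. P \<in> ?S \<Longrightarrow> F P = \<iota> (f P)" by blast
  have fiso: "dist (f P) (f Q) = \<delta> P Q" if "P \<in> ?S" "Q \<in> ?S" for P Q
    using F[OF that] f that emb by simp
  have fv: "dist (f P) x = \<delta> P X" "dist (f P) y = \<delta> P Y" "dist (f P) z = \<delta> P Z" "dist (f P) w = \<delta> P W" if "P \<in> ?S" for P
    using good[OF that] f[OF that] emb unfolding good_def by simp_all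
  have RN: "?R \<subseteq> N" by (auto simp: tri_reg_def)
  obtain g where g: "\<And>P Q. P \<in> ?R \<Longrightarrow> Q \<in> ?R \<Longrightarrow> dist (g P) (g Q) = \<delta> P Q"
    and gv: "\<And>P p. P \<in> ?R \<Longrightarrow> (\<And>Q. Q \<in> ?S \<Longrightarrow> dist (f Q) p = \<delta> Q P) \<Longrightarrow> g P = p"
    using isometry_extend[OF compl RN tri_int_subset tri_reg_approx[OF o] fiso] by blast
  have X: "X \<in> ?R" by (rule subsetD[OF tri_int_subset tri_int_center[OF o]])
  have V: "Y \<in> ?R" "Z \<in> ?R" "W \<in> ?R" using verts by auto
  show ?thesis
    by (rule that[OF g gv[OF X fv(1)] gv[OF V(1) fv(2)] gv[OF V(2) fv(3)] gv[OF V(3) fv(4)]])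
qed

end

section \<open>Existence and uniqueness of the region\<close>

lemma tri_reg_vertices:
  assumes "det3 a b c \<noteq> 0" "a \<in> hat_plane \<kappa>" "b \<in> hat_plane \<kappa>" "c \<in> hat_plane \<kappa>"
  shows "{a, b, c} \<subseteq> tri_reg \<kappa> s a b c"
  using assms(2-4) crd_basis[OF assms(1)] by (auto simp: tri_reg_def)

lemma tri_center_sign:
  assumes "tri_center \<kappa> s a b c p" "p \<in> tri_reg \<kappa> s' a b c" shows "s' = s"
  using assms by (cases s; cases s') (auto simp: tri_center_def tri_reg_def)

theorem theorem3:
  fixes \<kappa> :: real
    and x y z w :: "'a::metric_space"
    and y' z' w' :: "real ^ 3"
  assumes "alexandrov_space TYPE('a) \<kappa>"
    and "quadruple x y z w"
    and "\<kappa> > 0 \<longrightarrow> quadruple_size x y z w < 2 * pi / sqrt \<kappa>"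
    and "x \<notin> metric_interval y z \<union> metric_interval z w \<union> metric_interval w y"
    and "comparison_angle \<kappa> x y z + comparison_angle \<kappa> x z w + comparison_angle \<kappa> x w y = 2 * pi"
    and "is_comparison_triangle \<kappa> y z w y' z' w'"
  shows "\<exists>!D. closed D \<and> x \<in> D \<and> spans_region \<kappa> y z w y' z' w' D"
proof -
  have compl: "complete (UNIV :: 'a set)" using assms(1) by (simp add: alexandrov_space_def)
  interpret cbb_geodesic \<kappa> "TYPE('a upower)" by (rule upower_cbb_geodesic[OF assms(1)])
  let ?\<iota> = "uemb :: 'a \<Rightarrow> 'a upower"
  have ok: "okp \<kappa> (peri x y z)" "okp \<kappa> (peri x z w)" "okp \<kappa> (peri x w y)" "okp \<kappa> (peri y z w)"
    using assms(3) by (simp_all add: okp_def quadruple_size_def)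
  define Y Z W where "Y = hat \<kappa> y'" and "Z = hat \<kappa> z'" and "W = hat \<kappa> w'"
  have plane: "y' \<in> model_plane \<kappa>" "z' \<in> model_plane \<kappa>" "w' \<in> model_plane \<kappa>"
    and sides: "model_dist \<kappa> y' z' = dist y z" "model_dist \<kappa> z' w' = dist z w" "model_dist \<kappa> w' y' = dist w y"
    using assms(6) by (simp_all add: is_comparison_triangle_def)
  have NY: "Y \<in> N" "Z \<in> N" "W \<in> N" using plane by (simp_all add: Y_def Z_def W_def hat_mem)
  have d: "\<delta> Y Z = dist y z" "\<delta> Z W = dist z w" "\<delta> W Y = dist w y" using sides by (simp_all add: Y_def Z_def W_def)
  obtain X ly lz lw r where X: "X \<in> N" and l: "ly > 0" "lz > 0" "lw > 0" and r: "r \<noteq> 0" "\<kappa> \<le> 0 \<Longrightarrow> r > 0"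
    and e: "ly *\<^sub>R Y + lz *\<^sub>R Z + lw *\<^sub>R W = r *\<^sub>R X"
    and dX: "\<delta> X Y = dist x y" "\<delta> X Z = dist x z" "\<delta> X W = dist x w" and det: "det3 X Y Z \<noteq> 0"
    using model_center_exists[OF assms(2) ok assms(4,5) NY d] by blast
  have q: "xquad (?\<iota> x) (?\<iota> y) (?\<iota> z) (?\<iota> w) X Y Z W"
    by (rule xquadI[OF X NY _ _ _ _ _ _ _ _ _ det l e]) (use ok dX d in \<open>simp_all add: peri_def\<close>)
  define s where "s \<longleftrightarrow> r > 0"
  have dYZW: "det3 Y Z W \<noteq> 0" and o: "tri_center \<kappa> s Y Z W X"
    using center_coordinates[OF det X l r(1) e] by (simp_all add: s_def)
  have verts: "{Y, Z, W} \<subseteq> tri_reg \<kappa> s' Y Z W" for s' by (rule tri_reg_vertices[OF dYZW NY])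
  obtain g where g: "\<And>P Q. P \<in> tri_reg \<kappa> s Y Z W \<Longrightarrow> Q \<in> tri_reg \<kappa> s Y Z W \<Longrightarrow> dist (g P) (g Q) = \<delta> P Q"
    and gv: "g X = x" "g Y = y" "g Z = z" "g W = w"
    unfolding s_def using closed_region_exists[OF compl dist_uemb upower_determined[OF compl] q l r e verts] by blast
  interpret M: model_triangle \<kappa> y' z' w'
    by unfold_locales (use plane dYZW sides peri_dist_less[OF ok(4)] peri_dist_less[of \<kappa> z w y] ok(4) in
      \<open>auto simp: Y_def Z_def W_def peri_def dist_commute algebra_simps\<close>)
  have MR: "p \<in> M.MR s' \<longleftrightarrow> p \<in> model_plane \<kappa> \<and> hat \<kappa> p \<in> tri_reg \<kappa> s' Y Z W" for p s'
    by (simp add: M.MR_def Y_def Z_def W_def)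
  have sk: "s \<or> \<kappa> > 0" using r by (auto simp: s_def not_le)
  have region: "is_triangular_region \<kappa> y' z' w' R \<longleftrightarrow> R = M.MR True \<or> \<kappa> > 0 \<and> R = M.MR False" for R
    by (rule M.triangular_region_iff[OF o[unfolded Y_def Z_def W_def] sk])
  have vertsM: "y' \<in> M.MR s'" "z' \<in> M.MR s'" "w' \<in> M.MR s'" for s'
    using verts[of s'] plane by (simp_all add: MR flip: Y_def Z_def W_def)
  have tri_R: "P - lift_vec \<kappa> \<in> M.MR s" if "P \<in> tri_reg \<kappa> s Y Z W" for P
    using that tri_reg_mem[OF that] hat_mem[of \<kappa> "P - lift_vec \<kappa>"] by (simp add: MR hat_inverse)
  have XR: "X \<in> tri_reg \<kappa> s Y Z W" by (rule subsetD[OF tri_int_subset tri_int_center[OF o]])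
  define f where "f p = g (hat \<kappa> p)" for p
  have fiso: "dist (f p) (f p') = model_dist \<kappa> p p'" if "p \<in> M.MR s" "p' \<in> M.MR s" for p p'
    using g that by (simp add: f_def MR)
  have spans: "spans_region \<kappa> y z w y' z' w' (f ` M.MR s)"
    unfolding spans_region_def
  proof (intro exI[of _ "M.MR s"] exI[of _ f] conjI ballI)
    show "is_triangular_region \<kappa> y' z' w' (M.MR s)" unfolding region using sk by (cases s) auto
  qed (use gv fiso in \<open>simp_all add: f_def Y_def Z_def W_def\<close>)
  have "x = f (X - lift_vec \<kappa>)" using gv by (simp add: f_def hat_inverse)
  then have xD: "x \<in> f ` M.MR s" using tri_R[OF XR] by blast
  have "closed (M.MR s)" "bounded (M.MR s)"
    using M.closure_MI[OF o[unfolded Y_def Z_def W_def]] bounded_closure[OF M.bounded_MI[OF sk]] closed_closure by metis+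
  then have "compact (M.MR s)" by (simp add: compact_eq_bounded_closed)
  moreover have "continuous_on (M.MR s) f"
    by (rule isometry_continuous[OF _ fiso]) (auto simp: MR)
  ultimately have closed: "closed (f ` M.MR s)" by (intro compact_imp_closed compact_continuous_image)
  have unique: "D = f ` M.MR s" if xD': "x \<in> D" and D: "spans_region \<kappa> y z w y' z' w' D" for D
  proof -
    obtain R h where R: "is_triangular_region \<kappa> y' z' w' R" and hD: "h ` R = D"
      and h: "\<And>p q. p \<in> R \<Longrightarrow> q \<in> R \<Longrightarrow> dist (h p) (h q) = model_dist \<kappa> p q" and hv: "h y' = y" "h z' = z" "h w' = w"
      using D unfolding spans_region_def by blast
    obtain s' where s': "R = M.MR s'" using R unfolding region by blast
    obtain p where p: "p \<in> R" "h p = x" using xD' hD by blast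
    have vR: "y' \<in> R" "z' \<in> R" "w' \<in> R" using vertsM[of s'] by (simp_all add: s')
    have pN: "hat \<kappa> p \<in> N" and pR: "hat \<kappa> p \<in> tri_reg \<kappa> s' Y Z W" using p(1) by (simp_all add: s' MR hat_mem)
    have "\<delta> (hat \<kappa> p) Y = dist x y" using h[OF p(1) vR(1)] unfolding p(2) hv Y_def model_dist_hat by (rule sym)
    moreover have "\<delta> (hat \<kappa> p) Z = dist x z" using h[OF p(1) vR(2)] unfolding p(2) hv Z_def model_dist_hat by (rule sym)
    moreover have "\<delta> (hat \<kappa> p) W = dist x w" using h[OF p(1) vR(3)] unfolding p(2) hv W_def model_dist_hat by (rule sym)
    ultimately have dv: "v \<in> N \<and> \<delta> (hat \<kappa> p) v = \<delta> X v" if "v \<in> {Y, Z, W}" for v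
      using that NY unfolding dX[symmetric] by blast
    \<comment> \<open>The distances to independent vertices determine the point that
      \<open>h\<close> sends to \<open>x\<close>. On a sphere this also decides which of the two
      regions is spanned, since just one of them contains \<open>X\<close>.\<close>
    have px: "hat \<kappa> p = X" by (rule model_point_unique[OF pN X dYZW dv])
    have "s' = s" by (rule tri_center_sign[OF o]) (use pR px in simp)
    then have Rs: "R = M.MR s" by (simp add: s')
    \<comment> \<open>\<open>region_map_unique\<close> speaks about the geodesic space, so both maps
      are followed by the embedding into the ultrapower.\<close>
    have hg: "?\<iota> (h (P - lift_vec \<kappa>)) = ?\<iota> (g P)" if P: "P \<in> tri_reg \<kappa> s Y Z W" for P
    proof (rule region_map_unique[OF q o _ _ _ _ _ _ _ _ _ _ verts P])
      fix P Q assume PQ: "P \<in> tri_reg \<kappa> s Y Z W" "Q \<in> tri_reg \<kappa> s Y Z W"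
      have "dist (h (P - lift_vec \<kappa>)) (h (Q - lift_vec \<kappa>)) = model_dist \<kappa> (P - lift_vec \<kappa>) (Q - lift_vec \<kappa>)"
        by (rule h) (use tri_R PQ Rs in auto)
      also have "\<dots> = \<delta> P Q"
        using model_dist_hat[of \<kappa> "P - lift_vec \<kappa>" "Q - lift_vec \<kappa>"] unfolding hat_inverse by (rule sym)
      finally show "dist (?\<iota> (h (P - lift_vec \<kappa>))) (?\<iota> (h (Q - lift_vec \<kappa>))) = \<delta> P Q" by simp
      show "dist (?\<iota> (g P)) (?\<iota> (g Q)) = \<delta> P Q" using g[OF PQ] by simp
    next
      have "X - lift_vec \<kappa> = p" unfolding px[symmetric] by (simp add: hat_eq)
      then show "?\<iota> (h (X - lift_vec \<kappa>)) = ?\<iota> x" using p(2) by simp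
    qed (use gv hv in \<open>simp_all add: Y_def Z_def W_def hat_eq\<close>)
    have "h p = f p" if p: "p \<in> M.MR s" for p
    proof -
      have "?\<iota> (h p) = ?\<iota> (f p)" using hg[of "hat \<kappa> p"] p by (simp add: MR f_def hat_eq)
      then have "dist (h p) (f p) = 0" using dist_uemb[of "h p" "f p"] by simp
      then show ?thesis by simp
    qed
    then have "h ` R = f ` M.MR s" unfolding Rs by (rule image_cong[OF refl])
    then show ?thesis using hD by simp
  qed
  show ?thesis
  proof (rule ex1I)
    show "closed (f ` M.MR s) \<and> x \<in> f ` M.MR s \<and> spans_region \<kappa> y z w y' z' w' (f ` M.MR s)"
      using closed xD spans by blast
    show "D = f ` M.MR s" if "closed D \<and> x \<in> D \<and> spans_region \<kappa> y z w y' z' w' D" for D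
      by (rule unique) (use that in blast)+
  qed
qed

end
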